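(* Let $X$ be a connected finite $T_0$ space. If there exists $a\in X$ such that $X=U_a\cup\mathrm{mxl}(X)\cup\mathrm{mnl}(X)$, then $$X\simeq_w\Bigl(\bigvee_{\substack{b\in\mathrm{mxl}(X)\\ U_a\cap U_b\neq\emptyset}}\mathbb{S}(U_a\cap U_b)\Bigr)\vee\Bigl(\bigvee_k S^1\Bigr)$$ for some $k\ge 0$. In particular, $X$ splits into smaller spaces.
   Context: A finite $T_0$ space is identified with a finite poset whose open sets are the down sets; subsets carry the induced order. $U_a=\{x\in X\mid x\le a\}$; $\mathrm{mxl}(X)$ and $\mathrm{mnl}(X)$ are the sets of maximal and minimal elements of $X$. $\mathbb{S}Y$ is the non-Hausdorff suspension: $Y$ with two new mutually incomparable points added, each greater than every element of $Y$; $\mathbb{S}^0Y=Y$, $\mathbb{S}^nY=\mathbb{S}(\mathbb{S}^{n-1}Y)$. $\simeq_w$ denotes weak homotopy equivalence (via zigzags); wedge sums are taken up to weak homotopy type, where finite $T_0$ spaces may be replaced by their order complexes, and wedges of connected spaces do not depend on base points. The empty wedge is a point. A connected finite space $X$ splits into smaller spaces if there exist finitely many finite spaces $A_i$ (possibly empty) with $|A_i|<|X|$ and integers $n_i\ge 0$ such that $X\simeq_w\bigvee_i\mathbb{S}^{n_i}A_i$. *)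

theory Defs
  imports "HOL-Analysis.Analysis"
begin

section \<open>Finite \<open>T\<^sub>0\<close> spaces as finite posets\<close>

text \<open>
  A finite \<open>T\<^sub>0\<close> space is represented by its partial order \<open>r\<close>, a relation with
  \<^term>\<open>Partial_order r\<close> and finite \<^term>\<open>Field r\<close>; the points are the elements of
  \<^term>\<open>Field r\<close>.  The set \<open>U\<^sub>a\<close> is \<^term>\<open>under r a\<close>, and a subset \<open>S\<close> carries the induced
  order \<^term>\<open>Restr r S\<close>.
\<close>

definition poset_topology :: "'a rel \<Rightarrow> 'a topology" where
  "poset_topology r =
     topology (\<lambda>U. U \<subseteq> Field r \<and> (\<forall>y\<in>U. \<forall>x. (x, y) \<in> r \<longrightarrow> x \<in> U))"

lemma openin_poset_topology:
  "openin (poset_topology r) U \<longleftrightarrow> U \<subseteq> Field r \<and> (\<forall>y\<in>U. \<forall>x. (x, y) \<in> r \<longrightarrow> x \<in> U)"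
proof -
  have "istopology (\<lambda>U. U \<subseteq> Field r \<and> (\<forall>y\<in>U. \<forall>x. (x, y) \<in> r \<longrightarrow> x \<in> U))"
    unfolding istopology_def by blast
  then show ?thesis
    by (simp add: poset_topology_def)
qed

lemma topspace_poset_topology [simp]: "topspace (poset_topology r) = Field r"
proof -
  have "openin (poset_topology r) (Field r)"
    by (auto simp: openin_poset_topology Field_def)
  then show ?thesis
    by (metis openin_poset_topology openin_subset openin_topspace subset_antisym)
qed

definition mxl :: "'a rel \<Rightarrow> 'a set" where
  "mxl r = {m \<in> Field r. \<forall>x. (m, x) \<in> r \<longrightarrow> x = m}"

definition mnl :: "'a rel \<Rightarrow> 'a set" where
  "mnl r = {m \<in> Field r. \<forall>x. (x, m) \<in> r \<longrightarrow> x = m}"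


section \<open>Non-Hausdorff suspension\<close>

definition adjoin_tops :: "'a rel \<Rightarrow> 'a \<Rightarrow> 'a \<Rightarrow> 'a rel" where
  "adjoin_tops r p q = r \<union> insert p (Field r) \<times> {p} \<union> insert q (Field r) \<times> {q}"

text \<open>
  \<open>nh_susp n r\<close> is the \<open>n\<close>-fold suspension.  All iterates live on one type: the original points
  are tagged with \<^const>\<open>Inl\<close>, and the two points added in step \<open>n + 1\<close> are
  \<^term>\<open>Inr (n, False)\<close> and \<^term>\<open>Inr (n, True)\<close>, which are new by the lemma below.
\<close>

primrec nh_susp :: "nat \<Rightarrow> 'a rel \<Rightarrow> ('a + nat \<times> bool) rel" where
  "nh_susp 0 r = map_prod Inl Inl ` r"
| "nh_susp (Suc n) r = adjoin_tops (nh_susp n r) (Inr (n, False)) (Inr (n, True))"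

lemma Field_adjoin_tops: "Field (adjoin_tops r p q) = Field r \<union> {p, q}"
  by (auto simp: adjoin_tops_def Field_def)

lemma Field_nh_susp: "Field (nh_susp n r) = Inl ` Field r \<union> Inr ` ({..<n} \<times> UNIV)"
proof (induction n)
  case 0
  show ?case
    by (force simp: Field_def map_prod_def Domain.simps Range.simps)
next
  case (Suc n)
  show ?case
    unfolding nh_susp.simps Field_adjoin_tops Suc
    by (auto simp: less_Suc_eq image_iff)
qed


section \<open>Order complexes\<close>

definition order_complex :: "'a rel \<Rightarrow> 'a set set" where
  "order_complex r = {C \<in> Chains r. finite C \<and> C \<noteq> {}}"

text \<open>
  Barycentric coordinates; the topology is the correct one for complexes with finitely many
  vertices, the only ones to which it is applied.
\<close>

definition realization :: "'a set set \<Rightarrow> ('a \<Rightarrow> real) topology" where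
  "realization K = subtopology (product_topology (\<lambda>_. euclideanreal) UNIV)
     {t. (\<forall>v. 0 \<le> t v) \<and> {v. t v \<noteq> 0} \<in> K \<and> (\<Sum>v | t v \<noteq> 0. t v) = 1}"


section \<open>Weak homotopy equivalence\<close>

definition cube :: "nat \<Rightarrow> (nat \<Rightarrow> real) topology" where
  "cube n = product_topology (\<lambda>_. top_of_set {0..1}) {..<n}"

definition cube_boundary :: "nat \<Rightarrow> (nat \<Rightarrow> real) set" where
  "cube_boundary n = {c \<in> topspace (cube n). \<exists>i<n. c i = 0 \<or> c i = 1}"

definition based_cubes :: "nat \<Rightarrow> 'a topology \<Rightarrow> 'a \<Rightarrow> ((nat \<Rightarrow> real) \<Rightarrow> 'a) set" where
  "based_cubes n X x =
     {g. continuous_map (cube n) X g \<and> (\<forall>c\<in>cube_boundary n. g c = x)}"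

definition cube_homotopy :: "nat \<Rightarrow> 'a topology \<Rightarrow> 'a \<Rightarrow> ((nat \<Rightarrow> real) \<Rightarrow> 'a) rel" where
  "cube_homotopy n X x =
     {(g, h). homotopic_with (\<lambda>k. \<forall>c\<in>cube_boundary n. k c = x) (cube n) X g h}"

definition homotopy_group :: "nat \<Rightarrow> 'a topology \<Rightarrow> 'a \<Rightarrow> ((nat \<Rightarrow> real) \<Rightarrow> 'a) set set" where
  "homotopy_group n X x = based_cubes n X x // cube_homotopy n X x"

text \<open>
  The maps induced by \<open>f\<close> on \<open>\<pi>\<^sub>0\<close> and on \<open>\<pi>\<^sub>n\<close> send the class of \<open>x\<close> to the class of \<open>f x\<close> and
  the class of \<open>g\<close> to the class of \<open>f \<circ> g\<close>.  For \<open>n \<ge> 1\<close> the latter is always a group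
  homomorphism, so it is an isomorphism as soon as it is bijective.
\<close>

definition pi0_induced ::
  "'b topology \<Rightarrow> ('a \<Rightarrow> 'b) \<Rightarrow> 'a set \<Rightarrow> 'b set" where
  "pi0_induced Y f C = {(u, v). path_component_of Y u v} `` (f ` C)"

definition pi_induced ::
  "nat \<Rightarrow> 'b topology \<Rightarrow> 'b \<Rightarrow> ('a \<Rightarrow> 'b) \<Rightarrow> ((nat \<Rightarrow> real) \<Rightarrow> 'a) set \<Rightarrow> ((nat \<Rightarrow> real) \<Rightarrow> 'b) set"
  where "pi_induced n Y y f C = cube_homotopy n Y y `` ((\<lambda>g. f \<circ> g) ` C)"

definition weak_homotopy_equivalence :: "'a topology \<Rightarrow> 'b topology \<Rightarrow> ('a \<Rightarrow> 'b) \<Rightarrow> bool" where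
  "weak_homotopy_equivalence X Y f \<longleftrightarrow>
     continuous_map X Y f \<and>
     bij_betw (pi0_induced Y f) (path_components_of X) (path_components_of Y) \<and>
     (\<forall>n\<ge>1. \<forall>x\<in>topspace X.
        bij_betw (pi_induced n Y (f x) f) (homotopy_group n X x) (homotopy_group n Y (f x)))"

text \<open>
  \<open>X\<close> and \<open>Y\<close> are joined by a finite zigzag of weak homotopy equivalences.  The spaces in the
  zigzag have to live on a fixed type, so \<open>X\<close> and \<open>Y\<close> are first replaced by homeomorphic copies.
  The type \<^typ>\<open>real \<Rightarrow> 'a + 'b\<close> is large enough for this to be no restriction: a copy of the
  realized singular complex of any space on \<open>'a\<close> or \<open>'b\<close> fits into it, and any two spaces
  joined by a zigzag are joined by one through their realized singular complexes.
\<close>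

definition weakly_equivalent :: "'a topology \<Rightarrow> 'b topology \<Rightarrow> bool" (infix \<open>\<simeq>\<^sub>w\<close> 50) where
  "X \<simeq>\<^sub>w Y \<longleftrightarrow>
     (\<exists>(Z :: (real \<Rightarrow> 'a + 'b) topology) Z'.
        X homeomorphic_space Z \<and> Y homeomorphic_space Z' \<and>
        equivclp (\<lambda>V W. \<exists>f. weak_homotopy_equivalence V W f) Z Z')"


section \<open>Wedges\<close>

definition quotient_topology :: "'a topology \<Rightarrow> ('a \<Rightarrow> 'b) \<Rightarrow> 'b topology" where
  "quotient_topology X f =
     topology (\<lambda>U. U \<subseteq> f ` topspace X \<and> openin X {x \<in> topspace X. f x \<in> U})"

lemma openin_quotient_topology:
  "openin (quotient_topology X f) U \<longleftrightarrow>
     U \<subseteq> f ` topspace X \<and> openin X {x \<in> topspace X. f x \<in> U}"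
proof -
  have "openin X {x \<in> topspace X. f x \<in> \<Union>\<K>}"
    if "\<forall>K\<in>\<K>. openin X {x \<in> topspace X. f x \<in> K}" for \<K>
  proof -
    have "{x \<in> topspace X. f x \<in> \<Union>\<K>} = (\<Union>K\<in>\<K>. {x \<in> topspace X. f x \<in> K})"
      by blast
    then show ?thesis
      using that by auto
  qed
  moreover have "openin X {x \<in> topspace X. f x \<in> S \<inter> T}"
    if "openin X {x \<in> topspace X. f x \<in> S}" "openin X {x \<in> topspace X. f x \<in> T}" for S T
  proof -
    have "{x \<in> topspace X. f x \<in> S \<inter> T} =
        {x \<in> topspace X. f x \<in> S} \<inter> {x \<in> topspace X. f x \<in> T}"
      by blast
    then show ?thesis
      using that by auto
  qed
  ultimately have "istopology (\<lambda>U. U \<subseteq> f ` topspace X \<and> openin X {x \<in> topspace X. f x \<in> U})"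
    unfolding istopology_def by blast
  then show ?thesis
    by (simp add: quotient_topology_def)
qed

lemma topspace_quotient_topology [simp]: "topspace (quotient_topology X f) = f ` topspace X"
proof -
  have "{x \<in> topspace X. f x \<in> f ` topspace X} = topspace X"
    by blast
  then have "openin (quotient_topology X f) (f ` topspace X)"
    by (simp add: openin_quotient_topology)
  then show ?thesis
    by (metis openin_quotient_topology openin_subset openin_topspace subset_antisym)
qed

lemma quotient_map_quotient_topology: "quotient_map X (quotient_topology X f) f"
  by (simp add: quotient_map_def openin_quotient_topology)

text \<open>
  The wedge of the spaces \<open>Y i\<close> with base points \<open>y i\<close>, \<open>i \<in> I\<close>: the quotient of the disjoint
  union in which all base points become the point \<^const>\<open>None\<close>.  The empty wedge is a point.
\<close>

definition wedge ::
  "'i set \<Rightarrow> ('i \<Rightarrow> 'a topology) \<Rightarrow> ('i \<Rightarrow> 'a) \<Rightarrow> ('i \<times> 'a) option topology" where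
  "wedge I Y y =
     (if I = {} then discrete_topology {None}
      else quotient_topology (sum_topology Y I)
             (\<lambda>(i, x). if x = y i then None else Some (i, x)))"

text \<open>
  For two summands on different types; \<open>quotient_topology X Inl\<close> is just a homeomorphic copy
  of \<open>X\<close> on the sum type.
\<close>

definition wedge2 ::
  "'a topology \<Rightarrow> 'a \<Rightarrow> 'b topology \<Rightarrow> 'b \<Rightarrow> (bool \<times> ('a + 'b)) option topology" where
  "wedge2 X x Y y =
     wedge UNIV (\<lambda>i. if i then quotient_topology X Inl else quotient_topology Y Inr)
                (\<lambda>i. if i then Inl x else Inr y)"


section \<open>Splitting into smaller spaces\<close>

text \<open>
  In wedges, the finite spaces \<open>\<S>\<^sup>n A\<close> are replaced by the realizations of their order
  complexes, in which every point is a nondegenerate base point.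
\<close>

abbreviation susp_real :: "nat \<Rightarrow> 'a rel \<Rightarrow> ('a + nat \<times> bool \<Rightarrow> real) topology" where
  "susp_real n A \<equiv> realization (order_complex (nh_susp n A))"

text \<open>
  The notion is used for connected \<open>X\<close>; then all wedge summands are connected and the choice of
  base points is immaterial.  Every finite poset is isomorphic to one on \<^typ>\<open>nat\<close>.
\<close>

definition splits_into_smaller :: "'a rel \<Rightarrow> bool" where
  "splits_into_smaller X \<longleftrightarrow>
     (\<exists>(m :: nat) (A :: nat \<Rightarrow> nat rel) (n :: nat \<Rightarrow> nat) p.
        (\<forall>i<m. Partial_order (A i) \<and> finite (Field (A i)) \<and>
               card (Field (A i)) < card (Field X) \<and>
               p i \<in> topspace (susp_real (n i) (A i))) \<and>
        poset_topology X \<simeq>\<^sub>w wedge {..<m} (\<lambda>i. susp_real (n i) (A i)) p)"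

end

theory Submission
  imports Defs
begin

text \<open>
  Put a new point \<open>s\<close> on top of \<open>U\<^sub>a\<close>, and, if \<open>a\<close> is itself maximal, a second one that takes the place of \<open>a\<close>;
  adding down beat points does not change the weak homotopy type.  An element below a maximal point \<open>b \<noteq> s\<close>
  that does not lie below \<open>a\<close> is then minimal, so it only contributes edges.  Sliding edges along each other,
  as in a graph, one reaches a poset in which every element that is not maximal lies below \<open>s\<close>, and in which each
  maximal point other than \<open>s\<close> has below it either a copy of some \<open>U\<^sub>a \<inter> U\<^sub>b\<close> or precisely two minimal points.
  Such a poset is the union of the cone under \<open>s\<close> with further cones attached to it along the sets below the other
  maximal points; collapsing the cone under \<open>s\<close> gives a wedge of suspensions, in which two points suspend to a circle.

  Weak equivalences are established through a relative lifting property for cubes, which is closed under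
  composition and can be verified over finite posets by means of the order.
\<close>

section \<open>Lifting maps\<close>

text \<open>A continuous map from a connected finite space to a Hausdorff space is constant, so the
  comparison has to run from the realized wedge to the poset, and cubes in the poset are lifted with
  partitions of unity. The base points in the statement are arbitrary and may lie inside a simplex,
  whereas the quotient belonging to a fan has one point that stands for the whole cone. Hence there
  are two successive maps: the wedge is collapsed onto \<open>cone_wedge\<close>, for which one half
  of each summand must be contracted to the given base point without moving that point, and
  \<open>cone_wedge\<close> is sent to the fan by least vertices. The second new point over a
  maximal a accounts for the index b = a: its summand, the suspension of U_a, is contractible but
  has to appear in the wedge. The number k is not computed in advance; it is the number of maximal
  points with two legs that are left, besides those for the suspensions, when the reduction
  stops.\<close>

lemma topspace_cube: "topspace (cube n) = {..<n} \<rightarrow>\<^sub>E {0..1}"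
  by (simp add: cube_def)

lemma continuous_map_into_cube:
  "continuous_map X (cube n) f \<longleftrightarrow>
     f \<in> topspace X \<rightarrow> topspace (cube n) \<and> (\<forall>i<n. continuous_map X euclideanreal (\<lambda>x. f x i))"
  unfolding cube_def continuous_map_componentwise continuous_map_in_subtopology
  by (auto simp: PiE_iff Pi_iff)

lemma continuous_map_cube_coordinate:
  "i < n \<Longrightarrow> continuous_map (cube n) euclideanreal (\<lambda>c. c i)"
  using continuous_map_into_cube[of "cube n" n "\<lambda>c. c"] by (simp add: continuous_map_id[unfolded id_def])

lemma cube_boundary_subset: "cube_boundary n \<subseteq> topspace (cube n)"
  by (auto simp: cube_boundary_def)

lemma cube_boundary_0 [simp]: "cube_boundary 0 = {}"
  by (auto simp: cube_boundary_def)

lemma compact_space_cube: "compact_space (cube n)"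
  by (simp add: cube_def compact_space_product_topology compact_space_subtopology)

lemma Hausdorff_space_cube: "Hausdorff_space (cube n)"
  by (simp add: cube_def Hausdorff_space_product_topology Hausdorff_space_subtopology)

lemma closedin_cube_boundary: "closedin (cube n) (cube_boundary n)"
proof -
  have "closedin (cube n) {c \<in> topspace (cube n). c i \<in> {0, 1}}" if "i < n" for i
    using that by (intro closedin_continuous_map_preimage[OF continuous_map_cube_coordinate]) auto
  then have "closedin (cube n) (\<Union>i<n. {c \<in> topspace (cube n). c i \<in> {0, 1}})"
    by (intro closedin_Union) auto
  moreover have "cube_boundary n = (\<Union>i<n. {c \<in> topspace (cube n). c i \<in> {0, 1}})"
    by (auto simp: cube_boundary_def)
  ultimately show ?thesis by simp
qed

text \<open>
  The relative lifting property up to homotopy for \<open>(I\<^sup>n, \<partial>I\<^sup>n)\<close>; unlike bijectivity on homotopy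
  groups it is base point free, and it is what the constructions below produce.
\<close>

definition lifting_map :: "'a topology \<Rightarrow> 'b topology \<Rightarrow> ('a \<Rightarrow> 'b) \<Rightarrow> bool" where
  "lifting_map E Y f \<longleftrightarrow> continuous_map E Y f \<and>
    (\<forall>n h g. continuous_map (cube n) Y h \<longrightarrow>
       continuous_map (subtopology (cube n) (cube_boundary n)) E g \<longrightarrow>
       (\<forall>c\<in>cube_boundary n. f (g c) = h c) \<longrightarrow>
       (\<exists>g'. continuous_map (cube n) E g' \<and> (\<forall>c\<in>cube_boundary n. g' c = g c) \<and>
          homotopic_with (\<lambda>k. \<forall>c\<in>cube_boundary n. k c = h c) (cube n) Y h (f \<circ> g')))"

lemma lifting_mapD:
  assumes "lifting_map E Y f" "continuous_map (cube n) Y h"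
    and "continuous_map (subtopology (cube n) (cube_boundary n)) E g"
    and "\<forall>c\<in>cube_boundary n. f (g c) = h c"
  shows "\<exists>g'. continuous_map (cube n) E g' \<and> (\<forall>c\<in>cube_boundary n. g' c = g c) \<and>
          homotopic_with (\<lambda>k. \<forall>c\<in>cube_boundary n. k c = h c) (cube n) Y h (f \<circ> g')"
  by (rule assms(1)[unfolded lifting_map_def, THEN conjunct2, rule_format, OF assms(2,3)])
     (rule assms(4)[rule_format])

lemma lifting_map_extension:
  assumes "lifting_map E Y f" "continuous_map (cube n) Y h"
    and "continuous_map (subtopology (cube n) (cube_boundary n)) E g"
    and "\<forall>c\<in>cube_boundary n. f (g c) = h c"
  shows "\<exists>g'. continuous_map (cube n) E g' \<and> (\<forall>c\<in>cube_boundary n. g' c = g c)"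
  using lifting_mapD[OF assms] by blast

text \<open>The problem is solved over \<open>g\<close> first, and its solution is then lifted
  through \<open>f\<close>; the second homotopy is fixed on the boundary, so its image under
  \<open>g\<close> still restricts to \<open>h\<close> there.\<close>

lemma lifting_map_compose:
  assumes f: "lifting_map X Y f" and g: "lifting_map Y Z g"
  shows "lifting_map X Z (g \<circ> f)"
  unfolding lifting_map_def
proof (intro conjI allI impI)
  show "continuous_map X Z (g \<circ> f)"
    using f g continuous_map_compose[of X Y f Z g] by (auto simp: lifting_map_def)
  fix n h k
  assume h: "continuous_map (cube n) Z h"
    and k: "continuous_map (subtopology (cube n) (cube_boundary n)) X k"
    and eq: "\<forall>c\<in>cube_boundary n. (g \<circ> f) (k c) = h c"
  have "continuous_map (subtopology (cube n) (cube_boundary n)) Y (f \<circ> k)"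
    using f continuous_map_compose[OF k, of Y f] by (auto simp: lifting_map_def)
  moreover have "\<forall>c\<in>cube_boundary n. g ((f \<circ> k) c) = h c"
    using eq by simp
  ultimately obtain h' where h': "continuous_map (cube n) Y h'"
      "\<forall>c\<in>cube_boundary n. h' c = (f \<circ> k) c"
      "homotopic_with (\<lambda>k. \<forall>c\<in>cube_boundary n. k c = h c) (cube n) Z h (g \<circ> h')"
    using lifting_mapD[OF g h] by blast
  have "\<forall>c\<in>cube_boundary n. f (k c) = h' c"
    using h'(2) by simp
  then obtain k' where k': "continuous_map (cube n) X k'" "\<forall>c\<in>cube_boundary n. k' c = k c"
      "homotopic_with (\<lambda>k. \<forall>c\<in>cube_boundary n. k c = h' c) (cube n) Y h' (f \<circ> k')"
    using lifting_mapD[OF f h'(1) k] by blast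
  have "homotopic_with (\<lambda>k. \<forall>c\<in>cube_boundary n. k c = h c) (cube n) Z (g \<circ> h') (g \<circ> (f \<circ> k'))"
    by (rule homotopic_with_compose_continuous_map_left[OF k'(3)])
       (use g eq h'(2) in \<open>auto simp: lifting_map_def\<close>)
  from homotopic_with_trans[OF h'(3) this]
  have "homotopic_with (\<lambda>k. \<forall>c\<in>cube_boundary n. k c = h c) (cube n) Z h (g \<circ> f \<circ> k')"
    by (simp add: comp_assoc)
  with k' show "\<exists>g'. continuous_map (cube n) X g' \<and> (\<forall>c\<in>cube_boundary n. g' c = k c) \<and>
      homotopic_with (\<lambda>k. \<forall>c\<in>cube_boundary n. k c = h c) (cube n) Z h (g \<circ> f \<circ> g')"
    by blast
qed

section \<open>Bijectivity on path components and homotopy groups\<close>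

lemma topspace_cube_0: "topspace (cube 0) = {\<lambda>x. undefined}"
  by (simp add: topspace_cube)

text \<open>This is the lifting property for \<open>n = 0\<close>: the cube is a single point with
  empty boundary, and a homotopy of maps on it is a path.\<close>

lemma lifting_map_imp_path_component:
  assumes f: "lifting_map X Y f" and y: "y \<in> topspace Y"
  shows "\<exists>x\<in>topspace X. path_component_of Y y (f x)"
proof -
  let ?o = "\<lambda>x::nat. undefined::real"
  have "continuous_map (cube 0) Y (\<lambda>_. y)" "continuous_map (subtopology (cube 0) (cube_boundary 0)) X (\<lambda>_. undefined)"
    using y by auto
  from lifting_mapD[OF f this] obtain g' where g': "continuous_map (cube 0) X g'"
    "homotopic_with (\<lambda>k. \<forall>c\<in>cube_boundary 0. k c = y) (cube 0) Y (\<lambda>_. y) (f \<circ> g')"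
    by auto
  have o: "?o \<in> topspace (cube 0)"
    by (simp add: topspace_cube_0)
  obtain H where H: "continuous_map (prod_topology (top_of_set {0..1::real}) (cube 0)) Y H"
     "\<And>c. H (0, c) = y" "\<And>c. H (1, c) = f (g' c)"
    using g'(2) by (auto simp: homotopic_with_def)
  have "continuous_map (top_of_set {0..1::real}) Y (H \<circ> (\<lambda>t. (t, ?o)))"
    by (rule continuous_map_compose[OF _ H(1)]) (use o in \<open>auto intro!: continuous_map_pairedI\<close>)
  then have "path_component_of Y y (f (g' ?o))"
    using H by (auto simp: path_component_of_def pathin_def comp_def intro!: exI[of _ "\<lambda>t. H (t, ?o)"])
  moreover have "g' ?o \<in> topspace X"
    using g'(1) o by (auto simp: continuous_map_def)
  ultimately show ?thesis by blast
qed

text \<open>This is the lifting property for \<open>n = 1\<close>: a path between the images, with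
  its two end points already lifted, yields a path between the lifted end points.\<close>

lemma lifting_map_reflects_path_component:
  assumes f: "lifting_map X Y f" and x: "x \<in> topspace X" "x' \<in> topspace X"
    and p: "path_component_of Y (f x) (f x')"
  shows "path_component_of X x x'"
proof -
  obtain \<gamma> where \<gamma>: "continuous_map (top_of_set {0..1::real}) Y \<gamma>" "\<gamma> 0 = f x" "\<gamma> 1 = f x'"
    using p by (auto simp: path_component_of_def pathin_def)
  have c0: "continuous_map (cube 1) (top_of_set {0..1::real}) (\<lambda>c. c 0)"
    by (auto simp: continuous_map_in_subtopology continuous_map_cube_coordinate topspace_cube PiE_iff)
  then have h: "continuous_map (cube 1) Y (\<lambda>c. \<gamma> (c 0))"
    using continuous_map_compose[OF c0 \<gamma>(1)] by (simp add: comp_def)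
  \<comment> \<open>The boundary of the 1-cube consists of two points; any threshold strictly
    between them makes \<open>g\<close> continuous, as nothing has to be matched at the
    threshold.\<close>
  define g where "g = (\<lambda>c::nat \<Rightarrow> real. if c 0 \<le> 1/2 then x else x')"
  have "continuous_map (subtopology (cube 1) (cube_boundary 1)) X g"
    unfolding g_def
  proof (rule continuous_map_cases_le)
    show "continuous_map (subtopology (cube 1) (cube_boundary 1)) euclideanreal (\<lambda>c. c 0)"
      by (simp add: continuous_map_cube_coordinate continuous_map_from_subtopology)
  qed (use x in \<open>auto simp: cube_boundary_def\<close>)
  moreover have "\<forall>c\<in>cube_boundary 1. f (g c) = \<gamma> (c 0)"
    using \<gamma> by (auto simp: cube_boundary_def g_def)
  ultimately obtain g' where g': "continuous_map (cube 1) X g'" "\<forall>c\<in>cube_boundary 1. g' c = g c"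
    using lifting_map_extension[OF f h] by blast
  define e where "e = (\<lambda>(t::real) (i::nat). if i = 0 then t else undefined)"
  have "continuous_map (top_of_set {0..1::real}) (cube 1) e"
    by (auto simp: continuous_map_into_cube topspace_cube e_def PiE_iff extensional_def)
  then have "continuous_map (top_of_set {0..1::real}) X (g' \<circ> e)"
    using g'(1) by (rule continuous_map_compose)
  moreover have "e 0 \<in> cube_boundary 1" "e 1 \<in> cube_boundary 1"
    by (auto simp: cube_boundary_def topspace_cube e_def PiE_iff extensional_def)
  moreover have "g (e 0) = x" "g (e 1) = x'"
    by (auto simp: g_def e_def)
  ultimately show ?thesis
    using g'(2) by (auto simp: path_component_of_def pathin_def intro!: exI[of _ "g' \<circ> e"])
qed

lemma path_component_of_image:
  assumes "continuous_map X Y f" "path_component_of X x x'"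
  shows "path_component_of Y (f x) (f x')"
  using assms pathin_compose unfolding path_component_of_def by (metis comp_apply)

lemma pi0_induced_path_component:
  assumes "continuous_map X Y f" "x \<in> topspace X"
  shows "pi0_induced Y f (path_component_of_set X x) = path_component_of_set Y (f x)"
proof (intro equalityI subsetI)
  fix y assume "y \<in> pi0_induced Y f (path_component_of_set X x)"
  then obtain x' where "path_component_of X x x'" "path_component_of Y (f x') y"
    by (auto simp: pi0_induced_def)
  then show "y \<in> path_component_of_set Y (f x)"
    using path_component_of_image[OF assms(1)] path_component_of_trans by (metis mem_Collect_eq)
next
  fix y assume "y \<in> path_component_of_set Y (f x)"
  then show "y \<in> pi0_induced Y f (path_component_of_set X x)"
    using assms(2) path_component_of_refl[of X x] by (auto simp: pi0_induced_def)
qed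

lemma lifting_map_bij_pi0:
  assumes f: "lifting_map X Y f"
  shows "bij_betw (pi0_induced Y f) (path_components_of X) (path_components_of Y)"
proof -
  have c: "continuous_map X Y f"
    using f by (simp add: lifting_map_def)
  show ?thesis
    unfolding bij_betw_def
  proof (intro conjI inj_onI)
    fix C D assume "C \<in> path_components_of X" "D \<in> path_components_of X"
      and eq: "pi0_induced Y f C = pi0_induced Y f D"
    then obtain x x' where x: "x \<in> topspace X" "x' \<in> topspace X" "C = path_component_of_set X x" "D = path_component_of_set X x'"
      by (auto simp: path_components_of_def)
    then have "path_component_of_set Y (f x) = path_component_of_set Y (f x')"
      using eq c by (simp add: pi0_induced_path_component)
    moreover have "f x' \<in> topspace Y"
      using c x by (auto simp: continuous_map_def)
    ultimately have "path_component_of Y (f x) (f x')"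
      using path_component_of_refl[of Y "f x'"] by auto
    then have "path_component_of X x x'"
      by (rule lifting_map_reflects_path_component[OF f x(1,2)])
    then show "C = D"
      using x path_component_of_eq[of X x x'] by simp
  next
    show "pi0_induced Y f ` path_components_of X = path_components_of Y"
    proof (intro equalityI subsetI)
      fix D assume "D \<in> pi0_induced Y f ` path_components_of X"
      then show "D \<in> path_components_of Y"
      proof -
        obtain x where x: "x \<in> topspace X" "D = pi0_induced Y f (path_component_of_set X x)"
          using \<open>D \<in> _\<close> by (auto simp: path_components_of_def)
        then have "f x \<in> topspace Y" "D = path_component_of_set Y (f x)"
          using c by (auto simp: continuous_map_def pi0_induced_path_component)
        then show ?thesis
          unfolding path_components_of_def by (rule image_eqI[rotated])
      qed
    next
      fix D assume "D \<in> path_components_of Y"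
      then obtain y where y: "y \<in> topspace Y" "D = path_component_of_set Y y"
        by (auto simp: path_components_of_def)
      obtain x where x: "x \<in> topspace X" "path_component_of Y y (f x)"
        using lifting_map_imp_path_component[OF f y(1)] by blast
      then have "D = path_component_of_set Y (f x)"
        using y path_component_of_eq[of Y y "f x"] path_component_in_topspace[OF x(2)] by simp
      then have "D = pi0_induced Y f (path_component_of_set X x)"
        using c x by (simp add: pi0_induced_path_component)
      then show "D \<in> pi0_induced Y f ` path_components_of X"
        using x by (auto simp: path_components_of_def)
    qed
  qed
qed

lemma equiv_cube_homotopy: "equiv (based_cubes n X x) (cube_homotopy n X x)"
proof (rule equivI)
  show "cube_homotopy n X x \<subseteq> based_cubes n X x \<times> based_cubes n X x"
  proof clarify
    fix g h assume "(g, h) \<in> cube_homotopy n X x"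
    then have *: "homotopic_with (\<lambda>k. \<forall>c\<in>cube_boundary n. k c = x) (cube n) X g h"
      by (simp add: cube_homotopy_def)
    show "g \<in> based_cubes n X x \<and> h \<in> based_cubes n X x"
      using homotopic_with_imp_continuous_maps[OF *] homotopic_with_imp_property[OF *]
      by (simp add: based_cubes_def)
  qed
  show "refl_on (based_cubes n X x) (cube_homotopy n X x)"
    by (auto simp: refl_on_def cube_homotopy_def based_cubes_def)
  show "sym (cube_homotopy n X x)"
  proof (rule symI)
    fix g h assume "(g, h) \<in> cube_homotopy n X x"
    then show "(h, g) \<in> cube_homotopy n X x"
      unfolding cube_homotopy_def mem_Collect_eq case_prod_conv by (rule homotopic_with_symD)
  qed
  show "trans (cube_homotopy n X x)"
  proof (rule transI)
    fix g h k assume "(g, h) \<in> cube_homotopy n X x" "(h, k) \<in> cube_homotopy n X x"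
    then show "(g, k) \<in> cube_homotopy n X x"
      unfolding cube_homotopy_def mem_Collect_eq case_prod_conv by (rule homotopic_with_trans)
  qed
qed

lemma based_cubes_compose:
  assumes "continuous_map X Y f" "g \<in> based_cubes n X x"
  shows "f \<circ> g \<in> based_cubes n Y (f x)"
  using assms continuous_map_compose[of "cube n" X g Y f] by (auto simp: based_cubes_def)

lemma cube_homotopy_compose:
  assumes "continuous_map X Y f" "(g, h) \<in> cube_homotopy n X x"
  shows "(f \<circ> g, f \<circ> h) \<in> cube_homotopy n Y (f x)"
proof -
  have "homotopic_with (\<lambda>k. \<forall>c\<in>cube_boundary n. k c = x) (cube n) X g h"
    using assms by (simp add: cube_homotopy_def)
  then show ?thesis
    unfolding cube_homotopy_def mem_Collect_eq case_prod_conv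
    by (rule homotopic_with_compose_continuous_map_left[OF _ assms(1)]) auto
qed

lemma pi_induced_class:
  assumes f: "continuous_map X Y f" and g: "g \<in> based_cubes n X x"
  shows "pi_induced n Y (f x) f (cube_homotopy n X x `` {g}) = cube_homotopy n Y (f x) `` {f \<circ> g}"
proof -
  have tr: "trans (cube_homotopy n Y (f x))" and rf: "(g, g) \<in> cube_homotopy n X x"
    using equiv_cube_homotopy[of n X x] equiv_cube_homotopy[of n Y "f x"] g
    by (simp_all add: equiv_def refl_on_def)
  have "(f \<circ> g, k) \<in> cube_homotopy n Y (f x)"
    if "(g, g') \<in> cube_homotopy n X x" "(f \<circ> g', k) \<in> cube_homotopy n Y (f x)" for g' k
    using cube_homotopy_compose[OF f that(1)] that(2) tr by (meson transD)
  with rf show ?thesis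
    by (auto simp: pi_induced_def)
qed

text \<open>Injectivity on homotopy groups in dimension \<open>n\<close> is the lifting property in
  dimension \<open>n + 1\<close>: a homotopy between \<open>f \<circ> g0\<close> and
  \<open>f \<circ> g1\<close> is a cube with time as its last coordinate, and its boundary is lifted
  by \<open>g0\<close>, \<open>g1\<close> and the constant \<open>x\<close>.\<close>

lemma lifting_map_reflects_cube_homotopy:
  assumes f: "lifting_map X Y f" and x: "x \<in> topspace X"
    and g: "g0 \<in> based_cubes n X x" "g1 \<in> based_cubes n X x"
    and hom: "(f \<circ> g0, f \<circ> g1) \<in> cube_homotopy n Y (f x)"
  shows "(g0, g1) \<in> cube_homotopy n X x"
proof -
  define pr where "pr = (\<lambda>c::nat \<Rightarrow> real. restrict c {..<n})"
  let ?B = "subtopology (cube (Suc n)) (cube_boundary (Suc n))"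
  let ?I = "top_of_set {0..1::real}"
  have c: "continuous_map X Y f"
    using f by (simp add: lifting_map_def)
  obtain H where H: "continuous_map (prod_topology ?I (cube n)) Y H"
     "\<And>c. H (0, c) = f (g0 c)" "\<And>c. H (1, c) = f (g1 c)"
     "\<And>t c. t \<in> {0..1} \<Longrightarrow> c \<in> cube_boundary n \<Longrightarrow> H (t, c) = f x"
    using hom by (auto simp: homotopic_with_def cube_homotopy_def)
  have pr: "continuous_map (cube (Suc n)) (cube n) pr"
    by (auto simp: continuous_map_into_cube continuous_map_cube_coordinate topspace_cube pr_def PiE_iff)
  have cn: "continuous_map (cube (Suc n)) ?I (\<lambda>c. c n)"
    by (auto simp: continuous_map_in_subtopology continuous_map_cube_coordinate topspace_cube PiE_iff)
  have h: "continuous_map (cube (Suc n)) Y (\<lambda>c. H (c n, pr c))"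
    using continuous_map_compose[OF continuous_map_pairedI[OF cn pr] H(1)] by (simp add: comp_def)
  \<comment> \<open>The bottom, the top and the union of the side faces. Where a side meets the
    bottom or the top, both formulas give \<open>x\<close>, since \<open>g0\<close> and
    \<open>g1\<close> are based.\<close>
  define A where "A = (\<lambda>j::nat. {c \<in> cube_boundary (Suc n).
     if j = 0 then c n = 0 else if j = 1 then c n = 1 else \<exists>i<n. c i = 0 \<or> c i = 1})"
  define gg where "gg = (\<lambda>j::nat. if j = 0 then g0 \<circ> pr else if j = 1 then g1 \<circ> pr else (\<lambda>_. x))"
  define g where "g = (\<lambda>c. if c n = 0 then g0 (pr c) else if c n = 1 then g1 (pr c) else x)"
  have prb: "pr c \<in> cube_boundary n" if "c \<in> topspace (cube (Suc n))" "\<exists>i<n. c i = 0 \<or> c i = 1" for c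
    using that pr by (auto simp: cube_boundary_def pr_def continuous_map_def)
  have B: "topspace ?B = cube_boundary (Suc n)"
    using cube_boundary_subset by auto
  have gcont: "continuous_map ?B X g"
  proof (rule pasting_lemma_closed[where I = "{0,1,2}" and T = A and f = gg])
    have cl: "closedin ?B {c \<in> topspace ?B. c i \<in> S}" if "i < Suc n" "closed S" for i S
      by (rule closedin_continuous_map_preimage[OF continuous_map_from_subtopology[OF continuous_map_cube_coordinate]])
         (use that in auto)
    have A2: "A 2 = (\<Union>i<n. {c \<in> topspace ?B. c i \<in> {0,1}})"
      using B by (auto simp: A_def)
    show "closedin ?B (A i)" if "i \<in> {0,1,2}" for i
    proof -
      have "closedin ?B (A 0)" "closedin ?B (A 1)"
        using cl[of n "{0}"] cl[of n "{1}"] by (simp_all add: A_def B del: topspace_subtopology)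
      moreover have "closedin ?B (A 2)"
        unfolding A2 by (intro closedin_Union) (use cl[of _ "{0,1}"] in \<open>auto simp del: topspace_subtopology\<close>)
      ultimately show ?thesis using that by auto
    qed
    show "continuous_map (subtopology ?B (A i)) X (gg i)" if "i \<in> {0,1,2}" for i
      using g x continuous_map_compose[OF pr, of X g0] continuous_map_compose[OF pr, of X g1]
      by (auto simp: gg_def based_cubes_def intro!: continuous_map_from_subtopology)
    have g0b: "g0 (pr c) = x" "g1 (pr c) = x" if "c \<in> A 2" for c
      using prb[of c] that g by (auto simp: A_def based_cubes_def cube_boundary_def)
    show "gg i c = gg j c" if "i \<in> {0,1,2}" "j \<in> {0,1,2}" "c \<in> topspace ?B \<inter> A i \<inter> A j" for i j c
      using that g0b[of c] by (auto simp: gg_def) (auto simp: A_def)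
    show "\<exists>j. j \<in> {0,1,2} \<and> c \<in> A j \<and> g c = gg j c" if "c \<in> topspace ?B" for c
    proof -
      have "c \<in> cube_boundary (Suc n)" using that B by simp
      then have "(c \<in> A 0) = (c n = 0)" "(c \<in> A 1) = (c n = 1)"
          "c n \<noteq> 0 \<Longrightarrow> c n \<noteq> 1 \<Longrightarrow> c \<in> A 2"
        by (auto simp: A_def cube_boundary_def less_Suc_eq)
      moreover have "g c = gg (if c n = 0 then 0 else if c n = 1 then 1 else 2) c"
        by (simp add: g_def gg_def)
      ultimately show ?thesis
        by (intro exI[of _ "if c n = 0 then 0 else if c n = 1 then 1 else 2"]) simp
    qed
  qed simp
  have "f (g c) = H (c n, pr c)" if cb: "c \<in> cube_boundary (Suc n)" for c
  proof -
    obtain i where "i < Suc n" "c i = 0 \<or> c i = 1"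
      using cb by (auto simp: cube_boundary_def)
    then consider "c n = 0" | "c n = 1" | "c n \<noteq> 0" "c n \<noteq> 1" "\<exists>i<n. c i = 0 \<or> c i = 1"
      by (metis less_SucE)
    then show ?thesis
    proof cases
      case 3
      then have "pr c \<in> cube_boundary n" "c n \<in> {0..1}"
        using cb prb[of c] by (auto simp: cube_boundary_def topspace_cube PiE_iff)
      with 3 show ?thesis by (simp add: g_def H(4))
    qed (auto simp: g_def H)
  qed
  then have "\<forall>c\<in>cube_boundary (Suc n). f (g c) = H (c n, pr c)" ..
  from lifting_map_extension[OF f h gcont this]
  obtain G where G: "continuous_map (cube (Suc n)) X G" "\<forall>c\<in>cube_boundary (Suc n). G c = g c"
    by blast
  \<comment> \<open>The inverse of reading off time and position. Beyond the first
    \<open>n + 1\<close> coordinates the value must be \<open>undefined\<close>, because points of a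
    cube are extensional functions.\<close>
  define e where "e = (\<lambda>(t::real, c) i. if i = n then t else if i < n then c i else undefined :: real)"
  have e: "continuous_map (prod_topology ?I (cube n)) (cube (Suc n)) e"
    unfolding continuous_map_into_cube
  proof (intro conjI allI impI)
    show "e \<in> topspace (prod_topology ?I (cube n)) \<rightarrow> topspace (cube (Suc n))"
    proof
      fix p assume "p \<in> topspace (prod_topology ?I (cube n))"
      then have "fst p \<in> {0..1}" "\<forall>i<n. snd p i \<in> {0..1}"
        by (simp_all add: topspace_cube mem_Times_iff PiE_iff)
      then have "e p i \<in> {0..1}" if "i < Suc n" for i
        using that unfolding e_def split_def by (auto simp: less_Suc_eq)
      moreover have "e p i = undefined" if "\<not> i < Suc n" for i
        using that unfolding e_def split_def by simp
      ultimately show "e p \<in> topspace (cube (Suc n))"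
        unfolding topspace_cube PiE_iff extensional_def by blast
    qed
    fix i assume "i < Suc n"
    then consider "i = n" | "i < n" by (meson less_SucE)
    then show "continuous_map (prod_topology ?I (cube n)) euclideanreal (\<lambda>p. e p i)"
    proof cases
      case 1
      have "continuous_map (prod_topology ?I (cube n)) euclideanreal fst"
        using continuous_map_fst[of ?I "cube n"] by (simp add: continuous_map_in_subtopology)
      with 1 show ?thesis by (simp add: e_def split_def)
    next
      case 2
      have "continuous_map (prod_topology ?I (cube n)) euclideanreal ((\<lambda>c. c i) \<circ> snd)"
        by (rule continuous_map_compose[OF continuous_map_snd continuous_map_cube_coordinate[OF 2]])
      with 2 show ?thesis by (simp add: e_def split_def comp_def)
    qed
  qed
  have pre: "pr (e (t, c)) = c" if "c \<in> topspace (cube n)" for t c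
    using that unfolding pr_def e_def topspace_cube PiE_iff extensional_def restrict_def
    by (intro ext) simp
  have et: "e (t, c) \<in> topspace (cube (Suc n))" if "t \<in> {0..1}" "c \<in> topspace (cube n)" for t c
    using e that by (auto simp: continuous_map_def)
  have "homotopic_with (\<lambda>k. \<forall>c\<in>cube_boundary n. k c = x) (cube n) X g0 g1"
  proof (subst homotopic_with, goal_cases)
    case (1 h k)
    then show ?case using cube_boundary_subset by (metis subsetD)
  next
    case 2
    show ?case
    proof (intro exI[of _ "G \<circ> e"] conjI ballI)
      show "continuous_map (prod_topology ?I (cube n)) X (G \<circ> e)"
        using e G(1) by (rule continuous_map_compose)
    next
      fix c assume c: "c \<in> topspace (cube n)"
      have "e (0, c) \<in> cube_boundary (Suc n)" "e (1, c) \<in> cube_boundary (Suc n)"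
        using et[OF _ c] by (auto simp: cube_boundary_def e_def)
      then show "(G \<circ> e) (0, c) = g0 c" "(G \<circ> e) (1, c) = g1 c"
        using c G(2) pre by (auto simp: g_def) (auto simp: e_def)
    next
      fix t :: real and c assume t: "t \<in> {0..1}" and c: "c \<in> cube_boundary n"
      then obtain i where i: "i < n" "c i = 0 \<or> c i = 1" "c \<in> topspace (cube n)"
        by (auto simp: cube_boundary_def)
      then have b: "e (t, c) \<in> cube_boundary (Suc n)"
        using et[OF t] by (auto simp: cube_boundary_def e_def intro!: exI[of _ i])
      have "g0 c = x" "g1 c = x"
        using g c by (auto simp: based_cubes_def)
      then show "(G \<circ> e) (t, c) = x"
        using bspec[OF G(2) b] pre[OF i(3)] by (auto simp: g_def)
    qed
  qed
  then show ?thesis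
    by (simp add: cube_homotopy_def)
qed

lemma lifting_map_bij_pi:
  assumes f: "lifting_map X Y f" and x: "x \<in> topspace X"
  shows "bij_betw (pi_induced n Y (f x) f) (homotopy_group n X x) (homotopy_group n Y (f x))"
proof -
  have c: "continuous_map X Y f"
    using f by (simp add: lifting_map_def)
  note eqX = equiv_cube_homotopy[of n X x] and eqY = equiv_cube_homotopy[of n Y "f x"]
  show ?thesis
    unfolding bij_betw_def
  proof (intro conjI inj_onI)
    fix C D assume "C \<in> homotopy_group n X x" "D \<in> homotopy_group n X x"
      and eq: "pi_induced n Y (f x) f C = pi_induced n Y (f x) f D"
    then obtain g0 g1 where g: "g0 \<in> based_cubes n X x" "g1 \<in> based_cubes n X x"
        "C = cube_homotopy n X x `` {g0}" "D = cube_homotopy n X x `` {g1}"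
      by (auto simp: homotopy_group_def quotient_def)
    then have "cube_homotopy n Y (f x) `` {f \<circ> g0} = cube_homotopy n Y (f x) `` {f \<circ> g1}"
      using eq c by (simp add: pi_induced_class)
    then have "(f \<circ> g0, f \<circ> g1) \<in> cube_homotopy n Y (f x)"
      using eq_equiv_class_iff[OF eqY] g c by (simp add: based_cubes_compose)
    then show "C = D"
      using lifting_map_reflects_cube_homotopy[OF f x g(1,2)] g equiv_class_eq[OF eqX] by simp
  next
    show "pi_induced n Y (f x) f ` homotopy_group n X x = homotopy_group n Y (f x)"
    proof (intro equalityI subsetI)
      fix D assume "D \<in> pi_induced n Y (f x) f ` homotopy_group n X x"
      then show "D \<in> homotopy_group n Y (f x)"
        using c by (auto simp: homotopy_group_def quotient_def pi_induced_class based_cubes_compose)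
    next
      fix D assume "D \<in> homotopy_group n Y (f x)"
      then obtain k where k: "k \<in> based_cubes n Y (f x)" "D = cube_homotopy n Y (f x) `` {k}"
        by (auto simp: homotopy_group_def quotient_def)
      have "continuous_map (subtopology (cube n) (cube_boundary n)) X (\<lambda>_. x)"
        using x by simp
      moreover have "\<forall>c\<in>cube_boundary n. f x = k c"
        using k by (auto simp: based_cubes_def)
      moreover have "continuous_map (cube n) Y k"
        using k by (simp add: based_cubes_def)
      ultimately obtain g' where g': "continuous_map (cube n) X g'" "\<forall>c\<in>cube_boundary n. g' c = x"
        "homotopic_with (\<lambda>j. \<forall>c\<in>cube_boundary n. j c = k c) (cube n) Y k (f \<circ> g')"
        using lifting_mapD[OF f] by blast
      have "(k, f \<circ> g') \<in> cube_homotopy n Y (f x)"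
        unfolding cube_homotopy_def mem_Collect_eq case_prod_conv
        by (rule homotopic_with_mono[OF g'(3)]) (use k in \<open>auto simp: based_cubes_def\<close>)
      moreover have b: "g' \<in> based_cubes n X x"
        using g' by (auto simp: based_cubes_def)
      ultimately have "D = pi_induced n Y (f x) f (cube_homotopy n X x `` {g'})"
        using k c equiv_class_eq[OF eqY] by (simp add: pi_induced_class)
      then show "D \<in> pi_induced n Y (f x) f ` homotopy_group n X x"
        using b by (auto simp: homotopy_group_def quotient_def)
    qed
  qed
qed

lemma lifting_map_imp_weak_homotopy_equivalence:
  "lifting_map X Y f \<Longrightarrow> weak_homotopy_equivalence X Y f"
  unfolding weak_homotopy_equivalence_def
  by (intro conjI allI impI ballI lifting_map_bij_pi0 lifting_map_bij_pi) (simp add: lifting_map_def)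

section \<open>Lifting over finite posets\<close>

lemma continuous_map_fst_real: "continuous_map (prod_topology (top_of_set S) X) euclideanreal fst"
  using continuous_map_fst[of "top_of_set S" X] by (simp add: continuous_map_in_subtopology)

lemma continuous_map_of_snd: "continuous_map Y Z u \<Longrightarrow> continuous_map (prod_topology X Y) Z (\<lambda>p. u (snd p))"
  using continuous_map_compose[OF continuous_map_snd] by (auto simp: comp_def)

text \<open>The inserted 0 covers the empty index set, as it occurs for the cube of dimension
  0.\<close>

lemma continuous_map_Max_insert:
  fixes f :: "'i \<Rightarrow> 'a \<Rightarrow> real"
  assumes "finite I" "\<And>i. i \<in> I \<Longrightarrow> continuous_map X euclideanreal (f i)"
  shows "continuous_map X euclideanreal (\<lambda>x. Max (insert 0 ((\<lambda>i. f i x) ` I)))"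
  using assms
proof (induction I rule: finite_induct)
  case (insert j I)
  have "Max (insert 0 ((\<lambda>i. f i x) ` insert j I)) = max (f j x) (Max (insert 0 ((\<lambda>i. f i x) ` I)))" for x
    unfolding image_insert insert_commute[of 0] by (rule Max_insert) (use insert.hyps in auto)
  then show ?case
    using insert by (simp del: Max_insert) (intro continuous_map_real_max; simp)
qed simp

text \<open>
  A lift that restricts to \<open>g\<close> only up to a homotopy compatible with \<open>H\<close> is corrected by putting
  the homotopy \<open>K\<close> on a collar of the boundary: \<open>(s, pos)\<close> below is a map of the cube onto
  its top and side walls.
\<close>

lemma lifting_mapI:
  assumes f: "continuous_map E Y f"
    and lift: "\<And>n h g. \<lbrakk>continuous_map (cube n) Y h;
        continuous_map (subtopology (cube n) (cube_boundary n)) E g;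
        \<forall>c\<in>cube_boundary n. f (g c) = h c\<rbrakk> \<Longrightarrow>
      \<exists>g' H K. continuous_map (cube n) E g' \<and>
         continuous_map (prod_topology (top_of_set {0..1::real}) (cube n)) Y H \<and>
         continuous_map (prod_topology (top_of_set {0..1::real}) (subtopology (cube n) (cube_boundary n))) E K \<and>
         (\<forall>c\<in>topspace (cube n). H (0, c) = h c \<and> H (1, c) = f (g' c)) \<and>
         (\<forall>c\<in>cube_boundary n. K (0, c) = g c \<and> K (1, c) = g' c) \<and>
         (\<forall>t\<in>{0..1}. \<forall>c\<in>cube_boundary n. f (K (t, c)) = H (t, c))"
  shows "lifting_map E Y f"
  unfolding lifting_map_def
proof (intro conjI allI impI f)
  fix n h g
  let ?I = "top_of_set {0..1::real}"
  let ?B = "subtopology (cube n) (cube_boundary n)"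
  assume h: "continuous_map (cube n) Y h" and g: "continuous_map ?B E g"
    and eq: "\<forall>c\<in>cube_boundary n. f (g c) = h c"
  obtain g' H K where g': "continuous_map (cube n) E g'"
    and H: "continuous_map (prod_topology ?I (cube n)) Y H"
    and K: "continuous_map (prod_topology ?I ?B) E K"
    and H01: "\<And>c. c \<in> topspace (cube n) \<Longrightarrow> H (0, c) = h c"
      "\<And>c. c \<in> topspace (cube n) \<Longrightarrow> H (1, c) = f (g' c)"
    and K01: "\<And>c. c \<in> cube_boundary n \<Longrightarrow> K (0, c) = g c"
      "\<And>c. c \<in> cube_boundary n \<Longrightarrow> K (1, c) = g' c"
    and fK: "\<And>t c. t \<in> {0..1} \<Longrightarrow> c \<in> cube_boundary n \<Longrightarrow> f (K (t, c)) = H (t, c)"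
    using lift[OF h g eq] by blast
  \<comment> \<open>\<open>m\<close> is the distance from the centre in the maximum norm, scaled to
    be 1 on the boundary. On the inner cube \<open>m c \<le> 1/2\<close>, \<open>pos\<close>
    stretches by the factor 2 and \<open>s\<close> is 1; on the collar, \<open>pos\<close> projects
    radially to the boundary and \<open>s\<close> falls from 1 to 0.\<close>
  define m where "m = (\<lambda>c::nat\<Rightarrow>real. Max (insert 0 ((\<lambda>i. \<bar>2 * c i - 1\<bar>) ` {..<n})))"
  define d where "d = (\<lambda>c. max (m c) (1/2))"
  define s where "s = (\<lambda>c. min 1 (2 - 2 * m c))"
  define pos where "pos = (\<lambda>c::nat\<Rightarrow>real. \<lambda>i. if i < n then 1/2 + (c i - 1/2) / d c else undefined)"
  have mi: "\<bar>2 * c i - 1\<bar> \<le> m c" if "i < n" for c i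
    using that by (auto simp: m_def)
  have m0: "0 \<le> m c" for c
    by (auto simp: m_def)
  have m1: "m c \<le> 1" if "c \<in> topspace (cube n)" for c
    using that by (auto simp: m_def topspace_cube PiE_iff abs_le_iff)
  have mb: "m c = 1" if cb: "c \<in> cube_boundary n" for c
  proof -
    obtain i where "i < n" "c i = 0 \<or> c i = 1" using cb by (auto simp: cube_boundary_def)
    then have "1 \<le> m c" using mi[of i c] by auto
    moreover have "m c \<le> 1" using cb cube_boundary_subset by (blast intro: m1)
    ultimately show ?thesis by simp
  qed
  have d0: "d c > 0" "1/2 \<le> d c" "m c \<le> d c" for c
    by (auto simp: d_def)
  have contm: "continuous_map (cube n) euclideanreal m"
    unfolding m_def
    by (rule continuous_map_Max_insert) (auto intro!: continuous_intros continuous_map_cube_coordinate)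
  have contd: "continuous_map (cube n) euclideanreal d"
    unfolding d_def by (intro continuous_intros contm) simp
  have conts: "continuous_map (cube n) euclideanreal s"
    unfolding s_def by (intro continuous_intros contm) simp_all
  have s01: "s c \<in> {0..1}" if "c \<in> topspace (cube n)" for c
    using m1[OF that] by (auto simp: s_def)
  have pos_cube: "pos c \<in> topspace (cube n)" for c
  proof -
    have *: "\<bar>(c i - 1/2) / d c\<bar> \<le> 1/2" if "i < n" for i
    proof -
      have "\<bar>c i - 1/2\<bar> * 2 = \<bar>2 * c i - 1\<bar>" by (simp add: abs_if)
      then show ?thesis
        using mi[OF that, of c] d0[of c] by (simp add: abs_divide pos_divide_le_eq)
    qed
    have "1/2 + (c i - 1/2) / d c \<in> {0..1}" if "i < n" for i
      using abs_le_D1[OF *[OF that]] abs_le_D2[OF *[OF that]] unfolding atLeastAtMost_iff by linarith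
    then show ?thesis
      by (simp add: topspace_cube PiE_iff pos_def extensional_def)
  qed
  have contpos: "continuous_map (cube n) (cube n) pos"
    unfolding continuous_map_into_cube
  proof (intro conjI allI impI)
    fix i assume i: "i < n"
    have "continuous_map (cube n) euclideanreal (\<lambda>c. 1/2 + (c i - 1/2) / d c)"
      by (intro continuous_intros contd continuous_map_cube_coordinate[OF i]) (use d0 in \<open>simp_all add: less_imp_neq[symmetric]\<close>)
    then show "continuous_map (cube n) euclideanreal (\<lambda>c. pos c i)"
      using i by (simp add: pos_def)
  qed (use pos_cube in auto)
  have pos_bd: "pos c \<in> cube_boundary n" if mc: "1/2 \<le> m c" for c
  proof -
    have "m c \<in> insert 0 ((\<lambda>i. \<bar>2 * c i - 1\<bar>) ` {..<n})"
      unfolding m_def by (rule Max_in) auto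
    then obtain i where i: "i < n" "m c = \<bar>2 * c i - 1\<bar>"
      using mc by auto
    moreover have "d c = m c" using mc by (simp add: d_def)
    moreover have "\<bar>c i - 1/2\<bar> * 2 = \<bar>2 * c i - 1\<bar>" by (simp add: abs_if)
    ultimately have "\<bar>(c i - 1/2) / d c\<bar> = 1/2"
      using d0(1)[of c] by (simp add: abs_divide field_simps)
    then have "(c i - 1/2) / d c = 1/2 \<or> (c i - 1/2) / d c = - (1/2)"
      by (metis abs_eq_iff abs_of_nonneg half_gt_zero_iff less_eq_real_def zero_less_one)
    moreover have "pos c i = 1/2 + (c i - 1/2) / d c"
      using i(1) by (simp add: pos_def)
    ultimately have "pos c i = 0 \<or> pos c i = 1"
      by linarith
    then show ?thesis
      using i pos_cube[of c] by (auto simp: cube_boundary_def)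
  qed
  have pos_id: "pos c = c" "s c = 0" if "c \<in> cube_boundary n" for c
  proof -
    have "d c = 1" using mb[OF that] by (simp add: d_def)
    then show "pos c = c"
      using that by (auto simp: pos_def fun_eq_iff cube_boundary_def topspace_cube PiE_iff extensional_def)
    show "s c = 0" using mb[OF that] by (simp add: s_def)
  qed
  \<comment> \<open>Both formulas agree for \<open>m c = 1/2\<close>, since there
    \<open>s c = 1\<close> and \<open>K\<close> has arrived at \<open>g'\<close>; on the boundary
    \<open>s c = 0\<close> and \<open>pos c = c\<close>, so the value is \<open>g c\<close>.\<close>
  define g'' where "g'' = (\<lambda>c. if m c \<le> 1/2 then g' (pos c) else K (s c, pos c))"
  have "continuous_map (cube n) E g''"
    unfolding g''_def
  proof (rule continuous_map_cases_le[OF contm])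
    show "continuous_map (subtopology (cube n) {c \<in> topspace (cube n). m c \<le> 1/2}) E (\<lambda>c. g' (pos c))"
      using continuous_map_compose[OF contpos g'] by (auto simp: comp_def intro: continuous_map_from_subtopology)
    let ?S = "subtopology (cube n) {c \<in> topspace (cube n). 1/2 \<le> m c}"
    have 1: "continuous_map ?S ?I s"
      using conts s01 by (auto simp: continuous_map_in_subtopology continuous_map_from_subtopology)
    have 2: "continuous_map ?S ?B pos"
      using contpos pos_bd by (auto simp: continuous_map_in_subtopology continuous_map_from_subtopology)
    show "continuous_map ?S E (\<lambda>c. K (s c, pos c))"
      using continuous_map_compose[OF continuous_map_pairedI[OF 1 2] K] by (simp add: comp_def)
    show "g' (pos c) = K (s c, pos c)" if "m c = 1/2" for c
      using that K01(2)[OF pos_bd[of c]] by (simp add: s_def)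
  qed simp
  moreover have "g'' c = g c" if "c \<in> cube_boundary n" for c
    using that pos_id[OF that] mb[OF that] K01(1) by (simp add: g''_def)
  moreover have "homotopic_with (\<lambda>k. \<forall>c\<in>cube_boundary n. k c = h c) (cube n) Y h (f \<circ> g'')"
  proof (subst homotopic_with, goal_cases)
    case (1 h k)
    then show ?case using cube_boundary_subset by (metis subsetD)
  next
    case 2
    \<comment> \<open>The position moves on a straight line from \<open>c\<close> to
      \<open>pos c\<close> while the time argument of \<open>H\<close> grows from 0 to
      \<open>s c\<close>; for boundary points neither of them changes.\<close>
    define e where "e = (\<lambda>p. (\<lambda>i. if i < n then (1 - fst p) * snd p i + fst p * pos (snd p) i else undefined))"
    define q where "q = (\<lambda>p. (fst p * s (snd p), e p))"
    let ?P = "prod_topology ?I (cube n)"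
    have e_cube: "e p \<in> topspace (cube n)" if "p \<in> topspace ?P" for p
    proof -
      have p: "0 \<le> fst p" "fst p \<le> 1" "snd p \<in> topspace (cube n)"
        using that by (simp_all add: mem_Times_iff)
      have "(1 - fst p) * snd p i + fst p * pos (snd p) i \<in> {0..1}" if "i < n" for i
      proof -
        have "snd p i \<in> {0..1}" "pos (snd p) i \<in> {0..1}"
          using p(3) pos_cube[of "snd p"] that by (auto simp: topspace_cube PiE_iff)
        then show ?thesis
          using p convexD[OF convex_real_interval(5), of "snd p i" 0 1 "pos (snd p) i" "1 - fst p" "fst p"] by auto
      qed
      then show ?thesis
        by (simp add: topspace_cube PiE_iff e_def extensional_def)
    qed
    have conte: "continuous_map ?P (cube n) e"
      unfolding continuous_map_into_cube
    proof (intro conjI allI impI)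
      fix i assume i: "i < n"
      have "continuous_map (cube n) euclideanreal (\<lambda>c. pos c i)"
        using contpos i by (simp add: continuous_map_into_cube)
      then have "continuous_map ?P euclideanreal (\<lambda>p. (1 - fst p) * snd p i + fst p * pos (snd p) i)"
        by (intro continuous_intros continuous_map_fst_real continuous_map_of_snd[where u = "\<lambda>c. c i"]
            continuous_map_of_snd[where u = "\<lambda>c. pos c i"] continuous_map_cube_coordinate[OF i]) simp_all
      then show "continuous_map ?P euclideanreal (\<lambda>p. e p i)"
        using i by (simp add: e_def)
    qed (use e_cube in auto)
    have contq1: "continuous_map ?P ?I (\<lambda>p. fst p * s (snd p))"
    proof -
      have "continuous_map ?P euclideanreal (\<lambda>p. fst p * s (snd p))"
        by (intro continuous_intros continuous_map_fst_real continuous_map_of_snd conts)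
      moreover have "fst p * s (snd p) \<in> {0..1}" if "p \<in> topspace ?P" for p
        using that s01[of "snd p"] by (auto simp: mem_Times_iff mult_le_one)
      ultimately show ?thesis
        by (auto simp: continuous_map_in_subtopology)
    qed
    have contq: "continuous_map ?P ?P q"
      unfolding q_def by (intro continuous_map_pairedI contq1 conte)
    show ?case
    proof (intro exI[of _ "H \<circ> q"] conjI ballI)
      show "continuous_map ?P Y (H \<circ> q)"
        using contq H by (rule continuous_map_compose)
      fix c assume c: "c \<in> topspace (cube n)"
      have "e (0, c) = c"
        using c by (auto simp: e_def fun_eq_iff topspace_cube PiE_iff extensional_def)
      then show "(H \<circ> q) (0, c) = h c"
        using H01 c by (simp add: q_def)
      have "e (1, c) = pos c"
        by (auto simp: e_def fun_eq_iff pos_def)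
      moreover have "f (g'' c) = H (s c, pos c)"
      proof (cases "m c \<le> 1/2")
        case True
        then have "s c = 1" by (simp add: s_def)
        with True show ?thesis using H01(2)[OF pos_cube[of c]] by (simp add: g''_def)
      next
        case False
        then show ?thesis using fK[OF s01[OF c] pos_bd[of c]] by (simp add: g''_def)
      qed
      ultimately show "(H \<circ> q) (1, c) = (f \<circ> g'') c"
        by (simp add: q_def)
    next
      fix t :: real and c assume t: "t \<in> {0..1}" and c: "c \<in> cube_boundary n"
      have "c \<in> topspace (cube n)" using c cube_boundary_subset by blast
      then have "e (t, c) = c"
        using pos_id[OF c] by (auto simp: e_def fun_eq_iff topspace_cube PiE_iff extensional_def algebra_simps)
      then show "(H \<circ> q) (t, c) = h c"
        using pos_id[OF c] H01(1)[OF \<open>c \<in> topspace (cube n)\<close>] by (simp add: q_def)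
    qed
  qed
  ultimately show "\<exists>g'. continuous_map (cube n) E g' \<and> (\<forall>c\<in>cube_boundary n. g' c = g c) \<and>
      homotopic_with (\<lambda>k. \<forall>c\<in>cube_boundary n. k c = h c) (cube n) Y h (f \<circ> g')"
    by blast
qed

section \<open>Homotopies along the order and retracts of finite posets\<close>

lemma continuous_map_into_poset:
  assumes r: "Partial_order r"
  shows "continuous_map P (poset_topology r) h \<longleftrightarrow>
     h \<in> topspace P \<rightarrow> Field r \<and> (\<forall>x\<in>Field r. openin P {p \<in> topspace P. (h p, x) \<in> r})"
proof
  assume h: "continuous_map P (poset_topology r) h"
  have "trans r" using r by (auto simp: partial_order_on_def preorder_on_def)
  then have "openin (poset_topology r) {y. (y, x) \<in> r}" for x
    by (auto simp: openin_poset_topology Field_def dest: transD)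
  then have "openin P {p \<in> topspace P. h p \<in> {y. (y, x) \<in> r}}" for x
    using h openin_continuous_map_preimage by blast
  with h show "h \<in> topspace P \<rightarrow> Field r \<and> (\<forall>x\<in>Field r. openin P {p \<in> topspace P. (h p, x) \<in> r})"
    by (auto simp: continuous_map_def)
next
  assume h: "h \<in> topspace P \<rightarrow> Field r \<and> (\<forall>x\<in>Field r. openin P {p \<in> topspace P. (h p, x) \<in> r})"
  have refl: "(x, x) \<in> r" if "x \<in> Field r" for x
    using r that by (auto simp: partial_order_on_def preorder_on_def refl_on_def)
  show "continuous_map P (poset_topology r) h"
    unfolding continuous_map_def
  proof (intro conjI allI impI)
    fix U assume U: "openin (poset_topology r) U"
    then have "{p \<in> topspace P. h p \<in> U} = (\<Union>x\<in>U. {p \<in> topspace P. (h p, x) \<in> r})"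
      using refl by (auto simp: openin_poset_topology)
    moreover have "openin P (\<Union>x\<in>U. {p \<in> topspace P. (h p, x) \<in> r})"
      using h U by (intro openin_Union) (auto simp: openin_poset_topology)
    ultimately show "openin P {p \<in> topspace P. h p \<in> U}" by simp
  qed (use h in auto)
qed

lemma Partial_order_refl: "Partial_order r \<Longrightarrow> x \<in> Field r \<Longrightarrow> (x, x) \<in> r"
  by (auto simp: partial_order_on_def preorder_on_def refl_on_def)

lemma Partial_order_trans: "Partial_order r \<Longrightarrow> (x, y) \<in> r \<Longrightarrow> (y, z) \<in> r \<Longrightarrow> (x, z) \<in> r"
  by (auto simp: partial_order_on_def preorder_on_def dest: transD)

lemma Partial_order_antisym: "Partial_order r \<Longrightarrow> (x, y) \<in> r \<Longrightarrow> (y, x) \<in> r \<Longrightarrow> x = y"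
  by (auto simp: partial_order_on_def dest: antisymD)

lemma continuous_map_monotone:
  assumes "Partial_order r" "Partial_order r'"
    and "\<And>x y. (x, y) \<in> r \<Longrightarrow> (f x, f y) \<in> r'"
  shows "continuous_map (poset_topology r) (poset_topology r') f"
  unfolding continuous_map_into_poset[OF assms(2)]
proof (intro conjI ballI)
  show "f \<in> topspace (poset_topology r) \<rightarrow> Field r'"
    using assms(3) Partial_order_refl[OF assms(1)] by (auto intro: FieldI1)
  show "openin (poset_topology r) {p \<in> topspace (poset_topology r). (f p, x) \<in> r'}" for x
    unfolding openin_poset_topology
    using Partial_order_trans[OF assms(2) assms(3)] by (auto intro: FieldI1)
qed

text \<open>The jump from \<open>u\<close> up to \<open>v\<close> takes place at the closed end
  \<open>t = 1\<close>: a down set that contains \<open>v p\<close> contains \<open>u p\<close> as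
  well, so preimages are open as soon as the times with value \<open>u\<close> form an open
  set.\<close>

lemma continuous_map_switch:
  assumes r: "Partial_order r"
    and u: "continuous_map P (poset_topology r) u" and v: "continuous_map P (poset_topology r) v"
    and uv: "\<And>p. p \<in> topspace P \<Longrightarrow> (u p, v p) \<in> r"
  shows "continuous_map (prod_topology (top_of_set {0..1::real}) P) (poset_topology r)
     (\<lambda>p. if fst p < 1 then u (snd p) else v (snd p))"
  unfolding continuous_map_into_poset[OF r]
proof (intro conjI ballI)
  let ?Q = "prod_topology (top_of_set {0..1::real}) P"
  show "(\<lambda>p. if fst p < 1 then u (snd p) else v (snd p)) \<in> topspace ?Q \<rightarrow> Field r"
    using u v by (auto simp: continuous_map_def)
  fix x assume x: "x \<in> Field r"
  have "openin ?Q {p \<in> topspace ?Q. fst p \<in> {..<1}}"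
    by (rule openin_continuous_map_preimage[OF continuous_map_fst_real]) auto
  moreover have *: "openin ?Q {p \<in> topspace ?Q. w (snd p) \<in> {y. (y, x) \<in> r}}"
    if "continuous_map P (poset_topology r) w" for w
    by (rule openin_continuous_map_preimage[OF continuous_map_of_snd[OF that]])
      (auto simp: openin_poset_topology Field_def intro: Partial_order_trans[OF r])
  ultimately have "openin ?Q (({p \<in> topspace ?Q. fst p \<in> {..<1}} \<inter> {p \<in> topspace ?Q. u (snd p) \<in> {y. (y, x) \<in> r}})
      \<union> {p \<in> topspace ?Q. v (snd p) \<in> {y. (y, x) \<in> r}})"
    using *[OF u] *[OF v] by blast
  moreover have "{p \<in> topspace ?Q. ((if fst p < 1 then u (snd p) else v (snd p)), x) \<in> r} =
      (({p \<in> topspace ?Q. fst p \<in> {..<1}} \<inter> {p \<in> topspace ?Q. u (snd p) \<in> {y. (y, x) \<in> r}})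
      \<union> {p \<in> topspace ?Q. v (snd p) \<in> {y. (y, x) \<in> r}})"
    using Partial_order_trans[OF r uv] by (auto simp: mem_Times_iff)
  ultimately show "openin ?Q {p \<in> topspace ?Q. ((if fst p < 1 then u (snd p) else v (snd p)), x) \<in> r}"
    by simp
qed

lemma homotopic_with_le:
  assumes "Partial_order r"
    and "continuous_map P (poset_topology r) u" and "continuous_map P (poset_topology r) v"
    and "\<And>p. p \<in> topspace P \<Longrightarrow> (u p, v p) \<in> r"
    and "\<And>c. c \<in> A \<Longrightarrow> u c = w c" "\<And>c. c \<in> A \<Longrightarrow> v c = w c"
  shows "homotopic_with (\<lambda>k. \<forall>c\<in>A. k c = w c) P (poset_topology r) u v"
  unfolding homotopic_with_def
  by (rule exI[of _ "\<lambda>p. if fst p < 1 then u (snd p) else v (snd p)"])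
     (use continuous_map_switch[OF assms(1-4)] assms(5,6) in auto)

text \<open>The lift of \<open>h\<close> is \<open>\<rho> \<circ> h\<close>. Since
  \<open>\<rho>\<close> inverts \<open>f\<close> strictly, it agrees with \<open>g\<close> on the
  boundary, and comparability of \<open>f \<circ> \<rho>\<close> with the identity supplies the
  homotopy. Beat points are added and deleted in this way.\<close>

lemma lifting_map_retraction:
  assumes r: "Partial_order r"
    and f: "continuous_map X (poset_topology r) f" and \<rho>: "continuous_map (poset_topology r) X \<rho>"
    and \<rho>f: "\<And>x. x \<in> topspace X \<Longrightarrow> \<rho> (f x) = x"
    and cmp: "(\<forall>y\<in>Field r. (y, f (\<rho> y)) \<in> r) \<or> (\<forall>y\<in>Field r. (f (\<rho> y), y) \<in> r)"
  shows "lifting_map X (poset_topology r) f"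
  unfolding lifting_map_def
proof (intro conjI allI impI f)
  fix n h g
  assume h: "continuous_map (cube n) (poset_topology r) h"
    and g: "continuous_map (subtopology (cube n) (cube_boundary n)) X g"
    and eq: "\<forall>c\<in>cube_boundary n. f (g c) = h c"
  have c: "continuous_map (cube n) X (\<rho> \<circ> h)"
    using h \<rho> by (rule continuous_map_compose)
  have c': "continuous_map (cube n) (poset_topology r) (f \<circ> (\<rho> \<circ> h))"
    using c f by (rule continuous_map_compose)
  have "g c \<in> topspace X" if "c \<in> cube_boundary n" for c
    using g that cube_boundary_subset by (auto simp: continuous_map_def Pi_iff)
  then have b: "(\<rho> \<circ> h) c = g c" if "c \<in> cube_boundary n" for c
    using eq \<rho>f that by force
  have hF: "h p \<in> Field r" if "p \<in> topspace (cube n)" for p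
    using h that by (auto simp: continuous_map_def)
  let ?h = "homotopic_with (\<lambda>k. \<forall>c\<in>cube_boundary n. k c = h c) (cube n) (poset_topology r)"
  from cmp have "?h h (f \<circ> (\<rho> \<circ> h)) \<or> ?h (f \<circ> (\<rho> \<circ> h)) h"
  proof
    assume "\<forall>y\<in>Field r. (y, f (\<rho> y)) \<in> r"
    then show ?thesis
      by (intro disjI1 homotopic_with_le[OF r h c']) (use hF eq b in auto)
  next
    assume "\<forall>y\<in>Field r. (f (\<rho> y), y) \<in> r"
    then show ?thesis
      by (intro disjI2 homotopic_with_le[OF r c' h]) (use hF eq b in auto)
  qed
  then have "?h h (f \<circ> (\<rho> \<circ> h))"
    using homotopic_with_symD by blast
  with c b show "\<exists>g'. continuous_map (cube n) X g' \<and> (\<forall>c\<in>cube_boundary n. g' c = g c) \<and> ?h h (f \<circ> g')"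
    by blast
qed

section \<open>Deleting a weak point, and partitions along a map into a poset\<close>

lemma Field_Restr_poset: "Partial_order r \<Longrightarrow> S \<subseteq> Field r \<Longrightarrow> Field (Restr r S) = S"
  using Partial_order_refl by (fastforce simp: Field_def)

lemma subtopology_poset_topology:
  assumes r: "Partial_order r" and S: "S \<subseteq> Field r"
  shows "subtopology (poset_topology r) S = poset_topology (Restr r S)"
proof (rule topology_eq[THEN iffD2], rule allI)
  fix U
  show "openin (subtopology (poset_topology r) S) U \<longleftrightarrow> openin (poset_topology (Restr r S)) U"
  proof
    assume "openin (subtopology (poset_topology r) S) U"
    then show "openin (poset_topology (Restr r S)) U"
      using Field_Restr_poset[OF r S] by (auto simp: openin_subtopology openin_poset_topology)
  next
    assume U: "openin (poset_topology (Restr r S)) U"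
    then have US: "U \<subseteq> S" using Field_Restr_poset[OF r S] by (auto simp: openin_poset_topology)
    have "openin (poset_topology r) (\<Union>y\<in>U. {x. (x, y) \<in> r})"
      using Partial_order_trans[OF r] by (auto simp: openin_poset_topology Field_def)
    moreover have "U = (\<Union>y\<in>U. {x. (x, y) \<in> r}) \<inter> S"
      using U US S Partial_order_refl[OF r] by (fastforce simp: openin_poset_topology)
    ultimately show "openin (subtopology (poset_topology r) S) U"
      by (auto simp: openin_subtopology)
  qed
qed

text \<open>A cube that hits \<open>t\<close> is changed near the closed set \<open>h = t\<close>:
  around it \<open>h\<close> runs in the contractible set \<open>V\<close> below \<open>t\<close>,
  so it can follow the contraction to \<open>y\<close>, which then replaces \<open>t\<close>. The
  old and the new map are homotopic because both lie below a third map \<open>h'\<close>.\<close>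

lemma lifting_map_weak_point:
  assumes r: "Partial_order r" and t: "t \<in> Field r" and tmax: "\<And>x. (t, x) \<in> r \<Longrightarrow> x = t"
    and V: "V = under r t - {t}" and y: "y \<in> V"
    and contr: "homotopic_with (\<lambda>_. True) (subtopology (poset_topology r) V)
        (subtopology (poset_topology r) V) id (\<lambda>_. y)"
  shows "lifting_map (subtopology (poset_topology r) (Field r - {t})) (poset_topology r) id"
  unfolding lifting_map_def
proof (intro conjI allI impI)
  let ?X = "poset_topology r"
  let ?E = "subtopology ?X (Field r - {t})"
  let ?I = "top_of_set {0..1::real}"
  show "continuous_map ?E ?X id"
    by (rule continuous_map_from_subtopology) simp
  fix n h g
  let ?P = "cube n"
  assume h: "continuous_map ?P ?X h"
    and g: "continuous_map (subtopology ?P (cube_boundary n)) ?E g"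
    and eq: "\<forall>c\<in>cube_boundary n. id (g c) = h c"
  have VF: "V \<subseteq> Field r - {t}"
    by (auto simp: V under_def Field_def)
  obtain \<Gamma> where \<Gamma>: "continuous_map (prod_topology ?I (subtopology ?X V)) (subtopology ?X V) \<Gamma>"
    and \<Gamma>01: "\<And>x. \<Gamma> (0, x) = x" "\<And>x. \<Gamma> (1, x) = y"
    using contr by (auto simp: homotopic_with_def)
  define Z where "Z = {p \<in> topspace ?P. h p = t}"
  \<comment> \<open>Leaving out the boundary forces \<open>\<phi>\<close> to vanish on it, so that
    nothing is changed there.\<close>
  define W where "W = {p \<in> topspace ?P. (h p, t) \<in> r} - cube_boundary n"
  have "openin ?X (Field r - {t})"
    using tmax by (auto simp: openin_poset_topology Field_def)
  then have "openin ?P {p \<in> topspace ?P. h p \<in> Field r - {t}}"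
    using h openin_continuous_map_preimage by blast
  moreover have "topspace ?P - Z = {p \<in> topspace ?P. h p \<in> Field r - {t}}"
    using h by (auto simp: Z_def continuous_map_def)
  ultimately have Z: "closedin ?P Z"
    by (auto simp: closedin_def Z_def)
  have W: "openin ?P W"
    unfolding W_def using h t closedin_cube_boundary by (auto simp: continuous_map_into_poset[OF r] intro: openin_diff)
  have "h c \<noteq> t" if "c \<in> cube_boundary n" for c
    using g eq that cube_boundary_subset[of n] by (force simp: continuous_map_def)
  then have "Z \<subseteq> W"
    using Partial_order_refl[OF r t] by (auto simp: Z_def W_def)
  then have "disjnt (topspace ?P - W) Z"
    by (auto simp: disjnt_def)
  moreover have "normal_space ?P"
    using compact_space_cube Hausdorff_space_cube by (simp add: compact_Hausdorff_or_regular_imp_normal_space)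
  moreover have "closedin ?P (topspace ?P - W)"
    using W by blast
  ultimately obtain \<phi> where "continuous_map ?P (top_of_set {0..1::real}) \<phi>"
      and \<phi>0: "\<phi> ` (topspace ?P - W) \<subseteq> {0}" and \<phi>1: "\<phi> ` Z \<subseteq> {1}"
    using Urysohn_lemma[of ?P "topspace ?P - W" Z 0 1] Z by auto
  then have \<phi>: "continuous_map ?P euclideanreal \<phi>" and \<phi>01: "\<And>p. p \<in> topspace ?P \<Longrightarrow> \<phi> p \<in> {0..1}"
    by (auto simp: continuous_map_in_subtopology)
  have \<phi>W: "p \<in> W" if "p \<in> topspace ?P" "\<phi> p > 0" for p
    using \<phi>0 that by force
  have \<phi>Z: "h p \<noteq> t" if "p \<in> topspace ?P" "\<phi> p < 1" for p
    using \<phi>1 that by (force simp: Z_def)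
  have \<phi>b: "\<phi> c = 0" if "c \<in> cube_boundary n" for c
    using \<phi>0 that cube_boundary_subset[of n] by (force simp: W_def)
  \<comment> \<open>\<open>k\<close> rises from 0 to 1 for \<open>\<phi>\<close> between 1/3 and
    2/3: the contraction starts as the identity and is complete before \<open>h\<close> can reach
    \<open>t\<close>, which requires \<open>\<phi> = 1\<close>.\<close>
  define k where "k = (\<lambda>p. max 0 (min 1 (3 * \<phi> p - 1)))"
  define g' where "g' = (\<lambda>p. if \<phi> p < 1/3 then h p else if \<phi> p < 1 then \<Gamma> (k p, h p) else y)"
  define T where "T = (\<lambda>i::nat. {p \<in> topspace ?P. \<phi> p \<in> (if i = 0 then {..<1/3} else if i = 1 then {0<..<1} else {2/3<..})})"
  define ff where "ff = (\<lambda>i::nat. if i = 0 then h else if i = 1 then (\<lambda>p. \<Gamma> (k p, h p)) else (\<lambda>_. y))"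
  have g': "continuous_map ?P ?E g'"
  proof (rule pasting_lemma[where I = "{0,1,2}" and T = T and f = ff])
    show "openin ?P (T i)" for i
      unfolding T_def by (rule openin_continuous_map_preimage[OF \<phi>]) auto
    have "continuous_map (subtopology ?P (T 0)) ?E h"
    proof -
      have "h p \<in> Field r - {t}" if "p \<in> T 0" for p
        using that \<phi>Z[of p] h by (auto simp: T_def continuous_map_def)
      then show ?thesis
        using h by (auto simp: continuous_map_in_subtopology continuous_map_from_subtopology)
    qed
    moreover have "continuous_map (subtopology ?P (T 1)) ?E (\<lambda>p. \<Gamma> (k p, h p))"
    proof -
      have "continuous_map ?P euclideanreal k"
        unfolding k_def by (intro continuous_intros \<phi>) simp_all
      then have k: "continuous_map (subtopology ?P (T 1)) ?I k"
        by (auto simp: continuous_map_in_subtopology continuous_map_from_subtopology k_def)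
      have "h p \<in> V" if "p \<in> T 1" for p
        using that \<phi>Z[of p] \<phi>W[of p] by (auto simp: T_def V under_def W_def)
      then have "continuous_map (subtopology ?P (T 1)) (subtopology ?X V) h"
        using h by (auto simp: continuous_map_in_subtopology continuous_map_from_subtopology)
      from continuous_map_compose[OF continuous_map_pairedI[OF k this] \<Gamma>]
      have "continuous_map (subtopology ?P (T 1)) (subtopology ?X V) (\<lambda>p. \<Gamma> (k p, h p))"
        by (simp add: comp_def)
      then show ?thesis
        using VF by (auto simp: continuous_map_in_subtopology)
    qed
    moreover have "continuous_map (subtopology ?P (T 2)) ?E (\<lambda>_. y)"
      using VF y by auto
    ultimately show "continuous_map (subtopology ?P (T i)) ?E (ff i)" if "i \<in> {0,1,2}" for i
      using that by (auto simp: ff_def)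
    have "ff i p = ff 1 p" if "i \<in> {0,1,2}" "p \<in> T i" for i p
      using that \<Gamma>01 by (auto simp: ff_def T_def k_def)
    then show "ff i p = ff j p" if "i \<in> {0,1,2}" "j \<in> {0,1,2}" "p \<in> topspace ?P \<inter> T i \<inter> T j" for i j p
      using that by (metis IntD1 IntD2)
    show "\<exists>j. j \<in> {0,1,2} \<and> p \<in> T j \<and> g' p = ff j p" if p: "p \<in> topspace ?P" for p
    proof -
      consider "\<phi> p < 1/3" | "1/3 \<le> \<phi> p" "\<phi> p < 1" | "1 \<le> \<phi> p" by linarith
      then show ?thesis
      proof cases
        case 1 then show ?thesis using p by (intro exI[of _ 0]) (simp add: T_def g'_def ff_def)
      next
        case 2 then show ?thesis using p by (intro exI[of _ 1]) (simp add: T_def g'_def ff_def)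
      next
        case 3 then show ?thesis using p by (intro exI[of _ 2]) (simp add: T_def g'_def ff_def)
      qed
    qed
  qed
  then have g'X: "continuous_map ?P ?X g'"
    by (simp add: continuous_map_in_subtopology)
  \<comment> \<open>A common upper bound of \<open>h\<close> and \<open>g'\<close>. It is continuous
    although it jumps to \<open>t\<close>, because \<open>t\<close> is maximal and \<open>h\<close>
    is already below \<open>t\<close> wherever \<open>\<phi>\<close> is positive.\<close>
  define h' where "h' = (\<lambda>p. if \<phi> p < 1/3 then h p else t)"
  have h': "continuous_map ?P ?X h'"
    unfolding continuous_map_into_poset[OF r]
  proof (intro conjI ballI)
    show "h' \<in> topspace ?P \<rightarrow> Field r"
      using h t by (auto simp: continuous_map_def h'_def)
    fix x assume x: "x \<in> Field r"
    have o: "openin ?P {p \<in> topspace ?P. (h p, x) \<in> r}"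
      using h x by (simp add: continuous_map_into_poset[OF r])
    have "openin ?P {p \<in> topspace ?P. \<phi> p \<in> {..<1/3}}"
      by (rule openin_continuous_map_preimage[OF \<phi>]) auto
    with o have o': "openin ?P ({p \<in> topspace ?P. (h p, x) \<in> r} \<inter> {p \<in> topspace ?P. \<phi> p \<in> {..<1/3}})"
      by blast
    show "openin ?P {p \<in> topspace ?P. (h' p, x) \<in> r}"
    proof (cases "x = t")
      case True
      have "(h' p, t) \<in> r \<longleftrightarrow> (h p, t) \<in> r" if "p \<in> topspace ?P" for p
        using \<phi>W[OF that] Partial_order_refl[OF r t] by (auto simp: h'_def W_def)
      with o True show ?thesis by (simp cong: conj_cong)
    next
      case False
      then have "(h' p, x) \<in> r \<longleftrightarrow> (h p, x) \<in> r \<and> \<phi> p < 1/3" for p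
        using tmax by (auto simp: h'_def)
      then have "{p \<in> topspace ?P. (h' p, x) \<in> r} = {p \<in> topspace ?P. (h p, x) \<in> r} \<inter> {p \<in> topspace ?P. \<phi> p \<in> {..<1/3}}"
        by auto
      with o' show ?thesis by simp
    qed
  qed
  have hF: "h p \<in> Field r" if "p \<in> topspace ?P" for p
    using h that by (auto simp: continuous_map_def)
  have "homotopic_with (\<lambda>k. \<forall>c\<in>cube_boundary n. k c = h c) ?P ?X h h'"
  proof (rule homotopic_with_le[OF r h h'])
    show "(h p, h' p) \<in> r" if "p \<in> topspace ?P" for p
      using \<phi>W[OF that] Partial_order_refl[OF r hF[OF that]] by (auto simp: h'_def W_def)
  qed (use \<phi>b in \<open>auto simp: h'_def\<close>)
  moreover have "homotopic_with (\<lambda>k. \<forall>c\<in>cube_boundary n. k c = h c) ?P ?X g' h'"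
  proof (rule homotopic_with_le[OF r g'X h'])
    show "(g' p, h' p) \<in> r" if p: "p \<in> topspace ?P" for p
    proof (cases "\<phi> p < 1/3")
      case True
      then show ?thesis using Partial_order_refl[OF r hF[OF p]] by (simp add: h'_def g'_def)
    next
      case False
      have "\<Gamma> (k p, h p) \<in> V" if "\<phi> p < 1"
      proof -
        have "h p \<in> V"
          using False p that \<phi>Z[of p] \<phi>W[of p] by (auto simp: V under_def W_def)
        moreover have "k p \<in> {0..1}" by (auto simp: k_def)
        ultimately show ?thesis
          using \<Gamma> VF by (auto simp: continuous_map_def Pi_iff)
      qed
      then have "g' p \<in> V" using False y by (auto simp: g'_def)
      with False show ?thesis by (simp add: h'_def V under_def)
    qed
  qed (use \<phi>b in \<open>auto simp: h'_def g'_def\<close>)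
  ultimately have "homotopic_with (\<lambda>k. \<forall>c\<in>cube_boundary n. k c = h c) ?P ?X h (id \<circ> g')"
    using homotopic_with_symD homotopic_with_trans by (metis (no_types, lifting) id_comp)
  moreover have "g' c = g c" if "c \<in> cube_boundary n" for c
    using that eq \<phi>b by (simp add: g'_def)
  ultimately show "\<exists>g'. continuous_map ?P ?E g' \<and> (\<forall>c\<in>cube_boundary n. g' c = g c) \<and>
      homotopic_with (\<lambda>k. \<forall>c\<in>cube_boundary n. k c = h c) ?P ?X h (id \<circ> g')"
    using g' by blast
qed

text \<open>
  The strata \<open>h = x\<close> are treated from the top down: the highest one is closed and is fattened first,
  and the fattenings of all strata not below it are then kept away from it.
\<close>

lemma chain_partition_aux:
  assumes r: "Partial_order r" and fin: "finite S"
    and SF: "S \<subseteq> Field r" and down: "\<And>x y. (x, y) \<in> r \<Longrightarrow> y \<in> S \<Longrightarrow> x \<in> S"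
    and P: "normal_space P" and h: "h \<in> topspace P \<rightarrow> S"
    and op: "\<And>x. x \<in> S \<Longrightarrow> openin P {p \<in> topspace P. (h p, x) \<in> r}"
    and G: "\<And>x. x \<in> S \<Longrightarrow> openin P (G x)" "\<And>x p. x \<in> S \<Longrightarrow> p \<in> topspace P \<Longrightarrow> h p = x \<Longrightarrow> p \<in> G x"
  shows "\<exists>\<phi>::'a \<Rightarrow> 'b \<Rightarrow> real. (\<forall>x. continuous_map P euclideanreal (\<phi> x)) \<and>
    (\<forall>p\<in>topspace P. (\<forall>x. 0 \<le> \<phi> x p) \<and> (\<forall>x. \<phi> x p > 0 \<longrightarrow> x \<in> S \<and> (h p, x) \<in> r \<and> p \<in> G x) \<and>
       (\<Sum>x\<in>S. \<phi> x p) = 1 \<and> (\<forall>x y. \<phi> x p > 0 \<longrightarrow> \<phi> y p > 0 \<longrightarrow> (x, y) \<in> r \<or> (y, x) \<in> r))"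
  using fin SF down P h op G
proof (induction "card S" arbitrary: S P G)
  case 0
  then have "p \<notin> topspace P" for p by auto
  then show ?case
    by (intro exI[of _ "\<lambda>_ _. 0"]) simp
next
  case (Suc n)
  obtain x where x: "x \<in> S" and xmax: "\<And>y. y \<in> S \<Longrightarrow> (x, y) \<in> r \<Longrightarrow> y = x"
  proof -
    have "S \<noteq> {}" using Suc.hyps(2) by auto
    have "asymp_on S (\<lambda>a b. (a, b) \<in> r - Id)" "transp_on S (\<lambda>a b. (a, b) \<in> r - Id)"
      using Partial_order_antisym[OF r] Partial_order_trans[OF r]
      by (auto simp: asymp_on_def transp_on_def)
    from Finite_Set.bex_max_element[OF \<open>finite S\<close> this \<open>S \<noteq> {}\<close>]
    obtain m where "m \<in> S" "\<forall>x\<in>S. x \<noteq> m \<longrightarrow> (m, x) \<notin> r - Id" by auto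
    then show thesis using that[of m] by auto
  qed
  let ?S = "S - {x}"
  have downS: "(y, z) \<in> r \<Longrightarrow> z \<in> ?S \<Longrightarrow> y \<in> ?S" for y z
    using Suc.prems(3) xmax by blast
  define Z where "Z = {p \<in> topspace P. h p = x}"
  define W where "W = {p \<in> topspace P. (h p, x) \<in> r} \<inter> G x"
  have "{p \<in> topspace P. h p \<noteq> x} = (\<Union>y\<in>?S. {p \<in> topspace P. (h p, y) \<in> r})"
    using Suc.prems(2,5) Partial_order_refl[OF r] xmax by (auto simp: Pi_iff)
  moreover have "openin P (\<Union>y\<in>?S. {p \<in> topspace P. (h p, y) \<in> r})"
    using Suc.prems(6) by auto
  moreover have "topspace P - Z = {p \<in> topspace P. h p \<noteq> x}"
    by (auto simp: Z_def)
  ultimately have Z: "closedin P Z"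
    by (auto simp: closedin_def Z_def)
  have W: "openin P W"
    unfolding W_def using Suc.prems(6,7) x by blast
  have "Z \<subseteq> W"
    using Suc.prems(2,8) x Partial_order_refl[OF r] by (auto simp: Z_def W_def)
  then have "disjnt (topspace P - W) Z"
    by (auto simp: disjnt_def)
  then obtain \<psi> where "continuous_map P (top_of_set {0..1::real}) \<psi>"
      and \<psi>0: "\<psi> ` (topspace P - W) \<subseteq> {0}" and \<psi>1: "\<psi> ` Z \<subseteq> {1}"
    using Urysohn_lemma[of P "topspace P - W" Z 0 1] Z W Suc.prems(4) by auto
  then have \<psi>: "continuous_map P euclideanreal \<psi>" and \<psi>01: "\<And>p. p \<in> topspace P \<Longrightarrow> \<psi> p \<in> {0..1}"
    by (auto simp: continuous_map_in_subtopology)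
  have \<psi>W: "p \<in> W" if "p \<in> topspace P" "\<psi> p > 0" for p
    using \<psi>0 that by force
  \<comment> \<open>The induction hypothesis is applied to the closed part
    \<open>\<psi> \<le> 2/3\<close>. It misses \<open>Z\<close>, so \<open>h\<close> takes values in
    \<open>S - {x}\<close> there, and it is again normal.\<close>
  define P' where "P' = subtopology P {p \<in> topspace P. \<psi> p \<in> {..2/3}}"
  have tP': "topspace P' = {p \<in> topspace P. \<psi> p \<le> 2/3}"
    by (auto simp: P'_def)
  have clP': "closedin P {p \<in> topspace P. \<psi> p \<in> {..2/3}}"
    by (rule closedin_continuous_map_preimage[OF \<psi>]) auto
  \<comment> \<open>Points not below \<open>x\<close> are barred from
    \<open>\<psi> \<ge> 1/3\<close>. Outside this region the weight \<open>\<xi>\<close> of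
    \<open>x\<close> is 0, so \<open>x\<close> only ever meets points below it, and supports remain
    chains.\<close>
  define G' where "G' = (\<lambda>y. (G y - (if (y, x) \<in> r then {} else {p \<in> topspace P. \<psi> p \<in> {1/3..}})) \<inter> {p \<in> topspace P. \<psi> p \<in> {..2/3}})"
  have "\<exists>\<phi>::'a \<Rightarrow> 'b \<Rightarrow> real. (\<forall>x. continuous_map P' euclideanreal (\<phi> x)) \<and>
    (\<forall>p\<in>topspace P'. (\<forall>x. 0 \<le> \<phi> x p) \<and> (\<forall>x. \<phi> x p > 0 \<longrightarrow> x \<in> ?S \<and> (h p, x) \<in> r \<and> p \<in> G' x) \<and>
       (\<Sum>x\<in>?S. \<phi> x p) = 1 \<and> (\<forall>x y. \<phi> x p > 0 \<longrightarrow> \<phi> y p > 0 \<longrightarrow> (x, y) \<in> r \<or> (y, x) \<in> r))"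
  proof (rule Suc.hyps(1))
    show "n = card ?S" using Suc.hyps(2) x Suc.prems(1) by simp
    show "normal_space P'"
      unfolding P'_def by (rule normal_space_closed_subtopology[OF Suc.prems(4) clP'])
    show "h \<in> topspace P' \<rightarrow> ?S"
      using Suc.prems(5) \<psi>1 by (force simp: tP' Z_def)
    fix y assume y: "y \<in> ?S"
    have "openin P' ({p \<in> topspace P. (h p, y) \<in> r} \<inter> {p \<in> topspace P. \<psi> p \<in> {..2/3}})"
      using Suc.prems(6) y unfolding P'_def by (intro openin_subtopology_Int) auto
    moreover have "{p \<in> topspace P'. (h p, y) \<in> r} = {p \<in> topspace P. (h p, y) \<in> r} \<inter> {p \<in> topspace P. \<psi> p \<in> {..2/3}}"
      by (auto simp: tP')
    ultimately show "openin P' {p \<in> topspace P'. (h p, y) \<in> r}" by simp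
    have "closedin P {p \<in> topspace P. \<psi> p \<in> {1/3..}}"
      by (rule closedin_continuous_map_preimage[OF \<psi>]) auto
    then show "openin P' (G' y)"
      unfolding G'_def P'_def using Suc.prems(7) y by (intro openin_subtopology_Int openin_diff) auto
    show "p \<in> G' y" if p: "p \<in> topspace P'" "h p = y" for p
    proof -
      have "\<not> \<psi> p \<ge> 1/3" if "(y, x) \<notin> r"
        using \<psi>W[of p] p that by (force simp: tP' W_def)
      then show ?thesis
        using p Suc.prems(8) y by (auto simp: G'_def tP')
    qed
  qed (use Suc.prems downS in auto)
  then obtain \<phi>' :: "'a \<Rightarrow> 'b \<Rightarrow> real" where \<phi>': "\<And>x. continuous_map P' euclideanreal (\<phi>' x)"
    and \<phi>'0: "\<And>p x. p \<in> topspace P' \<Longrightarrow> 0 \<le> \<phi>' x p"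
    and \<phi>'S: "\<And>p x. p \<in> topspace P' \<Longrightarrow> \<phi>' x p > 0 \<Longrightarrow> x \<in> ?S \<and> (h p, x) \<in> r \<and> p \<in> G' x"
    and \<phi>'1: "\<And>p. p \<in> topspace P' \<Longrightarrow> (\<Sum>x\<in>?S. \<phi>' x p) = 1"
    and \<phi>'c: "\<And>p x y. p \<in> topspace P' \<Longrightarrow> \<phi>' x p > 0 \<Longrightarrow> \<phi>' y p > 0 \<Longrightarrow> (x, y) \<in> r \<or> (y, x) \<in> r"
    by blast
  define \<xi> where "\<xi> = (\<lambda>p. max 0 (min 1 (3 * \<psi> p - 1)))"
  have \<xi>: "continuous_map P euclideanreal \<xi>"
    unfolding \<xi>_def by (intro continuous_intros \<psi>) simp_all
  have \<xi>01: "0 \<le> \<xi> p" "\<xi> p \<le> 1" for p by (auto simp: \<xi>_def)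
  \<comment> \<open>\<open>1 - \<xi> p\<close> vanishes at \<open>\<psi> p = 2/3\<close>, which
    makes the extension by 0 beyond the domain of \<open>\<phi>'\<close> continuous.\<close>
  define \<phi> where "\<phi> = (\<lambda>y p. if y = x then \<xi> p else if \<psi> p \<le> 2/3 then (1 - \<xi> p) * \<phi>' y p else 0)"
  have "continuous_map P euclideanreal (\<phi> y)" for y
  proof (cases "y = x")
    case False
    have "continuous_map P euclideanreal (\<lambda>p. if \<psi> p \<le> 2/3 then (1 - \<xi> p) * \<phi>' y p else 0)"
    proof (rule continuous_map_cases_le[OF \<psi>])
      have "continuous_map P' euclideanreal (\<lambda>p. (1 - \<xi> p) * \<phi>' y p)"
        by (intro continuous_intros \<phi>' \<xi>[THEN continuous_map_from_subtopology, of "{p \<in> topspace P. \<psi> p \<in> {..2/3}}", folded P'_def]) simp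
      then show "continuous_map (subtopology P {p \<in> topspace P. \<psi> p \<le> 2/3}) euclideanreal (\<lambda>p. (1 - \<xi> p) * \<phi>' y p)"
        by (simp add: P'_def)
    qed (auto simp: \<xi>_def)
    then show ?thesis using False by (simp add: \<phi>_def[abs_def])
  qed (use \<xi> in \<open>simp add: \<phi>_def[abs_def]\<close>)
  moreover have "(\<forall>x. 0 \<le> \<phi> x p) \<and> (\<forall>x. \<phi> x p > 0 \<longrightarrow> x \<in> S \<and> (h p, x) \<in> r \<and> p \<in> G x) \<and>
       (\<Sum>x\<in>S. \<phi> x p) = 1 \<and> (\<forall>x y. \<phi> x p > 0 \<longrightarrow> \<phi> y p > 0 \<longrightarrow> (x, y) \<in> r \<or> (y, x) \<in> r)"
    if p: "p \<in> topspace P" for p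
  proof -
    have \<xi>W: "\<psi> p > 1/3 \<and> p \<in> W" if "\<xi> p > 0"
      using that \<psi>W[OF p] by (auto simp: \<xi>_def max_def min_def split: if_splits)
    have pos: "\<psi> p \<le> 2/3 \<and> p \<in> topspace P' \<and> \<phi>' y p > 0" if "\<phi> y p > 0" "y \<noteq> x" for y
      using that p \<phi>'0[of p y] \<xi>01[of p] by (auto simp: \<phi>_def tP' zero_less_mult_iff split: if_splits)
    have "0 \<le> \<phi> y p" for y
      using \<xi>01[of p] \<phi>'0[of p y] p by (auto simp: \<phi>_def tP')
    moreover have S: "y \<in> S \<and> (h p, y) \<in> r \<and> p \<in> G y" if "\<phi> y p > 0" for y
    proof (cases "y = x")
      case True
      then show ?thesis using that \<xi>W x by (auto simp: \<phi>_def W_def)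
    next
      case False
      then show ?thesis using pos[OF that False] \<phi>'S[of p y] by (auto simp: G'_def)
    qed
    moreover have "(\<Sum>y\<in>S. \<phi> y p) = 1"
    proof -
      have "(\<Sum>y\<in>S. \<phi> y p) = \<xi> p + (\<Sum>y\<in>?S. \<phi> y p)"
        using x Suc.prems(1) by (subst sum.remove[of S x]) (auto simp: \<phi>_def)
      also have "(\<Sum>y\<in>?S. \<phi> y p) = 1 - \<xi> p"
      proof (cases "\<psi> p \<le> 2/3")
        case True
        have "(\<Sum>y\<in>?S. \<phi> y p) = (\<Sum>y\<in>?S. (1 - \<xi> p) * \<phi>' y p)"
          using True by (intro sum.cong) (auto simp: \<phi>_def)
        also have "\<dots> = 1 - \<xi> p"
          using \<phi>'1[of p] True p by (simp add: tP' flip: sum_distrib_left)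
        finally show ?thesis .
      next
        case False
        then show ?thesis
          by (subst sum.neutral) (auto simp: \<phi>_def \<xi>_def)
      qed
      finally show ?thesis by simp
    qed
    moreover have cx: "(y, x) \<in> r" if "\<phi> x p > 0" "\<phi> y p > 0" for y
    proof (cases "y = x")
      case True
      then show ?thesis using Partial_order_refl[OF r] x Suc.prems(2) by blast
    next
      case False
      have "\<psi> p > 1/3" using that(1) \<xi>W by (simp add: \<phi>_def)
      moreover have "p \<in> G' y" using pos[OF that(2) False] \<phi>'S[of p y] by blast
      ultimately show ?thesis using p by (auto simp: G'_def split: if_splits)
    qed
    moreover have "(y, z) \<in> r \<or> (z, y) \<in> r" if "\<phi> y p > 0" "\<phi> z p > 0" for y z
    proof (cases "y = x \<or> z = x")
      case True
      then show ?thesis using cx that by blast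
    next
      case False
      then show ?thesis using \<phi>'c[of p y z] pos that by blast
    qed
    ultimately show ?thesis by blast
  qed
  ultimately show ?case by blast
qed

text \<open>The \<open>\<phi> x\<close> are the barycentric coordinates of a map into the realized
  order complex whose carriers lie above \<open>h p\<close>; this map plays the role of a lift of
  \<open>h\<close>. The open sets \<open>G x\<close> prescribe where the vertex \<open>x\<close> may
  occur.\<close>

lemma chain_partition:
  assumes r: "Partial_order r" and fin: "finite (Field r)"
    and P: "normal_space P" and h: "continuous_map P (poset_topology r) h"
    and G: "\<And>x. x \<in> Field r \<Longrightarrow> openin P (G x)"
      "\<And>x p. x \<in> Field r \<Longrightarrow> p \<in> topspace P \<Longrightarrow> h p = x \<Longrightarrow> p \<in> G x"
  obtains \<phi> :: "'a \<Rightarrow> 'b \<Rightarrow> real" where "\<And>x. continuous_map P euclideanreal (\<phi> x)"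
    "\<And>p x. p \<in> topspace P \<Longrightarrow> 0 \<le> \<phi> x p"
    "\<And>p x. p \<in> topspace P \<Longrightarrow> \<phi> x p > 0 \<Longrightarrow> x \<in> Field r \<and> (h p, x) \<in> r \<and> p \<in> G x"
    "\<And>p. p \<in> topspace P \<Longrightarrow> (\<Sum>x\<in>Field r. \<phi> x p) = 1"
    "\<And>p x y. p \<in> topspace P \<Longrightarrow> \<phi> x p > 0 \<Longrightarrow> \<phi> y p > 0 \<Longrightarrow> (x, y) \<in> r \<or> (y, x) \<in> r"
proof -
  have "\<exists>\<phi>::'a \<Rightarrow> 'b \<Rightarrow> real. (\<forall>x. continuous_map P euclideanreal (\<phi> x)) \<and>
    (\<forall>p\<in>topspace P. (\<forall>x. 0 \<le> \<phi> x p) \<and> (\<forall>x. \<phi> x p > 0 \<longrightarrow> x \<in> Field r \<and> (h p, x) \<in> r \<and> p \<in> G x) \<and>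
       (\<Sum>x\<in>Field r. \<phi> x p) = 1 \<and> (\<forall>x y. \<phi> x p > 0 \<longrightarrow> \<phi> y p > 0 \<longrightarrow> (x, y) \<in> r \<or> (y, x) \<in> r))"
    using h by (intro chain_partition_aux[OF r fin _ _ P _ _ G])
      (auto simp: continuous_map_into_poset[OF r] Field_def)
  then show thesis
    using that by blast
qed

section \<open>Cones attached to a cone\<close>

text \<open>At a zero of \<open>k\<close> the function \<open>w\<close> is squeezed between
  \<open>- k\<close> and \<open>k\<close>, so continuity has to be checked only off the zeros. This
  handles quotients whose denominator may vanish where \<open>k\<close> does.\<close>

lemma continuous_map_dominated:
  assumes k: "continuous_map X euclideanreal k"
    and w: "continuous_map (subtopology X {p \<in> topspace X. k p \<noteq> 0}) euclideanreal w"
    and le: "\<And>p. p \<in> topspace X \<Longrightarrow> \<bar>w p\<bar> \<le> k p"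
  shows "continuous_map X euclideanreal w"
  unfolding continuous_map_def
proof (intro conjI allI impI)
  fix U :: "real set" assume U: "openin euclideanreal U"
  let ?N = "{p \<in> topspace X. k p \<in> - {0}}"
  have N: "openin X ?N"
    by (rule openin_continuous_map_preimage[OF k]) auto
  have "openin (subtopology X ?N) {p \<in> topspace (subtopology X ?N). w p \<in> U}"
    by (rule openin_continuous_map_preimage[OF _ U]) (use w in simp)
  then have "openin X {p \<in> topspace (subtopology X ?N). w p \<in> U}"
    using N by (rule openin_trans_full)
  moreover have "{p \<in> topspace (subtopology X ?N). w p \<in> U} = {p \<in> topspace X. w p \<in> U} \<inter> ?N"
    by auto
  ultimately have o: "openin X ({p \<in> topspace X. w p \<in> U} \<inter> ?N)"
    by simp
  show "openin X {p \<in> topspace X. w p \<in> U}"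
  proof (cases "0 \<in> U")
    case True
    have "open U" using U by simp
    then obtain e where e: "e > 0" "ball 0 e \<subseteq> U"
      using openE[OF _ True] by metis
    have 1: "openin X {p \<in> topspace X. k p \<in> {..<e}}"
      by (rule openin_continuous_map_preimage[OF k]) auto
    have "w p \<in> U" if "p \<in> topspace X" "k p < e" for p
    proof -
      have "w p \<in> ball 0 e" using le[OF that(1)] that(2) by simp
      then show ?thesis using e(2) by blast
    qed
    moreover have "k p < e \<or> k p \<noteq> 0" for p using e(1) by auto
    ultimately have 2: "{p \<in> topspace X. w p \<in> U} = {p \<in> topspace X. k p \<in> {..<e}} \<union> ({p \<in> topspace X. w p \<in> U} \<inter> ?N)"
      by blast
    show ?thesis
      by (subst 2) (rule openin_Un[OF 1 o])
  next
    case False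
    then have "k p \<noteq> 0" if "p \<in> topspace X" "w p \<in> U" for p
      using le[OF that(1)] that(2) by auto
    then have "{p \<in> topspace X. w p \<in> U} = {p \<in> topspace X. w p \<in> U} \<inter> ?N"
      by auto
    with o show ?thesis by simp
  qed
qed simp

lemma finite_chain_least:
  assumes r: "Partial_order r" and A: "finite A" "A \<noteq> {}" "A \<subseteq> Field r"
    and chain: "\<And>x y. x \<in> A \<Longrightarrow> y \<in> A \<Longrightarrow> (x, y) \<in> r \<or> (y, x) \<in> r"
  obtains m where "m \<in> A" "\<And>y. y \<in> A \<Longrightarrow> (m, y) \<in> r"
proof -
  have "\<exists>m\<in>A. \<forall>y\<in>A. (m, y) \<in> r"
    using A chain
  proof (induction A rule: finite_ne_induct)
    case (singleton x)
    then show ?case using Partial_order_refl[OF r] by auto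
  next
    case (insert x A)
    then obtain m where m: "m \<in> A" "\<forall>y\<in>A. (m, y) \<in> r" by auto
    have "(x, m) \<in> r \<or> (m, x) \<in> r" using insert m by blast
    then show ?case
    proof
      assume "(x, m) \<in> r"
      then have "\<forall>y\<in>insert x A. (x, y) \<in> r"
        using m Partial_order_trans[OF r] Partial_order_refl[OF r] insert.prems by auto
      then show ?thesis by blast
    next
      assume "(m, x) \<in> r"
      with m show ?thesis by blast
    qed
  qed
  then show thesis using that by blast
qed

text \<open>
  A fan has a maximal point \<open>a\<close> above every non-maximal point.  Its weak homotopy type is that of the
  wedge of the suspensions of the sets \<open>L b\<close>, whose suspension points are \<open>a\<close> and \<open>b\<close>.
\<close>

locale fan =
  fixes r :: "'a rel" and a :: 'a
  assumes po: "Partial_order r" and fin: "finite (Field r)"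
    and a: "a \<in> mxl r" and cover: "Field r = under r a \<union> mxl r"
begin

definition "M = mxl r - {a}"

definition "L b = under r b - {b}"

lemma a_Field: "a \<in> Field r" and a_max: "(a, x) \<in> r \<Longrightarrow> x = a"
  using a by (auto simp: mxl_def)

lemma M_Field: "b \<in> M \<Longrightarrow> b \<in> Field r" and M_max: "b \<in> M \<Longrightarrow> (b, x) \<in> r \<Longrightarrow> x = b"
  and M_not_a: "b \<in> M \<Longrightarrow> b \<noteq> a"
  by (auto simp: M_def mxl_def)

lemma finite_M: "finite M"
  using fin by (rule rev_finite_subset) (auto simp: M_Field)

lemma L_iff: "x \<in> L b \<longleftrightarrow> (x, b) \<in> r \<and> x \<noteq> b"
  by (auto simp: L_def under_def)

lemma finite_L: "finite (L b)"
  using fin by (rule rev_finite_subset) (auto simp: L_iff Field_def)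

lemma L_below_a: "b \<in> M \<Longrightarrow> x \<in> L b \<Longrightarrow> (x, a) \<in> r \<and> x \<noteq> a"
  using cover a_max[of b] M_not_a[of b] by (auto simp: L_iff under_def Field_def mxl_def)

text \<open>
  The wedge of the quotients \<open>|U\<^sub>b| / |L b|\<close>, with the vertex \<open>a\<close> collapsed into the base point
  \<open>0\<close>.  The coordinate \<open>z (b, b)\<close> is the barycentric coordinate at \<open>b\<close>, and the others are those of
  a point of \<open>|L b|\<close> multiplied by \<open>z (b, b) (1 - z (b, b))\<close>.
\<close>

definition cone_set :: "('a \<times> 'a \<Rightarrow> real) set" where
  "cone_set = {z. (\<forall>i. 0 \<le> z i) \<and>
     (\<forall>x b. z (x, b) > 0 \<longrightarrow> b \<in> M \<and> (x, b) \<in> r \<and> z (b, b) > 0) \<and>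
     (\<forall>x b y b'. z (x, b) > 0 \<longrightarrow> z (y, b') > 0 \<longrightarrow> b = b' \<and> ((x, y) \<in> r \<or> (y, x) \<in> r)) \<and>
     (\<forall>b\<in>M. z (b, b) \<le> 1 \<and> (\<Sum>x\<in>L b. z (x, b)) = z (b, b) * (1 - z (b, b)))}"

definition "cone_wedge = subtopology (product_topology (\<lambda>_. euclideanreal) UNIV) cone_set"

text \<open>McCord's map: a point goes to the least vertex of its carrier. The base point 0
  represents the collapsed cone and goes to the top \<open>a\<close> of that cone.\<close>

definition "cone_map z = (if z = (\<lambda>_. 0) then a else SOME x. \<exists>b. z (x, b) > 0 \<and> (\<forall>y. z (y, b) > 0 \<longrightarrow> (x, y) \<in> r))"

text \<open>The weights \<open>v\<close> on \<open>L b\<close> need not be normalized, so data can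
  be interpolated linearly before the equation in \<open>cone_set\<close> is restored. The factor
  \<open>u b * (1 - u b)\<close> makes the quotient 0 at the base point and at the tip, where the
  weights may add up to 0.\<close>

definition "cone_join u v = (\<lambda>(x, b). if b \<in> M then if x = b then u b
   else if x \<in> L b then u b * (1 - u b) * v x b / (\<Sum>y\<in>L b. v y b) else 0 else 0 :: real)"

section \<open>The quotient wedge of a fan and its map to the fan\<close>

lemma topspace_cone_wedge: "topspace cone_wedge = cone_set"
  by (simp add: cone_wedge_def)

lemma cone_setD:
  assumes "z \<in> cone_set"
  shows "0 \<le> z i" "z (x, b) > 0 \<Longrightarrow> b \<in> M" "z (x, b) > 0 \<Longrightarrow> (x, b) \<in> r" "z (x, b) > 0 \<Longrightarrow> z (b, b) > 0"
    "z (x, b) > 0 \<Longrightarrow> z (y, b') > 0 \<Longrightarrow> b = b'"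
    "z (x, b) > 0 \<Longrightarrow> z (y, b') > 0 \<Longrightarrow> (x, y) \<in> r \<or> (y, x) \<in> r"
    "b \<in> M \<Longrightarrow> z (b, b) \<le> 1" "b \<in> M \<Longrightarrow> (\<Sum>x\<in>L b. z (x, b)) = z (b, b) * (1 - z (b, b))"
  using assms unfolding cone_set_def by blast+

lemma zero_cone_set: "(\<lambda>_. 0) \<in> cone_set"
  by (simp add: cone_set_def)

lemma cone_map_eq:
  assumes z: "z \<in> cone_set" "z (x, b) > 0" "\<And>y. z (y, b) > 0 \<Longrightarrow> (x, y) \<in> r"
  shows "cone_map z = x"
proof -
  have "(SOME x. \<exists>b. z (x, b) > 0 \<and> (\<forall>y. z (y, b) > 0 \<longrightarrow> (x, y) \<in> r)) = x"
  proof (rule some_equality)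
    fix y assume "\<exists>b. z (y, b) > 0 \<and> (\<forall>w. z (w, b) > 0 \<longrightarrow> (y, w) \<in> r)"
    then obtain c where "z (y, c) > 0" "\<forall>w. z (w, c) > 0 \<longrightarrow> (y, w) \<in> r" by blast
    moreover have "c = b" using cone_setD(5)[OF z(1)] z(2) calculation(1) by blast
    ultimately show "y = x"
      using z Partial_order_antisym[OF po] by blast
  qed (use z in blast)
  moreover have "z \<noteq> (\<lambda>_. 0)" using z(2) by auto
  ultimately show ?thesis by (simp add: cone_map_def)
qed

lemma cone_map_zero: "cone_map (\<lambda>_. 0) = a"
  by (simp add: cone_map_def)

lemma cone_map_cases:
  assumes z: "z \<in> cone_set"
  obtains "z = (\<lambda>_. 0)" "cone_map z = a"
  | b where "b \<in> M" "z (b, b) > 0" "z (cone_map z, b) > 0" "\<And>y. z (y, b) > 0 \<Longrightarrow> (cone_map z, y) \<in> r"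
proof (cases "z = (\<lambda>_. 0)")
  case True
  then show thesis using that cone_map_zero by blast
next
  case False
  then obtain i where "z i \<noteq> 0" by blast
  then obtain x b where "z (x, b) \<noteq> 0" by (cases i) blast
  then have xb: "z (x, b) > 0" using cone_setD(1)[OF z, of "(x, b)"] by auto
  let ?A = "{y. z (y, b) > 0}"
  have "?A \<subseteq> Field r"
    using cone_setD(3)[OF z] by (auto simp: Field_def)
  with fin have "finite ?A" by (rule rev_finite_subset)
  obtain m where m: "m \<in> ?A" "\<And>y. y \<in> ?A \<Longrightarrow> (m, y) \<in> r"
    by (rule finite_chain_least[OF po \<open>finite ?A\<close> _ \<open>?A \<subseteq> Field r\<close>])
      (use xb cone_setD(6)[OF z] in auto)
  then have "cone_map z = m"
    using cone_map_eq[OF z] by auto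
  with m xb that(2)[of b] cone_setD[OF z] show thesis by auto
qed

text \<open>The value fails to be below \<open>a\<close> only at the tips
  \<open>z (b, b) = 1\<close>: at a positive smaller height some coordinate on \<open>L b\<close> is
  positive, and \<open>L b\<close> lies below \<open>a\<close>. Since \<open>M\<close> is finite,
  this makes the preimage of \<open>under r a\<close> open.\<close>

lemma cone_map_le_a_iff:
  assumes z: "z \<in> cone_set"
  shows "(cone_map z, a) \<in> r \<longleftrightarrow> (\<forall>b\<in>M. z (b, b) < 1)"
proof (cases rule: cone_map_cases[OF z])
  case 1
  then show ?thesis using Partial_order_refl[OF po a_Field] by simp
next
  case (2 b)
  have other: "z (b', b') < 1" if "b' \<noteq> b" for b'
    using cone_setD(5)[OF z 2(2), of b' b'] cone_setD(1)[OF z, of "(b', b')"] that by force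
  show ?thesis
  proof (cases "z (b, b) < 1")
    case True
    then have "(\<Sum>x\<in>L b. z (x, b)) > 0"
      using cone_setD(8)[OF z 2(1)] 2(2) by simp
    then obtain x where x: "x \<in> L b" "z (x, b) > 0"
      by (meson not_less sum_nonpos)
    then have "(cone_map z, a) \<in> r"
      using 2 L_below_a[OF 2(1) x(1)] Partial_order_trans[OF po] by blast
    then show ?thesis using other True by force
  next
    case False
    then have "z (b, b) = 1" using cone_setD(7)[OF z 2(1)] by linarith
    then have "(\<Sum>x\<in>L b. z (x, b)) = 0"
      using cone_setD(8)[OF z 2(1)] by simp
    then have "z (x, b) = 0" if "x \<in> L b" for x
      using that finite_L cone_setD(1)[OF z] by (subst (asm) sum_nonneg_eq_0_iff) auto
    then have "cone_map z \<notin> L b" using 2(3) by force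
    then have "cone_map z = b"
      using cone_setD(3)[OF z 2(3)] by (simp add: L_iff)
    then show ?thesis
      using False 2(1) M_max M_not_a by metis
  qed
qed

text \<open>The carrier has a least vertex, so one vertex of it below \<open>x\<close> suffices. The
  base point does not interfere, because its value \<open>a\<close> is maximal and
  \<open>x \<noteq> a\<close>.\<close>

lemma cone_map_le_iff:
  assumes z: "z \<in> cone_set" and x: "x \<noteq> a"
  shows "(cone_map z, x) \<in> r \<longleftrightarrow> (\<exists>y b. (y, x) \<in> r \<and> z (y, b) > 0)"
proof
  assume "(cone_map z, x) \<in> r"
  then show "\<exists>y b. (y, x) \<in> r \<and> z (y, b) > 0"
    by (cases rule: cone_map_cases[OF z]) (use a_max x in auto)
next
  assume "\<exists>y b. (y, x) \<in> r \<and> z (y, b) > 0"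
  then obtain y b where y: "(y, x) \<in> r" "z (y, b) > 0" by blast
  show "(cone_map z, x) \<in> r"
  proof (cases rule: cone_map_cases[OF z])
    case (2 c)
    then have "c = b" using cone_setD(5)[OF z 2(2) y(2)] by simp
    then show ?thesis using 2(4)[of y] y Partial_order_trans[OF po] by blast
  qed (use y in auto)
qed

lemma cone_map_Field: "z \<in> cone_set \<Longrightarrow> cone_map z \<in> Field r"
  by (cases rule: cone_map_cases) (use a_Field cone_setD(3) in \<open>auto simp: Field_def\<close>)

lemma continuous_map_cone_coordinate: "continuous_map cone_wedge euclideanreal (\<lambda>z. z i)"
  unfolding cone_wedge_def
  by (intro continuous_map_from_subtopology continuous_map_product_projection) simp

lemma continuous_cone_map: "continuous_map cone_wedge (poset_topology r) cone_map"
  unfolding continuous_map_into_poset[OF po] topspace_cone_wedge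
proof (intro conjI ballI)
  show "cone_map \<in> cone_set \<rightarrow> Field r"
    using cone_map_Field by blast
  fix x assume x: "x \<in> Field r"
  have o: "openin cone_wedge {z \<in> cone_set. z i \<in> V}" if "open V" for i V
    using openin_continuous_map_preimage[OF continuous_map_cone_coordinate, of V i] that
    by (simp add: topspace_cone_wedge)
  show "openin cone_wedge {z \<in> cone_set. (cone_map z, x) \<in> r}"
  proof (cases "x = a")
    case True
    \<comment> \<open>The intersection with the whole space covers the case that \<open>M\<close> is
      empty.\<close>
    have "{z \<in> cone_set. (cone_map z, x) \<in> r} = topspace cone_wedge \<inter> (\<Inter>b\<in>M. {z \<in> cone_set. z (b, b) \<in> {..<1}})"
      using True cone_map_le_a_iff by (auto simp: topspace_cone_wedge)
    moreover have "openin cone_wedge \<dots>"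
      by (intro openin_Int_Inter) (use finite_M o[OF open_lessThan] in blast)+
    ultimately show ?thesis by simp
  next
    case False
    have "{z \<in> cone_set. (cone_map z, x) \<in> r} = (\<Union>y\<in>under r x. \<Union>b\<in>UNIV. {z \<in> cone_set. z (y, b) \<in> {0<..}})"
      using False cone_map_le_iff by (auto simp: under_def)
    moreover have "openin cone_wedge (\<Union>b\<in>UNIV. {z \<in> cone_set. z (y, b) \<in> {0<..}})" for y
      using o[OF open_greaterThan] by blast
    then have "openin cone_wedge (\<Union>y\<in>under r x. \<Union>b\<in>UNIV. {z \<in> cone_set. z (y, b) \<in> {0<..}})"
      by blast
    ultimately show ?thesis by simp
  qed
qed

section \<open>Normalization, and lifting cubes to the quotient wedge\<close>

lemma cone_join_pos:
  assumes "b \<in> M" "0 \<le> u b" "u b \<le> 1" "\<And>x. x \<in> L b \<Longrightarrow> 0 \<le> v x b" 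
    and "0 < u b \<Longrightarrow> u b < 1 \<Longrightarrow> (\<Sum>y\<in>L b. v y b) > 0"
  shows "cone_join u v (x, b) \<ge> 0"
    "cone_join u v (x, b) > 0 \<longleftrightarrow> u b > 0 \<and> (x = b \<or> x \<in> L b \<and> u b < 1 \<and> v x b > 0)"
proof -
  have s: "(\<Sum>y\<in>L b. v y b) \<ge> 0" using assms(4) by (rule sum_nonneg)
  then show "cone_join u v (x, b) \<ge> 0"
    using assms by (auto simp: cone_join_def)
  show "cone_join u v (x, b) > 0 \<longleftrightarrow> u b > 0 \<and> (x = b \<or> x \<in> L b \<and> u b < 1 \<and> v x b > 0)"
  proof (cases "x \<noteq> b \<and> x \<in> L b \<and> 0 < u b \<and> u b < 1")
    case True
    then show ?thesis using assms(1) assms(5)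
    proof -
      have "u b * (1 - u b) > 0" using True by simp
      moreover have "0 \<le> v x b" using True assms(4) by blast
      ultimately show ?thesis using True assms(1,5)
        by (auto simp: cone_join_def zero_less_divide_iff zero_less_mult_iff)
    qed
  next
    case False
    then show ?thesis using assms(1-3)
      by (auto simp: cone_join_def L_iff not_less)
  qed
qed

lemma cone_join_outside: "b \<notin> M \<Longrightarrow> cone_join u v (x, b) = 0"
  by (simp add: cone_join_def)

lemma cone_join_in:
  assumes u: "\<And>b. b \<in> M \<Longrightarrow> 0 \<le> u b \<and> u b \<le> 1" and v: "\<And>b x. b \<in> M \<Longrightarrow> x \<in> L b \<Longrightarrow> 0 \<le> v x b"
    and s: "\<And>b. b \<in> M \<Longrightarrow> 0 < u b \<Longrightarrow> u b < 1 \<Longrightarrow> (\<Sum>y\<in>L b. v y b) > 0"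
    and one: "\<And>b b'. b \<in> M \<Longrightarrow> b' \<in> M \<Longrightarrow> u b > 0 \<Longrightarrow> u b' > 0 \<Longrightarrow> b = b'"
    and chain: "\<And>b x y. b \<in> M \<Longrightarrow> u b > 0 \<Longrightarrow> x \<in> L b \<Longrightarrow> y \<in> L b \<Longrightarrow> v x b > 0 \<Longrightarrow> v y b > 0 \<Longrightarrow> (x, y) \<in> r \<or> (y, x) \<in> r"
  shows "cone_join u v \<in> cone_set"
proof -
  let ?z = "cone_join u v"
  have pos: "?z (x, b) > 0 \<longleftrightarrow> b \<in> M \<and> u b > 0 \<and> (x = b \<or> x \<in> L b \<and> u b < 1 \<and> v x b > 0)" for x b
  proof (cases "b \<in> M")
    case True
    then show ?thesis using cone_join_pos(2)[of b u v x] u[OF True] v[OF True] s[OF True] by auto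
  qed (simp add: cone_join_outside)
  have n0: "0 \<le> ?z i" for i
  proof (cases i)
    case (Pair x b)
    then show ?thesis
      using cone_join_pos(1)[of b u v x] u[of b] v[of b] s[of b] by (cases "b \<in> M") (auto simp: cone_join_outside)
  qed
  have nb: "b \<in> M \<and> (x, b) \<in> r \<and> ?z (b, b) > 0" if "?z (x, b) > 0" for x b
    using that Partial_order_refl[OF po M_Field[of b]] by (auto simp: pos L_iff)
  have nc: "b = b' \<and> ((x, y) \<in> r \<or> (y, x) \<in> r)" if "?z (x, b) > 0" "?z (y, b') > 0" for x b y b'
  proof
    show "b = b'" using that one by (auto simp: pos)
    then show "(x, y) \<in> r \<or> (y, x) \<in> r"
      using that chain[of b x y] Partial_order_refl[OF po M_Field[of b]] by (auto simp: pos L_iff)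
  qed
  have ns: "?z (b, b) \<le> 1 \<and> (\<Sum>x\<in>L b. ?z (x, b)) = ?z (b, b) * (1 - ?z (b, b))" if b: "b \<in> M" for b
  proof
    show "?z (b, b) \<le> 1" using b u by (simp add: cone_join_def)
    have "(\<Sum>x\<in>L b. ?z (x, b)) = (\<Sum>x\<in>L b. u b * (1 - u b) * v x b / (\<Sum>y\<in>L b. v y b))"
      using b by (intro sum.cong) (auto simp: cone_join_def L_iff)
    also have "\<dots> = u b * (1 - u b) * (\<Sum>x\<in>L b. v x b) / (\<Sum>y\<in>L b. v y b)"
      by (simp flip: sum_divide_distrib sum_distrib_left)
    also have "\<dots> = u b * (1 - u b)"
    proof (cases "0 < u b \<and> u b < 1")
      case True
      with s[OF b] have "(\<Sum>y\<in>L b. v y b) \<noteq> 0" by simp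
      then show ?thesis by simp
    next
      case False
      then have "u b = 0 \<or> u b = 1" using u[OF b] by linarith
      then show ?thesis by auto
    qed
    finally show "(\<Sum>x\<in>L b. ?z (x, b)) = ?z (b, b) * (1 - ?z (b, b))"
      using b by (simp add: cone_join_def)
  qed
  show ?thesis
    unfolding cone_set_def mem_Collect_eq by (rule conjI, rule allI, rule n0, rule conjI, intro allI impI, erule nb, rule conjI, intro allI impI, erule nc, assumption, rule ballI, erule ns)
qed

text \<open>Only the quotient is critical. It is bounded by \<open>u b * (1 - u b)\<close>, and
  where this bound is nonzero the denominator is positive.\<close>

lemma continuous_cone_join:
  assumes u: "\<And>b. b \<in> M \<Longrightarrow> continuous_map X euclideanreal (\<lambda>p. u p b)"
    and v: "\<And>b x. b \<in> M \<Longrightarrow> x \<in> L b \<Longrightarrow> continuous_map X euclideanreal (\<lambda>p. v p x b)"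
    and u01: "\<And>b p. p \<in> topspace X \<Longrightarrow> b \<in> M \<Longrightarrow> 0 \<le> u p b \<and> u p b \<le> 1"
    and v0: "\<And>b x p. p \<in> topspace X \<Longrightarrow> b \<in> M \<Longrightarrow> x \<in> L b \<Longrightarrow> 0 \<le> v p x b"
    and s: "\<And>b p. p \<in> topspace X \<Longrightarrow> b \<in> M \<Longrightarrow> 0 < u p b \<Longrightarrow> u p b < 1 \<Longrightarrow> (\<Sum>y\<in>L b. v p y b) > 0"
    and mem: "\<And>p. p \<in> topspace X \<Longrightarrow> cone_join (u p) (v p) \<in> cone_set"
  shows "continuous_map X cone_wedge (\<lambda>p. cone_join (u p) (v p))"
proof -
  have "continuous_map X euclideanreal (\<lambda>p. cone_join (u p) (v p) i)" for i
  proof (cases i)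
    case (Pair x b)
    consider "b \<in> M" "x = b" | "b \<in> M" "x \<noteq> b" "x \<in> L b" | "b \<notin> M \<or> x \<noteq> b \<and> x \<notin> L b" by blast
    then show ?thesis
    proof cases
      case 1
      then show ?thesis using u Pair by (simp add: cone_join_def)
    next
      case 2
      let ?s = "\<lambda>p. \<Sum>y\<in>L b. v p y b"
      have s0: "?s p \<ge> 0" if "p \<in> topspace X" for p
        using v0 that 2 by (intro sum_nonneg) blast
      have "continuous_map X euclideanreal (\<lambda>p. u p b * (1 - u p b) * v p x b / ?s p)"
      proof (rule continuous_map_dominated)
        show "continuous_map X euclideanreal (\<lambda>p. u p b * (1 - u p b))"
          using 2 by (intro continuous_intros u) simp_all
        let ?Y = "subtopology X {p \<in> topspace X. u p b * (1 - u p b) \<noteq> 0}"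
        have uY: "continuous_map ?Y euclideanreal (\<lambda>p. u p b)"
          using 2 by (intro continuous_map_from_subtopology u)
        have vY: "continuous_map ?Y euclideanreal (\<lambda>p. v p y b)" if "y \<in> L b" for y
          using 2 that by (intro continuous_map_from_subtopology v)
        have "?s p \<noteq> 0" if "p \<in> topspace ?Y" for p
        proof -
          have "u p b \<noteq> 0" "u p b \<noteq> 1" "p \<in> topspace X" using that by auto
          then have "0 < u p b" "u p b < 1" using u01[of p b] 2 by auto
          then show ?thesis using s[of p b] 2 \<open>p \<in> topspace X\<close> by simp
        qed
        then show "continuous_map ?Y euclideanreal (\<lambda>p. u p b * (1 - u p b) * v p x b / ?s p)"
          by (intro continuous_intros uY vY finite_L) (use 2 in simp_all)
        fix p assume p: "p \<in> topspace X"
        have "v p x b \<le> ?s p"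
          using 2 p v0 by (intro member_le_sum finite_L) auto
        then have "v p x b / ?s p \<le> 1" "0 \<le> v p x b / ?s p"
          using v0[OF p 2(1,3)] s0[OF p] by (auto simp: divide_le_eq_1)
        moreover have "0 \<le> u p b * (1 - u p b)" using u01[OF p 2(1)] by simp
        ultimately show "\<bar>u p b * (1 - u p b) * v p x b / ?s p\<bar> \<le> u p b * (1 - u p b)"
          using mult_left_mono[of "v p x b / ?s p" 1 "u p b * (1 - u p b)"]
            mult_nonneg_nonneg[of "u p b * (1 - u p b)" "v p x b / ?s p"]
          by (simp only: times_divide_eq_right abs_of_nonneg mult_1_right)
      qed
      then show ?thesis using 2 Pair by (simp add: cone_join_def)
    next
      case 3
      then have "cone_join (u p) (v p) i = 0" for p
        using Pair by (auto simp: cone_join_def)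
      then show ?thesis by simp
    qed
  qed
  then show ?thesis
    unfolding cone_wedge_def continuous_map_in_subtopology continuous_map_componentwise_UNIV
    using mem by auto
qed

lemma cone_map_tip:
  assumes z: "z \<in> cone_set" and b: "b \<in> M" "z (b, b) = 1"
  shows "cone_map z = b"
proof -
  have "(\<Sum>x\<in>L b. z (x, b)) = 0"
    using cone_setD(8)[OF z b(1)] b(2) by simp
  then have *: "z (x, b) = 0" if "x \<in> L b" for x
    using that finite_L cone_setD(1)[OF z] by (subst (asm) sum_nonneg_eq_0_iff) auto
  show ?thesis
  proof (rule cone_map_eq[OF z, of b b])
    fix y assume y: "z (y, b) > 0"
    then have "y = b" using * cone_setD(3)[OF z y] by (force simp: L_iff)
    then show "(b, y) \<in> r" using Partial_order_refl[OF po M_Field[OF b(1)]] by simp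
  qed (use b in simp)
qed

text \<open>Normalizing changes nothing on \<open>cone_set\<close>; so the interpolation in
  \<open>lifting_map_cone_map\<close> starts exactly at the prescribed boundary map.\<close>

lemma cone_join_coordinates:
  assumes z: "z \<in> cone_set"
  shows "cone_join (\<lambda>b. z (b, b)) (\<lambda>x b. z (x, b)) = z"
proof
  fix i
  obtain x b :: 'a where i: "i = (x, b)" by fastforce
  have z0: "z (x, b) = 0" if "\<not> z (x, b) > 0"
    using that cone_setD(1)[OF z, of "(x, b)"] by auto
  consider "b \<in> M" "x = b" | "b \<in> M" "x \<noteq> b" "x \<in> L b" | "b \<notin> M \<or> x \<noteq> b \<and> x \<notin> L b" by blast
  then show "cone_join (\<lambda>b. z (b, b)) (\<lambda>x b. z (x, b)) i = z i"
  proof cases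
    case 1
    then show ?thesis by (simp add: i cone_join_def)
  next
    case 2
    have s: "(\<Sum>y\<in>L b. z (y, b)) = z (b, b) * (1 - z (b, b))"
      using cone_setD(8)[OF z 2(1)] .
    have "z (b, b) * (1 - z (b, b)) = 0 \<Longrightarrow> z (x, b) = 0"
      using s finite_L cone_setD(1)[OF z] 2 by (subst (asm) s[symmetric]) (subst (asm) sum_nonneg_eq_0_iff, auto)
    then show ?thesis using 2 s by (auto simp: i cone_join_def)
  next
    case 3
    then have "z (x, b) = 0" using z0 cone_setD(2,3)[OF z] by (auto simp: L_iff)
    with 3 show ?thesis by (auto simp: i cone_join_def)
  qed
qed

text \<open>A partition along \<open>h\<close> gives a lift \<open>g'\<close> whose image under
  \<open>cone_map\<close> lies above \<open>h\<close>. On the boundary the partition uses, apart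
  from \<open>a\<close>, only vertices in the carrier of \<open>g c\<close>. Linear interpolation
  from \<open>g\<close> to \<open>g'\<close> therefore keeps that carrier until time 1, so
  \<open>cone_map\<close> stays at \<open>h c\<close> and jumps only at the end, exactly as the
  homotopy along the order does.\<close>

lemma lifting_map_cone_map: "lifting_map cone_wedge (poset_topology r) cone_map"
proof (rule lifting_mapI[OF continuous_cone_map])
  fix n h g
  let ?P = "cube n" and ?A = "cube_boundary n" and ?I = "top_of_set {0..1::real}"
  let ?B = "subtopology ?P ?A"
  assume h: "continuous_map ?P (poset_topology r) h" and g: "continuous_map ?B cone_wedge g"
    and eq: "\<forall>c\<in>?A. cone_map (g c) = h c"
  have tB: "topspace ?B = ?A" using cube_boundary_subset by auto
  have gC: "g c \<in> cone_set" if "c \<in> ?A" for c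
    using g that tB by (auto simp: continuous_map_def topspace_cone_wedge Pi_iff)
  have gi: "continuous_map ?B euclideanreal (\<lambda>c. g c i)" for i
    using continuous_map_compose[OF g continuous_map_cone_coordinate] by (simp add: comp_def)
  define G where "G = (\<lambda>x. if x = a then topspace ?P else topspace ?P - (?A - (\<Union>b\<in>M. {c \<in> ?A. g c (x, b) \<in> {0<..}})))"
  have "openin ?B {c \<in> ?A. g c (x, b) \<in> {0<..}}" for x b
    using openin_continuous_map_preimage[OF gi, of "{0<..}"] unfolding tB by simp
  then have "openin ?B (\<Union>b\<in>M. {c \<in> ?A. g c (x, b) \<in> {0<..}})" for x
    by (intro openin_Union) auto
  from closedin_diff[OF closedin_topspace this]
  have "closedin ?B (?A - (\<Union>b\<in>M. {c \<in> ?A. g c (x, b) \<in> {0<..}}))" for x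
    unfolding tB .
  then have "closedin ?P (?A - (\<Union>b\<in>M. {c \<in> ?A. g c (x, b) \<in> {0<..}}))" for x
    using closedin_trans_full[OF _ closedin_cube_boundary] by blast
  from openin_diff[OF openin_topspace this] have G1: "openin ?P (G x)" for x
    by (simp add: G_def)
  have gpos: "\<exists>b\<in>M. g c (x, b) > 0" if "c \<in> ?A" "h c = x" "x \<noteq> a" for c x
    using that eq by (cases rule: cone_map_cases[OF gC[OF that(1)]]) auto
  then have G2: "p \<in> G x" if "p \<in> topspace ?P" "h p = x" for x p
    using that by (auto simp: G_def)
  have "normal_space ?P"
    using compact_space_cube Hausdorff_space_cube by (simp add: compact_Hausdorff_or_regular_imp_normal_space)
  then obtain \<phi> where \<phi>: "\<And>x. continuous_map ?P euclideanreal (\<phi> x)"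
    and \<phi>0: "\<And>p x. p \<in> topspace ?P \<Longrightarrow> 0 \<le> \<phi> x p"
    and \<phi>S: "\<And>p x. p \<in> topspace ?P \<Longrightarrow> \<phi> x p > 0 \<Longrightarrow> x \<in> Field r \<and> (h p, x) \<in> r \<and> p \<in> G x"
    and \<phi>1: "\<And>p. p \<in> topspace ?P \<Longrightarrow> (\<Sum>x\<in>Field r. \<phi> x p) = 1"
    and \<phi>c: "\<And>p x y. p \<in> topspace ?P \<Longrightarrow> \<phi> x p > 0 \<Longrightarrow> \<phi> y p > 0 \<Longrightarrow> (x, y) \<in> r \<or> (y, x) \<in> r"
    using chain_partition[OF po fin _ h, of G] G1 G2 by blast
  have \<phi>le1: "\<phi> x p \<le> 1" if "p \<in> topspace ?P" for x p
  proof (cases "x \<in> Field r")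
    case True
    then show ?thesis using \<phi>1[OF that] member_le_sum[of x "Field r" "\<lambda>x. \<phi> x p"] \<phi>0[OF that] fin by simp
  next
    case False
    then show ?thesis using \<phi>S[OF that, of x] by force
  qed
  have \<phi>b: "(x, b) \<in> r" if "p \<in> topspace ?P" "b \<in> M" "\<phi> b p > 0" "\<phi> x p > 0" for x b p
    using \<phi>c[OF that(1,3,4)] M_max[OF that(2), of x] that(2) M_Field Partial_order_refl[OF po] by auto
  have \<phi>sum: "(\<Sum>x\<in>L b. \<phi> x p) = 1 - \<phi> b p" if p: "p \<in> topspace ?P" and b: "b \<in> M" "\<phi> b p > 0" for b p
  proof -
    have z: "\<phi> x p = 0" if "x \<notin> insert b (L b)" for x
      using \<phi>b[OF p b, of x] \<phi>0[OF p, of x] that by (force simp: L_iff)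
    have "insert b (L b) \<subseteq> Field r"
      using M_Field[OF b(1)] by (auto simp: L_iff intro: FieldI1)
    then have "(\<Sum>x\<in>Field r. \<phi> x p) = (\<Sum>x\<in>insert b (L b). \<phi> x p)"
      by (intro sum.mono_neutral_right fin) (use z in blast)+
    also have "\<dots> = \<phi> b p + (\<Sum>x\<in>L b. \<phi> x p)"
      using finite_L by (subst sum.insert) (auto simp: L_iff)
    finally show ?thesis using \<phi>1[OF p] by simp
  qed
  have \<phi>one: "b = b'" if "p \<in> topspace ?P" "b \<in> M" "b' \<in> M" "\<phi> b p > 0" "\<phi> b' p > 0" for b b' p
    using \<phi>b[OF that(1,2,4,5)] M_max[OF that(3)] by simp
  have \<phi>A: "\<exists>b\<in>M. g c (x, b) > 0" if "c \<in> ?A" "\<phi> x c > 0" "x \<noteq> a" for c x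
    using \<phi>S[of c x] that cube_boundary_subset by (auto simp: G_def)
  define g' where "g' = (\<lambda>p. cone_join (\<lambda>b. \<phi> b p) (\<lambda>x b. \<phi> x p))"
  have g'C: "g' p \<in> cone_set" if p: "p \<in> topspace ?P" for p
    unfolding g'_def
    by (rule cone_join_in) (use p \<phi>0 \<phi>le1 \<phi>sum \<phi>one \<phi>c in auto)
  have g': "continuous_map ?P cone_wedge g'"
    unfolding g'_def
    by (rule continuous_cone_join) (use \<phi> \<phi>0 \<phi>le1 \<phi>sum g'C in \<open>auto simp: g'_def\<close>)
  have g'pos: "\<phi> x p > 0" if p: "p \<in> topspace ?P" and pos: "g' p (x, b) > 0" for p x b
  proof -
    have b: "b \<in> M" using cone_setD(2)[OF g'C[OF p] pos] .
    have "\<phi> b p > 0 \<and> (x = b \<or> x \<in> L b \<and> \<phi> b p < 1 \<and> \<phi> x p > 0)"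
      using pos unfolding g'_def
      by (subst (asm) cone_join_pos(2)) (use b p \<phi>0 \<phi>le1 \<phi>sum in auto)
    then show ?thesis by auto
  qed
  have cont_fg': "continuous_map ?P (poset_topology r) (\<lambda>p. cone_map (g' p))"
    using continuous_map_compose[OF g' continuous_cone_map] by (simp add: comp_def)
  have le: "(h p, cone_map (g' p)) \<in> r" if p: "p \<in> topspace ?P" for p
  proof (cases rule: cone_map_cases[OF g'C[OF p]])
    \<comment> \<open>The lift is the base point, so no vertex in \<open>M\<close> has weight; a
      vertex that does have weight then lies below \<open>a\<close>, and it lies above
      \<open>h p\<close>.\<close>
    case 1
    have "\<phi> b p = 0" if "b \<in> M" for b
    proof -
      have "g' p (b, b) = \<phi> b p" using that by (simp add: g'_def cone_join_def)
      then show ?thesis using 1 by simp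
    qed
    moreover obtain x where "x \<in> Field r" "\<phi> x p > 0"
      using \<phi>1[OF p] by (metis less_numeral_extra(1) not_less sum_nonpos)
    ultimately have "(x, a) \<in> r"
      using cover a_Field Partial_order_refl[OF po a_Field] by (force simp: M_def under_def)
    with \<phi>S[OF p \<open>\<phi> x p > 0\<close>] 1 show ?thesis
      using Partial_order_trans[OF po] by metis
  next
    case (2 b)
    then show ?thesis using g'pos[OF p 2(3)] \<phi>S[OF p] by blast
  qed
  define H where "H = (\<lambda>p. if fst p < (1::real) then h (snd p) else cone_map (g' (snd p)))"
  have H: "continuous_map (prod_topology ?I ?P) (poset_topology r) H"
    unfolding H_def by (rule continuous_map_switch[OF po h cont_fg' le])
  \<comment> \<open>The interpolation takes place before normalization: \<open>cone_set\<close> is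
    not convex in general, as the height enters its equation quadratically.\<close>
  define u where "u = (\<lambda>p b. (1 - fst p) * g (snd p) (b, b) + fst p * \<phi> b (snd p))"
  define v where "v = (\<lambda>p x b. (1 - fst p) * g (snd p) (x, b) + fst p * \<phi> x (snd p))"
  define K where "K = (\<lambda>p. cone_join (u p) (v p))"
  let ?Q = "prod_topology ?I ?B"
  have gb: "g c (b, b) > 0" if c: "c \<in> ?A" "b \<in> M" "\<phi> b c > 0" for c b
  proof -
    obtain b' where "b' \<in> M" "g c (b, b') > 0"
      using \<phi>A[OF c(1,3)] M_not_a[OF c(2)] by blast
    then show ?thesis using cone_setD(3,4)[OF gC[OF c(1)]] M_max[OF c(2)] by metis
  qed
  have gx: "g c (x, b) > 0" if c: "c \<in> ?A" "b \<in> M" "x \<in> L b" "\<phi> x c > 0" "g c (b, b) > 0" for c b x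
  proof -
    obtain b' where "b' \<in> M" "g c (x, b') > 0"
      using \<phi>A[OF c(1,4)] L_below_a[OF c(2,3)] by blast
    then show ?thesis using cone_setD(5)[OF gC[OF c(1)]] c(5) by metis
  qed
  have Q: "0 \<le> fst p" "fst p \<le> 1" "snd p \<in> ?A" "snd p \<in> topspace ?P" if "p \<in> topspace ?Q" for p
    using that subsetD[OF cube_boundary_subset] unfolding topspace_prod_topology tB mem_Times_iff by simp_all
  have up: "g (snd p) (b, b) > 0"
    if p: "p \<in> topspace ?Q" and b: "b \<in> M" "u p b > 0" for p b
  proof (rule ccontr)
    assume n: "\<not> g (snd p) (b, b) > 0"
    note A = Q(3)[OF p]
    have "\<not> \<phi> b (snd p) > 0" using n gb[OF A b(1)] by blast
    then have "\<phi> b (snd p) = 0" "g (snd p) (b, b) = 0"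
      using n \<phi>0[OF Q(4)[OF p], of b] cone_setD(1)[OF gC[OF A], of "(b, b)"] by simp_all
    then show False using b by (simp add: u_def)
  qed
  have vp: "g (snd p) (x, b) > 0"
    if p: "p \<in> topspace ?Q" and b: "b \<in> M" "x \<in> L b" "u p b > 0" "v p x b > 0" for p b x
  proof (rule ccontr)
    assume n: "\<not> g (snd p) (x, b) > 0"
    note A = Q(3)[OF p]
    have "\<not> \<phi> x (snd p) > 0" using n gx[OF A b(1,2) _ up[OF p b(1,3)]] by blast
    then have "\<phi> x (snd p) = 0" "g (snd p) (x, b) = 0"
      using n \<phi>0[OF Q(4)[OF p], of x] cone_setD(1)[OF gC[OF A], of "(x, b)"] by simp_all
    then show False using b by (simp add: v_def)
  qed
  have u01: "0 \<le> u p b \<and> u p b \<le> 1" if p: "p \<in> topspace ?Q" and "b \<in> M" for p b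
  proof -
    have "g (snd p) (b, b) \<in> {0..1}" "\<phi> b (snd p) \<in> {0..1}"
      using cone_setD(1,7)[OF gC[OF Q(3)[OF p]]] \<phi>0 \<phi>le1 Q(4)[OF p] that by auto
    then show ?thesis
      using Q(1,2)[OF p] convexD[OF convex_real_interval(5), of "g (snd p) (b, b)" 0 1 "\<phi> b (snd p)" "1 - fst p" "fst p"]
      by (auto simp: u_def)
  qed
  have v0: "0 \<le> v p x b" if p: "p \<in> topspace ?Q" for p x b
    using Q[OF p] cone_setD(1)[OF gC[OF Q(3)[OF p]]] \<phi>0[OF Q(4)[OF p]] by (simp add: v_def)
  have vsum: "(\<Sum>x\<in>L b. v p x b) > 0" if p: "p \<in> topspace ?Q" and b: "b \<in> M" "0 < u p b" "u p b < 1" for p b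
  proof -
    let ?c = "snd p" and ?t = "fst p"
    note A = Q(3)[OF p] and gc = gC[OF Q(3)[OF p]]
    have e: "(\<Sum>x\<in>L b. v p x b) = (1 - ?t) * (g ?c (b, b) * (1 - g ?c (b, b))) + ?t * (\<Sum>x\<in>L b. \<phi> x ?c)"
      by (simp add: v_def sum.distrib flip: sum_distrib_left cone_setD(8)[OF gc b(1)])
    have s0: "(\<Sum>x\<in>L b. \<phi> x ?c) \<ge> 0" using \<phi>0[OF Q(4)[OF p]] by (simp add: sum_nonneg)
    have z0: "g ?c (b, b) > 0" using up[OF p b(1,2)] .
    have z1: "g ?c (b, b) \<le> 1" using cone_setD(7)[OF gc b(1)] .
    have "g ?c (b, b) \<noteq> 1"
    proof
      \<comment> \<open>At a tip \<open>h\<close> takes the maximal value \<open>b\<close>, so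
        \<open>b\<close> is the only vertex of the partition, and the height is 1 throughout the
        interpolation.\<close>
      assume 1: "g ?c (b, b) = 1"
      then have hb: "h ?c = b" using cone_map_tip[OF gc b(1)] eq A by simp
      have "\<phi> x ?c = 0" if "x \<noteq> b" for x
        using \<phi>S[OF Q(4)[OF p], of x] hb M_max[OF b(1)] that \<phi>0[OF Q(4)[OF p], of x] by force
      then have "(\<Sum>x\<in>Field r. \<phi> x ?c) = \<phi> b ?c"
        using fin M_Field[OF b(1)] by (subst sum.remove[of _ b]) auto
      then have "u p b = 1" using \<phi>1[OF Q(4)[OF p]] 1 by (simp add: u_def)
      with b show False by simp
    qed
    with z1 have z1: "g ?c (b, b) < 1" by simp
    show ?thesis
    proof (cases "?t < 1")
      case True
      then have "(1 - ?t) * (g ?c (b, b) * (1 - g ?c (b, b))) > 0" using z0 z1 by simp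
      moreover have "?t * (\<Sum>x\<in>L b. \<phi> x ?c) \<ge> 0" using s0 Q(1)[OF p] by simp
      ultimately show ?thesis using e by linarith
    next
      case False
      then have t: "?t = 1" using Q(2)[OF p] by simp
      then have "\<phi> b ?c > 0" "\<phi> b ?c < 1" using b by (simp_all add: u_def)
      then show ?thesis using e t \<phi>sum[OF Q(4)[OF p] b(1)] by simp
    qed
  qed
  have KC: "K p \<in> cone_set" if p: "p \<in> topspace ?Q" for p
    unfolding K_def
  proof (rule cone_join_in)
    fix b b' assume b: "b \<in> M" "b' \<in> M" "u p b > 0" "u p b' > 0"
    show "b = b'"
      using cone_setD(5)[OF gC[OF Q(3)[OF p]] up[OF p b(1,3)] up[OF p b(2,4)]] .
  next
    fix b x y assume b: "b \<in> M" "u p b > 0" "x \<in> L b" "y \<in> L b" "v p x b > 0" "v p y b > 0"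
    show "(x, y) \<in> r \<or> (y, x) \<in> r"
      using cone_setD(6)[OF gC[OF Q(3)[OF p]] vp[OF p b(1,3,2,5)] vp[OF p b(1,4,2,6)]] .
  qed (use p u01 v0 vsum in auto)
  have K: "continuous_map ?Q cone_wedge K"
    unfolding K_def
  proof (rule continuous_cone_join)
    have \<phi>B: "continuous_map ?B euclideanreal (\<phi> x)" for x
      by (rule continuous_map_from_subtopology[OF \<phi>])
    show "continuous_map ?Q euclideanreal (\<lambda>p. u p b)" for b
      unfolding u_def
      by (intro continuous_intros continuous_map_fst_real continuous_map_of_snd[where u = "\<lambda>c. g c (b, b)"]
        continuous_map_of_snd[where u = "\<phi> b"] gi \<phi>B) simp
    show "continuous_map ?Q euclideanreal (\<lambda>p. v p x b)" for x b
      unfolding v_def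
      by (intro continuous_intros continuous_map_fst_real continuous_map_of_snd[where u = "\<lambda>c. g c (x, b)"]
        continuous_map_of_snd[where u = "\<phi> x"] gi \<phi>B) simp
  qed (use u01 v0 vsum KC in \<open>auto simp: K_def\<close>)
  have K0: "K (0, c) = g c" and K1: "K (1, c) = g' c" if "c \<in> ?A" for c
    using cone_join_coordinates[OF gC[OF that]] by (simp_all add: K_def u_def v_def g'_def)
  have fK: "cone_map (K (t, c)) = H (t, c)" if t: "t \<in> {0..1}" and c: "c \<in> ?A" for t c
  proof (cases "t < 1")
    case False
    then have "t = 1" using t by simp
    then show ?thesis using K1[OF c] by (simp add: H_def)
  next
    case True
    have p: "(t, c) \<in> topspace ?Q" using t c unfolding topspace_prod_topology tB by simp
    have cP: "c \<in> topspace ?P" using c cube_boundary_subset by auto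
    have "cone_map (K (t, c)) = cone_map (g c)"
    proof (cases rule: cone_map_cases[OF gC[OF c]])
      case 1
      have "K (t, c) i = 0" for i
      proof (rule ccontr)
        obtain x b :: 'a where i: "i = (x, b)" by fastforce
        assume "K (t, c) i \<noteq> 0"
        then have "K (t, c) (x, b) > 0" using cone_setD(1)[OF KC[OF p], of "(x, b)"] i by auto
        then have "b \<in> M" "K (t, c) (b, b) > 0" using cone_setD(2,4)[OF KC[OF p]] by blast+
        then have "u (t, c) b > 0" by (simp add: K_def cone_join_def)
        then show False using up[OF p \<open>b \<in> M\<close>] 1 by simp
      qed
      then have "K (t, c) = (\<lambda>_. 0)" by blast
      with 1 show ?thesis by simp
    next
      case (2 b)
      let ?m = "cone_map (g c)"
      have u0: "u (t, c) b > 0"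
        using 2(1,2) True t \<phi>0[OF cP, of b] by (simp add: u_def add_pos_nonneg)
      have Kpos: "K (t, c) (x, b) > 0 \<longleftrightarrow> x = b \<or> x \<in> L b \<and> u (t, c) b < 1 \<and> v (t, c) x b > 0" for x
        unfolding K_def by (subst cone_join_pos(2)) (use 2(1) p u0 u01 v0 vsum in auto)
      show ?thesis
      proof (rule cone_map_eq[OF KC[OF p]])
        show "K (t, c) (?m, b) > 0"
        proof (cases "?m = b")
          case False
          then have m: "?m \<in> L b" using cone_setD(3)[OF gC[OF c] 2(3)] by (simp add: L_iff)
          have "v (t, c) ?m b > 0"
            using 2(3) True t \<phi>0[OF cP, of ?m] by (simp add: v_def add_pos_nonneg)
          moreover have "g c (b, b) \<noteq> 1" using cone_map_tip[OF gC[OF c] 2(1)] False by blast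
          then have "g c (b, b) < 1" using cone_setD(7)[OF gC[OF c] 2(1)] by simp
          then have "(1 - t) * g c (b, b) < (1 - t) * 1" "t * \<phi> b c \<le> t * 1"
            using True t \<phi>le1[OF cP, of b] by (simp_all add: mult_left_le)
          then have "u (t, c) b < 1" by (simp add: u_def)
          ultimately show ?thesis using m by (simp add: Kpos)
        qed (simp add: Kpos)
        fix y assume "K (t, c) (y, b) > 0"
        then have "g c (y, b) > 0"
          using Kpos[of y] 2(2) vp[OF p 2(1) _ u0] by auto
        then show "(?m, y) \<in> r" by (rule 2(4))
      qed
    qed
    then show ?thesis using True eq c by (simp add: H_def)
  qed
  show "\<exists>g' H K. continuous_map ?P cone_wedge g' \<and>
         continuous_map (prod_topology ?I ?P) (poset_topology r) H \<and>
         continuous_map (prod_topology ?I ?B) cone_wedge K \<and>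
         (\<forall>c\<in>topspace ?P. H (0, c) = h c \<and> H (1, c) = cone_map (g' c)) \<and>
         (\<forall>c\<in>?A. K (0, c) = g c \<and> K (1, c) = g' c) \<and>
         (\<forall>t\<in>{0..1}. \<forall>c\<in>?A. cone_map (K (t, c)) = H (t, c))"
    by (rule exI[of _ g'], rule exI[of _ H], rule exI[of _ K])
      (use g' H K K0 K1 fK in \<open>auto simp: H_def\<close>)
qed

end

section \<open>Order complexes\<close>

text \<open>The final map of the deformation is constant on the fibres of \<open>q\<close> and
  factors as \<open>E \<circ> q\<close>; \<open>E\<close> is a homotopy inverse, and
  \<open>h\<close> is lifted to \<open>E \<circ> h\<close>. Compactness makes \<open>q\<close> and
  its product with the interval closed, hence quotient maps, so \<open>q \<circ> \<delta>\<close>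
  descends to a homotopy as well.\<close>

lemma lifting_map_collapse:
  assumes W: "compact_space W" and C: "Hausdorff_space C"
    and q: "continuous_map W C q" "q ` topspace W = topspace C"
    and \<delta>: "continuous_map (prod_topology (top_of_set {0..1::real}) W) W \<delta>"
    and \<delta>0: "\<And>w. w \<in> topspace W \<Longrightarrow> \<delta> (0, w) = w"
    and fib: "\<And>w w'. \<lbrakk>w \<in> topspace W; w' \<in> topspace W; q w = q w'\<rbrakk> \<Longrightarrow> \<delta> (1, w) = \<delta> (1, w')"
      "\<And>t w w'. \<lbrakk>t \<in> {0..1}; w \<in> topspace W; w' \<in> topspace W; q w = q w'\<rbrakk> \<Longrightarrow> q (\<delta> (t, w)) = q (\<delta> (t, w'))"
  shows "lifting_map W C q"
proof (rule lifting_mapI[OF q(1)])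
  fix n h g
  let ?I = "top_of_set {0..1::real}"
  let ?B = "subtopology (cube n) (cube_boundary n)"
  assume h: "continuous_map (cube n) C h" and g: "continuous_map ?B W g"
    and eq: "\<forall>c\<in>cube_boundary n. q (g c) = h c"
  have kc: "kc_space C" and kcI: "kc_space (prod_topology ?I C)"
    using C by (simp_all add: Hausdorff_imp_kc_space Hausdorff_space_prod_topology Hausdorff_space_subtopology)
  have quot: "quotient_map W C q"
    by (rule continuous_closed_imp_quotient_map[OF q(1) continuous_imp_closed_map_gen[OF W kc q(1)] q(2)])
  define qI where "qI = (\<lambda>p. (fst p :: real, q (snd p)))"
  have cI: "continuous_map (prod_topology ?I W) (prod_topology ?I C) qI"
    unfolding qI_def
    by (intro continuous_map_pairedI continuous_map_fst continuous_map_of_snd[OF q(1)])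
  have "compact_space (prod_topology ?I W)"
    using W by (simp add: compact_space_prod_topology compact_space_subtopology)
  then have "closed_map (prod_topology ?I W) (prod_topology ?I C) qI"
    using kcI cI by (rule continuous_imp_closed_map_gen)
  moreover have "qI ` topspace (prod_topology ?I W) = topspace (prod_topology ?I C)"
    unfolding qI_def topspace_prod_topology using q(2) by (force simp: image_iff)
  ultimately have quotI: "quotient_map (prod_topology ?I W) (prod_topology ?I C) qI"
    by (rule continuous_closed_imp_quotient_map[OF cI])
  have \<delta>1: "continuous_map W W (\<lambda>w. \<delta> (1, w))"
    using continuous_map_compose[OF continuous_map_pairedI[of W ?I "\<lambda>_. 1" W "\<lambda>w. w"] \<delta>]
    by (simp add: comp_def)
  obtain E where E: "continuous_map C W E" "\<And>w. w \<in> topspace W \<Longrightarrow> E (q w) = \<delta> (1, w)"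
    by (rule quotient_map_lift_exists[OF quot \<delta>1 fib(1)]) (assumption+, rule that)
  have q\<delta>: "continuous_map (prod_topology ?I W) C (\<lambda>p. q (\<delta> p))"
    using continuous_map_compose[OF \<delta> q(1)] by (simp add: comp_def)
  have qI: "q (\<delta> p) = q (\<delta> p')"
    if "p \<in> topspace (prod_topology ?I W)" "p' \<in> topspace (prod_topology ?I W)" "qI p = qI p'" for p p'
    using that fib(2)[of "fst p" "snd p" "snd p'"] by (simp add: qI_def mem_Times_iff) (metis prod.collapse)
  obtain Hq where Hq: "continuous_map (prod_topology ?I C) C Hq"
      "\<And>p. p \<in> topspace (prod_topology ?I W) \<Longrightarrow> Hq (qI p) = q (\<delta> p)"
    by (rule quotient_map_lift_exists[OF quotI q\<delta> qI]) (assumption+, rule that)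
  have Hq': "Hq (t, q w) = q (\<delta> (t, w))" if "t \<in> {0..1}" "w \<in> topspace W" for t w
    using Hq(2)[of "(t, w)"] that by (simp add: qI_def)
  define H where "H = (\<lambda>p. Hq (fst p, h (snd p)))"
  define K where "K = (\<lambda>p. \<delta> (fst p, g (snd p)))"
  have "continuous_map (prod_topology ?I (cube n)) C H"
    using continuous_map_compose[OF continuous_map_pairedI[OF continuous_map_fst continuous_map_of_snd[OF h]] Hq(1)]
    by (simp add: H_def comp_def)
  moreover have "continuous_map (prod_topology ?I ?B) W K"
    using continuous_map_compose[OF continuous_map_pairedI[OF continuous_map_fst continuous_map_of_snd[OF g]] \<delta>]
    by (simp add: K_def comp_def)
  moreover have "continuous_map (cube n) W (\<lambda>c. E (h c))"
    using continuous_map_compose[OF h E(1)] by (simp add: comp_def)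
  moreover have "H (0, c) = h c \<and> H (1, c) = q (E (h c))" if "c \<in> topspace (cube n)" for c
  proof -
    have "h c \<in> topspace C" using h that by (auto simp: continuous_map_def)
    then obtain w where w: "w \<in> topspace W" "h c = q w" using q(2) by auto
    then show ?thesis using Hq'[OF _ w(1)] \<delta>0 E(2) by (simp add: H_def)
  qed
  moreover have gW: "g c \<in> topspace W" if "c \<in> cube_boundary n" for c
    using g that cube_boundary_subset by (auto simp: continuous_map_def Pi_iff)
  then have "K (0, c) = g c \<and> K (1, c) = E (h c)" if "c \<in> cube_boundary n" for c
    using \<delta>0 E(2) eq that by (metis K_def fst_conv snd_conv)
  moreover have "q (K (t, c)) = H (t, c)" if "t \<in> {0..1}" "c \<in> cube_boundary n" for t c
    using Hq'[OF that(1) gW[OF that(2)]] eq that(2) by (simp add: K_def H_def)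
  ultimately show "\<exists>g' H K. continuous_map (cube n) W g' \<and>
         continuous_map (prod_topology ?I (cube n)) C H \<and>
         continuous_map (prod_topology ?I ?B) W K \<and>
         (\<forall>c\<in>topspace (cube n). H (0, c) = h c \<and> H (1, c) = q (g' c)) \<and>
         (\<forall>c\<in>cube_boundary n. K (0, c) = g c \<and> K (1, c) = g' c) \<and>
         (\<forall>t\<in>{0..1}. \<forall>c\<in>cube_boundary n. q (K (t, c)) = H (t, c))"
    by (intro exI[of _ "\<lambda>c. E (h c)"] exI[of _ H] exI[of _ K]) blast
qed

section \<open>Realizations of finite order complexes\<close>

abbreviation order_realization :: "'a rel \<Rightarrow> ('a \<Rightarrow> real) topology" where
  "order_realization R \<equiv> realization (order_complex R)"

lemma topspace_order_realization:
  assumes "finite (Field R)"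
  shows "t \<in> topspace (order_realization R) \<longleftrightarrow> (\<forall>v. 0 \<le> t v) \<and> (\<forall>v. t v > 0 \<longrightarrow> v \<in> Field R) \<and>
     (\<forall>v w. t v > 0 \<longrightarrow> t w > 0 \<longrightarrow> (v, w) \<in> R \<or> (w, v) \<in> R) \<and> (\<Sum>v\<in>Field R. t v) = 1"
    (is "_ \<longleftrightarrow> ?rhs")
proof -
  have "t \<in> topspace (order_realization R) \<longleftrightarrow>
      (\<forall>v. 0 \<le> t v) \<and> {v. t v \<noteq> 0} \<in> order_complex R \<and> (\<Sum>v | t v \<noteq> 0. t v) = 1"
    by (simp add: realization_def)
  also have "\<dots> \<longleftrightarrow> ?rhs"
  proof (cases "\<forall>v. 0 \<le> t v")
    case True
    then have p: "t v \<noteq> 0 \<longleftrightarrow> t v > 0" for v by (metis less_le)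
    have s: "(\<Sum>v | t v \<noteq> 0. t v) = (\<Sum>v\<in>Field R. t v)" if "{v. t v \<noteq> 0} \<subseteq> Field R"
      using that assms by (intro sum.mono_neutral_left) auto
    show ?thesis
    proof
      assume l: "(\<forall>v. 0 \<le> t v) \<and> {v. t v \<noteq> 0} \<in> order_complex R \<and> (\<Sum>v | t v \<noteq> 0. t v) = 1"
      then have ch: "(v, w) \<in> R \<or> (w, v) \<in> R" if "t v > 0" "t w > 0" for v w
        using that by (auto simp: order_complex_def Chains_def p)
      then have "v \<in> Field R" if "t v > 0" for v
        using that by (blast intro: FieldI1)
      with l ch s show ?rhs by (auto simp: p)
    next
      assume rr: ?rhs
      then have sub: "{v. t v \<noteq> 0} \<subseteq> Field R" using p by auto
      moreover have "{v. t v \<noteq> 0} \<noteq> {}"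
      proof
        assume "{v. t v \<noteq> 0} = {}"
        then have "(\<Sum>v\<in>Field R. t v) = 0" by (intro sum.neutral) auto
        with rr show False by simp
      qed
      ultimately show "(\<forall>v. 0 \<le> t v) \<and> {v. t v \<noteq> 0} \<in> order_complex R \<and> (\<Sum>v | t v \<noteq> 0. t v) = 1"
        using rr s[OF sub] finite_subset[OF sub assms] by (auto simp: order_complex_def Chains_def p)
    qed
  qed blast
  finally show ?thesis .
qed

lemma continuous_map_order_realization_coordinate:
  "continuous_map (order_realization R) euclideanreal (\<lambda>t. t v)"
  unfolding realization_def
  by (intro continuous_map_from_subtopology continuous_map_product_projection) simp

lemma continuous_map_into_order_realization:
  assumes "\<And>v. continuous_map X euclideanreal (\<lambda>p. f p v)"
    and "\<And>p. p \<in> topspace X \<Longrightarrow> f p \<in> topspace (order_realization R)"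
  shows "continuous_map X (order_realization R) f"
  using assms unfolding realization_def continuous_map_in_subtopology continuous_map_componentwise_UNIV
  by auto

lemma Hausdorff_space_order_realization: "Hausdorff_space (order_realization R)"
  unfolding realization_def
  by (intro Hausdorff_space_subtopology) (simp add: Hausdorff_space_product_topology)

lemma compact_space_order_realization:
  assumes fin: "finite (Field R)"
  shows "compact_space (order_realization R)"
proof -
  let ?X = "product_topology (\<lambda>_. euclideanreal) (UNIV :: 'a set)"
  let ?S = "{t :: 'a \<Rightarrow> real. (\<forall>v. 0 \<le> t v) \<and> {v. t v \<noteq> 0} \<in> order_complex R \<and> (\<Sum>v | t v \<noteq> 0. t v) = 1}"
  have S: "?S = topspace (order_realization R)"
    by (simp add: realization_def)
  have c: "continuous_map ?X euclideanreal (\<lambda>t. t v)" for v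
    by (intro continuous_map_product_projection) simp
  \<comment> \<open>For incomparable \<open>v\<close> and \<open>w\<close> the chain condition reads
    \<open>t v * t w = 0\<close>, which is a closed condition.\<close>
  let ?T = "\<lambda>v w. if (v, w) \<in> R \<or> (w, v) \<in> R then UNIV else {t. t v * t w \<in> {0 :: real}}"
  have SE: "?S = (\<Inter>v. {t. t v \<in> {0..}}) \<inter> (\<Inter>v\<in>- Field R. {t. t v \<in> {0}}) \<inter> (\<Inter>v. \<Inter>w. ?T v w)
      \<inter> {t. (\<Sum>v\<in>Field R. t v) \<in> {1}}" (is "_ = ?rhs")
  proof (intro set_eqI)
    fix t :: "'a \<Rightarrow> real"
    have "t \<in> ?rhs \<longleftrightarrow> (\<forall>v. 0 \<le> t v) \<and> (\<forall>v. v \<notin> Field R \<longrightarrow> t v = 0) \<and>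
       (\<forall>v w. (v, w) \<in> R \<or> (w, v) \<in> R \<or> t v * t w = 0) \<and> (\<Sum>v\<in>Field R. t v) = 1"
    proof -
      have "t \<in> ?T v w \<longleftrightarrow> (v, w) \<in> R \<or> (w, v) \<in> R \<or> t v * t w = 0" for v w
        by simp
      then show ?thesis
        unfolding Int_iff by (simp only: INT_iff mem_Collect_eq atLeast_iff singleton_iff Compl_iff) blast
    qed
    also have "\<dots> \<longleftrightarrow> (\<forall>v. 0 \<le> t v) \<and> (\<forall>v. t v > 0 \<longrightarrow> v \<in> Field R) \<and>
     (\<forall>v w. t v > 0 \<longrightarrow> t w > 0 \<longrightarrow> (v, w) \<in> R \<or> (w, v) \<in> R) \<and> (\<Sum>v\<in>Field R. t v) = 1"
      by (metis less_irrefl less_le mult_eq_0_iff)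
    finally show "t \<in> ?S \<longleftrightarrow> t \<in> ?rhs"
      unfolding S topspace_order_realization[OF fin] by simp
  qed
  have cl: "closedin ?X {t. f t \<in> D}" if "continuous_map ?X euclideanreal f" "closed D" for f and D :: "real set"
    using closedin_continuous_map_preimage[OF that(1), of D] that(2) by simp
  have clT: "closedin ?X (?T v w)" for v w
  proof (cases "(v, w) \<in> R \<or> (w, v) \<in> R")
    case True
    then show ?thesis using closedin_topspace[of ?X] by simp
  next
    case False
    have "closedin ?X {t. t v * t w \<in> {0}}"
      by (rule cl) (intro continuous_intros c, simp)
    with False show ?thesis by simp
  qed
  have 1: "closedin ?X (\<Inter>v. {t. t v \<in> {0..}})"
    by (intro closedin_Inter) (auto intro: cl[OF c closed_atLeast, simplified])
  have 3: "closedin ?X (\<Inter>v. \<Inter>w. ?T v w)"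
    by (intro closedin_INT clT) auto
  have 4: "closedin ?X {t. (\<Sum>v\<in>Field R. t v) \<in> {1}}"
    by (rule cl) (intro continuous_intros c fin, simp)
  have 2: "closedin ?X (\<Inter>v\<in>- Field R. {t. t v \<in> {0}})"
  proof (cases "- Field R = {}")
    case True
    then show ?thesis using closedin_topspace[of ?X] by simp
  next
    case False
    then show ?thesis
      by (intro closedin_Inter) (auto intro: cl[OF c closed_singleton, simplified])
  qed
  have "closedin ?X ?S"
    unfolding SE using 1 2 3 4 by (intro closedin_Int)
  moreover have "compactin ?X (PiE UNIV (\<lambda>v. if v \<in> Field R then {0..1} else {0}))"
    by (subst compactin_PiE) auto
  moreover have "?S \<subseteq> PiE UNIV (\<lambda>v. if v \<in> Field R then {0..1} else {0})"
  proof
    fix t :: "'a \<Rightarrow> real" assume "t \<in> ?S"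
    then have t: "\<And>v. 0 \<le> t v" "\<And>v. t v > 0 \<Longrightarrow> v \<in> Field R" "(\<Sum>v\<in>Field R. t v) = 1"
      unfolding S topspace_order_realization[OF fin] by blast+
    have "t v \<le> 1" if "v \<in> Field R" for v
      using member_le_sum[of v "Field R" t] t that fin by simp
    moreover have "t v = 0" if "v \<notin> Field R" for v
      using t(1)[of v] t(2)[of v] that by force
    ultimately show "t \<in> PiE UNIV (\<lambda>v. if v \<in> Field R then {0..1} else {0})"
      using t(1) by (simp add: PiE_iff)
  qed
  ultimately have "compactin ?X ?S"
    by (meson closed_compactin)
  then show ?thesis
    unfolding realization_def by (rule compact_space_subtopology)
qed

text \<open>The effect on coordinates is recorded along with the homeomorphism, because it locates
  the images of base points.\<close>

lemma homeomorphic_order_realization: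
  assumes fin: "finite (Field R)" and \<sigma>: "bij_betw \<sigma> (Field R) (Field R')"
    and iso: "\<And>x y. x \<in> Field R \<Longrightarrow> y \<in> Field R \<Longrightarrow> (\<sigma> x, \<sigma> y) \<in> R' \<longleftrightarrow> (x, y) \<in> R"
  obtains \<theta> where "homeomorphic_map (order_realization R) (order_realization R') \<theta>"
    "\<And>t v. t \<in> topspace (order_realization R) \<Longrightarrow> v \<in> Field R \<Longrightarrow> \<theta> t (\<sigma> v) = t v"
proof -
  define \<tau> where "\<tau> = inv_into (Field R) \<sigma>"
  have \<tau>: "bij_betw \<tau> (Field R') (Field R)"
    unfolding \<tau>_def using \<sigma> by (rule bij_betw_inv_into)
  have st: "\<sigma> (\<tau> w) = w" if "w \<in> Field R'" for w
    using \<sigma> that by (simp add: \<tau>_def bij_betw_inv_into_right)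
  have ts: "\<tau> (\<sigma> v) = v" if "v \<in> Field R" for v
    using \<sigma> that by (simp add: \<tau>_def bij_betw_inv_into_left)
  have fin': "finite (Field R')" using \<sigma> fin bij_betw_finite by blast
  have \<tau>F: "\<tau> w \<in> Field R" if "w \<in> Field R'" for w using \<tau> that bij_betwE by blast
  have \<sigma>F: "\<sigma> v \<in> Field R'" if "v \<in> Field R" for v using \<sigma> that bij_betwE by blast
  define \<theta> where "\<theta> = (\<lambda>t w. if w \<in> Field R' then t (\<tau> w) else 0 :: real)"
  define \<eta> where "\<eta> = (\<lambda>t v. if v \<in> Field R then t (\<sigma> v) else 0 :: real)"
  have \<theta>: "continuous_map (order_realization R) (order_realization R') \<theta>"
  proof (rule continuous_map_into_order_realization)
    show "continuous_map (order_realization R) euclideanreal (\<lambda>p. \<theta> p v)" for v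
      by (cases "v \<in> Field R'") (simp_all add: \<theta>_def continuous_map_order_realization_coordinate)
    fix t assume "t \<in> topspace (order_realization R)"
    moreover have "(\<Sum>w\<in>Field R'. \<theta> t w) = (\<Sum>v\<in>Field R. t v)"
      by (subst sum.reindex_bij_betw[OF \<tau>, symmetric]) (simp add: \<theta>_def)
    moreover have "(v, w) \<in> R' \<longleftrightarrow> (\<tau> v, \<tau> w) \<in> R" if "v \<in> Field R'" "w \<in> Field R'" for v w
      using iso[OF \<tau>F[OF that(1)] \<tau>F[OF that(2)]] st that by simp
    ultimately show "\<theta> t \<in> topspace (order_realization R')"
      unfolding topspace_order_realization[OF fin] topspace_order_realization[OF fin']
      by (auto simp: \<theta>_def)
  qed
  have \<eta>: "continuous_map (order_realization R') (order_realization R) \<eta>"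
  proof (rule continuous_map_into_order_realization)
    show "continuous_map (order_realization R') euclideanreal (\<lambda>p. \<eta> p v)" for v
      by (cases "v \<in> Field R") (simp_all add: \<eta>_def continuous_map_order_realization_coordinate)
    fix t assume "t \<in> topspace (order_realization R')"
    moreover have "(\<Sum>w\<in>Field R. \<eta> t w) = (\<Sum>v\<in>Field R'. t v)"
      by (subst sum.reindex_bij_betw[OF \<sigma>, symmetric]) (simp add: \<eta>_def)
    ultimately show "\<eta> t \<in> topspace (order_realization R)"
      unfolding topspace_order_realization[OF fin] topspace_order_realization[OF fin']
      using iso by (auto simp: \<eta>_def) blast
  qed
  have zero: "t v = 0" if "t \<in> topspace (order_realization Q)" "v \<notin> Field Q" "finite (Field Q)" for t v and Q :: "'x rel"
    using that(1) unfolding topspace_order_realization[OF that(3)] using that(2) by (metis less_le)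
  have "\<eta> (\<theta> t) = t" if "t \<in> topspace (order_realization R)" for t
    using zero[OF that _ fin] \<sigma>F ts by (auto simp: \<eta>_def \<theta>_def)
  moreover have "\<theta> (\<eta> t) = t" if "t \<in> topspace (order_realization R')" for t
    using zero[OF that _ fin'] \<tau>F st by (auto simp: \<eta>_def \<theta>_def)
  ultimately have "homeomorphic_maps (order_realization R) (order_realization R') \<theta> \<eta>"
    using \<theta> \<eta> by (simp add: homeomorphic_maps_def)
  then have "homeomorphic_map (order_realization R) (order_realization R') \<theta>"
    by (simp add: homeomorphic_maps_map)
  then show thesis
    using that \<sigma>F ts by (simp add: \<theta>_def)
qed

lemma order_realization_convex:
  assumes fin: "finite (Field R)"
    and f: "f \<in> topspace (order_realization R)" and g: "g \<in> topspace (order_realization R)"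
    and chain: "\<And>v w. f v > 0 \<Longrightarrow> g w > 0 \<Longrightarrow> (v, w) \<in> R \<or> (w, v) \<in> R"
    and s: "0 \<le> s" "s \<le> 1"
  shows "(\<lambda>v. (1 - s) * f v + s * g v) \<in> topspace (order_realization R)"
proof -
  note fp = f[unfolded topspace_order_realization[OF fin]] and gp = g[unfolded topspace_order_realization[OF fin]]
  let ?t = "\<lambda>v. (1 - s) * f v + s * g v"
  have f0: "0 \<le> f v" and g0: "0 \<le> g v" for v using fp gp by auto
  have nn: "0 \<le> ?t v" for v using s f0 g0 by simp
  have pos: "f v > 0 \<or> g v > 0" if "?t v > 0" for v
  proof (rule ccontr)
    assume "\<not> ?thesis"
    then have "f v = 0" "g v = 0" using f0[of v] g0[of v] by auto
    with that show False by simp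
  qed
  have "(\<Sum>v\<in>Field R. ?t v) = (1 - s) * (\<Sum>v\<in>Field R. f v) + s * (\<Sum>v\<in>Field R. g v)"
    by (simp add: sum.distrib sum_distrib_left)
  then have "(\<Sum>v\<in>Field R. ?t v) = 1" using fp gp by simp
  moreover have "v \<in> Field R" if "?t v > 0" for v using pos[OF that] fp gp by blast
  moreover have "(v, w) \<in> R \<or> (w, v) \<in> R" if "?t v > 0" "?t w > 0" for v w
    using pos[OF that(1)] pos[OF that(2)] fp gp chain by blast
  ultimately show ?thesis
    unfolding topspace_order_realization[OF fin] using nn by blast
qed

text \<open>The carriers of \<open>f p\<close> and \<open>g p\<close> form a chain together, so the
  segment between the two points stays in one simplex. The predicate \<open>P\<close> serves
  homotopies that have to fix a point and to preserve a part of the space.\<close>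

lemma homotopic_with_order_realization:
  assumes fin: "finite (Field R)"
    and f: "continuous_map X (order_realization R) f" and g: "continuous_map X (order_realization R) g"
    and chain: "\<And>p v w. \<lbrakk>p \<in> topspace X; f p v > 0; g p w > 0\<rbrakk> \<Longrightarrow> (v, w) \<in> R \<or> (w, v) \<in> R"
    and P: "\<And>s. 0 \<le> s \<Longrightarrow> s \<le> 1 \<Longrightarrow> P (\<lambda>p v. (1 - s) * f p v + s * g p v)"
  shows "homotopic_with P X (order_realization R) f g"
  unfolding homotopic_with_def
proof (intro exI[of _ "\<lambda>q v. (1 - fst q) * f (snd q) v + fst q * g (snd q) v"] conjI)
  let ?Q = "prod_topology (top_of_set {0..1::real}) X"
  show "continuous_map ?Q (order_realization R) (\<lambda>q v. (1 - fst q) * f (snd q) v + fst q * g (snd q) v)"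
  proof (rule continuous_map_into_order_realization)
    fix v
    have "continuous_map X euclideanreal (\<lambda>p. f p v)" "continuous_map X euclideanreal (\<lambda>p. g p v)"
      using continuous_map_compose[OF f continuous_map_order_realization_coordinate]
        continuous_map_compose[OF g continuous_map_order_realization_coordinate] by (simp_all add: comp_def)
    from this[THEN continuous_map_of_snd]
    show "continuous_map ?Q euclideanreal (\<lambda>q. (1 - fst q) * f (snd q) v + fst q * g (snd q) v)"
      by (intro continuous_intros continuous_map_fst_real) simp_all
  next
    fix q assume q: "q \<in> topspace ?Q"
    obtain s p where sp: "q = (s, p)" by fastforce
    have s: "0 \<le> s" "s \<le> 1" and p: "p \<in> topspace X" using q sp by auto
    then have "f p \<in> topspace (order_realization R)" "g p \<in> topspace (order_realization R)"
      using f g by (auto simp: continuous_map_def)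
    from order_realization_convex[OF fin this chain[OF p] s]
    show "(\<lambda>v. (1 - fst q) * f (snd q) v + fst q * g (snd q) v) \<in> topspace (order_realization R)"
      unfolding sp fst_conv snd_conv .
  qed
  show "\<forall>x. (\<lambda>v. (1 - fst (0, x)) * f (snd (0, x)) v + fst (0, x) * g (snd (0, x)) v) = f x"
    "\<forall>x. (\<lambda>v. (1 - fst (1, x)) * f (snd (1, x)) v + fst (1, x) * g (snd (1, x)) v) = g x"
    by auto
  show "\<forall>t\<in>{0..1}. P (\<lambda>x v. (1 - fst (t, x)) * f (snd (t, x)) v + fst (t, x) * g (snd (t, x)) v)"
    using P by auto
qed

section \<open>One suspension summand: contracting and collapsing the half that contains its base
  point\<close>

context fan begin

text \<open>For \<open>b\<close> in \<open>M\<close> this is \<open>L b\<close> with the two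
  incomparable points \<open>a\<close> and \<open>b\<close> on top, a copy of the suspension of
  \<open>L b\<close>.\<close>

definition "arc_poset b = Restr r (insert a (under r b))"

lemma Field_arc_poset:
  assumes b: "b \<in> M"
  shows "Field (arc_poset b) = insert a (insert b (L b))"
proof -
  have "insert a (under r b) = insert a (insert b (L b))"
    using Partial_order_refl[OF po M_Field[OF b]] by (auto simp: L_def under_def)
  moreover have "insert a (under r b) \<subseteq> Field r"
    using a_Field by (auto simp: under_def intro: FieldI1)
  ultimately show ?thesis
    unfolding arc_poset_def using Field_Restr_poset[OF po] by metis
qed

lemma finite_Field_arc_poset: "b \<in> M \<Longrightarrow> finite (Field (arc_poset b))"
  by (simp add: Field_arc_poset finite_L)

lemma a_notin_L: "b \<in> M \<Longrightarrow> a \<notin> L b" and b_notin_L: "b \<notin> L b"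
  using L_below_a by (auto simp: L_iff)

lemma arc_poset_iff: "(v, w) \<in> arc_poset b \<longleftrightarrow> (v, w) \<in> r \<and> v \<in> insert a (under r b) \<and> w \<in> insert a (under r b)"
  by (auto simp: arc_poset_def)

lemma topspace_arc:
  assumes b: "b \<in> M"
  shows "t \<in> topspace (order_realization (arc_poset b)) \<longleftrightarrow>
    (\<forall>v. 0 \<le> t v) \<and> (\<forall>v. t v > 0 \<longrightarrow> v \<in> insert a (insert b (L b))) \<and>
    (\<forall>v w. t v > 0 \<longrightarrow> t w > 0 \<longrightarrow> (v, w) \<in> r \<or> (w, v) \<in> r) \<and> t a + t b + (\<Sum>v\<in>L b. t v) = 1"
proof -
  have s: "(\<Sum>v\<in>insert a (insert b (L b)). t v) = t a + t b + (\<Sum>v\<in>L b. t v)"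
    using finite_L a_notin_L[OF b] b_notin_L M_not_a[OF b] by simp
  have e: "insert a (under r b) = insert a (insert b (L b))"
    using Partial_order_refl[OF po M_Field[OF b]] by (auto simp: L_def under_def)
  show ?thesis
    unfolding topspace_order_realization[OF finite_Field_arc_poset[OF b]] arc_poset_iff Field_arc_poset[OF b] s e
    by blast
qed

lemma arc_not_both:
  assumes "b \<in> M" "t \<in> topspace (order_realization (arc_poset b))" "t b > 0"
  shows "t a = 0"
proof (rule ccontr)
  assume "t a \<noteq> 0"
  then have "t a > 0" using assms by (auto simp: topspace_arc less_le)
  then have "(a, b) \<in> r \<or> (b, a) \<in> r" using assms by (auto simp: topspace_arc)
  then show False using a_max M_max[OF assms(1)] M_not_a[OF assms(1)] by metis
qed

text \<open>The difficulty is to keep \<open>\<pi>\<close>, which need not be a vertex, fixed at all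
  times. The coordinate at \<open>b\<close> is removed first; then points are pushed towards
  \<open>a\<close>, all the way if they are outside the open star of \<open>\<pi>\<close>; finally
  all are moved straight to \<open>\<pi>\<close>. The last move stays in the complex because both
  \<open>a\<close> and the points of the open star can be joined to \<open>\<pi>\<close> inside a
  simplex.\<close>

lemma arc_pointed_contraction:
  assumes b: "b \<in> M" and \<pi>: "\<pi> \<in> topspace (order_realization (arc_poset b))" and \<pi>b: "\<pi> b = 0"
  defines "X \<equiv> order_realization (arc_poset b)"
  shows "\<exists>k. homotopic_with (\<lambda>f. f \<pi> = \<pi> \<and> (\<forall>t\<in>topspace X. t b \<le> 1/2 \<longrightarrow> f t b \<le> 1/2)) X X id k \<and>
           (\<forall>t\<in>topspace X. t b \<le> 1/2 \<longrightarrow> k t = \<pi>)"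
proof -
  note fin = finite_Field_arc_poset[OF b]
  note T = topspace_arc[OF b, folded X_def]
  note \<pi> = \<pi>[folded X_def]
  have Tnn: "0 \<le> t v" if "t \<in> topspace X" for t v using that T by blast
  have Tch: "(v, w) \<in> arc_poset b \<or> (w, v) \<in> arc_poset b" if "t \<in> topspace X" "t v > 0" "t w > 0" for t v w
    using that topspace_order_realization[OF fin, of t] unfolding X_def by blast
  have a_cmp: "(v, a) \<in> arc_poset b" if "t \<in> topspace X" "t v > 0" "v \<noteq> b" for t v
  proof -
    have "v \<in> insert a (L b)" using that T by blast
    then show ?thesis
      using L_below_a[OF b] Partial_order_refl[OF po a_Field] by (auto simp: arc_poset_iff L_def)
  qed
  have tb1: "t b \<le> 1" if "t \<in> topspace X" for t
  proof -
    have "0 \<le> (\<Sum>v\<in>L b. t v)" using Tnn[OF that] by (simp add: sum_nonneg)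
    moreover have "t a + t b + (\<Sum>v\<in>L b. t v) = 1" using that T by blast
    ultimately show ?thesis using Tnn[OF that, of a] by linarith
  qed
  have co: "continuous_map X euclideanreal (\<lambda>t. t v)" for v
    unfolding X_def by (rule continuous_map_order_realization_coordinate)
  \<comment> \<open>For \<open>t b \<le> 3/4\<close> this is the projection from \<open>b\<close>
    onto the face \<open>t b = 0\<close>; above that height, dividing by 1/4 leaves
    \<open>4 * t b - 3\<close> for \<open>b\<close>, so that the coordinates still add up to
    1.\<close>
  define \<kappa> where "\<kappa> = (\<lambda>t v. if v = b then max 0 (4 * t b - 3) else t v / max (1 - t b) (1/4 :: real))"
  have \<kappa>pos: "t v > 0" if "t \<in> topspace X" "\<kappa> t v > 0" for t v
    using that Tnn[OF that(1), of v] by (auto simp: \<kappa>_def zero_less_divide_iff max_def split: if_splits)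
  have \<kappa>T: "\<kappa> t \<in> topspace X" if t: "t \<in> topspace X" for t
  proof -
    have e: "t a + t b + (\<Sum>v\<in>L b. t v) = 1" using t T by blast
    have "(\<Sum>v\<in>L b. \<kappa> t v) = (\<Sum>v\<in>L b. t v / max (1 - t b) (1/4))"
      using b_notin_L by (intro sum.cong) (auto simp: \<kappa>_def)
    then have "\<kappa> t a + \<kappa> t b + (\<Sum>v\<in>L b. \<kappa> t v)
        = max 0 (4 * t b - 3) + (t a + (\<Sum>v\<in>L b. t v)) / max (1 - t b) (1/4)"
      using M_not_a[OF b] by (simp add: \<kappa>_def add_divide_distrib sum_divide_distrib)
    also have "t a + (\<Sum>v\<in>L b. t v) = 1 - t b" using e by linarith
    also have "max 0 (4 * t b - 3) + (1 - t b) / max (1 - t b) (1/4) = 1"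
      using tb1[OF t] by (cases "1 - t b \<ge> 1/4") (auto simp: max_def)
    finally have "\<kappa> t a + \<kappa> t b + (\<Sum>v\<in>L b. \<kappa> t v) = 1" .
    moreover have "0 \<le> \<kappa> t v" for v using Tnn[OF t] by (auto simp: \<kappa>_def max_def intro!: divide_nonneg_pos)
    ultimately show ?thesis using t \<kappa>pos[OF t] unfolding T by blast
  qed
  have \<kappa>: "continuous_map X X \<kappa>"
    unfolding X_def
  proof (rule continuous_map_into_order_realization[OF _ \<kappa>T[unfolded X_def]], fold X_def)
    show "continuous_map X euclideanreal (\<lambda>t. \<kappa> t v)" for v
    proof (cases "v = b")
      case True
      then show ?thesis unfolding \<kappa>_def by (simp, intro continuous_intros co) simp_all
    next
      case False
      have "continuous_map X euclideanreal (\<lambda>t. t v / max (1 - t b) (1/4))"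
        by (intro continuous_intros co) (simp_all add: max_def)
      with False show ?thesis unfolding \<kappa>_def by simp
    qed
  qed
  define \<sigma> where "\<sigma> = {x. \<pi> x > 0}"
  have "\<sigma> \<subseteq> insert a (insert b (L b))" using \<pi> T by (auto simp: \<sigma>_def)
  then have fin\<sigma>: "finite \<sigma>" using finite_L by (meson finite_insert finite_subset)
  \<comment> \<open>On points of the complex \<open>\<omega> t < 1\<close> says that every vertex
    carrying \<open>\<pi>\<close> also carries \<open>t\<close>. As \<open>\<omega>\<close> vanishes
    at \<open>\<pi>\<close>, this point itself is not pushed.\<close>
  define \<omega> where "\<omega> = (\<lambda>t. Max (insert 0 ((\<lambda>x. 1 - t x / \<pi> x) ` \<sigma>)))"
  have \<omega>0: "0 \<le> \<omega> t" for t using fin\<sigma> by (auto simp: \<omega>_def)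
  have \<omega>1: "\<omega> t \<le> 1" if "t \<in> topspace X" for t
    using fin\<sigma> Tnn[OF that] by (auto simp: \<omega>_def \<sigma>_def)
  have \<omega>pos: "t x > 0" if "t \<in> topspace X" "\<omega> t < 1" "\<pi> x > 0" for t x
  proof -
    have "1 - t x / \<pi> x \<le> \<omega> t" unfolding \<omega>_def by (rule Max_ge) (use fin\<sigma> that in \<open>auto simp: \<sigma>_def\<close>)
    then have "t x / \<pi> x > 0" using that by linarith
    then show ?thesis using that by (simp add: zero_less_divide_iff)
  qed
  have \<omega>\<pi>: "\<omega> \<pi> = 0"
  proof -
    have "(\<lambda>x. 1 - \<pi> x / \<pi> x) ` \<sigma> \<subseteq> {0}" by (auto simp: \<sigma>_def)
    then have e: "insert 0 ((\<lambda>x. 1 - \<pi> x / \<pi> x) ` \<sigma>) = {0}" by blast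
    show ?thesis unfolding \<omega>_def e by simp
  qed
  \<comment> \<open>Staggered cutoffs: \<open>\<zeta>1\<close> is 1 up to height 5/8 and vanishes
    from 3/4 on, so it acts only where \<open>\<kappa>\<close> has removed \<open>b\<close>;
    \<open>\<zeta>2\<close> is 1 up to 1/2 and vanishes from 5/8 on, so it acts only where the push
    towards \<open>a\<close> has full strength.\<close>
  define \<zeta>1 \<zeta>2 where "\<zeta>1 = (\<lambda>t::'a\<Rightarrow>real. max 0 (min 1 (6 - 8 * t b)))"
    and "\<zeta>2 = (\<lambda>t::'a\<Rightarrow>real. max 0 (min 1 (5 - 8 * t b)))"
  have \<zeta>: "0 \<le> \<zeta>1 t" "\<zeta>1 t \<le> 1" "0 \<le> \<zeta>2 t" "\<zeta>2 t \<le> 1" for t by (auto simp: \<zeta>1_def \<zeta>2_def)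
  define \<mu> where "\<mu> = (\<lambda>t. \<zeta>1 t * \<omega> (\<kappa> t))"
  have \<mu>: "0 \<le> \<mu> t" "\<mu> t \<le> 1" if "t \<in> topspace X" for t
    using \<zeta>[of t] \<omega>0 \<omega>1[OF \<kappa>T[OF that]] by (auto simp: \<mu>_def mult_le_one)
  define v0 where "v0 = (\<lambda>v. if v = a then 1 else 0 :: real)"
  have v0T: "v0 \<in> topspace X"
    using Partial_order_refl[OF po a_Field] M_not_a[OF b] a_notin_L[OF b]
    by (subst T) (auto simp: v0_def intro!: sum.neutral)
  have \<kappa>b: "\<kappa> t b = 0" if "\<zeta>1 t > 0" for t
    using that by (auto simp: \<kappa>_def \<zeta>1_def max_def split: if_splits)
  have \<kappa>a: "(v, a) \<in> arc_poset b" if t: "t \<in> topspace X" and "\<zeta>1 t > 0" "\<kappa> t v > 0" for t v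
  proof -
    have "v \<noteq> b" using that \<kappa>b[of t] by auto
    then show ?thesis using a_cmp[OF \<kappa>T[OF t] that(3)] by blast
  qed
  define f2 where "f2 = (\<lambda>t v. (1 - \<mu> t) * \<kappa> t v + \<mu> t * v0 v)"
  have f2_cases: "\<kappa> t v > 0 \<or> v = a \<and> \<zeta>1 t > 0" if t: "t \<in> topspace X" and "f2 t v > 0" for t v
  proof (rule ccontr)
    assume "\<not> ?thesis"
    then have "\<kappa> t v = 0" "v0 v = 0 \<or> \<mu> t = 0"
      using Tnn[OF \<kappa>T[OF t], of v] \<zeta>[of t] by (auto simp: v0_def \<mu>_def)
    then show False using that by (auto simp: f2_def)
  qed
  have f2T: "f2 t \<in> topspace X" if t: "t \<in> topspace X" for t
  proof (cases "\<zeta>1 t > 0")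
    case True
    show ?thesis
      unfolding f2_def X_def
      by (rule order_realization_convex[OF fin]; (fold X_def)?)
        (use t \<kappa>T v0T \<kappa>a[OF t True] \<mu> in \<open>auto simp: v0_def split: if_splits\<close>)
  next
    case False
    then have "\<mu> t = 0" using \<zeta>[of t] by (simp add: \<mu>_def)
    then show ?thesis using \<kappa>T[OF t] by (simp add: f2_def)
  qed
  have co\<zeta>: "continuous_map X euclideanreal \<zeta>1" "continuous_map X euclideanreal \<zeta>2"
    unfolding \<zeta>1_def \<zeta>2_def by (intro continuous_intros co; simp)+
  have co\<kappa>: "continuous_map X euclideanreal (\<lambda>t. \<kappa> t v)" for v
    using continuous_map_compose[OF \<kappa> co] by (simp add: comp_def)
  have "continuous_map X euclideanreal (\<lambda>t. \<omega> (\<kappa> t))"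
    unfolding \<omega>_def
    by (rule continuous_map_Max_insert[OF fin\<sigma>], intro continuous_intros co\<kappa>) (auto simp: \<sigma>_def)
  then have co\<mu>: "continuous_map X euclideanreal \<mu>"
    unfolding \<mu>_def by (intro continuous_intros co\<zeta>)
  have f2: "continuous_map X X f2"
    unfolding X_def
  proof (rule continuous_map_into_order_realization[OF _ f2T[unfolded X_def]], fold X_def)
    show "continuous_map X euclideanreal (\<lambda>t. f2 t v)" for v
      unfolding f2_def by (intro continuous_intros co\<mu> co\<kappa>) simp_all
  qed
  have cof2: "continuous_map X euclideanreal (\<lambda>t. f2 t v)" for v
    using continuous_map_compose[OF f2 co] by (simp add: comp_def)
  define f3 where "f3 = (\<lambda>t v. (1 - \<zeta>2 t) * f2 t v + \<zeta>2 t * \<pi> v)"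
  have f2\<pi>: "(v, w) \<in> arc_poset b \<or> (w, v) \<in> arc_poset b"
    if t: "t \<in> topspace X" and p: "\<zeta>2 t > 0" "f2 t v > 0" "\<pi> w > 0" for t v w
  proof -
    have z1: "\<zeta>1 t = 1" using p(1) by (auto simp: \<zeta>1_def \<zeta>2_def max_def min_def split: if_splits)
    have "w \<noteq> b" using \<pi>b p(3) by auto
    then have wa: "(w, a) \<in> arc_poset b" by (rule a_cmp[OF \<pi> p(3)])
    show ?thesis
    proof (cases "v = a")
      case False
      then have v: "\<kappa> t v > 0" using f2_cases[OF t p(2)] by blast
      have "\<omega> (\<kappa> t) \<noteq> 1"
      proof
        assume "\<omega> (\<kappa> t) = 1"
        then have "f2 t v = 0" using False z1 by (simp add: f2_def \<mu>_def v0_def)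
        with p(2) show False by simp
      qed
      then have "\<kappa> t w > 0"
        using \<omega>pos[OF \<kappa>T[OF t] _ p(3)] \<omega>1[OF \<kappa>T[OF t]] by simp
      then show ?thesis using Tch[OF \<kappa>T[OF t] v] by blast
    qed (use wa in simp)
  qed
  have f3T: "f3 t \<in> topspace X" if t: "t \<in> topspace X" for t
  proof (cases "\<zeta>2 t > 0")
    case True
    show ?thesis
      unfolding f3_def X_def
      by (rule order_realization_convex[OF fin]; (fold X_def)?)
        (use f2T[OF t] \<pi> f2\<pi>[OF t True] \<zeta>[of t] in auto)
  next
    case False
    then have "\<zeta>2 t = 0" using \<zeta>[of t] by simp
    then show ?thesis using f2T[OF t] by (simp add: f3_def)
  qed
  have f3: "continuous_map X X f3"
    unfolding X_def
  proof (rule continuous_map_into_order_realization[OF _ f3T[unfolded X_def]], fold X_def)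
    show "continuous_map X euclideanreal (\<lambda>t. f3 t v)" for v
      unfolding f3_def by (intro continuous_intros co\<zeta> cof2) simp_all
  qed
  let ?P = "\<lambda>f. f \<pi> = \<pi> \<and> (\<forall>t\<in>topspace X. t b \<le> 1/2 \<longrightarrow> f t b \<le> 1/2)"
  \<comment> \<open>The predicate is preserved by convex combinations, hence along all three
    straight homotopies.\<close>
  have Pcomb: "?P (\<lambda>p v. (1 - s) * f p v + s * g p v)" if "?P f" "?P g" "0 \<le> s" "s \<le> 1" for f g :: "('a \<Rightarrow> real) \<Rightarrow> 'a \<Rightarrow> real" and s
  proof (intro conjI ballI impI)
    show "(\<lambda>v. (1 - s) * f \<pi> v + s * g \<pi> v) = \<pi>" using that by (auto simp: algebra_simps)
    fix t assume "t \<in> topspace X" "t b \<le> 1/2"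
    then have "f t b \<le> 1/2" "g t b \<le> 1/2" using that by auto
    then have "(1 - s) * f t b \<le> (1 - s) * (1/2)" "s * g t b \<le> s * (1/2)"
      using mult_left_mono[of "f t b" "1/2" "1 - s"] mult_left_mono[of "g t b" "1/2" s] that(3,4) by auto
    then show "(1 - s) * f t b + s * g t b \<le> 1/2" by (simp add: algebra_simps)
  qed
  have P0: "?P id" by simp
  have P1: "?P \<kappa>" using \<pi>b by (auto simp: \<kappa>_def)
  have P2: "?P f2"
  proof (intro conjI ballI impI)
    have "\<kappa> \<pi> = \<pi>" using P1 by blast
    then show "f2 \<pi> = \<pi>" by (simp add: f2_def \<mu>_def \<omega>\<pi>)
    fix t :: "'a \<Rightarrow> real" assume "t \<in> topspace X" "t b \<le> 1/2"
    then show "f2 t b \<le> 1/2" using M_not_a[OF b] by (simp add: f2_def v0_def \<kappa>_def)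
  qed
  have P3: "?P f3"
  proof (intro conjI ballI impI)
    show "f3 \<pi> = \<pi>" using P2 by (auto simp: f3_def algebra_simps)
    fix t :: "'a \<Rightarrow> real" assume t: "t \<in> topspace X" "t b \<le> 1/2"
    then have "\<zeta>2 t = 1" by (simp add: \<zeta>2_def)
    then show "f3 t b \<le> 1/2" using \<pi>b by (simp add: f3_def)
  qed
  have "homotopic_with ?P X X id \<kappa>"
    unfolding X_def
    by (rule homotopic_with_order_realization[OF fin]; (fold X_def)?)
      (use \<kappa> Tch \<kappa>pos Pcomb[OF P0 P1] in auto)
  moreover have "homotopic_with ?P X X \<kappa> f2"
    unfolding X_def
  proof (rule homotopic_with_order_realization[OF fin], fold X_def)
    fix t v w assume t: "t \<in> topspace X" "\<kappa> t v > 0" "f2 t w > 0"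
    then show "(v, w) \<in> arc_poset b \<or> (w, v) \<in> arc_poset b"
      using f2_cases[OF t(1,3)] Tch[OF \<kappa>T[OF t(1)] t(2), of w] \<kappa>a[OF t(1) _ t(2)] by blast
  qed (use \<kappa> f2 Pcomb[OF P1 P2] in auto)
  moreover have "homotopic_with ?P X X f2 f3"
    unfolding X_def
  proof (rule homotopic_with_order_realization[OF fin], fold X_def)
    fix t v w assume t: "t \<in> topspace X" "f2 t v > 0" "f3 t w > 0"
    show "(v, w) \<in> arc_poset b \<or> (w, v) \<in> arc_poset b"
    proof (cases "f2 t w > 0")
      case True
      then show ?thesis using Tch[OF f2T[OF t(1)] t(2)] by blast
    next
      case False
      then have "f2 t w = 0" using Tnn[OF f2T[OF t(1)], of w] by simp
      then have "\<zeta>2 t > 0" "\<pi> w > 0"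
        using t(3) \<zeta>[of t] Tnn[OF \<pi>, of w] by (auto simp: f3_def zero_less_mult_iff)
      then show ?thesis using f2\<pi>[OF t(1) _ t(2)] by blast
    qed
  qed (use f2 f3 Pcomb[OF P2 P3] in auto)
  ultimately have "homotopic_with ?P X X id f3"
    using homotopic_with_trans by blast
  moreover have "f3 t = \<pi>" if "t b \<le> 1/2" for t
    using that by (simp add: f3_def \<zeta>2_def)
  ultimately show ?thesis by blast
qed

text \<open>The half \<open>t b \<le> 1/2\<close> becomes the base point, wherever the base point of
  the summand sits in the face \<open>t b = 0\<close>; the heights over the other half are rescaled
  to run from 0 to 1.\<close>

definition "arc_collapse b t = cone_join (\<lambda>b'. if b' = b then max 0 (2 * t b - 1) else 0) (\<lambda>x _. t x)"

lemma arc_collapse_tip: "b \<in> M \<Longrightarrow> arc_collapse b t (b, b) = max 0 (2 * t b - 1)"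
  by (simp add: arc_collapse_def cone_join_def)

lemma arc_collapse_other: "b' \<noteq> b \<Longrightarrow> arc_collapse b t (x, b') = 0"
  by (simp add: arc_collapse_def cone_join_def)

lemma arc_collapse_zero: "t b \<le> 1/2 \<Longrightarrow> arc_collapse b t = (\<lambda>_. 0)"
  by (auto simp: arc_collapse_def cone_join_def fun_eq_iff)

lemma arc_tip_le_1:
  assumes b: "b \<in> M" and t: "t \<in> topspace (order_realization (arc_poset b))"
  shows "t b \<le> 1" "t b = 1 \<Longrightarrow> x \<noteq> b \<Longrightarrow> t x = 0" "t b > 1/2 \<Longrightarrow> (\<Sum>x\<in>L b. t x) = 1 - t b"
proof -
  have nn: "0 \<le> t v" and sp: "t v > 0 \<Longrightarrow> v \<in> insert a (insert b (L b))"
    and e: "t a + t b + (\<Sum>v\<in>L b. t v) = 1" for v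
    using t unfolding topspace_arc[OF b] by blast+
  have s: "0 \<le> (\<Sum>v\<in>L b. t v)" using nn by (simp add: sum_nonneg)
  then show "t b \<le> 1" using e nn[of a] by linarith
  show "t x = 0" if "t b = 1" "x \<noteq> b"
  proof -
    have "t a = 0" "(\<Sum>v\<in>L b. t v) = 0" using e s nn[of a] that by linarith+
    then have "\<forall>v\<in>L b. t v = 0" using nn finite_L by (simp add: sum_nonneg_eq_0_iff)
    then show ?thesis using sp[of x] nn[of x] \<open>t a = 0\<close> that by force
  qed
  show "(\<Sum>x\<in>L b. t x) = 1 - t b" if "t b > 1/2"
    using arc_not_both[OF b t] that e by simp
qed

lemma arc_collapse_in:
  assumes b: "b \<in> M" and t: "t \<in> topspace (order_realization (arc_poset b))"
  shows "arc_collapse b t \<in> cone_set"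
  unfolding arc_collapse_def
proof (rule cone_join_in)
  note T = t[unfolded topspace_arc[OF b]]
  show "0 \<le> (if b' = b then max 0 (2 * t b - 1) else 0) \<and> (if b' = b then max 0 (2 * t b - 1) else 0) \<le> 1" for b'
    using arc_tip_le_1(1)[OF b t] by simp
  show "0 \<le> t x" for x using T by blast
  show "0 < sum t (L b')" if "0 < (if b' = b then max 0 (2 * t b - 1) else 0)" "(if b' = b then max 0 (2 * t b - 1) else 0) < 1" for b'
    using that arc_tip_le_1(3)[OF b t] by (auto split: if_splits)
  show "(x, y) \<in> r \<or> (y, x) \<in> r" if "0 < t x" "0 < t y" for x y
    using T that by blast
qed (auto split: if_splits)

lemma continuous_arc_collapse:
  assumes b: "b \<in> M"
  shows "continuous_map (order_realization (arc_poset b)) cone_wedge (arc_collapse b)"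
  unfolding arc_collapse_def
proof (rule continuous_cone_join)
  let ?X = "order_realization (arc_poset b)"
  show "continuous_map ?X euclideanreal (\<lambda>t. if b' = b then max 0 (2 * t b - 1) else 0)" for b'
    by (cases "b' = b") (simp_all, intro continuous_intros continuous_map_order_realization_coordinate, simp_all)
  show "continuous_map ?X euclideanreal (\<lambda>t. t x)" for x
    by (rule continuous_map_order_realization_coordinate)
  fix t assume t: "t \<in> topspace ?X"
  note T = t[unfolded topspace_arc[OF b]]
  show "0 \<le> (if b' = b then max 0 (2 * t b - 1) else 0) \<and> (if b' = b then max 0 (2 * t b - 1) else 0) \<le> 1" for b'
    using arc_tip_le_1(1)[OF b t] by simp
  show "0 \<le> t x" for x using T by blast
  show "0 < sum t (L b')" if "0 < (if b' = b then max 0 (2 * t b - 1) else 0)" "(if b' = b then max 0 (2 * t b - 1) else 0) < 1" for b'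
    using that arc_tip_le_1(3)[OF b t] by (auto split: if_splits)
  show "cone_join (\<lambda>b'. if b' = b then max 0 (2 * t b - 1) else 0) (\<lambda>x _. t x) \<in> cone_set"
    using arc_collapse_in[OF b t] by (simp add: arc_collapse_def)
qed

text \<open>For \<open>t b > 1/2\<close> the vertex \<open>a\<close> has no weight, so the weights
  on \<open>L b\<close> add up to \<open>1 - t b\<close> and can be recovered from the normalized
  ones.\<close>

lemma arc_collapse_inj:
  assumes b: "b \<in> M" and t: "t \<in> topspace (order_realization (arc_poset b))"
    and t': "t' \<in> topspace (order_realization (arc_poset b))"
    and eq: "arc_collapse b t = arc_collapse b t'" and tb: "t b > 1/2"
  shows "t = t'"
proof
  fix v
  have "max 0 (2 * t b - 1) = max 0 (2 * t' b - 1)"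
    using arc_collapse_tip[OF b] eq by metis
  then have bb: "t b = t' b" using tb by (auto simp: max_def split: if_splits)
  have nn: "0 \<le> t v" "0 \<le> t' v" using t t' topspace_arc[OF b] by blast+
  show "t v = t' v"
  proof (cases "t b = 1 \<or> v = b \<or> v \<notin> L b")
    case True
    then consider "t b = 1" "v \<noteq> b" | "v = b" | "v \<notin> L b" "v \<noteq> b" by blast
    then show ?thesis
    proof cases
      case 1
      then show ?thesis using arc_tip_le_1(2)[OF b t] arc_tip_le_1(2)[OF b t'] bb by simp
    next
      case 3
      have "t a = 0" "t' a = 0" using arc_not_both[OF b t] arc_not_both[OF b t'] tb bb by auto
      moreover have "t v > 0 \<Longrightarrow> v \<in> insert a (insert b (L b))" "t' v > 0 \<Longrightarrow> v \<in> insert a (insert b (L b))"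
        using t t' topspace_arc[OF b] by blast+
      ultimately show ?thesis using 3 nn by force
    qed (use bb in simp)
  next
    case False
    let ?u = "2 * t b - 1"
    have u: "?u > 0" "1 - ?u > 0" "1 - t b > 0" using False tb arc_tip_le_1(1)[OF b t] by auto
    have v: "v \<in> L b" "v \<noteq> b" using False by auto
    have h: "arc_collapse b s (v, b) = ?u * (1 - ?u) * s v / (1 - t b)"
      if "s \<in> topspace (order_realization (arc_poset b))" "s b = t b" for s
      using arc_tip_le_1(3)[OF b that(1)] that(2) tb u v b by (simp add: arc_collapse_def cone_join_def)
    have "?u * (1 - ?u) * t v / (1 - t b) = arc_collapse b t (v, b)"
      by (rule h[OF t refl, symmetric])
    also have "\<dots> = arc_collapse b t' (v, b)" using eq by simp
    also have "\<dots> = ?u * (1 - ?u) * t' v / (1 - t b)"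
      by (rule h[OF t' bb[symmetric]])
    finally have "?u * (1 - ?u) * t v / (1 - t b) = ?u * (1 - ?u) * t' v / (1 - t b)" .
    moreover have "?u * (1 - ?u) \<noteq> 0" "1 - t b \<noteq> 0" using u by auto
    ultimately show ?thesis by (metis divide_cancel_right mult_left_cancel)
  qed
qed

lemma arc_collapse_surj:
  assumes z: "z \<in> cone_set" and b: "b \<in> M" and zb: "z (b, b) > 0"
  obtains t where "t \<in> topspace (order_realization (arc_poset b))" "arc_collapse b t = z"
proof -
  let ?u = "z (b, b)"
  \<comment> \<open>Solves \<open>2 * t b - 1 = ?u\<close>. The coordinates of \<open>z\<close> on
    \<open>L b\<close> add up to \<open>?u * (1 - ?u)\<close>, so division by \<open>2 * ?u\<close>
    gives the missing total \<open>(1 - ?u) / 2\<close>.\<close>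
  define t where "t = (\<lambda>v. if v = b then (1 + ?u) / 2 else if v \<in> L b then z (v, b) / (2 * ?u) else 0)"
  have u1: "?u \<le> 1" using cone_setD(7)[OF z b] .
  have zn: "0 \<le> z i" for i using cone_setD(1)[OF z] .
  have "(\<Sum>v\<in>L b. t v) = (\<Sum>v\<in>L b. z (v, b) / (2 * ?u))"
    using b_notin_L by (intro sum.cong) (auto simp: t_def)
  also have "\<dots> = (1 - ?u) / 2"
    using zb by (simp add: cone_setD(8)[OF z b] field_simps flip: sum_divide_distrib)
  finally have s: "(\<Sum>v\<in>L b. t v) = (1 - ?u) / 2" .
  have pos: "z (v, b) > 0" if "t v > 0" for v
    using that zb zn[of "(v, b)"] by (auto simp: t_def zero_less_divide_iff split: if_splits)
  have T: "t \<in> topspace (order_realization (arc_poset b))"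
    unfolding topspace_arc[OF b]
  proof (intro conjI allI impI)
    show "0 \<le> t v" for v using zn zb by (simp add: t_def)
    show "v \<in> insert a (insert b (L b))" if "t v > 0" for v using that by (auto simp: t_def split: if_splits)
    show "(v, w) \<in> r \<or> (w, v) \<in> r" if "t v > 0" "t w > 0" for v w
      using cone_setD(6)[OF z pos[OF that(1)] pos[OF that(2)]] .
    show "t a + t b + (\<Sum>v\<in>L b. t v) = 1"
      unfolding s using M_not_a[OF b] a_notin_L[OF b] by (simp add: t_def field_simps)
  qed
  have "arc_collapse b t i = z i" for i
  proof -
    obtain x b' :: 'a where i: "i = (x, b')" by fastforce
    have zero: "z (x, b') = 0" if "\<not> z (x, b') > 0" using that zn[of "(x, b')"] by simp
    consider "b' \<noteq> b" | "b' = b" "x = b" | "b' = b" "x \<noteq> b" "x \<in> L b" | "b' = b" "x \<noteq> b" "x \<notin> L b" by blast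
    then show ?thesis
    proof cases
      case 1
      then show ?thesis using zero cone_setD(5)[OF z zb, of x b'] by (auto simp: i arc_collapse_other)
    next
      case 2
      then show ?thesis using zb by (simp add: i arc_collapse_tip[OF b] t_def add_divide_distrib)
    next
      case 3
      have "?u = 1 \<Longrightarrow> z (x, b) = 0"
        using cone_setD(8)[OF z b] zn 3 finite_L by (simp add: sum_nonneg_eq_0_iff)
      moreover have "u * w * (y / (2 * u)) / (w / 2) = y" if "u \<noteq> 0" "w \<noteq> 0" for u w y :: real
        using that by simp
      from this[of ?u "1 - ?u" "z (x, b)"]
      have "?u \<noteq> 1 \<Longrightarrow> ?u * (1 - ?u) * (z (x, b) / (2 * ?u)) / ((1 - ?u) / 2) = z (x, b)"
        using zb by simp
      moreover have "max 0 (2 * t b - 1) = ?u"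
        using zb by (simp add: t_def add_divide_distrib)
      then have "arc_collapse b t (x, b) = ?u * (1 - ?u) * (z (x, b) / (2 * ?u)) / ((1 - ?u) / 2)"
        using 3 b by (simp add: arc_collapse_def cone_join_def s) (simp add: t_def)
      ultimately show ?thesis using 3 by (cases "?u = 1") (simp_all add: i)
    next
      case 4
      then have "z (x, b) = 0" using zero cone_setD(3)[OF z, of x b] by (auto simp: L_iff)
      then show ?thesis using 4 by (simp add: i arc_collapse_def cone_join_def)
    qed
  qed
  then show thesis using that[OF T] by blast
qed

text \<open>The contractions of the summands fit together because they fix \<open>w0\<close>. A
  fibre of \<open>q\<close> is a single point or the union of all the collapsed halves; the
  deformation preserves this union and finally moves it to \<open>w0\<close>, as
  \<open>lifting_map_collapse\<close> requires.\<close>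

lemma lifting_map_wedge:
  fixes W :: "'w topology"
  assumes w0: "w0 \<in> topspace W" and cl: "\<And>b. b \<in> M \<Longrightarrow> closedin W (V b)"
    and cover: "topspace W = insert w0 (\<Union>b\<in>M. V b)" and base: "\<And>b. b \<in> M \<Longrightarrow> w0 \<in> V b"
    and meet: "\<And>b b' w. \<lbrakk>b \<in> M; b' \<in> M; b \<noteq> b'; w \<in> V b; w \<in> V b'\<rbrakk> \<Longrightarrow> w = w0"
    and \<theta>: "\<And>b. b \<in> M \<Longrightarrow> homeomorphic_map (subtopology W (V b)) (order_realization (arc_poset b)) (\<theta> b)"
    and \<theta>0: "\<And>b. b \<in> M \<Longrightarrow> \<theta> b w0 b = 0"
  shows "\<exists>q. lifting_map W cone_wedge q"
proof -
  let ?I = "top_of_set {0..1::real}"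
  let ?K = "\<lambda>b. order_realization (arc_poset b)"
  have VW: "V b \<subseteq> topspace W" if "b \<in> M" for b using cl[OF that] by (rule closedin_subset)
  have tV: "topspace (subtopology W (V b)) = V b" if "b \<in> M" for b using VW[OF that] by auto
  have "\<exists>\<eta>. \<forall>b\<in>M. homeomorphic_maps (subtopology W (V b)) (?K b) (\<theta> b) (\<eta> b)"
    using \<theta> by (intro bchoice) (auto simp: homeomorphic_map_maps)
  then obtain \<eta> where \<eta>: "\<And>b. b \<in> M \<Longrightarrow> homeomorphic_maps (subtopology W (V b)) (?K b) (\<theta> b) (\<eta> b)" by blast
  have \<theta>c: "continuous_map (subtopology W (V b)) (?K b) (\<theta> b)"
    and \<eta>c: "continuous_map (?K b) (subtopology W (V b)) (\<eta> b)"
    and \<eta>\<theta>: "w \<in> V b \<Longrightarrow> \<eta> b (\<theta> b w) = w"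
    and \<theta>\<eta>: "t \<in> topspace (?K b) \<Longrightarrow> \<theta> b (\<eta> b t) = t" if b: "b \<in> M" for b w t
    using \<eta>[OF b] tV[OF b] by (auto simp: homeomorphic_maps_def)
  have \<theta>T: "\<theta> b w \<in> topspace (?K b)" if "b \<in> M" "w \<in> V b" for b w
    using \<theta>c[OF that(1)] tV[OF that(1)] that(2) by (auto simp: continuous_map_def)
  have \<eta>V: "\<eta> b t \<in> V b" if "b \<in> M" "t \<in> topspace (?K b)" for b t
    using \<eta>c[OF that(1)] tV[OF that(1)] that(2) by (auto simp: continuous_map_def)
  have "\<forall>b\<in>M. \<exists>D. continuous_map (prod_topology ?I (?K b)) (?K b) D \<and> (\<forall>t. D (0, t) = t) \<and>
      (\<forall>s\<in>{0..1}. D (s, \<theta> b w0) = \<theta> b w0 \<and> (\<forall>t\<in>topspace (?K b). t b \<le> 1/2 \<longrightarrow> D (s, t) b \<le> 1/2)) \<and>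
      (\<forall>t\<in>topspace (?K b). t b \<le> 1/2 \<longrightarrow> D (1, t) = \<theta> b w0)"
  proof
    fix b assume b: "b \<in> M"
    obtain k where k: "homotopic_with (\<lambda>f. f (\<theta> b w0) = \<theta> b w0 \<and> (\<forall>t\<in>topspace (?K b). t b \<le> 1/2 \<longrightarrow> f t b \<le> 1/2)) (?K b) (?K b) id k"
        "\<forall>t\<in>topspace (?K b). t b \<le> 1/2 \<longrightarrow> k t = \<theta> b w0"
      using arc_pointed_contraction[OF b \<theta>T[OF b base[OF b]] \<theta>0[OF b]] by blast
    from k(1) obtain D where "continuous_map (prod_topology ?I (?K b)) (?K b) D" "\<forall>t. D (0, t) = t" "\<forall>t. D (1, t) = k t"
      "\<forall>s\<in>{0..1}. D (s, \<theta> b w0) = \<theta> b w0 \<and> (\<forall>t\<in>topspace (?K b). t b \<le> 1/2 \<longrightarrow> D (s, t) b \<le> 1/2)"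
      by (auto simp: homotopic_with_def)
    with k(2) show "\<exists>D. continuous_map (prod_topology ?I (?K b)) (?K b) D \<and> (\<forall>t. D (0, t) = t) \<and>
      (\<forall>s\<in>{0..1}. D (s, \<theta> b w0) = \<theta> b w0 \<and> (\<forall>t\<in>topspace (?K b). t b \<le> 1/2 \<longrightarrow> D (s, t) b \<le> 1/2)) \<and>
      (\<forall>t\<in>topspace (?K b). t b \<le> 1/2 \<longrightarrow> D (1, t) = \<theta> b w0)"
      by (intro exI[of _ D]) simp
  qed
  then obtain D where Dall: "\<forall>b\<in>M. continuous_map (prod_topology ?I (?K b)) (?K b) (D b) \<and> (\<forall>t. D b (0, t) = t) \<and>
      (\<forall>s\<in>{0..1}. D b (s, \<theta> b w0) = \<theta> b w0 \<and> (\<forall>t\<in>topspace (?K b). t b \<le> 1/2 \<longrightarrow> D b (s, t) b \<le> 1/2)) \<and>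
      (\<forall>t\<in>topspace (?K b). t b \<le> 1/2 \<longrightarrow> D b (1, t) = \<theta> b w0)"
    by (rule bchoice[THEN exE])
  have Dc: "continuous_map (prod_topology ?I (?K b)) (?K b) (D b)" and D0: "D b (0, t) = t"
    and D\<pi>: "s \<in> {0..1} \<Longrightarrow> D b (s, \<theta> b w0) = \<theta> b w0"
    and Db: "s \<in> {0..1} \<Longrightarrow> t \<in> topspace (?K b) \<Longrightarrow> t b \<le> 1/2 \<Longrightarrow> D b (s, t) b \<le> 1/2"
    and D1: "t \<in> topspace (?K b) \<Longrightarrow> t b \<le> 1/2 \<Longrightarrow> D b (1, t) = \<theta> b w0" if "b \<in> M" for b s t
    using Dall[rule_format, OF that] by blast+
  have DT: "D b (s, t) \<in> topspace (?K b)" if "b \<in> M" "s \<in> {0..1}" "t \<in> topspace (?K b)" for b s t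
    using Dc[OF that(1)] that(2,3) by (auto simp: continuous_map_def)
  \<comment> \<open>The choice is ambiguous only at \<open>w0\<close>, which lies in all pieces and
    is treated separately in \<open>\<delta>\<close> and \<open>q\<close>.\<close>
  define \<beta> where "\<beta> = (\<lambda>w. SOME b. b \<in> M \<and> w \<in> V b)"
  have \<beta>: "\<beta> w = b" if "b \<in> M" "w \<in> V b" "w \<noteq> w0" for b w
    unfolding \<beta>_def by (rule some_equality) (use that meet in blast)+
  define \<delta> where "\<delta> = (\<lambda>p. let w = snd p in if w = w0 then w0 else \<eta> (\<beta> w) (D (\<beta> w) (fst p, \<theta> (\<beta> w) w)))"
  define q where "q = (\<lambda>w. if w = w0 then (\<lambda>_. 0) else arc_collapse (\<beta> w) (\<theta> (\<beta> w) w))"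
  have \<delta>eq: "\<delta> (s, w) = \<eta> b (D b (s, \<theta> b w))" if "b \<in> M" "w \<in> V b" "s \<in> {0..1}" for b w s
    using \<beta>[OF that(1,2)] D\<pi>[OF that(1,3)] \<eta>\<theta>[OF that(1) base[OF that(1)]] by (auto simp: \<delta>_def Let_def)
  have qeq: "q w = arc_collapse b (\<theta> b w)" if "b \<in> M" "w \<in> V b" for b w
    using \<beta>[OF that(1,2)] arc_collapse_zero[of "\<theta> b w0" b] \<theta>0[OF that(1)] by (auto simp: q_def)
  have \<delta>w0: "\<delta> (s, w0) = w0" for s by (simp add: \<delta>_def)
  have M_empty: "topspace W = {w0}" if "M = {}" using cover that by simp
  have \<delta>c: "continuous_map (prod_topology ?I W) W \<delta>"
  proof (cases "M = {}")
    \<comment> \<open>Without summands no piece contains \<open>w0\<close>, and gluing over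
      \<open>M\<close> would not cover the space.\<close>
    case True
    have "continuous_map (prod_topology ?I W) W (\<lambda>_. w0)" using w0 by simp
    then show ?thesis
      by (rule continuous_map_eq) (use M_empty[OF True] \<delta>w0 in auto)
  next
    case False
    show ?thesis
    proof (rule pasting_lemma_closed[where I = M and T = "\<lambda>b. {0..1} \<times> V b" and f = "\<lambda>b p. \<eta> b (D b (fst p, \<theta> b (snd p)))"])
      fix b assume b: "b \<in> M"
      show "closedin (prod_topology ?I W) ({0..1} \<times> V b)"
        using cl[OF b] by (simp add: closedin_prod_Times_iff)
      have e: "subtopology (prod_topology ?I W) ({0..1} \<times> V b) = prod_topology ?I (subtopology W (V b))"
        by (simp add: subtopology_Times subtopology_subtopology)
      have "continuous_map (prod_topology ?I (subtopology W (V b))) (prod_topology ?I (?K b)) (\<lambda>p. (fst p, \<theta> b (snd p)))"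
        by (intro continuous_map_pairedI continuous_map_fst continuous_map_of_snd[OF \<theta>c[OF b]])
      from continuous_map_compose[OF continuous_map_compose[OF this Dc[OF b]] \<eta>c[OF b]]
      show "continuous_map (subtopology (prod_topology ?I W) ({0..1} \<times> V b)) W (\<lambda>p. \<eta> b (D b (fst p, \<theta> b (snd p))))"
        unfolding e by (simp add: comp_def continuous_map_in_subtopology)
    next
      fix b b' p assume b: "b \<in> M" "b' \<in> M" and p: "p \<in> topspace (prod_topology ?I W) \<inter> {0..1} \<times> V b \<inter> {0..1} \<times> V b'"
      then have "fst p \<in> {0..1}" "snd p \<in> V b" "snd p \<in> V b'" by auto
      then show "\<eta> b (D b (fst p, \<theta> b (snd p))) = \<eta> b' (D b' (fst p, \<theta> b' (snd p)))"
        using \<delta>eq[OF b(1)] \<delta>eq[OF b(2)] by metis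
    next
      fix p assume p: "p \<in> topspace (prod_topology ?I W)"
      then have fp: "fst p \<in> {0..1}" and sp: "snd p \<in> topspace W" by auto
      obtain b where "b \<in> M" "snd p \<in> V b"
        using sp cover False base by (metis UN_E all_not_in_conv insertE)
      then show "\<exists>b. b \<in> M \<and> p \<in> {0..1} \<times> V b \<and> \<delta> p = \<eta> b (D b (fst p, \<theta> b (snd p)))"
        using \<delta>eq[of b "snd p" "fst p"] fp by (intro exI[of _ b]) (simp add: mem_Times_iff)
    qed (rule finite_M)
  qed
  have qC: "q w \<in> cone_set" if w: "w \<in> topspace W" for w
  proof (cases "w = w0")
    case True
    then show ?thesis using zero_cone_set by (simp add: q_def)
  next
    case False
    then obtain b where "b \<in> M" "w \<in> V b" using w cover by blast
    then show ?thesis using qeq[of b w] arc_collapse_in[OF _ \<theta>T[of b w]] by simp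
  qed
  have qc: "continuous_map W cone_wedge q"
  proof (cases "M = {}")
    case True
    have "continuous_map W cone_wedge (\<lambda>_. \<lambda>_. 0)"
      using zero_cone_set by (simp add: topspace_cone_wedge)
    then show ?thesis
      by (rule continuous_map_eq) (use M_empty[OF True] in \<open>auto simp: q_def\<close>)
  next
    case False
    show ?thesis
    proof (rule pasting_lemma_closed[where I = M and T = V and f = "\<lambda>b w. arc_collapse b (\<theta> b w)"])
      show "continuous_map (subtopology W (V b)) cone_wedge (\<lambda>w. arc_collapse b (\<theta> b w))" if "b \<in> M" for b
        using continuous_map_compose[OF \<theta>c[OF that] continuous_arc_collapse[OF that]] by (simp add: comp_def)
      show "arc_collapse b (\<theta> b w) = arc_collapse b' (\<theta> b' w)" if "b \<in> M" "b' \<in> M" "w \<in> topspace W \<inter> V b \<inter> V b'" for b b' w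
        using qeq[of b w] qeq[of b' w] that by simp
      show "\<exists>b. b \<in> M \<and> w \<in> V b \<and> q w = arc_collapse b (\<theta> b w)" if w: "w \<in> topspace W" for w
      proof -
        obtain b where "b \<in> M" "w \<in> V b"
          using w cover False base by (metis UN_E all_not_in_conv insertE)
        then show ?thesis using qeq by blast
      qed
    qed (use finite_M cl in auto)
  qed
  have qsurj: "q ` topspace W = topspace cone_wedge"
  proof (intro equalityI subsetI)
    fix z assume "z \<in> q ` topspace W"
    then show "z \<in> topspace cone_wedge" using qC by (auto simp: topspace_cone_wedge)
  next
    fix z assume "z \<in> topspace cone_wedge"
    then have z: "z \<in> cone_set" by (simp add: topspace_cone_wedge)
    show "z \<in> q ` topspace W"
    proof (cases rule: cone_map_cases[OF z])
      case 1
      then show ?thesis using w0 by (auto simp: q_def intro!: image_eqI[of _ _ w0])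
    next
      case (2 b)
      obtain t where t: "t \<in> topspace (?K b)" "arc_collapse b t = z"
        using arc_collapse_surj[OF z 2(1,2)] .
      then have "q (\<eta> b t) = z"
        using qeq[OF 2(1) \<eta>V[OF 2(1) t(1)]] \<theta>\<eta>[OF 2(1) t(1)] by simp
      then show ?thesis using \<eta>V[OF 2(1) t(1)] VW[OF 2(1)] by blast
    qed
  qed
  have qnz: "\<exists>b\<in>M. w \<in> V b \<and> \<theta> b w b > 1/2 \<and> q w (b, b) > 0" if w: "w \<in> topspace W" "q w \<noteq> (\<lambda>_. 0)" for w
  proof -
    have "w \<noteq> w0" using w by (auto simp: q_def)
    then obtain b where b: "b \<in> M" "w \<in> V b" using w cover by blast
    then have "\<not> \<theta> b w b \<le> 1/2" using w(2) qeq[OF b] arc_collapse_zero by metis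
    then show ?thesis using b qeq[OF b] arc_collapse_tip[OF b(1)] by (intro bexI[of _ b]) auto
  qed
  have fib: "w = w' \<or> q w = (\<lambda>_. 0) \<and> q w' = (\<lambda>_. 0)"
    if w: "w \<in> topspace W" "w' \<in> topspace W" "q w = q w'" for w w'
  proof (cases "q w = (\<lambda>_. 0)")
    case False
    obtain b where b: "b \<in> M" "w \<in> V b" "\<theta> b w b > 1/2" "q w (b, b) > 0"
      using qnz[OF w(1) False] by blast
    obtain b' where b': "b' \<in> M" "w' \<in> V b'" "q w' (b', b') > 0"
      using qnz[OF w(2)] False w(3) by metis
    have "b = b'" using cone_setD(5)[OF qC[OF w(1)] b(4), of b' b'] b'(3) w(3) by simp
    then have "\<theta> b w = \<theta> b w'"
      using arc_collapse_inj[OF b(1) \<theta>T[OF b(1,2)] \<theta>T[OF b(1), of w'] _ b(3)] qeq[OF b(1,2)] qeq[OF b'(1,2)] b'(2) w(3) by simp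
    then show ?thesis using \<eta>\<theta>[OF b(1,2)] \<eta>\<theta>[OF b(1), of w'] b'(2) \<open>b = b'\<close> by metis
  qed (use w in simp)
  have qz: "\<delta> (1, w) = w0 \<and> (\<forall>s\<in>{0..1}. q (\<delta> (s, w)) = (\<lambda>_. 0))"
    if w: "w \<in> topspace W" "q w = (\<lambda>_. 0)" for w
  proof (cases "w = w0")
    case True
    then show ?thesis using \<delta>w0 by (simp add: q_def)
  next
    case False
    then obtain b where b: "b \<in> M" "w \<in> V b" using w cover by blast
    note tT = \<theta>T[OF b]
    have "max 0 (2 * \<theta> b w b - 1) = 0" using qeq[OF b] arc_collapse_tip[OF b(1)] w(2) by metis
    then have h: "\<theta> b w b \<le> 1/2" by (simp add: max_def split: if_splits)
    have "\<delta> (1, w) = w0"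
      using \<delta>eq[OF b, of 1] D1[OF b(1) tT h] \<eta>\<theta>[OF b(1) base[OF b(1)]] by simp
    moreover have "q (\<delta> (s, w)) = (\<lambda>_. 0)" if s: "s \<in> {0..1}" for s
    proof -
      have DK: "D b (s, \<theta> b w) \<in> topspace (?K b)" by (rule DT[OF b(1) s tT])
      then have "q (\<delta> (s, w)) = arc_collapse b (D b (s, \<theta> b w))"
        using \<delta>eq[OF b s] qeq[OF b(1) \<eta>V[OF b(1) DK]] \<theta>\<eta>[OF b(1) DK] by simp
      then show ?thesis using arc_collapse_zero Db[OF b(1) s tT h] by metis
    qed
    ultimately show ?thesis by blast
  qed
  have "compactin W (V b)" if "b \<in> M" for b
  proof -
    have "compact_space (?K b)" by (rule compact_space_order_realization[OF finite_Field_arc_poset[OF that]])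
    then have "compact_space (subtopology W (V b))"
      using homeomorphic_compact_space[OF homeomorphic_map_imp_homeomorphic_space[OF \<theta>[OF that]]] by simp
    then show ?thesis using VW[OF that] by (simp add: compactin_subspace)
  qed
  then have "compactin W (\<Union>(V ` M))" by (intro compactin_Union) (use finite_M in auto)
  then have "compactin W ({w0} \<union> \<Union>(V ` M))" by (intro compactin_Un) (use w0 in auto)
  then have "compact_space W" unfolding compact_space_def cover by simp
  moreover have "Hausdorff_space cone_wedge"
    unfolding cone_wedge_def by (intro Hausdorff_space_subtopology) (simp add: Hausdorff_space_product_topology)
  moreover have "\<delta> (0, w) = w" if w: "w \<in> topspace W" for w
  proof (cases "w = w0")
    case False
    then obtain b where b: "b \<in> M" "w \<in> V b" using w cover by blast
    then show ?thesis using \<delta>eq[OF b, of 0] D0[OF b(1)] \<eta>\<theta>[OF b] by simp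
  qed (use \<delta>w0 in simp)
  ultimately have "lifting_map W cone_wedge q"
  proof (intro lifting_map_collapse[OF _ _ qc qsurj \<delta>c])
    show "\<delta> (1, w) = \<delta> (1, w')" if "w \<in> topspace W" "w' \<in> topspace W" "q w = q w'" for w w'
      using fib[OF that] qz that by metis
    show "q (\<delta> (s, w)) = q (\<delta> (s, w'))" if "s \<in> {0..1}" "w \<in> topspace W" "w' \<in> topspace W" "q w = q w'" for s w w'
      using fib[OF that(2-4)] qz that by metis
  qed auto
  then show ?thesis by blast
qed

end

section \<open>Moves between finite posets\<close>

abbreviation lift_equivalent :: "'a topology \<Rightarrow> 'a topology \<Rightarrow> bool" where
  "lift_equivalent \<equiv> equivclp (\<lambda>V W. \<exists>f. lifting_map V W f)"

section \<open>Path connectedness along zigzags\<close>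

lemma lifting_map_path_connected_space:
  assumes f: "lifting_map X Y f"
  shows "path_connected_space X \<longleftrightarrow> path_connected_space Y"
proof -
  have c: "continuous_map X Y f" using f by (simp add: lifting_map_def)
  show ?thesis
    unfolding path_connected_space_iff_path_component
  proof (intro iffI ballI)
    fix y y' assume X: "\<forall>x\<in>topspace X. \<forall>x'\<in>topspace X. path_component_of X x x'"
      and y: "y \<in> topspace Y" "y' \<in> topspace Y"
    obtain x where x: "x \<in> topspace X" "path_component_of Y y (f x)"
      using lifting_map_imp_path_component[OF f y(1)] by blast
    obtain x' where x': "x' \<in> topspace X" "path_component_of Y y' (f x')"
      using lifting_map_imp_path_component[OF f y(2)] by blast
    have "path_component_of Y (f x) (f x')"
      using X x(1) x'(1) by (intro path_component_of_image[OF c]) blast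
    then show "path_component_of Y y y'"
      using path_component_of_trans[OF x(2)] path_component_of_sym[OF x'(2)] path_component_of_trans by metis
  next
    fix x x' assume Y: "\<forall>y\<in>topspace Y. \<forall>y'\<in>topspace Y. path_component_of Y y y'"
      and x: "x \<in> topspace X" "x' \<in> topspace X"
    then have "f x \<in> topspace Y" "f x' \<in> topspace Y" using c by (auto simp: continuous_map_def)
    then show "path_component_of X x x'"
      using lifting_map_reflects_path_component[OF f x] Y by blast
  qed
qed

lemma lift_equivalent_path_connected_space:
  "lift_equivalent X Y \<Longrightarrow> path_connected_space X \<longleftrightarrow> path_connected_space Y"
  by (induction rule: equivclp_induct) (use lifting_map_path_connected_space in blast)+

lemma lift_equivalentI: "lifting_map X Y f \<Longrightarrow> lift_equivalent X Y"
  by (rule r_into_equivclp) blast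

text \<open>Comparable points are joined by a path that jumps at its last moment, so a path
  component is closed upwards and downwards in the order, hence open and closed.\<close>

lemma finite_poset_connected_imp_path_connected:
  assumes r: "Partial_order r" and con: "connected_space (poset_topology r)"
  shows "path_connected_space (poset_topology r)"
  unfolding path_connected_space_iff_path_component
proof (intro ballI)
  let ?X = "poset_topology r"
  fix x y assume x: "x \<in> topspace ?X" and y: "y \<in> topspace ?X"
  have le: "path_component_of ?X u v" if uv: "(u, v) \<in> r" for u v
  proof -
    let ?P = "discrete_topology {()}"
    have F: "u \<in> Field r" "v \<in> Field r" using uv by (auto simp: Field_def)
    have "continuous_map (prod_topology (top_of_set {0..1::real}) ?P) ?X (\<lambda>p. if fst p < 1 then u else v)"
      using continuous_map_switch[OF r, of ?P "\<lambda>_. u" "\<lambda>_. v"] F uv by simp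
    from continuous_map_compose[OF continuous_map_pairedI[of "top_of_set {0..1}" "top_of_set {0..1}" "\<lambda>t. t" ?P "\<lambda>_. ()"] this]
    have "continuous_map (top_of_set {0..1::real}) ?X (\<lambda>t. if t < 1 then u else v)"
      by (simp add: comp_def)
    then show ?thesis
      by (auto simp: path_component_of_def pathin_def intro!: exI[of _ "\<lambda>t::real. if t < 1 then u else v"])
  qed
  let ?C = "path_component_of_set ?X x"
  have CF: "?C \<subseteq> Field r" using path_component_of_subset_topspace[of ?X x] by simp
  have "openin ?X ?C"
    unfolding openin_poset_topology
    using CF path_component_of_trans[OF _ path_component_of_sym[OF le]] by auto
  moreover have "openin ?X (Field r - ?C)"
    unfolding openin_poset_topology
    using path_component_of_trans[OF _ le] by (auto intro: FieldI1)
  then have "closedin ?X ?C" using CF by (simp add: closedin_def)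
  moreover have "x \<in> ?C" using x by (simp add: path_component_of_refl)
  ultimately have "?C = topspace ?X"
    using con unfolding connected_space_clopen_in by blast
  then show "path_component_of ?X x y" using y by auto
qed

lemma Field_monotone_closed: "(x, y) \<in> r \<Longrightarrow> x \<in> Field r \<and> y \<in> Field r"
  by (auto simp: Field_def)

lemma mnl_below:
  assumes r: "Partial_order r" and fin: "finite (Field r)" and x: "x \<in> Field r"
  obtains m where "m \<in> mnl r" "(m, x) \<in> r"
proof -
  let ?S = "under r x"
  have "finite ?S" using fin by (rule rev_finite_subset) (auto simp: under_def Field_def)
  moreover have "?S \<noteq> {}" using Partial_order_refl[OF r x] by (auto simp: under_def)
  moreover have "asymp_on ?S (\<lambda>a b. (a, b) \<in> r - Id)" "transp_on ?S (\<lambda>a b. (a, b) \<in> r - Id)"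
    using Partial_order_antisym[OF r] Partial_order_trans[OF r]
    by (auto simp: asymp_on_def transp_on_def)
  ultimately obtain m where "m \<in> ?S" "\<forall>y\<in>?S. y \<noteq> m \<longrightarrow> (y, m) \<notin> r - Id"
    using Finite_Set.bex_min_element[of ?S "\<lambda>a b. (a, b) \<in> r - Id"] by blast
  then have "m \<in> mnl r" "(m, x) \<in> r"
    using Partial_order_trans[OF r] by (auto simp: mnl_def under_def Field_def)
  then show thesis by (rule that)
qed

section \<open>Adding beat points and sliding edges\<close>

definition add_top :: "'a rel \<Rightarrow> 'a set \<Rightarrow> 'a \<Rightarrow> 'a rel" where
  "add_top r S t = r \<union> S \<times> {t} \<union> {(t, t)}"

lemma add_top_iff: "(x, y) \<in> add_top r S t \<longleftrightarrow> (x, y) \<in> r \<or> y = t \<and> (x \<in> S \<or> x = t)"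
  by (auto simp: add_top_def)

lemma Field_add_top: "S \<subseteq> Field r \<Longrightarrow> Field (add_top r S t) = insert t (Field r)"
  by (auto simp: add_top_def Field_def)

lemma Partial_orderI:
  assumes "\<And>x y. (x, y) \<in> r \<Longrightarrow> (x, x) \<in> r \<and> (y, y) \<in> r"
    and "\<And>x y z. (x, y) \<in> r \<Longrightarrow> (y, z) \<in> r \<Longrightarrow> (x, z) \<in> r"
    and "\<And>x y. (x, y) \<in> r \<Longrightarrow> (y, x) \<in> r \<Longrightarrow> x = y"
  shows "Partial_order r"
  unfolding partial_order_on_def preorder_on_def refl_on_def trans_def antisym_def
  using assms by (auto simp: Field_def)

lemma Partial_order_add_top:
  assumes r: "Partial_order r" and S: "S \<subseteq> Field r" and down: "\<And>x y. (x, y) \<in> r \<Longrightarrow> y \<in> S \<Longrightarrow> x \<in> S"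
    and t: "t \<notin> Field r"
  shows "Partial_order (add_top r S t)"
proof -
  have n: "(t, x) \<notin> r" "(x, t) \<notin> r" for x using t by (auto simp: Field_def)
  show ?thesis
  proof (rule Partial_orderI)
    show "(x, x) \<in> add_top r S t \<and> (y, y) \<in> add_top r S t" if "(x, y) \<in> add_top r S t" for x y
      using that Partial_order_refl[OF r] S by (auto simp: add_top_iff dest: Field_monotone_closed)
    show "(x, z) \<in> add_top r S t" if "(x, y) \<in> add_top r S t" "(y, z) \<in> add_top r S t" for x y z
      using that n down Partial_order_trans[OF r] unfolding add_top_iff by blast
    show "x = y" if "(x, y) \<in> add_top r S t" "(y, x) \<in> add_top r S t" for x y
      using that n S Partial_order_antisym[OF r] t unfolding add_top_iff by blast
  qed
qed

text \<open>The retraction lowers \<open>s\<close> to \<open>a\<close>, the greatest element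
  strictly below it.\<close>

lemma lift_equivalent_add_down_beat:
  assumes r: "Partial_order r" and a: "a \<in> Field r" and s: "s \<notin> Field r"
  shows "lift_equivalent (poset_topology r) (poset_topology (add_top r (under r a) s))"
proof -
  let ?r = "add_top r (under r a) s"
  have S: "under r a \<subseteq> Field r" by (auto simp: under_def Field_def)
  have po: "Partial_order ?r"
    by (rule Partial_order_add_top[OF r S _ s]) (use Partial_order_trans[OF r] in \<open>auto simp: under_def\<close>)
  define \<rho> where "\<rho> = (\<lambda>x. if x = s then a else x)"
  have n: "(s, x) \<notin> r" "(x, s) \<notin> r" for x using s by (auto simp: Field_def)
  have "lifting_map (poset_topology r) (poset_topology ?r) (\<lambda>x. x)"
  proof (rule lifting_map_retraction[OF po])
    show "continuous_map (poset_topology r) (poset_topology ?r) (\<lambda>x. x)"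
      by (rule continuous_map_monotone[OF r po]) (auto simp: add_top_iff)
    show "continuous_map (poset_topology ?r) (poset_topology r) \<rho>"
      by (rule continuous_map_monotone[OF po r])
        (use n Partial_order_refl[OF r a] in \<open>auto simp: add_top_iff \<rho>_def under_def\<close>)
    show "\<rho> x = x" if "x \<in> topspace (poset_topology r)" for x using that s by (auto simp: \<rho>_def)
    have "(\<rho> y, y) \<in> ?r" if "y \<in> Field ?r" for y
      using that Partial_order_refl[OF po that] Partial_order_refl[OF r a]
      by (auto simp: \<rho>_def add_top_iff under_def)
    then show "(\<forall>y\<in>Field ?r. (y, \<rho> y) \<in> ?r) \<or> (\<forall>y\<in>Field ?r. (\<rho> y, y) \<in> ?r)" by blast
  qed
  then show ?thesis by (rule lift_equivalentI)
qed

text \<open>Transitivity survives because nothing lies strictly between \<open>c\<close> and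
  \<open>b\<close>, so the deleted pair is not forced back by two others.\<close>

lemma Partial_order_remove_cover:
  assumes r: "Partial_order r" and "c \<noteq> b" and cover: "\<And>z. (c, z) \<in> r \<Longrightarrow> (z, b) \<in> r \<Longrightarrow> z = c \<or> z = b"
  shows "Partial_order (r - {(c, b)})"
proof (rule Partial_orderI)
  show "(x, x) \<in> r - {(c, b)} \<and> (y, y) \<in> r - {(c, b)}" if "(x, y) \<in> r - {(c, b)}" for x y
    using that assms(2) Partial_order_refl[OF r] by (auto dest: Field_monotone_closed)
  show "(x, z) \<in> r - {(c, b)}" if "(x, y) \<in> r - {(c, b)}" "(y, z) \<in> r - {(c, b)}" for x y z
    using that Partial_order_trans[OF r] cover by blast
  show "x = y" if "(x, y) \<in> r - {(c, b)}" "(y, x) \<in> r - {(c, b)}" for x y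
    using that Partial_order_antisym[OF r] by blast
qed

text \<open>
  The edge from \<open>c\<close> to the maximal point \<open>b\<close> is slid down to \<open>y < b\<close> and becomes the edge
  \<open>c < d > y\<close>.  Both posets embed into the one with a further point \<open>t\<close> above \<open>b\<close> and \<open>d\<close>: the
  first with \<open>t\<close> in the role of \<open>b\<close>, as a retract; in the second, \<open>t\<close> is a weak point.
\<close>

definition slide_edge :: "'a rel \<Rightarrow> 'a \<Rightarrow> 'a \<Rightarrow> 'a \<Rightarrow> 'a \<Rightarrow> 'a rel" where
  "slide_edge r c b y d = add_top (r - {(c, b)}) {c, y} d"

lemma slide_edge:
  fixes r :: "'a rel"
  assumes inf: "infinite (UNIV :: 'a set)" and r: "Partial_order r" and fin: "finite (Field r)"
    and b: "b \<in> mxl r" and c: "c \<in> mnl r" and y: "y \<in> mnl r" and cb: "(c, b) \<in> r" "c \<noteq> b"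
    and yb: "(y, b) \<in> r" "y \<noteq> c"
    and cover: "\<And>z. (c, z) \<in> r \<Longrightarrow> (z, b) \<in> r \<Longrightarrow> z = c \<or> z = b"
    and d: "d \<notin> Field r"
  shows "Partial_order (slide_edge r c b y d)" "Field (slide_edge r c b y d) = insert d (Field r)"
    "lift_equivalent (poset_topology r) (poset_topology (slide_edge r c b y d))"
proof -
  let ?r0 = "r - {(c, b)}"
  let ?r1 = "slide_edge r c b y d"
  have cF: "c \<in> Field r" and bF: "b \<in> Field r" and yF: "y \<in> Field r"
    using b c y by (auto simp: mxl_def mnl_def)
  have cmin: "(x, c) \<in> r \<Longrightarrow> x = c" and ymin: "(x, y) \<in> r \<Longrightarrow> x = y" and bmax: "(b, x) \<in> r \<Longrightarrow> x = b" for x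
    using b c y by (auto simp: mxl_def mnl_def)
  have ybn: "y \<noteq> b" using ymin cb yb by blast
  have po0: "Partial_order ?r0" by (rule Partial_order_remove_cover[OF r cb(2) cover])
  have F0: "Field ?r0 = Field r"
    using Partial_order_refl[OF r] cb(2) by (auto simp: Field_def)
  show po1: "Partial_order ?r1"
    unfolding slide_edge_def
    by (rule Partial_order_add_top[OF po0]) (use F0 cF yF d cmin ymin in auto)
  show F1: "Field ?r1 = insert d (Field r)"
    unfolding slide_edge_def using Field_add_top[of "{c, y}" ?r0 d] F0 cF yF by auto
  have r1: "(u, v) \<in> ?r1 \<longleftrightarrow> (u, v) \<in> r \<and> (u, v) \<noteq> (c, b) \<or> v = d \<and> u \<in> {c, y, d}" for u v
    by (auto simp: slide_edge_def add_top_iff)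
  have dn: "(d, x) \<notin> r" "(x, d) \<notin> r" for x using d by (auto simp: Field_def)
  have dne: "d \<noteq> c" "d \<noteq> b" "d \<noteq> y" using d cF bF yF by auto
  obtain t where t: "t \<notin> insert d (Field r)"
    using ex_new_if_finite[OF inf] fin by (metis finite_insert)
  have tn: "(t, x) \<notin> r" "(x, t) \<notin> r" for x using t by (auto simp: Field_def)
  have tne: "t \<noteq> c" "t \<noteq> b" "t \<noteq> y" "t \<noteq> d" using t cF bF yF by auto
  define S where "S = insert d (under r b)"
  have S: "x \<in> S \<longleftrightarrow> x = d \<or> (x, b) \<in> r" for x by (simp add: S_def under_def)
  \<comment> \<open>\<open>c\<close> lies below \<open>t\<close> through \<open>d\<close>, so the
    relation lost at \<open>b\<close> reappears at \<open>t\<close>; this lets \<open>f\<close>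
    carry \<open>r\<close> into \<open>r2\<close> by renaming \<open>b\<close> to
    \<open>t\<close>.\<close>
  define r2 where "r2 = add_top ?r1 S t"
  have SF: "S \<subseteq> Field ?r1" unfolding F1 by (auto simp: S Field_def)
  have po2: "Partial_order r2"
    unfolding r2_def
  proof (rule Partial_order_add_top[OF po1 SF])
    show "u \<in> S" if "(u, v) \<in> ?r1" "v \<in> S" for u v
      using that cb(1) yb(1) Partial_order_trans[OF r] dn unfolding r1 S by blast
    show "t \<notin> Field ?r1" using t F1 by simp
  qed
  have F2: "Field r2 = insert t (insert d (Field r))"
    using Field_add_top[OF SF] F1 by (simp add: r2_def)
  have r2: "(u, v) \<in> r2 \<longleftrightarrow> (u, v) \<in> r \<and> (u, v) \<noteq> (c, b) \<or> v = d \<and> u \<in> {c, y, d} \<or>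
      v = t \<and> ((u, b) \<in> r \<or> u = d \<or> u = t)" for u v
    unfolding r2_def add_top_iff r1 S by blast
  define f where "f = (\<lambda>x. if x = b then t else x)"
  define \<rho> where "\<rho> = (\<lambda>x. if x = t \<or> x = d then b else x)"
  have bb: "(b, b) \<in> r" by (rule Partial_order_refl[OF r bF])
  have "lifting_map (poset_topology r) (poset_topology r2) f"
  proof (rule lifting_map_retraction[OF po2])
    show "continuous_map (poset_topology r) (poset_topology r2) f"
    proof (rule continuous_map_monotone[OF r po2])
      fix u v assume uv: "(u, v) \<in> r"
      show "(f u, f v) \<in> r2"
      proof (cases "v = b")
        case True
        then show ?thesis using uv by (simp add: f_def r2)
      next
        case False
        then have "u \<noteq> b" using uv bmax by blast
        then show ?thesis using uv False by (simp add: f_def r2)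
      qed
    qed
    show "continuous_map (poset_topology r2) (poset_topology r) \<rho>"
    proof (rule continuous_map_monotone[OF po2 r])
      fix u v assume "(u, v) \<in> r2"
      then show "(\<rho> u, \<rho> v) \<in> r"
        unfolding r2 \<rho>_def using dn tn dne tne cb(1) yb(1) bb by auto
    qed
    show "\<rho> (f x) = x" if "x \<in> topspace (poset_topology r)" for x
      using that t d tne dne by (auto simp: f_def \<rho>_def)
    have "(x, f (\<rho> x)) \<in> r2" if "x \<in> Field r2" for x
      using Partial_order_refl[OF po2 that] bb unfolding r2 f_def \<rho>_def by auto
    then show "(\<forall>x\<in>Field r2. (x, f (\<rho> x)) \<in> r2) \<or> (\<forall>x\<in>Field r2. (f (\<rho> x), x) \<in> r2)" by blast
  qed
  then have 1: "lift_equivalent (poset_topology r) (poset_topology r2)" by (rule lift_equivalentI)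
  have V: "S = under r2 t - {t}"
  proof (rule set_eqI)
    fix x
    show "x \<in> S \<longleftrightarrow> x \<in> under r2 t - {t}"
      unfolding Diff_iff singleton_iff under_def mem_Collect_eq r2 S
      using tn tne by auto
  qed
  have SF2: "S \<subseteq> Field r2" using SF F1 F2 by auto
  define R where "R = Restr r2 S"
  have R: "(u, v) \<in> R \<longleftrightarrow> u \<in> S \<and> v \<in> S \<and> ((u, v) \<in> r \<and> (u, v) \<noteq> (c, b) \<or> v = d \<and> u \<in> {c, y, d})" for u v
    using r2 tn tne by (auto simp: R_def S)
  have poR: "Partial_order R" unfolding R_def using po2 by (rule Partial_order_Restr)
  have FR: "Field R = S" unfolding R_def by (rule Field_Restr_poset[OF po2 SF2])
  \<comment> \<open>The set below \<open>t\<close> contracts in three comparisons: \<open>c\<close>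
    rises to \<open>d\<close>, the only other point above it in this set; then \<open>d\<close>,
    left with \<open>y\<close> alone below it, sinks to \<open>y\<close>; what remains has the
    greatest element \<open>b\<close>.\<close>
  define \<phi>1 \<phi>2 where "\<phi>1 = (\<lambda>x. if x = c then d else x)" and "\<phi>2 = (\<lambda>x. if x = c \<or> x = d then y else x)"
  have dS: "d \<in> S" by (simp add: S)
  have cS: "c \<in> S" and yS: "y \<in> S" and bS: "b \<in> S" using cb yb bb by (auto simp: S)
  have cv: "v = c \<or> v = d" if "(c, v) \<in> R" for v
    using that cover[of v] dn by (auto simp: R S)
  have uc: "u = c" if "(u, c) \<in> R" for u using that cmin dne by (auto simp: R)
  have dv: "v = d" if "(d, v) \<in> R" for v using that dn by (auto simp: R)
  have ud: "u = c \<or> u = y \<or> u = d" if "(u, d) \<in> R" for u using that dn by (auto simp: R)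
  have rR: "(x, x) \<in> R" if "x \<in> S" for x using Partial_order_refl[OF poR] FR that by blast
  have \<phi>1: "continuous_map (poset_topology R) (poset_topology R) \<phi>1"
  proof (rule continuous_map_monotone[OF poR poR])
    fix u v assume uv: "(u, v) \<in> R"
    show "(\<phi>1 u, \<phi>1 v) \<in> R"
      using uv cv[of v] uc[of u] rR[OF dS] by (auto simp: \<phi>1_def)
  qed
  have yd: "(y, d) \<in> R" and cd: "(c, d) \<in> R" using yS cS dS by (auto simp: R)
  have \<phi>2: "continuous_map (poset_topology R) (poset_topology R) \<phi>2"
  proof (rule continuous_map_monotone[OF poR poR])
    fix u v assume uv: "(u, v) \<in> R"
    show "(\<phi>2 u, \<phi>2 v) \<in> R"
    proof (cases "u = c \<or> u = d")
      case True
      then have "v = c \<or> v = d" using uv cv dv by blast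
      with True show ?thesis using rR[OF yS] by (simp add: \<phi>2_def)
    next
      case False
      then have "v = d \<longrightarrow> u = y" "v \<noteq> c" using uv ud uc by blast+
      with False show ?thesis using uv rR[OF yS] by (auto simp: \<phi>2_def)
    qed
  qed
  have id: "continuous_map (poset_topology R) (poset_topology R) id" by simp
  have cb': "continuous_map (poset_topology R) (poset_topology R) (\<lambda>_. b)" using bS FR by simp
  have h1: "homotopic_with (\<lambda>k. \<forall>c\<in>{}. k c = undefined) (poset_topology R) (poset_topology R) id \<phi>1"
    by (rule homotopic_with_le[OF poR id \<phi>1]) (use rR cd FR in \<open>auto simp: \<phi>1_def\<close>)
  have h2: "homotopic_with (\<lambda>k. \<forall>c\<in>{}. k c = undefined) (poset_topology R) (poset_topology R) \<phi>2 \<phi>1"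
    by (rule homotopic_with_le[OF poR \<phi>2 \<phi>1]) (use rR yd FR dne in \<open>auto simp: \<phi>1_def \<phi>2_def\<close>)
  have h3: "homotopic_with (\<lambda>k. \<forall>c\<in>{}. k c = undefined) (poset_topology R) (poset_topology R) \<phi>2 (\<lambda>_. b)"
  proof (rule homotopic_with_le[OF poR \<phi>2 cb'])
    fix x assume "x \<in> topspace (poset_topology R)"
    then have x: "x \<in> S" using FR by simp
    have "(y, b) \<in> R" using yS bS yb by (simp add: R)
    moreover have "(x, b) \<in> R" if "x \<noteq> c" "x \<noteq> d"
    proof -
      have "(x, b) \<in> r" using x that by (auto simp: S)
      then show ?thesis using x bS that by (simp add: R)
    qed
    ultimately show "(\<phi>2 x, b) \<in> R" by (simp add: \<phi>2_def)
  qed auto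
  have "homotopic_with (\<lambda>k. \<forall>c\<in>{}. k c = undefined) (poset_topology R) (poset_topology R) id (\<lambda>_. b)"
    using homotopic_with_trans[OF homotopic_with_trans[OF h1 homotopic_with_symD[OF h2]] h3] .
  then have contr: "homotopic_with (\<lambda>_. True) (subtopology (poset_topology r2) S) (subtopology (poset_topology r2) S) id (\<lambda>_. b)"
    unfolding subtopology_poset_topology[OF po2 SF2] R_def by simp
  have "lifting_map (subtopology (poset_topology r2) (Field r2 - {t})) (poset_topology r2) id"
  proof (rule lifting_map_weak_point[OF po2 _ _ V bS contr])
    show "t \<in> Field r2" using F2 by simp
    show "x = t" if "(t, x) \<in> r2" for x using that tn tne by (auto simp: r2)
  qed
  moreover have "subtopology (poset_topology r2) (Field r2 - {t}) = poset_topology ?r1"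
  proof -
    have "Field r2 - {t} = Field ?r1" using F1 F2 t by auto
    moreover have "Restr r2 (Field ?r1) = ?r1"
      using t F1 by (auto simp: r2_def add_top_def dest: Field_monotone_closed)
    ultimately show ?thesis using subtopology_poset_topology[OF po2, of "Field ?r1"] F1 F2 by auto
  qed
  ultimately have "lift_equivalent (poset_topology ?r1) (poset_topology r2)"
    using lift_equivalentI by metis
  with 1 show "lift_equivalent (poset_topology r) (poset_topology ?r1)"
    using equivclp_sym equivclp_trans by metis
qed

text \<open>Sliding the edge off \<open>b\<close> in the first poset and off \<open>a\<close> in the
  second produces one and the same poset with a new \<open>d\<close> above \<open>c\<close> and
  \<open>y\<close>. Hence an edge can pass from \<open>b\<close> to \<open>a\<close> over a common
  minimal lower bound \<open>y\<close>.\<close>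

lemma slide_edge_across:
  fixes r :: "'a rel"
  assumes inf: "infinite (UNIV :: 'a set)" and r: "Partial_order r" and fin: "finite (Field r)"
    and b: "b \<in> mxl r" and a: "a \<in> mxl r" and c: "c \<in> mnl r" and y: "y \<in> mnl r"
    and cb: "(c, b) \<in> r" "c \<noteq> b" and yb: "(y, b) \<in> r" and ya: "(y, a) \<in> r" "y \<noteq> a" and ca: "(c, a) \<notin> r"
    and cover: "\<And>z. (c, z) \<in> r \<Longrightarrow> (z, b) \<in> r \<Longrightarrow> z = c \<or> z = b"
  shows "Partial_order (insert (c, a) (r - {(c, b)}))" "Field (insert (c, a) (r - {(c, b)})) = Field r"
    "lift_equivalent (poset_topology r) (poset_topology (insert (c, a) (r - {(c, b)})))"
proof -
  let ?r0 = "r - {(c, b)}" and ?r' = "insert (c, a) (r - {(c, b)})"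
  have cF: "c \<in> Field r" and bF: "b \<in> Field r" and yF: "y \<in> Field r" and aF: "a \<in> Field r"
    using b c y a by (auto simp: mxl_def mnl_def)
  have cmin: "(x, c) \<in> r \<Longrightarrow> x = c" and ymin: "(x, y) \<in> r \<Longrightarrow> x = y"
    and bmax: "(b, x) \<in> r \<Longrightarrow> x = b" and amax: "(a, x) \<in> r \<Longrightarrow> x = a" for x
    using b c y a by (auto simp: mxl_def mnl_def)
  have ne: "c \<noteq> a" "a \<noteq> b" "y \<noteq> c" using ca cb ya Partial_order_refl[OF r] aF by auto
  have po0: "Partial_order ?r0" by (rule Partial_order_remove_cover[OF r cb(2) cover])
  have F0: "Field ?r0 = Field r"
    using Partial_order_refl[OF r] cb(2) by (auto simp: Field_def)
  show po': "Partial_order ?r'"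
  proof (rule Partial_orderI)
    show "(x, x) \<in> ?r' \<and> (z, z) \<in> ?r'" if "(x, z) \<in> ?r'" for x z
      using that Partial_order_refl[OF r] cF aF cb(2) by (auto dest: Field_monotone_closed)
    show "(x, z) \<in> ?r'" if "(x, w) \<in> ?r'" "(w, z) \<in> ?r'" for x w z
      using that Partial_order_trans[OF po0, of x w z] cmin amax ne by auto
    show "x = z" if "(x, z) \<in> ?r'" "(z, x) \<in> ?r'" for x z
      using that Partial_order_antisym[OF r] cmin amax by blast
  qed
  show F': "Field ?r' = Field r" using F0 cF aF by (auto simp: Field_def)
  obtain d where d: "d \<notin> Field r"
    using ex_new_if_finite[OF inf fin] by blast
  have e: "slide_edge r c b y d = slide_edge ?r' c a y d"
    using ca ne by (auto simp: slide_edge_def)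
  have 1: "lift_equivalent (poset_topology r) (poset_topology (slide_edge r c b y d))"
    by (rule slide_edge(3)[OF inf r fin b c y cb yb ne(3) cover d])
  have 2: "lift_equivalent (poset_topology ?r') (poset_topology (slide_edge ?r' c a y d))"
  proof (rule slide_edge(3)[OF inf po'])
    show "a \<in> mxl ?r'" using a F' ne amax by (auto simp: mxl_def)
    show "c \<in> mnl ?r'" using c F' ne cmin by (auto simp: mnl_def)
    show "y \<in> mnl ?r'" using y F' ya ymin by (auto simp: mnl_def)
    show "z = c \<or> z = a" if "(c, z) \<in> ?r'" "(z, a) \<in> ?r'" for z
      using that ca Partial_order_trans[OF r, of c z a] by blast
  qed (use fin F' d ne ya in auto)
  show "lift_equivalent (poset_topology r) (poset_topology ?r')"
    by (rule equivclp_trans[OF 1[unfolded e] equivclp_sym[OF 2]])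
qed

section \<open>Reduction to a fan\<close>

text \<open>
  The posets occurring in the reduction: the suspensions of the sets \<open>Lo b\<close>, \<open>b \<in> B\<close>, will survive,
  and the remaining elements below maximal points other than \<open>a\<close> are minimal and only contribute edges.
\<close>

locale edge_form =
  fixes r :: "'a rel" and a :: 'a and B :: "'a set" and Lo :: "'a \<Rightarrow> 'a set"
  assumes po: "Partial_order r" and fin: "finite (Field r)" and a: "a \<in> mxl r"
    and cover: "Field r = under r a \<union> mxl r \<union> mnl r"
    and pc: "path_connected_space (poset_topology r)"
    and B: "B \<subseteq> mxl r - {a}"
    and Lo_ne: "\<And>b. b \<in> B \<Longrightarrow> Lo b \<noteq> {}"
    and Lo_a: "\<And>b x. b \<in> B \<Longrightarrow> x \<in> Lo b \<Longrightarrow> (x, a) \<in> r"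
    and Lo_b: "\<And>b x. b \<in> B \<Longrightarrow> x \<in> Lo b \<Longrightarrow> (x, b) \<in> r \<and> x \<noteq> b"
    and Lo_empty: "\<And>b. b \<notin> B \<Longrightarrow> Lo b = {}"
    and extra_mnl: "\<And>b x. \<lbrakk>b \<in> mxl r; b \<noteq> a; (x, b) \<in> r; x \<noteq> b; x \<notin> Lo b\<rbrakk> \<Longrightarrow> x \<in> mnl r"
    and extra_Lo: "\<And>b x z. \<lbrakk>b \<in> mxl r; b \<noteq> a; (x, b) \<in> r; x \<noteq> b; x \<notin> Lo b; z \<in> Lo b\<rbrakk> \<Longrightarrow> (x, z) \<notin> r"

definition extra :: "'a rel \<Rightarrow> ('a \<Rightarrow> 'a set) \<Rightarrow> 'a \<Rightarrow> 'a set" where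
  "extra r Lo b = {x. (x, b) \<in> r \<and> x \<noteq> b \<and> x \<notin> Lo b}"

text \<open>
  Sliding one edge off \<open>b\<close> creates a new maximal point with two edges, of weight 4; the weights are chosen
  to pay for it.
\<close>

definition weight :: "'a set \<Rightarrow> ('a \<Rightarrow> 'a set) \<Rightarrow> 'a rel \<Rightarrow> 'a \<Rightarrow> nat" where
  "weight B Lo r b = (if b \<in> B then 5 * card (extra r Lo b) else (card (extra r Lo b))\<^sup>2)"

section \<open>The three moves that lower the weight\<close>

context edge_form
begin

abbreviation "M \<equiv> mxl r - {a}"

text \<open>The order on each \<open>Lo b\<close> is kept because these sets have to be recognized
  at the end as the ones to be suspended.\<close>

definition reduces_to :: "'a rel \<Rightarrow> bool" where
  "reduces_to r' \<longleftrightarrow> edge_form r' a B Lo \<and> lift_equivalent (poset_topology r) (poset_topology r') \<and>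
     (\<forall>b\<in>B. Restr r' (Lo b) = Restr r (Lo b)) \<and> B \<subseteq> mxl r'"

lemma mxlD: "b \<in> mxl r \<Longrightarrow> (b, x) \<in> r \<Longrightarrow> x = b" and mxl_Field: "b \<in> mxl r \<Longrightarrow> b \<in> Field r"
  and mnlD: "b \<in> mnl r \<Longrightarrow> (x, b) \<in> r \<Longrightarrow> x = b" and mnl_Field: "b \<in> mnl r \<Longrightarrow> b \<in> Field r"
  by (auto simp: mxl_def mnl_def)

lemma finite_M: "finite M"
  using fin by (rule rev_finite_subset) (auto simp: mxl_Field)

lemma finite_extra: "finite (extra r Lo b)"
  using fin by (rule rev_finite_subset) (auto simp: extra_def Field_def)

lemma mxl_notin_Lo: "b \<in> mxl r \<Longrightarrow> b \<notin> Lo b'"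
  using Lo_b mxlD Lo_empty by (cases "b' \<in> B") blast+

lemma Lo_Field: "x \<in> Lo b \<Longrightarrow> x \<in> Field r"
  using Lo_b Lo_empty by (cases "b \<in> B") (auto simp: Field_def)

lemma connected_clopen:
  assumes "S \<subseteq> Field r" "\<And>x y. x \<in> S \<Longrightarrow> (x, y) \<in> r \<Longrightarrow> y \<in> S" "\<And>x y. y \<in> S \<Longrightarrow> (x, y) \<in> r \<Longrightarrow> x \<in> S"
    and "a \<notin> S"
  shows "S = {}"
proof -
  let ?X = "poset_topology r"
  have "openin ?X S" using assms(1,3) by (auto simp: openin_poset_topology)
  moreover have "openin ?X (Field r - S)"
    using assms(2) by (auto simp: openin_poset_topology intro: FieldI1)
  then have "closedin ?X S" using assms(1) by (simp add: closedin_def)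
  moreover have "S \<noteq> Field r" using assms(4) mxl_Field[OF a] by blast
  ultimately show ?thesis
    using path_connected_imp_connected_space[OF pc] unfolding connected_space_clopen_in by auto
qed

text \<open>An edge can be slid to \<open>a\<close> only from a maximal point that shares a lower
  bound with \<open>a\<close>. Let \<open>S\<close> consist of all points below maximal points that
  share none. If an edge leaves \<open>S\<close> upwards, it ends in a maximal point that does share
  one; otherwise \<open>S\<close> is open and closed and misses \<open>a\<close>, hence is empty,
  and the given \<open>c\<close> already has the required edge.\<close>

lemma edge_near_core:
  assumes c: "c \<in> Field r" "(c, a) \<notin> r" "c \<notin> mxl r"
  obtains c' b where "c' \<in> mnl r" "(c', a) \<notin> r" "b \<in> M" "(c', b) \<in> r" "c' \<noteq> b" "under r b \<inter> under r a \<noteq> {}"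
proof -
  define N where "N = {b \<in> mxl r. under r b \<inter> under r a = {}}"
  define S where "S = (\<Union>b\<in>N. under r b)"
  have aa: "(a, a) \<in> r" using Partial_order_refl[OF po mxl_Field[OF a]] .
  have nS: "(x, a) \<notin> r" if x: "x \<in> S" for x
    using x by (auto simp: S_def N_def under_def)
  have nmnl: "c' \<in> mnl r" if c': "c' \<in> Field r" "(c', a) \<notin> r" "c' \<notin> mxl r" for c'
    using c' cover by (auto simp: under_def)
  show thesis
  proof (cases "\<exists>x y. x \<in> S \<and> (x, y) \<in> r \<and> y \<notin> S")
    case True
    then obtain x y where xy: "x \<in> S" "(x, y) \<in> r" "y \<notin> S" by blast
    have F: "x \<in> Field r" "y \<in> Field r" using xy by (auto simp: Field_def)
    have ne: "x \<noteq> y" using xy by blast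
    have "(y, a) \<notin> r" using nS[OF xy(1)] Partial_order_trans[OF po xy(2)] by blast
    moreover have "y \<notin> mnl r" using mnlD[of y x] xy(2) ne by blast
    ultimately have y: "y \<in> mxl r" "y \<noteq> a" using F cover aa by (auto simp: under_def)
    have "y \<in> under r y" using Partial_order_refl[OF po F(2)] by (simp add: under_def)
    then have "y \<notin> N" using xy(3) by (auto simp: S_def)
    then have "under r y \<inter> under r a \<noteq> {}" using y by (auto simp: N_def)
    moreover have "x \<notin> mxl r" using mxlD[of x y] xy(2) ne by blast
    then have "x \<in> mnl r" using nmnl F nS[OF xy(1)] by blast
    ultimately show thesis using that[of x y] nS[OF xy(1)] y xy(2) ne by blast
  next
    case False
    have S0: "S = {}"
    proof (rule connected_clopen)
      show "S \<subseteq> Field r" by (auto simp: S_def under_def Field_def)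
      show "y \<in> S" if "x \<in> S" "(x, y) \<in> r" for x y using False that by blast
      show "x \<in> S" if "y \<in> S" "(x, y) \<in> r" for x y
        using that Partial_order_trans[OF po] by (auto simp: S_def under_def)
      show "a \<notin> S" using nS[of a] aa by blast
    qed
    have N: "under r b \<inter> under r a \<noteq> {}" if b: "b \<in> mxl r" for b
    proof (rule notI)
      assume "under r b \<inter> under r a = {}"
      then have "b \<in> N" using b by (simp add: N_def)
      moreover have "b \<in> under r b" using Partial_order_refl[OF po mxl_Field[OF b]] by (simp add: under_def)
      ultimately have "b \<in> S" unfolding S_def by blast
      with S0 show False by simp
    qed
    obtain b where b: "(c, b) \<in> r" "b \<noteq> c" using c(1,3) by (auto simp: mxl_def)
    have "b \<in> Field r" using b by (auto simp: Field_def)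
    moreover have "(b, a) \<notin> r" using c(2) Partial_order_trans[OF po b(1)] by blast
    moreover have "b \<notin> mnl r" using mnlD[of b c] b by blast
    ultimately have "b \<in> mxl r" "b \<noteq> a" using cover aa by (auto simp: under_def)
    then show thesis using that[of c b] nmnl[OF c] c(2) b N by blast
  qed
qed

text \<open>Once slid to \<open>a\<close>, the edge puts \<open>c\<close> below \<open>a\<close> and
  \<open>b\<close> has one extra element less, while the maximal points stay the same.\<close>

lemma reduce_across:
  assumes inf: "infinite (UNIV :: 'a set)" and c0: "c0 \<in> Field r" "(c0, a) \<notin> r" "c0 \<notin> mxl r"
  shows "\<exists>r'. reduces_to r' \<and> sum (weight B Lo r') (mxl r' - {a}) < sum (weight B Lo r) M"
proof -
  obtain c b where c: "c \<in> mnl r" "(c, a) \<notin> r" and b: "b \<in> mxl r" "b \<noteq> a" and cb: "(c, b) \<in> r" "c \<noteq> b"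
    and ne: "under r b \<inter> under r a \<noteq> {}"
    by (rule edge_near_core[OF c0]) (rule that; blast)
  obtain x where x: "(x, b) \<in> r" "(x, a) \<in> r" using ne by (auto simp: under_def)
  have "x \<in> Field r" using x by (auto simp: Field_def)
  then obtain y where y: "y \<in> mnl r" "(y, x) \<in> r"
    by (rule mnl_below[OF po fin])
  have yb: "(y, b) \<in> r" and ya: "(y, a) \<in> r" using y(2) x Partial_order_trans[OF po] by blast+
  have yna: "y \<noteq> a" using yb b mxlD[OF a] by blast
  have ynb: "y \<noteq> b" using ya b mxlD[OF b(1)] by blast
  let ?r' = "insert (c, a) (r - {(c, b)})"
  have cLo: "c \<notin> Lo b'" for b' using c(2) Lo_a Lo_empty by (cases "b' \<in> B") blast+
  \<comment> \<open>An element of \<open>Lo b\<close> cannot lie above \<open>c\<close>, and any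
    other element strictly below \<open>b\<close> is minimal; so \<open>b\<close> covers
    \<open>c\<close>.\<close>
  have cov: "z = c \<or> z = b" if z: "(c, z) \<in> r" "(z, b) \<in> r" for z
  proof (cases "z \<in> Lo b")
    case True
    then show ?thesis using extra_Lo[OF b cb cLo] z by blast
  next
    case False
    then show ?thesis using extra_mnl[OF b z(2)] mnlD[of z c] z(1) by blast
  qed
  note sl = slide_edge_across[OF inf po fin b(1) a c(1) y(1) cb yb ya yna c(2) cov]
  have po': "Partial_order ?r'" and F': "Field ?r' = Field r"
    and eq: "lift_equivalent (poset_topology r) (poset_topology ?r')"
    by (rule sl; blast)+
  have cna: "c \<noteq> a" using c(2) Partial_order_refl[OF po mxl_Field[OF a]] by blast
  have bn: "b \<notin> mnl r" "a \<notin> mnl r" using mnlD[of b c] cb mnlD[of a y] ya yna by blast+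
  have cn: "c \<notin> mxl r" using mxlD[of c b] cb by blast
  have mx: "mxl ?r' = mxl r"
    unfolding mxl_def F' using cn cna cb b by (auto simp: mxl_def)
  have mn: "mnl ?r' = mnl r"
  proof -
    have "x \<in> mnl ?r' \<longleftrightarrow> x \<in> mnl r" for x
    proof (cases "x = a \<or> x = b")
      case True
      have "(y, b) \<in> ?r'" "(y, a) \<in> ?r'" "y \<noteq> a" "y \<noteq> b"
        using yb ya yna ynb c(2) by auto
      then have "a \<notin> mnl ?r'" "b \<notin> mnl ?r'" by (auto simp: mnl_def)
      then show ?thesis using True bn by blast
    next
      case False
      then show ?thesis unfolding mnl_def F' by auto
    qed
    then show ?thesis by blast
  qed
  have ex: "extra ?r' Lo b' = (if b' = b then extra r Lo b - {c} else extra r Lo b')" if "b' \<noteq> a" for b'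
    using that by (auto simp: extra_def)
  have LoB: "c \<notin> Lo b' \<and> a \<notin> Lo b' \<and> b \<notin> Lo b'" for b'
    using cLo mxl_notin_Lo a b by blast
  have nf: "edge_form ?r' a B Lo"
  proof
    show "Partial_order ?r'" by (rule po')
    show "finite (Field ?r')" using fin F' by simp
    show "a \<in> mxl ?r'" using a mx by simp
    show "Field ?r' = under ?r' a \<union> mxl ?r' \<union> mnl ?r'"
    proof -
      have "under ?r' a = insert c (under r a)" using b by (auto simp: under_def)
      then show ?thesis unfolding F' mx mn using cover c(1) by auto
    qed
    show "path_connected_space (poset_topology ?r')"
      using pc lift_equivalent_path_connected_space[OF eq] by simp
    show "B \<subseteq> mxl ?r' - {a}" using B mx by simp
    show "Lo b' \<noteq> {}" if "b' \<in> B" for b' using Lo_ne that .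
    show "(x, a) \<in> ?r'" if "b' \<in> B" "x \<in> Lo b'" for b' x using Lo_a[OF that] LoB that(2) b by auto
    show "(x, b') \<in> ?r' \<and> x \<noteq> b'" if "b' \<in> B" "x \<in> Lo b'" for b' x using Lo_b[OF that] LoB that(2) by auto
    show "Lo b' = {}" if "b' \<notin> B" for b' using Lo_empty[OF that] .
    show "x \<in> mnl ?r'" if "b' \<in> mxl ?r'" "b' \<noteq> a" "(x, b') \<in> ?r'" "x \<noteq> b'" "x \<notin> Lo b'" for b' x
      using extra_mnl[of b' x] that unfolding mx mn by auto
    show "(x, z) \<notin> ?r'" if "b' \<in> mxl ?r'" "b' \<noteq> a" "(x, b') \<in> ?r'" "x \<noteq> b'" "x \<notin> Lo b'" "z \<in> Lo b'" for b' x z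
      using extra_Lo[of b' x z] that LoB[of b'] unfolding mx by auto
  qed
  have "reduces_to ?r'"
    unfolding reduces_to_def using nf eq LoB mx B by auto
  moreover have "sum (weight B Lo ?r') (mxl ?r' - {a}) < sum (weight B Lo r) M"
    unfolding mx
  proof (rule sum_strict_mono_ex1)
    have cx: "c \<in> extra r Lo b" using cb cLo by (simp add: extra_def)
    have "card (extra r Lo b - {c}) < card (extra r Lo b)"
      using cx by (intro psubset_card_mono finite_extra) auto
    then have "weight B Lo ?r' b < weight B Lo r b"
      unfolding weight_def ex[OF b(2)] by (simp add: power_strict_mono)
    then show "\<exists>x\<in>M. weight B Lo ?r' x < weight B Lo r x" using b by blast
    have "card (extra ?r' Lo b') \<le> card (extra r Lo b')" if "b' \<noteq> a" for b'
      unfolding ex[OF that] by (rule card_mono[OF finite_extra]) (auto split: if_splits)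
    then show "\<forall>x\<in>M. weight B Lo ?r' x \<le> weight B Lo r x"
      by (auto simp: weight_def power_mono)
  qed (rule finite_M)
  ultimately show ?thesis by blast
qed

text \<open>Connectedness leaves exactly one element \<open>c\<close> strictly below
  \<open>b\<close>, so \<open>b\<close> retracts to \<open>c\<close> and can be deleted. This does
  not make \<open>c\<close> maximal, because \<open>c\<close> lies below \<open>a\<close>.\<close>

lemma reduce_remove:
  assumes all: "Field r = under r a \<union> mxl r" and b: "b \<in> M" "b \<notin> B" and card: "card (extra r Lo b) \<le> 1"
  shows "\<exists>r'. reduces_to r' \<and> sum (weight B Lo r') (mxl r' - {a}) < sum (weight B Lo r) M"
proof -
  have bm: "b \<in> mxl r" "b \<noteq> a" using b by auto
  have "extra r Lo b \<noteq> {}"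
  proof
    assume "extra r Lo b = {}"
    then have "x = b" if x: "(x, b) \<in> r" for x using x Lo_empty[OF b(2)] by (auto simp: extra_def)
    \<comment> \<open>With nothing below it, \<open>b\<close> would be a component of its
      own.\<close>
    then have "{b} = {}"
      using mxlD[OF bm(1)] mxl_Field[OF bm(1)] bm(2) by (intro connected_clopen) auto
    then show False by simp
  qed
  then have "card (extra r Lo b) = 1" using card finite_extra[of b] by (metis card_0_eq le_antisym less_one not_less)
  then obtain c where cx: "extra r Lo b = {c}" by (auto simp: card_1_singleton_iff)
  have cb: "(c, b) \<in> r" "c \<noteq> b" using cx unfolding extra_def by blast+
  have bel: "x = c \<or> x = b" if x: "(x, b) \<in> r" for x
    using x cx Lo_empty[OF b(2)] unfolding extra_def by blast
  have cF: "c \<in> Field r" using cb by (auto simp: Field_def)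
  have "c \<notin> mxl r" using mxlD[of c b] cb by blast
  then have ca: "(c, a) \<in> r" using all cF by (auto simp: under_def)
  have cna: "c \<noteq> a" using mxlD[OF a] cb bm by blast
  let ?S = "Field r - {b}"
  let ?r' = "Restr r ?S"
  have po': "Partial_order ?r'" using po by (rule Partial_order_Restr)
  have F': "Field ?r' = ?S" by (rule Field_Restr_poset[OF po]) auto
  have r': "(x, y) \<in> ?r' \<longleftrightarrow> (x, y) \<in> r \<and> x \<noteq> b \<and> y \<noteq> b" for x y by (auto simp: Field_def)
  define \<rho> where "\<rho> = (\<lambda>x. if x = b then c else x)"
  have "lifting_map (poset_topology ?r') (poset_topology r) (\<lambda>x. x)"
  proof (rule lifting_map_retraction[OF po])
    show "continuous_map (poset_topology ?r') (poset_topology r) (\<lambda>x. x)"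
      by (rule continuous_map_monotone[OF po' po]) auto
    show "continuous_map (poset_topology r) (poset_topology ?r') \<rho>"
    proof (rule continuous_map_monotone[OF po po'])
      fix x y assume xy: "(x, y) \<in> r"
      show "(\<rho> x, \<rho> y) \<in> ?r'"
        using xy bel[of x] mxlD[OF bm(1), of y] cb Partial_order_refl[OF po cF]
        unfolding r' \<rho>_def by auto
    qed
    show "\<rho> x = x" if "x \<in> topspace (poset_topology ?r')" for x
      using that F' by (auto simp: \<rho>_def)
    show "(\<forall>y\<in>Field r. (y, \<rho> y) \<in> r) \<or> (\<forall>y\<in>Field r. (\<rho> y, y) \<in> r)"
      using Partial_order_refl[OF po] cb by (auto simp: \<rho>_def)
  qed
  then have eq: "lift_equivalent (poset_topology r) (poset_topology ?r')"
    using lift_equivalentI equivclp_sym by metis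
  have mx: "mxl ?r' = mxl r - {b}"
  proof (intro equalityI subsetI)
    fix x assume x: "x \<in> mxl ?r'"
    then have xF: "x \<in> Field r" "x \<noteq> b" unfolding mxl_def F' by auto
    have "x \<noteq> c" using x ca cna bm cb unfolding mxl_def r' by auto
    then have "(x, b) \<notin> r" using bel xF by blast
    then show "x \<in> mxl r - {b}" using x xF unfolding mxl_def r' by blast
  qed (unfold mxl_def F' r', blast)
  have bn: "b \<notin> mnl r" using mnlD[of b c] cb by blast
  have mn: "mnl ?r' = mnl r"
  proof (intro equalityI subsetI)
    fix x assume x: "x \<in> mnl ?r'"
    then show "x \<in> mnl r" using mxlD[OF bm(1)] unfolding mnl_def F' r' by blast
  next
    fix x assume "x \<in> mnl r"
    then show "x \<in> mnl ?r'" using bn unfolding mnl_def F' r' by auto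
  qed
  have ex: "extra ?r' Lo b' = extra r Lo b'" if "b' \<noteq> b" for b'
    using that mxlD[OF bm(1)] by (auto simp: extra_def intro: FieldI1 FieldI2)
  have bLo: "b \<notin> Lo b'" for b' by (rule mxl_notin_Lo[OF bm(1)])
  have nf: "edge_form ?r' a B Lo"
  proof
    show "Partial_order ?r'" by (rule po')
    show "finite (Field ?r')" using fin F' by simp
    show "a \<in> mxl ?r'" using a mx bm by simp
    show "Field ?r' = under ?r' a \<union> mxl ?r' \<union> mnl ?r'"
    proof -
      have "under ?r' a = under r a - {b}" using bm mxlD[OF bm(1)] by (auto simp: under_def intro: FieldI1 FieldI2)
      moreover have "mnl r \<subseteq> ?S" using bn mnl_Field by auto
      ultimately show ?thesis unfolding F' mx mn using all by auto
    qed
    show "path_connected_space (poset_topology ?r')"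
      using pc lift_equivalent_path_connected_space[OF eq] by simp
    show "B \<subseteq> mxl ?r' - {a}" using B mx b by auto
    show "Lo b' \<noteq> {}" if "b' \<in> B" for b' using Lo_ne that .
    show "(x, a) \<in> ?r'" if "b' \<in> B" "x \<in> Lo b'" for b' x
      using Lo_a[OF that] bLo[of b'] that(2) bm unfolding r' by auto
    show "(x, b') \<in> ?r' \<and> x \<noteq> b'" if "b' \<in> B" "x \<in> Lo b'" for b' x
      using Lo_b[OF that] bLo[of b'] that b unfolding r' by auto
    show "Lo b' = {}" if "b' \<notin> B" for b' using Lo_empty[OF that] .
    show "x \<in> mnl ?r'" if "b' \<in> mxl ?r'" "b' \<noteq> a" "(x, b') \<in> ?r'" "x \<noteq> b'" "x \<notin> Lo b'" for b' x
      using extra_mnl[of b' x] that unfolding mx mn by auto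
    show "(x, z) \<notin> ?r'" if "b' \<in> mxl ?r'" "b' \<noteq> a" "(x, b') \<in> ?r'" "x \<noteq> b'" "x \<notin> Lo b'" "z \<in> Lo b'" for b' x z
      using extra_Lo[of b' x z] that unfolding mx by auto
  qed
  have "Restr ?r' (Lo b') = Restr r (Lo b')" for b'
    using bLo[of b'] by (auto simp: Field_def)
  then have "reduces_to ?r'"
    unfolding reduces_to_def using nf eq mx B b by auto
  moreover have "sum (weight B Lo ?r') (mxl ?r' - {a}) < sum (weight B Lo r) M"
  proof -
    have "sum (weight B Lo r) M = weight B Lo r b + sum (weight B Lo r) (M - {b})"
      using b(1) finite_M by (rule sum.remove[rotated])
    moreover have "weight B Lo r b = 1" using b cx by (simp add: weight_def)
    moreover have "sum (weight B Lo ?r') (mxl ?r' - {a}) = sum (weight B Lo r) (M - {b})"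
      unfolding mx by (rule sum.cong) (auto simp: weight_def ex)
    ultimately show ?thesis by simp
  qed
  ultimately show ?thesis by blast
qed

text \<open>One edge of \<open>b\<close> is split off into a new maximal point \<open>d\<close> with
  just the legs \<open>c\<close> and \<open>y\<close>. The weight 4 of \<open>d\<close> is repaid by
  the loss of 5 if \<open>b\<close> lies in \<open>B\<close>, and otherwise by
  \<open>n\<^sup>2 - (n - 1)\<^sup>2 > 4\<close>, which needs \<open>n \<ge> 3\<close>; so maximal
  points outside \<open>B\<close> with two legs are left alone.\<close>

lemma reduce_slide:
  assumes inf: "infinite (UNIV :: 'a set)" and all: "Field r = under r a \<union> mxl r" and b: "b \<in> M"
    and c: "c \<in> extra r Lo b" and card: "b \<in> B \<or> 3 \<le> card (extra r Lo b)"
  shows "\<exists>r'. reduces_to r' \<and> sum (weight B Lo r') (mxl r' - {a}) < sum (weight B Lo r) M"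
proof -
  have bm: "b \<in> mxl r" "b \<noteq> a" using b by auto
  have cb: "(c, b) \<in> r" "c \<noteq> b" and cLo: "c \<notin> Lo b" using c by (auto simp: extra_def)
  have cm: "c \<in> mnl r" by (rule extra_mnl[OF bm cb cLo])
  \<comment> \<open>For \<open>b\<close> in \<open>B\<close> the leg \<open>y\<close> is taken below
    an element of \<open>Lo b\<close>, since \<open>c\<close> may be the only extra element;
    \<open>extra_Lo\<close> keeps it apart from \<open>c\<close>.\<close>
  obtain y where y: "y \<in> mnl r" "(y, b) \<in> r" "y \<noteq> c"
  proof (cases "b \<in> B")
    case True
    then obtain z where z: "z \<in> Lo b" using Lo_ne by blast
    obtain y where y: "y \<in> mnl r" "(y, z) \<in> r" using mnl_below[OF po fin Lo_Field[OF z]] .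
    have "(y, b) \<in> r" using y(2) Lo_b[OF True z] Partial_order_trans[OF po] by blast
    moreover have "y \<noteq> c" using y(2) extra_Lo[OF bm cb cLo z] by blast
    ultimately show thesis using that y by blast
  next
    case False
    then have "card (extra r Lo b - {c}) \<noteq> 0" using card c finite_extra[of b] by simp
    then obtain y where "y \<in> extra r Lo b" "y \<noteq> c" by (metis Diff_iff card.empty equals0I singletonI)
    then show thesis using that[of y] extra_mnl[OF bm, of y] by (auto simp: extra_def)
  qed
  have cov: "z = c \<or> z = b" if z: "(c, z) \<in> r" "(z, b) \<in> r" for z
  proof (cases "z \<in> Lo b")
    case True
    then show ?thesis using extra_Lo[OF bm cb cLo] z by blast
  next
    case False
    then show ?thesis using extra_mnl[OF bm z(2)] mnlD[of z c] z(1) by blast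
  qed
  obtain d where d: "d \<notin> Field r" using ex_new_if_finite[OF inf fin] by blast
  let ?r' = "slide_edge r c b y d"
  have po': "Partial_order ?r'" and F': "Field ?r' = insert d (Field r)"
    and eq: "lift_equivalent (poset_topology r) (poset_topology ?r')"
    using slide_edge[OF inf po fin bm(1) cm y(1) cb y(2,3) cov d] by blast+
  have dn: "(d, x) \<notin> r" "(x, d) \<notin> r" for x using d by (auto simp: Field_def)
  have r': "(u, v) \<in> ?r' \<longleftrightarrow> (u, v) \<in> r \<and> (u, v) \<noteq> (c, b) \<or> v = d \<and> u \<in> {c, y, d}" for u v
    by (auto simp: slide_edge_def add_top_iff)
  have cF: "c \<in> Field r" and yF: "y \<in> Field r" and bF: "b \<in> Field r" and aF: "a \<in> Field r"
    using cm y mnl_Field mxl_Field bm a by auto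
  have dne: "d \<noteq> c" "d \<noteq> y" "d \<noteq> b" "d \<noteq> a" using d cF yF bF aF by auto
  have "c \<notin> mxl r" using mxlD[of c b] cb by blast
  then have ca: "(c, a) \<in> r" using all cF by (auto simp: under_def)
  have cna: "c \<noteq> a" using mxlD[OF a] cb bm by blast
  have ynb: "y \<noteq> b" using y cm mnlD[of y c] cb by blast
  have "y \<notin> mxl r" using mxlD[of y b] y ynb by blast
  have cnm: "c \<notin> mxl r" by fact
  have dB: "d \<notin> B" using B d mxl_Field by blast
  have mx: "mxl ?r' = insert d (mxl r)"
  proof (intro equalityI subsetI)
    fix x assume x: "x \<in> mxl ?r'"
    have "(c, d) \<in> ?r'" "(y, d) \<in> ?r'" by (auto simp: r')
    then have "x \<noteq> c" "x \<noteq> y" using x dne unfolding mxl_def by auto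
    then show "x \<in> insert d (mxl r)" using x unfolding mxl_def F' r' by auto
  next
    fix x assume "x \<in> insert d (mxl r)"
    then show "x \<in> mxl ?r'"
      using cnm \<open>y \<notin> mxl r\<close> dn unfolding mxl_def F' r' by auto
  qed
  have bn: "b \<notin> mnl r" using mnlD[of b c] cb by blast
  have mn: "mnl ?r' = mnl r"
  proof -
    have "x \<in> mnl ?r' \<longleftrightarrow> x \<in> mnl r" for x
    proof (cases "x = b \<or> x = d")
      case True
      have "(y, b) \<in> ?r'" "(c, d) \<in> ?r'" using y by (auto simp: r')
      then have "b \<notin> mnl ?r'" "d \<notin> mnl ?r'" using ynb dne by (auto simp: mnl_def)
      moreover have "d \<notin> mnl r" using d mnl_Field by blast
      ultimately show ?thesis using True bn by blast
    next
      case False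
      then show ?thesis unfolding mnl_def F' r' by auto
    qed
    then show ?thesis by blast
  qed
  have dLo: "d \<notin> Lo b'" for b' using d Lo_Field by blast
  have Lod: "Lo d = {}" by (rule Lo_empty[OF dB])
  have exd: "extra ?r' Lo d = {c, y}"
    using dn dne Lod by (auto simp: extra_def r')
  have ex: "extra ?r' Lo b' = (if b' = b then extra r Lo b - {c} else extra r Lo b')" if "b' \<noteq> d" for b'
    using that by (auto simp: extra_def r')
  have bLo: "b \<notin> Lo b'" for b' by (rule mxl_notin_Lo[OF bm(1)])
  have nf: "edge_form ?r' a B Lo"
  proof
    show "Partial_order ?r'" by (rule po')
    show "finite (Field ?r')" using fin F' by simp
    show "a \<in> mxl ?r'" using a mx by simp
    show "Field ?r' = under ?r' a \<union> mxl ?r' \<union> mnl ?r'"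
    proof -
      have "under ?r' a = under r a" using dne bm dn by (auto simp: under_def r')
      moreover have "mnl r \<subseteq> Field r" using mnl_Field by blast
      ultimately show ?thesis unfolding F' mx mn using all by auto
    qed
    show "path_connected_space (poset_topology ?r')"
      using pc lift_equivalent_path_connected_space[OF eq] by simp
    show "B \<subseteq> mxl ?r' - {a}" using B mx by auto
    show "Lo b' \<noteq> {}" if "b' \<in> B" for b' using Lo_ne that .
    show "(x, a) \<in> ?r'" if "b' \<in> B" "x \<in> Lo b'" for b' x
      using Lo_a[OF that] bm unfolding r' by auto
    show "(x, b') \<in> ?r' \<and> x \<noteq> b'" if "b' \<in> B" "x \<in> Lo b'" for b' x
      using Lo_b[OF that] cLo that unfolding r' by auto
    show "Lo b' = {}" if "b' \<notin> B" for b' using Lo_empty[OF that] .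
    show "x \<in> mnl ?r'" if "b' \<in> mxl ?r'" "b' \<noteq> a" "(x, b') \<in> ?r'" "x \<noteq> b'" "x \<notin> Lo b'" for b' x
    proof (cases "b' = d")
      case True
      then show ?thesis using that(3,4) cm y(1) dn unfolding mn r' by auto
    next
      case False
      then show ?thesis using extra_mnl[of b' x] that unfolding mx mn r' by auto
    qed
    show "(x, z) \<notin> ?r'" if "b' \<in> mxl ?r'" "b' \<noteq> a" "(x, b') \<in> ?r'" "x \<noteq> b'" "x \<notin> Lo b'" "z \<in> Lo b'" for b' x z
    proof (cases "b' = d")
      case True
      then show ?thesis using that(6) Lod by simp
    next
      case False
      then show ?thesis using extra_Lo[of b' x z] that dLo[of b'] unfolding mx r' by auto
    qed
  qed
  have "Restr ?r' (Lo b') = Restr r (Lo b')" for b'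
    using bLo[of b'] dLo[of b'] by (auto simp: r')
  then have "reduces_to ?r'"
    unfolding reduces_to_def using nf eq mx B by auto
  moreover have "sum (weight B Lo ?r') (mxl ?r' - {a}) < sum (weight B Lo r) M"
  proof -
    let ?n = "card (extra r Lo b)"
    have n: "?n > 0" using c finite_extra[of b] by (auto simp: card_gt_0_iff)
    have dM: "d \<notin> M" using d mxl_Field by blast
    have "sum (weight B Lo ?r') (mxl ?r' - {a}) = sum (weight B Lo ?r') (insert d M)"
      unfolding mx using dne by (intro arg_cong2[where f = sum]) auto
    also have "\<dots> = 4 + sum (weight B Lo ?r') M"
      using dM finite_M y(3) by (simp add: weight_def[of _ _ _ d] exd dB power2_eq_square)
    also have "sum (weight B Lo ?r') M = weight B Lo ?r' b + sum (weight B Lo ?r') (M - {b})"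
      using b finite_M by (rule sum.remove[rotated])
    also have "sum (weight B Lo ?r') (M - {b}) = sum (weight B Lo r) (M - {b})"
    proof (rule sum.cong[OF refl])
      fix x assume "x \<in> M - {b}"
      then have "x \<noteq> d" "x \<noteq> b" using dM by blast+
      then show "weight B Lo ?r' x = weight B Lo r x" by (simp add: weight_def ex)
    qed
    finally have 1: "sum (weight B Lo ?r') (mxl ?r' - {a}) = 4 + (weight B Lo ?r' b + sum (weight B Lo r) (M - {b}))" .
    have 2: "sum (weight B Lo r) M = weight B Lo r b + sum (weight B Lo r) (M - {b})"
      using b finite_M by (rule sum.remove[rotated])
    have "card (extra ?r' Lo b) = ?n - 1"
      using ex[of b] dne c finite_extra[of b] by simp
    moreover have "4 + (?n - 1)\<^sup>2 < ?n\<^sup>2" if n3: "3 \<le> ?n"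
    proof -
      obtain k where k: "?n = k + 3" using n3 by (metis add.commute le_Suc_ex)
      show ?thesis unfolding k by (simp add: power2_eq_square algebra_simps)
    qed
    ultimately have "4 + weight B Lo ?r' b < weight B Lo r b"
      using card n by (auto simp: weight_def)
    then show ?thesis using 1 2 by simp
  qed
  ultimately show ?thesis by blast
qed

end

text \<open>Sliding across comes first because the two other moves presuppose that everything not
  maximal lies below \<open>a\<close>. When no move applies, the points of \<open>B\<close> have
  lost all extra edges, and each other maximal point except \<open>a\<close> has exactly two and
  will give a circle.\<close>

lemma edge_form_reduction:
  fixes r :: "'a rel"
  assumes inf: "infinite (UNIV :: 'a set)" and nf: "edge_form r a B Lo"
  shows "\<exists>r'. edge_form r' a B Lo \<and> lift_equivalent (poset_topology r) (poset_topology r') \<and>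
     (\<forall>b\<in>B. Restr r' (Lo b) = Restr r (Lo b)) \<and> Field r' = under r' a \<union> mxl r' \<and>
     (\<forall>b\<in>B. extra r' Lo b = {}) \<and> (\<forall>b\<in>mxl r' - {a} - B. card (extra r' Lo b) = 2)"
  using nf
proof (induction "sum (weight B Lo r) (mxl r - {a})" arbitrary: r rule: less_induct)
  case less
  interpret edge_form r a B Lo by (rule less.prems)
  have go: ?case if s: "\<exists>r'. reduces_to r' \<and> sum (weight B Lo r') (mxl r' - {a}) < sum (weight B Lo r) M"
  proof -
    obtain r1 where r1: "reduces_to r1" "sum (weight B Lo r1) (mxl r1 - {a}) < sum (weight B Lo r) M"
      using s by blast
    then have nf1: "edge_form r1 a B Lo" and eq1: "lift_equivalent (poset_topology r) (poset_topology r1)"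
      and R1: "\<forall>b\<in>B. Restr r1 (Lo b) = Restr r (Lo b)" by (auto simp: reduces_to_def)
    obtain r' where r': "edge_form r' a B Lo" "lift_equivalent (poset_topology r1) (poset_topology r')"
      "\<forall>b\<in>B. Restr r' (Lo b) = Restr r1 (Lo b)" "Field r' = under r' a \<union> mxl r'"
      "\<forall>b\<in>B. extra r' Lo b = {}" "\<forall>b\<in>mxl r' - {a} - B. card (extra r' Lo b) = 2"
      using less.hyps[OF r1(2) nf1] by blast
    moreover have "lift_equivalent (poset_topology r) (poset_topology r')"
      by (rule equivclp_trans[OF eq1 r'(2)])
    moreover have "\<forall>b\<in>B. Restr r' (Lo b) = Restr r (Lo b)"
      using R1 r'(3) by simp
    ultimately show ?thesis by blast
  qed
  show ?case
  proof (cases "Field r = under r a \<union> mxl r")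
    case False
    moreover have "under r a \<union> mxl r \<subseteq> Field r" using mxl_Field by (auto simp: under_def Field_def)
    ultimately obtain c where "c \<in> Field r" "(c, a) \<notin> r" "c \<notin> mxl r" by (auto simp: under_def)
    then show ?thesis using go reduce_across[OF inf] by blast
  next
    case all: True
    show ?thesis
    proof (cases "\<exists>b\<in>M - B. card (extra r Lo b) \<le> 1")
      case True
      then show ?thesis using go reduce_remove[OF all] by blast
    next
      case ge2: False
      show ?thesis
      proof (cases "\<exists>b\<in>M. extra r Lo b \<noteq> {} \<and> (b \<in> B \<or> 3 \<le> card (extra r Lo b))")
        case True
        then show ?thesis using go reduce_slide[OF inf all] by blast
      next
        case False
        then have "\<forall>b\<in>B. extra r Lo b = {}" using B by blast
        moreover have "card (extra r Lo b) = 2" if b: "b \<in> M - B" for b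
        proof -
          have "\<not> card (extra r Lo b) \<le> 1" using ge2 b by blast
          moreover from this have "extra r Lo b \<noteq> {}" by auto
          then have "\<not> 3 \<le> card (extra r Lo b)" using False b by blast
          ultimately show ?thesis by linarith
        qed
        ultimately show ?thesis
          using less.prems all by (intro exI[of _ r]) simp
      qed
    qed
  qed
qed

section \<open>Wedges\<close>

context fan begin

text \<open>
  A point of a suspension lies off one of the two suspension points; the isomorphism is chosen such that
  this one goes to \<open>b\<close>.
\<close>

lemma homeomorphic_map_arc:
  assumes b: "b \<in> M" and F: "Field Q = insert \<alpha> (insert \<beta> K)" and finK: "finite K" and ne: "\<alpha> \<noteq> \<beta>" "\<alpha> \<notin> K" "\<beta> \<notin> K"
    and \<iota>: "bij_betw \<iota> K (L b)" and iso: "\<And>x y. x \<in> K \<Longrightarrow> y \<in> K \<Longrightarrow> (\<iota> x, \<iota> y) \<in> r \<longleftrightarrow> (x, y) \<in> Q"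
    and up: "\<And>x. x \<in> K \<Longrightarrow> (x, \<alpha>) \<in> Q \<and> (x, \<beta>) \<in> Q \<and> (\<alpha>, x) \<notin> Q \<and> (\<beta>, x) \<notin> Q"
    and tops: "(\<alpha>, \<beta>) \<notin> Q" "(\<beta>, \<alpha>) \<notin> Q" "(\<alpha>, \<alpha>) \<in> Q" "(\<beta>, \<beta>) \<in> Q"
    and p: "p \<in> topspace (order_realization Q)"
  shows "\<exists>\<theta>. homeomorphic_map (order_realization Q) (order_realization (arc_poset b)) \<theta> \<and> \<theta> p b = 0"
proof -
  \<comment> \<open>Stated for arbitrary names \<open>\<alpha>\<close> and \<open>\<beta>\<close>,
    to be used a second time with the two suspension points exchanged.\<close>
  have gen: "\<exists>\<theta>. homeomorphic_map (order_realization Q) (order_realization (arc_poset b)) \<theta> \<and> \<theta> p b = 0"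
    if z: "p \<beta> = 0" and F: "Field Q = insert \<alpha> (insert \<beta> K)" and ne: "\<alpha> \<noteq> \<beta>" "\<alpha> \<notin> K" "\<beta> \<notin> K"
      and up: "\<And>x. x \<in> K \<Longrightarrow> (x, \<alpha>) \<in> Q \<and> (x, \<beta>) \<in> Q \<and> (\<alpha>, x) \<notin> Q \<and> (\<beta>, x) \<notin> Q"
      and tops: "(\<alpha>, \<beta>) \<notin> Q" "(\<beta>, \<alpha>) \<notin> Q" "(\<alpha>, \<alpha>) \<in> Q" "(\<beta>, \<beta>) \<in> Q" for \<alpha> \<beta>
  proof -
    define \<sigma> where "\<sigma> = (\<lambda>x. if x = \<alpha> then a else if x = \<beta> then b else \<iota> x)"
    have \<iota>L: "\<iota> x \<in> L b" if "x \<in> K" for x using \<iota> that bij_betwE by blast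
    have bij: "bij_betw \<sigma> (Field Q) (Field (arc_poset b))"
      unfolding bij_betw_def F Field_arc_poset[OF b]
    proof
      have \<sigma>\<alpha>: "\<sigma> \<alpha> = a" "\<sigma> \<beta> = b" using ne by (auto simp: \<sigma>_def)
      have "inj_on \<iota> K" using \<iota> by (simp add: bij_betw_def)
      then have "inj_on \<sigma> K" using ne by (subst inj_on_cong[of K \<sigma> \<iota>]) (auto simp: \<sigma>_def)
      moreover have "\<sigma> x \<noteq> a \<and> \<sigma> x \<noteq> b" if "x \<in> K" for x
        using \<iota>L[OF that] a_notin_L[OF b] b_notin_L that ne by (auto simp: \<sigma>_def)
      ultimately show "inj_on \<sigma> (insert \<alpha> (insert \<beta> K))"
        using M_not_a[OF b] ne by (auto simp: inj_on_insert \<sigma>\<alpha>)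
      have "\<sigma> ` K = \<iota> ` K" using ne by (intro image_cong) (auto simp: \<sigma>_def)
      then have "\<sigma> ` K = L b" using \<iota> by (simp add: bij_betw_def)
      then show "\<sigma> ` insert \<alpha> (insert \<beta> K) = insert a (insert b (L b))"
        by (simp add: \<sigma>\<alpha>)
    qed
    have fin': "finite (Field Q)" using F finK by simp
    have isoQ: "(\<sigma> x, \<sigma> y) \<in> arc_poset b \<longleftrightarrow> (x, y) \<in> Q" if x: "x \<in> Field Q" and y: "y \<in> Field Q" for x y
    proof -
      have mem: "\<sigma> x \<in> insert a (under r b)" "\<sigma> y \<in> insert a (under r b)"
        using x y \<iota>L Partial_order_refl[OF po M_Field[OF b]] unfolding F by (auto simp: \<sigma>_def L_def under_def)
      have "(\<sigma> x, \<sigma> y) \<in> r \<longleftrightarrow> (x, y) \<in> Q"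
      proof -
        have aa: "(a, a) \<in> r" "(b, b) \<in> r" using Partial_order_refl[OF po] a_Field M_Field[OF b] by auto
        have ab: "(a, b) \<notin> r" "(b, a) \<notin> r" using a_max M_max[OF b] M_not_a[OF b] by metis+
        have La: "(\<iota> x, a) \<in> r" "(\<iota> x, b) \<in> r" "(a, \<iota> x) \<notin> r" "(b, \<iota> x) \<notin> r" if "x \<in> K" for x
          using L_below_a[OF b \<iota>L[OF that]] \<iota>L[OF that] a_max[of "\<iota> x"] M_max[OF b, of "\<iota> x"] by (auto simp: L_iff)
        have K: "\<sigma> x = \<iota> x" if "x \<in> K" for x using that ne by (auto simp: \<sigma>_def)
        have \<sigma>ab: "\<sigma> \<alpha> = a" "\<sigma> \<beta> = b" using ne by (auto simp: \<sigma>_def)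
        consider "x = \<alpha>" | "x = \<beta>" | "x \<in> K" using x F by blast
        then show ?thesis
        proof cases
          case 1
          then show ?thesis using y F \<sigma>ab aa ab La K up tops by auto
        next
          case 2
          then show ?thesis using y F \<sigma>ab aa ab La K up tops by auto
        next
          case 3
          then show ?thesis using y F \<sigma>ab La K up iso by auto
        qed
      qed
      then show ?thesis using mem by (simp add: arc_poset_iff)
    qed
    obtain \<theta> where \<theta>: "homeomorphic_map (order_realization Q) (order_realization (arc_poset b)) \<theta>"
      "\<And>t v. t \<in> topspace (order_realization Q) \<Longrightarrow> v \<in> Field Q \<Longrightarrow> \<theta> t (\<sigma> v) = t v"
      by (rule homeomorphic_order_realization[OF fin' bij isoQ]) auto
    have "\<theta> p (\<sigma> \<beta>) = 0" using \<theta>(2)[OF p, of \<beta>] F z by simp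
    then show ?thesis using \<theta>(1) ne by (intro exI[of _ \<theta>]) (simp add: \<sigma>_def)
  qed
  have fin': "finite (Field Q)" using F finK by simp
  show ?thesis
  proof (cases "p \<beta> = 0")
    case True
    then show ?thesis using gen[OF _ F ne up tops] by blast
  next
    case False
    have "p \<alpha> = 0"
    proof (rule ccontr)
      assume "p \<alpha> \<noteq> 0"
      then have "p \<alpha> > 0" "p \<beta> > 0" using False p topspace_order_realization[OF fin'] by (metis less_le)+
      then have "(\<alpha>, \<beta>) \<in> Q \<or> (\<beta>, \<alpha>) \<in> Q" using p topspace_order_realization[OF fin'] by blast
      then show False using tops by blast
    qed
    moreover have "Field Q = insert \<beta> (insert \<alpha> K)" using F by blast
    ultimately show ?thesis
      by (rule gen) (use ne up tops in auto)
  qed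
qed

text \<open>The realization is a square with \<open>a\<close>, \<open>b\<close> at the ends of the
  real axis and \<open>c\<close>, \<open>y\<close> at those of the imaginary axis: the unit circle
  of the norm \<open>n\<close>. The round circle is projected radially onto it. Dividing by
  \<open>q\<close> first turns the base point into the vertex \<open>a\<close>, where the coordinate
  at \<open>b\<close> is 0.\<close>

lemma homeomorphic_map_circle_arc:
  assumes b: "b \<in> M" and Lb: "L b = {c, y}" and cy: "c \<noteq> y" "(c, y) \<notin> r" "(y, c) \<notin> r"
    and q: "q \<in> sphere (0::complex) 1"
  shows "\<exists>\<theta>. homeomorphic_map (top_of_set (sphere (0::complex) 1)) (order_realization (arc_poset b)) \<theta> \<and> \<theta> q b = 0"
proof -
  let ?S = "sphere (0::complex) 1"
  have ca: "(c, a) \<in> r" "(y, a) \<in> r" "c \<noteq> a" "y \<noteq> a" using L_below_a[OF b] Lb by auto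
  have cb: "(c, b) \<in> r" "(y, b) \<in> r" "c \<noteq> b" "y \<noteq> b" using Lb L_iff by blast+
  have ab: "a \<noteq> b" using M_not_a[OF b] by simp
  have rf: "(a, a) \<in> r" "(b, b) \<in> r" "(c, c) \<in> r" "(y, y) \<in> r"
    using Partial_order_refl[OF po] a_Field M_Field[OF b] ca by (auto simp: Field_def)
  have q0: "q \<noteq> 0" "cmod q = 1" using q by auto
  define n where "n = (\<lambda>w. \<bar>Re w\<bar> + \<bar>Im w\<bar>)"
  have n0: "n w > 0" if "w \<noteq> 0" for w using that by (auto simp: n_def complex_eq_iff add_pos_nonneg add_nonneg_pos)
  define co where "co = (\<lambda>w v. if v = a then max 0 (Re w) else if v = b then max 0 (- Re w)
     else if v = c then max 0 (Im w) else if v = y then max 0 (- Im w) else (0::real))"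
  define \<theta> where "\<theta> = (\<lambda>z v. co (z / q) v / n (z / q))"
  have co0: "co w v \<ge> 0" for w v by (simp add: co_def)
  have cov: "co w a = max 0 (Re w)" "co w b = max 0 (- Re w)" "co w c = max 0 (Im w)" "co w y = max 0 (- Im w)" for w
    using ca cb ab cy by (auto simp: co_def)
  have zq: "z / q \<noteq> 0" if "z \<in> ?S" for z using that q0 by auto
  have \<theta>T: "\<theta> z \<in> topspace (order_realization (arc_poset b))" if z: "z \<in> ?S" for z
    unfolding topspace_arc[OF b] Lb
  proof (intro conjI allI impI)
    let ?w = "z / q"
    have npos: "n ?w > 0" by (rule n0[OF zq[OF z]])
    show "0 \<le> \<theta> z v" for v using co0 npos by (simp add: \<theta>_def)
    have pos: "co ?w v > 0" if "\<theta> z v > 0" for v using that npos by (simp add: \<theta>_def zero_less_divide_iff)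
    show "v \<in> insert a (insert b {c, y})" if "\<theta> z v > 0" for v
      using pos[OF that] by (auto simp: co_def split: if_splits)
    show "(v, w) \<in> r \<or> (w, v) \<in> r" if "\<theta> z v > 0" "\<theta> z w > 0" for v w
      using pos[OF that(1)] pos[OF that(2)] ca cb rf by (auto simp: co_def split: if_splits)
    have "\<theta> z a + \<theta> z b + (\<Sum>v\<in>{c, y}. \<theta> z v) = (max 0 (Re ?w) + max 0 (- Re ?w) + max 0 (Im ?w) + max 0 (- Im ?w)) / n ?w"
      using cy by (simp add: \<theta>_def cov add_divide_distrib)
    also have "max 0 (Re ?w) + max 0 (- Re ?w) + max 0 (Im ?w) + max 0 (- Im ?w) = n ?w"
      by (auto simp: n_def max_def abs_if)
    finally show "\<theta> z a + \<theta> z b + (\<Sum>v\<in>{c, y}. \<theta> z v) = 1" using npos by simp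
  qed
  have cont: "continuous_map (top_of_set ?S) (order_realization (arc_poset b)) \<theta>"
  proof (rule continuous_map_into_order_realization)
    fix v
    have "n (z / q) \<noteq> 0" if "z \<in> ?S" for z using n0[OF zq[OF that]] by simp
    moreover have "continuous_on ?S (\<lambda>z. co (z / q) v)"
      by (cases "v = a"; cases "v = b"; cases "v = c"; cases "v = y"; simp add: co_def; intro continuous_intros; simp add: q0)
    moreover have "continuous_on ?S (\<lambda>z. n (z / q))"
      unfolding n_def by (intro continuous_intros) (simp_all add: q0)
    ultimately show "continuous_map (top_of_set ?S) euclideanreal (\<lambda>z. \<theta> z v)"
      unfolding \<theta>_def by (simp add: continuous_on_divide)
  qed (use \<theta>T in auto)
  have rec: "Re (z / q) = n (z / q) * (\<theta> z a - \<theta> z b)" "Im (z / q) = n (z / q) * (\<theta> z c - \<theta> z y)" if z: "z \<in> ?S" for z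
  proof -
    have "n (z / q) \<noteq> 0" using n0[OF zq[OF z]] by simp
    then show "Re (z / q) = n (z / q) * (\<theta> z a - \<theta> z b)" "Im (z / q) = n (z / q) * (\<theta> z c - \<theta> z y)"
      by (auto simp: \<theta>_def cov max_def right_diff_distrib)
  qed
  have inj: "inj_on \<theta> ?S"
  proof (rule inj_onI)
    fix z z' assume z: "z \<in> ?S" "z' \<in> ?S" and eq: "\<theta> z = \<theta> z'"
    let ?X = "\<theta> z a - \<theta> z b" and ?Y = "\<theta> z c - \<theta> z y"
    \<comment> \<open>The radial factor can be recovered from the image, since points of the circle
      have Euclidean norm 1.\<close>
    have sq: "(n (x / q))\<^sup>2 * (?X\<^sup>2 + ?Y\<^sup>2) = 1" if "x \<in> ?S" "\<theta> x = \<theta> z" for x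
    proof -
      have "cmod (x / q) = 1" using that q0 by (simp add: norm_divide)
      then have "(Re (x / q))\<^sup>2 + (Im (x / q))\<^sup>2 = 1" by (simp add: cmod_def)
      then show ?thesis using rec[OF that(1)] that(2) by (simp add: power_mult_distrib distrib_left)
    qed
    have "(n (z / q))\<^sup>2 * (?X\<^sup>2 + ?Y\<^sup>2) = (n (z' / q))\<^sup>2 * (?X\<^sup>2 + ?Y\<^sup>2)"
      using sq[OF z(1)] sq[OF z(2)] eq by simp
    moreover have "?X\<^sup>2 + ?Y\<^sup>2 \<noteq> 0" using sq[OF z(1)] by auto
    ultimately have "(n (z / q))\<^sup>2 = (n (z' / q))\<^sup>2" by (metis mult_right_cancel)
    then have "n (z / q) = n (z' / q)"
      using n0[OF zq[OF z(1)]] n0[OF zq[OF z(2)]] by (simp add: power2_eq_iff_nonneg)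
    then have "z / q = z' / q"
      using rec[OF z(1)] rec[OF z(2)] eq by (simp add: complex_eq_iff)
    then show "z = z'" using q0 by simp
  qed
  have surj: "\<theta> ` ?S = topspace (order_realization (arc_poset b))"
  proof (intro equalityI subsetI)
    fix t assume t: "t \<in> topspace (order_realization (arc_poset b))"
    have nn: "0 \<le> t v" and sp: "t v > 0 \<Longrightarrow> v \<in> {a, b, c, y}"
      and ch: "t v > 0 \<Longrightarrow> t w > 0 \<Longrightarrow> (v, w) \<in> r \<or> (w, v) \<in> r" for v w
      using t unfolding topspace_arc[OF b] Lb by blast+
    have sum: "t a + t b + t c + t y = 1"
      using t cy unfolding topspace_arc[OF b] Lb by (simp add: add.assoc)
    have abz: "t a = 0 \<or> t b = 0" using arc_not_both[OF b t] nn[of b] by force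
    have cyz: "t c = 0 \<or> t y = 0" using ch[of c y] cy nn[of c] nn[of y] by force
    \<comment> \<open>The point of the square with these barycentric coordinates; of two opposite
      ones at most one is nonzero. Division by its Euclidean norm and rotation by \<open>q\<close>
      give the preimage.\<close>
    define w where "w = Complex (t a - t b) (t c - t y)"
    have nw: "n w = 1" using abz cyz sum nn by (auto simp: n_def w_def)
    then have w0: "w \<noteq> 0" by (auto simp: n_def)
    define k where "k = inverse (cmod w)"
    have k: "k > 0" using w0 by (simp add: k_def)
    define z where "z = of_real k * w * q"
    have zS: "z \<in> ?S" using w0 q0 by (simp add: z_def norm_mult k_def norm_inverse)
    have zw: "z / q = of_real k * w" using q0 by (simp add: z_def)
    have "n (of_real k * w) = k * n w" using k by (simp add: n_def abs_mult distrib_left)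
    then have nz: "n (z / q) = k" using nw by (simp add: zw)
    have mk: "max 0 (k * x) = k * max 0 x" for x using max_mult_distrib_left[of k 0 x] k by simp
    have mk': "max 0 (- (k * x)) = k * max 0 (- x)" for x using mk[of "- x"] by simp
    have "max 0 (t a - t b) = t a" "max 0 (t b - t a) = t b" using abz nn[of a] nn[of b] by auto
    moreover have "max 0 (t c - t y) = t c" "max 0 (t y - t c) = t y" using cyz nn[of c] nn[of y] by auto
    ultimately have cow: "co w a = t a" "co w b = t b" "co w c = t c" "co w y = t y"
      unfolding cov by (simp_all add: w_def)
    have "\<theta> z v = t v" for v
    proof -
      have "co (z / q) v = k * co w v"
        by (simp add: zw co_def mk mk')
      then have "\<theta> z v = co w v" using nz k by (simp add: \<theta>_def)
      also have "co w v = t v"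
      proof (cases "v \<in> {a, b, c, y}")
        case True
        then show ?thesis using cow by auto
      next
        case False
        then have "\<not> t v > 0" using sp[of v] by blast
        then have "t v = 0" using nn[of v] by linarith
        then show ?thesis using False by (simp add: co_def)
      qed
      finally show ?thesis .
    qed
    then show "t \<in> \<theta> ` ?S" using zS by (intro image_eqI[of _ _ z]) auto
  qed (use \<theta>T in auto)
  have "closed_map (top_of_set ?S) (order_realization (arc_poset b)) \<theta>"
    by (rule continuous_imp_closed_map_gen[OF _ _ cont])
      (simp_all add: compact_space_subtopology Hausdorff_imp_kc_space Hausdorff_space_order_realization)
  then have "homeomorphic_map (top_of_set ?S) (order_realization (arc_poset b)) \<theta>"
    using cont inj surj by (intro bijective_closed_imp_homeomorphic_map) auto
  moreover have "\<theta> q b = 0" using q0 by (simp add: \<theta>_def cov)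
  ultimately show ?thesis by blast
qed

end

section \<open>Wedges described by their closed pieces\<close>

definition closed_embedding :: "'a topology \<Rightarrow> 'b topology \<Rightarrow> ('a \<Rightarrow> 'b) \<Rightarrow> bool" where
  "closed_embedding X Y g \<longleftrightarrow> continuous_map X Y g \<and> closed_map X Y g \<and> inj_on g (topspace X)"

lemma closed_embedding_compose:
  assumes f: "closed_embedding X Y f" and g: "closed_embedding Y Z g"
  shows "closed_embedding X Z (g \<circ> f)"
proof -
  have "f ` topspace X \<subseteq> topspace Y" using f by (auto simp: closed_embedding_def continuous_map_def)
  then have "inj_on (g \<circ> f) (topspace X)"
    using f g by (intro comp_inj_on) (auto simp: closed_embedding_def intro: inj_on_subset)
  then show ?thesis
    using f g continuous_map_compose[of X Y f Z g] closed_map_compose[of X Y f Z g] by (simp add: closed_embedding_def)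
qed

lemma closed_embedding_closedin: "closed_embedding X Y g \<Longrightarrow> closedin Y (g ` topspace X)"
  by (auto simp: closed_embedding_def closed_map_def)

lemma closed_embedding_homeomorphic_map:
  assumes g: "closed_embedding X Y g"
  shows "homeomorphic_map X (subtopology Y (g ` topspace X)) g"
proof (rule bijective_closed_imp_homeomorphic_map)
  have c: "continuous_map X Y g" and cl: "closed_map X Y g" using g by (auto simp: closed_embedding_def)
  show "continuous_map X (subtopology Y (g ` topspace X)) g"
    using c by (simp add: continuous_map_in_subtopology image_subset_iff_funcset[symmetric])
  show "closed_map X (subtopology Y (g ` topspace X)) g"
    using cl by (rule closed_map_into_subtopology) auto
  show "g ` topspace X = topspace (subtopology Y (g ` topspace X))"
    using c by (auto simp: continuous_map_def)
  show "inj_on g (topspace X)" using g by (simp add: closed_embedding_def)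
qed

lemma closed_embedding_transfer:
  assumes g: "closed_embedding E W g" and \<theta>: "homeomorphic_map E T \<theta>" and e: "e \<in> topspace E" "\<theta> e b = 0"
  shows "\<exists>\<theta>'. homeomorphic_map (subtopology W (g ` topspace E)) T \<theta>' \<and> \<theta>' (g e) b = 0"
proof -
  obtain h where "homeomorphic_maps E (subtopology W (g ` topspace E)) g h"
    using closed_embedding_homeomorphic_map[OF g] by (auto simp: homeomorphic_map_maps)
  then have h: "homeomorphic_map (subtopology W (g ` topspace E)) E h" "h (g e) = e"
    using e(1) by (auto simp: homeomorphic_maps_map)
  have "homeomorphic_map (subtopology W (g ` topspace E)) T (\<theta> \<circ> h)"
    using h(1) \<theta> by (rule homeomorphic_map_compose)
  then show ?thesis using h(2) e(2) by (intro exI[of _ "\<theta> \<circ> h"]) simp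
qed

lemma quotient_topology_inj:
  assumes "inj f"
  shows "homeomorphic_map X (quotient_topology X f) f"
  using quotient_map_quotient_topology assms by (auto simp: homeomorphic_map_def intro: inj_on_subset)

lemma closed_embedding_quotient_topology: "inj f \<Longrightarrow> closed_embedding X (quotient_topology X f) f"
  using quotient_topology_inj[of f X]
  by (auto simp: closed_embedding_def homeomorphic_eq_everything_map intro: inj_on_subset)

definition wedge_point :: "('i \<Rightarrow> 'a) \<Rightarrow> 'i \<Rightarrow> 'a \<Rightarrow> ('i \<times> 'a) option" where
  "wedge_point y i x = (if x = y i then None else Some (i, x))"

lemma topspace_wedge:
  assumes "\<And>i. i \<in> I \<Longrightarrow> y i \<in> topspace (E i)"
  shows "topspace (wedge I E y) = insert None (\<Union>i\<in>I. wedge_point y i ` topspace (E i))"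
proof (cases "I = {}")
  case False
  then obtain i where "i \<in> I" by blast
  then have "None \<in> (\<Union>i\<in>I. wedge_point y i ` topspace (E i))"
    using assms by (intro UN_I[of i] image_eqI[of _ _ "y i"]) (auto simp: wedge_point_def)
  moreover have "topspace (wedge I E y) = (\<Union>i\<in>I. wedge_point y i ` topspace (E i))"
    using False by (force simp: wedge_def wedge_point_def topspace_sum_topology)
  ultimately show ?thesis by auto
qed (simp add: wedge_def)

text \<open>The image of a closed set meets any other summand in its base point or not at all, so
  closed base points make the inclusion closed.\<close>

lemma closed_embedding_wedge_point:
  assumes i: "i \<in> I" and y: "\<And>i. i \<in> I \<Longrightarrow> y i \<in> topspace (E i)" and H: "\<And>i. i \<in> I \<Longrightarrow> closedin (E i) {y i}"
  shows "closed_embedding (E i) (wedge I E y) (wedge_point y i)"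
  unfolding closed_embedding_def
proof (intro conjI)
  let ?f = "\<lambda>(i, x). if x = y i then None else Some (i, x)"
  have W: "wedge I E y = quotient_topology (sum_topology E I) ?f" using i by (auto simp: wedge_def)
  have q: "quotient_map (sum_topology E I) (wedge I E y) ?f"
    unfolding W by (rule quotient_map_quotient_topology)
  have e: "wedge_point y i = ?f \<circ> Pair i" by (auto simp: wedge_point_def)
  show "continuous_map (E i) (wedge I E y) (wedge_point y i)"
    unfolding e by (rule continuous_map_compose[OF continuous_map_component_injection[OF i] quotient_imp_continuous_map[OF q]])
  show "inj_on (wedge_point y i) (topspace (E i))"
    by (auto simp: inj_on_def wedge_point_def split: if_splits)
  show "closed_map (E i) (wedge I E y) (wedge_point y i)"
    unfolding closed_map_def
  proof (intro allI impI)
    fix C assume C: "closedin (E i) C"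
    have sub: "C \<subseteq> topspace (E i)" by (rule closedin_subset[OF C])
    have WC: "wedge_point y i ` C \<subseteq> topspace (wedge I E y)"
      using topspace_wedge[of I y E, OF y] i sub by blast
    have "closedin (sum_topology E I) {p \<in> topspace (sum_topology E I). ?f p \<in> wedge_point y i ` C}"
      unfolding closedin_sum_topology
    proof (intro conjI ballI)
      fix j assume j: "j \<in> I"
      have "{x. (j, x) \<in> {p \<in> topspace (sum_topology E I). ?f p \<in> wedge_point y i ` C}} =
          (if j = i then C else if y i \<in> C then {y j} else {})"
        using j sub y[OF i] y[OF j] by (auto simp: wedge_point_def topspace_sum_topology split: if_splits)
      moreover have "closedin (E j) {y j}"
        by (rule H[OF j])
      ultimately show "closedin (E j) {x. (j, x) \<in> {p \<in> topspace (sum_topology E I). ?f p \<in> wedge_point y i ` C}}"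
        using C by simp
    qed auto
    then show "closedin (wedge I E y) (wedge_point y i ` C)"
      using q WC unfolding quotient_map_closedin by blast
  qed
qed

lemma Field_map_prod: "Field (map_prod f f ` R) = f ` Field R"
  by (force simp: Field_def)

lemma map_prod_iff:
  assumes "inj_on f (Field R)" "x \<in> Field R" "y \<in> Field R"
  shows "(f x, f y) \<in> map_prod f f ` R \<longleftrightarrow> (x, y) \<in> R"
proof
  assume "(f x, f y) \<in> map_prod f f ` R"
  then obtain x' y' where "(x', y') \<in> R" "f x = f x'" "f y = f y'" by auto
  then show "(x, y) \<in> R" using assms by (metis FieldI1 FieldI2 inj_onD)
qed force

lemma closed_embedding_subtopology:
  assumes g: "closed_embedding X Y g" and S: "closedin X S"
  shows "closed_embedding (subtopology X S) Y g"
  unfolding closed_embedding_def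
proof (intro conjI)
  show "continuous_map (subtopology X S) Y g"
    using g by (simp add: closed_embedding_def continuous_map_from_subtopology)
  show "closed_map (subtopology X S) Y g"
    using g S by (auto simp: closed_embedding_def closed_map_def closedin_closed_subtopology)
  show "inj_on g (topspace (subtopology X S))"
    using g by (auto simp: closed_embedding_def intro: inj_on_subset)
qed

lemma closed_embedding_closed_image: "closed_embedding X Y g \<Longrightarrow> closedin X C \<Longrightarrow> closedin Y (g ` C)"
  by (simp add: closed_embedding_def closed_map_def)

lemma closedin_wedge_base:
  assumes y: "\<And>i. i \<in> I \<Longrightarrow> closedin (E i) {y i}"
  shows "closedin (wedge I E y) {None}"
proof (cases "I = {}")
  case False
  then obtain i where i: "i \<in> I" by blast
  have "closed_map (E i) (wedge I E y) (wedge_point y i)"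
    using closed_embedding_wedge_point[of i I y E] i y closedin_subset[OF y] by (auto simp: closed_embedding_def)
  then have "closedin (wedge I E y) (wedge_point y i ` {y i})" using y[OF i] unfolding closed_map_def by blast
  then show ?thesis by (simp add: wedge_point_def)
qed (simp add: wedge_def)

context fan begin

text \<open>\<open>\<theta> w b = 0\<close> puts the wedge point into the face opposite to
  \<open>b\<close>, where \<open>arc_pointed_contraction\<close> can contract towards it.\<close>

definition arc_in :: "'w topology \<Rightarrow> 'w \<Rightarrow> 'a \<Rightarrow> 'w set \<Rightarrow> bool" where
  "arc_in W w b V \<longleftrightarrow> closedin W V \<and> w \<in> V \<and>
     (\<exists>\<theta>. homeomorphic_map (subtopology W V) (order_realization (arc_poset b)) \<theta> \<and> \<theta> w b = 0)"

definition arc_cover :: "'w topology \<Rightarrow> 'w set \<Rightarrow> 'w \<Rightarrow> 'a set \<Rightarrow> bool" where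
  "arc_cover W S w N \<longleftrightarrow> (\<exists>V. S = insert w (\<Union>b\<in>N. V b) \<and> (\<forall>b\<in>N. arc_in W w b (V b)) \<and>
     (\<forall>b\<in>N. \<forall>b'\<in>N. b \<noteq> b' \<longrightarrow> V b \<inter> V b' \<subseteq> {w}))"

lemma arc_cover_embedding:
  assumes W: "arc_cover W S w N" and g: "closed_embedding W W' g" and S: "S \<subseteq> topspace W"
  shows "arc_cover W' (g ` S) (g w) N"
proof -
  obtain V where V: "S = insert w (\<Union>b\<in>N. V b)" "\<forall>b\<in>N. arc_in W w b (V b)"
    "\<forall>b\<in>N. \<forall>b'\<in>N. b \<noteq> b' \<longrightarrow> V b \<inter> V b' \<subseteq> {w}"
    using W unfolding arc_cover_def by (elim exE conjE) (rule that)
  have inj: "inj_on g (topspace W)" using g by (simp add: closed_embedding_def)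
  show ?thesis
    unfolding arc_cover_def
  proof (intro exI[of _ "\<lambda>b. g ` V b"] conjI ballI impI)
    show "g ` S = insert (g w) (\<Union>b\<in>N. g ` V b)" unfolding V(1) by blast
    fix b assume b: "b \<in> N"
    have "arc_in W w b (V b)" using V(2) b by blast
    then obtain \<theta> where cl: "closedin W (V b)" and wV: "w \<in> V b"
      and \<theta>: "homeomorphic_map (subtopology W (V b)) (order_realization (arc_poset b)) \<theta>" "\<theta> w b = 0"
      unfolding arc_in_def by (elim exE conjE) (rule that)
    have top: "topspace (subtopology W (V b)) = V b" using closedin_subset[OF cl] by auto
    have "closedin W' (g ` V b)" using g cl by (auto simp: closed_embedding_def closed_map_def)
    moreover have "g w \<in> g ` V b" using wV by simp
    moreover have "\<exists>\<theta>. homeomorphic_map (subtopology W' (g ` V b)) (order_realization (arc_poset b)) \<theta> \<and> \<theta> (g w) b = 0"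
      by (rule closed_embedding_transfer[OF closed_embedding_subtopology[OF g cl] \<theta>(1), of w b, unfolded top])
        (simp_all add: \<theta>(2) wV)
    ultimately show "arc_in W' (g w) b (g ` V b)" unfolding arc_in_def by (intro conjI)
    fix b' assume b': "b' \<in> N" "b \<noteq> b'"
    have "V b \<subseteq> topspace W" "V b' \<subseteq> topspace W" using b b' S V(1) by blast+
    then have "g ` V b \<inter> g ` V b' = g ` (V b \<inter> V b')" using inj by (simp add: inj_on_image_Int)
    moreover have "V b \<inter> V b' \<subseteq> {w}" using V(3) b b' by blast
    ultimately show "g ` V b \<inter> g ` V b' \<subseteq> {g w}" by auto
  qed
qed

lemma arc_cover_Un:
  assumes 1: "arc_cover W S w N" and 2: "arc_cover W S' w N'" and S: "S \<inter> S' \<subseteq> {w}" and N: "N \<inter> N' = {}"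
  shows "arc_cover W (S \<union> S') w (N \<union> N')"
proof -
  obtain V where V: "S = insert w (\<Union>b\<in>N. V b)" "\<forall>b\<in>N. arc_in W w b (V b)"
    "\<forall>b\<in>N. \<forall>b'\<in>N. b \<noteq> b' \<longrightarrow> V b \<inter> V b' \<subseteq> {w}"
    using 1 unfolding arc_cover_def by (elim exE conjE) (rule that)
  obtain V' where V': "S' = insert w (\<Union>b\<in>N'. V' b)" "\<forall>b\<in>N'. arc_in W w b (V' b)"
    "\<forall>b\<in>N'. \<forall>b'\<in>N'. b \<noteq> b' \<longrightarrow> V' b \<inter> V' b' \<subseteq> {w}"
    using 2 unfolding arc_cover_def by (elim exE conjE) (rule that)
  define U where "U = (\<lambda>b. if b \<in> N then V b else V' b)"
  have UN: "U b = V b" if "b \<in> N" for b using that by (simp add: U_def)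
  have UN': "U b = V' b" if "b \<in> N'" for b using that N by (auto simp: U_def)
  have cross: "V b \<inter> V' b' \<subseteq> {w}" if "b \<in> N" "b' \<in> N'" for b b'
    using that S unfolding V(1) V'(1) by blast
  show ?thesis
    unfolding arc_cover_def
  proof (intro exI[of _ U] conjI)
    have u: "(\<Union>b\<in>N. U b) = (\<Union>b\<in>N. V b)" "(\<Union>b\<in>N'. U b) = (\<Union>b\<in>N'. V' b)"
      using UN UN' by simp_all
    show "S \<union> S' = insert w (\<Union>b\<in>N \<union> N'. U b)"
      unfolding V(1) V'(1) UN_Un u by simp
    show "\<forall>b\<in>N \<union> N'. arc_in W w b (U b)"
      using V(2) V'(2) UN UN' by (simp add: ball_Un)
    show "\<forall>b\<in>N \<union> N'. \<forall>b'\<in>N \<union> N'. b \<noteq> b' \<longrightarrow> U b \<inter> U b' \<subseteq> {w}"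
    proof (intro ballI impI)
      fix b b' assume b: "b \<in> N \<union> N'" "b' \<in> N \<union> N'" "b \<noteq> b'"
      consider "b \<in> N" "b' \<in> N" | "b \<in> N" "b' \<in> N'" | "b \<in> N'" "b' \<in> N" | "b \<in> N'" "b' \<in> N'" using b by blast
      then show "U b \<inter> U b' \<subseteq> {w}"
      proof cases
        case 1
        then show ?thesis using V(3) b(3) by (simp add: UN)
      next
        case 2
        then show ?thesis using cross[of b b'] by (simp add: UN UN')
      next
        case 3
        then show ?thesis using cross[of b' b] by (simp add: UN UN' Int_commute)
      next
        case 4
        then show ?thesis using V'(3) b(3) by (simp add: UN')
      qed
    qed
  qed
qed

text \<open>Each summand is embedded as a closed set, and different summands meet only in
  \<open>None\<close>; the bijection \<open>\<nu>\<close> renames the summands to maximal points of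
  the fan.\<close>

lemma arc_cover_wedge:
  assumes \<nu>: "bij_betw \<nu> I N" and y: "\<And>i. i \<in> I \<Longrightarrow> closedin (E i) {y i}"
    and arcs: "\<And>i. i \<in> I \<Longrightarrow> \<exists>\<theta>. homeomorphic_map (E i) (order_realization (arc_poset (\<nu> i))) \<theta> \<and> \<theta> (y i) (\<nu> i) = 0"
  shows "arc_cover (wedge I E y) (topspace (wedge I E y)) None N"
proof -
  let ?W = "wedge I E y"
  have yE: "y i \<in> topspace (E i)" if "i \<in> I" for i using closedin_subset[OF y[OF that]] by simp
  define V where "V = (\<lambda>b. wedge_point y (inv_into I \<nu> b) ` topspace (E (inv_into I \<nu> b)))"
  have inv: "inv_into I \<nu> b \<in> I" "\<nu> (inv_into I \<nu> b) = b" if "b \<in> N" for b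
    using that \<nu> by (auto simp: bij_betw_def inv_into_into f_inv_into_f)
  have emb: "closed_embedding (E i) ?W (wedge_point y i)" if "i \<in> I" for i
    by (rule closed_embedding_wedge_point[OF that yE y])
  show ?thesis
    unfolding arc_cover_def
  proof (intro exI[of _ V] conjI ballI impI)
    have "inv_into I \<nu> ` N = I" using \<nu> by (metis bij_betw_def bij_betw_inv_into)
    moreover have "(\<Union>b\<in>N. V b) = (\<Union>i\<in>inv_into I \<nu> ` N. wedge_point y i ` topspace (E i))" by (simp add: V_def)
    ultimately have "(\<Union>b\<in>N. V b) = (\<Union>i\<in>I. wedge_point y i ` topspace (E i))" by simp
    then show "topspace ?W = insert None (\<Union>b\<in>N. V b)" using topspace_wedge[of I y E, OF yE] by simp
    fix b assume b: "b \<in> N"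
    let ?i = "inv_into I \<nu> b"
    have base: "wedge_point y ?i (y ?i) = None" by (simp add: wedge_point_def)
    have "closedin ?W (V b)" unfolding V_def by (rule closed_embedding_closedin[OF emb[OF inv(1)[OF b]]])
    moreover have "None \<in> V b" unfolding V_def using base yE[OF inv(1)[OF b]] by (metis image_eqI)
    moreover obtain \<theta> where \<theta>: "homeomorphic_map (E ?i) (order_realization (arc_poset b)) \<theta>" "\<theta> (y ?i) b = 0"
      using arcs[OF inv(1)[OF b]] unfolding inv(2)[OF b] by (elim exE conjE) (rule that)
    have "\<exists>\<theta>. homeomorphic_map (subtopology ?W (V b)) (order_realization (arc_poset b)) \<theta> \<and> \<theta> None b = 0"
      unfolding V_def
      by (rule closed_embedding_transfer[OF emb[OF inv(1)[OF b]] \<theta>(1), of "y ?i" b, unfolded base])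
        (simp_all add: \<theta>(2) yE[OF inv(1)[OF b]])
    ultimately show "arc_in ?W None b (V b)" unfolding arc_in_def by (intro conjI)
    fix b' assume b': "b' \<in> N" "b \<noteq> b'"
    have "?i \<noteq> inv_into I \<nu> b'" using inv(2)[OF b] inv(2)[OF b'(1)] b'(2) by metis
    then show "V b \<inter> V b' \<subseteq> {None}" unfolding V_def by (auto simp: wedge_point_def split: if_splits)
  qed
qed

lemma arc_cover_wedge2:
  assumes X: "arc_cover X (topspace X) x N" "closedin X {x}" and Y: "arc_cover Y (topspace Y) y N'" "closedin Y {y}"
    and N: "N \<inter> N' = {}"
  shows "arc_cover (wedge2 X x Y y) (topspace (wedge2 X x Y y)) None (N \<union> N')"
proof -
  let ?E = "\<lambda>i. if i then quotient_topology X Inl else quotient_topology Y Inr"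
  let ?y = "\<lambda>i. if i then Inl x else Inr y"
  let ?W = "wedge2 X x Y y"
  have W: "?W = wedge UNIV ?E ?y" by (simp add: wedge2_def)
  have l: "closed_embedding X (?E True) Inl" and r: "closed_embedding Y (?E False) Inr"
    by (simp_all add: closed_embedding_quotient_topology)
  have "closedin (?E True) (Inl ` {x})" "closedin (?E False) (Inr ` {y})"
    by (rule closed_embedding_closed_image[OF l X(2)], rule closed_embedding_closed_image[OF r Y(2)])
  then have cl: "closedin (?E i) {?y i}" for i by (cases i) simp_all
  have mem: "?y i \<in> topspace (?E i)" for i using closedin_subset[OF cl[of i]] by simp
  have e: "closed_embedding (?E i) ?W (wedge_point ?y i)" for i
    unfolding W by (rule closed_embedding_wedge_point[OF _ mem cl]) simp
  let ?f = "wedge_point ?y True \<circ> Inl" and ?g = "wedge_point ?y False \<circ> Inr"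
  have f: "closed_embedding X ?W ?f" using closed_embedding_compose[OF l e[of True]] .
  have g: "closed_embedding Y ?W ?g" using closed_embedding_compose[OF r e[of False]] .
  have base: "?f x = None" "?g y = None" by (simp_all add: wedge_point_def)
  have "arc_cover ?W (?f ` topspace X) None N" "arc_cover ?W (?g ` topspace Y) None N'"
    using arc_cover_embedding[OF X(1) f] arc_cover_embedding[OF Y(1) g] unfolding base by simp_all
  moreover have "?f ` topspace X \<inter> ?g ` topspace Y \<subseteq> {None}"
    by (auto simp: wedge_point_def)
  ultimately have "arc_cover ?W (?f ` topspace X \<union> ?g ` topspace Y) None (N \<union> N')"
    by (rule arc_cover_Un) (rule N)
  moreover have "topspace ?W = ?f ` topspace X \<union> ?g ` topspace Y"
  proof -
    have "None \<in> ?f ` topspace X" using closedin_subset[OF X(2)] base by (metis image_eqI insert_subset)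
    moreover have "topspace ?W = insert None (\<Union>i\<in>UNIV. wedge_point ?y i ` topspace (?E i))"
      unfolding W by (rule topspace_wedge[OF mem])
    ultimately show ?thesis by (auto simp: UNIV_bool image_comp)
  qed
  ultimately show ?thesis by simp
qed

text \<open>The map is the collapse onto \<open>cone_wedge\<close> followed by
  \<open>cone_map\<close>.\<close>

lemma lifting_map_arc_cover:
  assumes "arc_cover W (topspace W) w M"
  shows "\<exists>q. lifting_map W (poset_topology r) q"
proof -
  obtain V where V: "topspace W = insert w (\<Union>b\<in>M. V b)" "\<forall>b\<in>M. arc_in W w b (V b)"
    "\<forall>b\<in>M. \<forall>b'\<in>M. b \<noteq> b' \<longrightarrow> V b \<inter> V b' \<subseteq> {w}"
    using assms unfolding arc_cover_def by (elim exE conjE) (rule that)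
  have arcs: "closedin W (V b)" "w \<in> V b"
    "\<exists>\<theta>. homeomorphic_map (subtopology W (V b)) (order_realization (arc_poset b)) \<theta> \<and> \<theta> w b = 0" if "b \<in> M" for b
    using V(2) that unfolding arc_in_def by simp_all
  have "\<exists>\<theta>. \<forall>b\<in>M. homeomorphic_map (subtopology W (V b)) (order_realization (arc_poset b)) (\<theta> b) \<and> \<theta> b w b = 0"
    by (rule bchoice) (simp add: arcs(3))
  then obtain \<theta> where \<theta>: "\<forall>b\<in>M. homeomorphic_map (subtopology W (V b)) (order_realization (arc_poset b)) (\<theta> b) \<and> \<theta> b w b = 0"
    by (elim exE) (rule that)
  have "\<exists>q. lifting_map W cone_wedge q"
  proof (rule lifting_map_wedge[of w W V \<theta>])
    show "topspace W = insert w (\<Union>b\<in>M. V b)" by (rule V(1))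
    then show "w \<in> topspace W" by simp
    show "w' = w" if "b \<in> M" "b' \<in> M" "b \<noteq> b'" "w' \<in> V b" "w' \<in> V b'" for b b' w' using V(3) that by blast
  qed (simp_all add: arcs \<theta>)
  then obtain q where "lifting_map W cone_wedge q" by (elim exE) (rule that)
  then show ?thesis by (intro exI) (rule lifting_map_compose[OF _ lifting_map_cone_map])
qed

lemma homeomorphic_map_suspension_arc:
  assumes b: "b \<in> M" and fin: "finite (Field R)" and \<iota>: "bij_betw \<iota> (Field (nh_susp n R)) (L b)"
    and iso: "\<And>x y. x \<in> Field (nh_susp n R) \<Longrightarrow> y \<in> Field (nh_susp n R) \<Longrightarrow> (\<iota> x, \<iota> y) \<in> r \<longleftrightarrow> (x, y) \<in> nh_susp n R"
    and p: "p \<in> topspace (susp_real (Suc n) R)"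
  shows "\<exists>\<theta>. homeomorphic_map (susp_real (Suc n) R) (order_realization (arc_poset b)) \<theta> \<and> \<theta> p b = 0"
proof (rule homeomorphic_map_arc[where \<alpha> = "Inr (n, False)" and \<beta> = "Inr (n, True)", OF b _ _ _ _ _ \<iota> _ _ _ _ _ _ p])
  let ?K = "Field (nh_susp n R)"
  have new: "Inr (n, i) \<notin> ?K" for i by (auto simp: Field_nh_susp)
  have no: "(Inr (n, i), x) \<notin> nh_susp n R" "(x, Inr (n, i)) \<notin> nh_susp n R" for i x
    using new by (auto simp: Field_def)
  show "Field (nh_susp (Suc n) R) = insert (Inr (n, False)) (insert (Inr (n, True)) ?K)"
    by (auto simp: Field_adjoin_tops)
  show "finite ?K" using fin by (simp add: Field_nh_susp)
  show "Inr (n, False) \<noteq> (Inr (n, True) :: 'b + nat \<times> bool)" by simp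
  show "Inr (n, False) \<notin> ?K" "Inr (n, True) \<notin> ?K" by (fact new)+
  show "(\<iota> x, \<iota> y) \<in> r \<longleftrightarrow> (x, y) \<in> nh_susp (Suc n) R" if "x \<in> ?K" "y \<in> ?K" for x y
    using iso[OF that] that new by (auto simp: adjoin_tops_def)
  show "(x, Inr (n, False)) \<in> nh_susp (Suc n) R \<and> (x, Inr (n, True)) \<in> nh_susp (Suc n) R \<and>
      (Inr (n, False), x) \<notin> nh_susp (Suc n) R \<and> (Inr (n, True), x) \<notin> nh_susp (Suc n) R" if "x \<in> ?K" for x
    using that new no by (auto simp: adjoin_tops_def)
  show "(Inr (n, False), Inr (n, True)) \<notin> nh_susp (Suc n) R" "(Inr (n, True), Inr (n, False)) \<notin> nh_susp (Suc n) R"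
    "(Inr (n, False), Inr (n, False)) \<in> nh_susp (Suc n) R" "(Inr (n, True), Inr (n, True)) \<in> nh_susp (Suc n) R"
    using new no by (auto simp: adjoin_tops_def)
qed

lemma homeomorphic_map_suspension1_arc:
  assumes b: "b \<in> M" and fin: "finite (Field R)" and j: "bij_betw j (Field R) (L b)"
    and iso: "\<And>x y. x \<in> Field R \<Longrightarrow> y \<in> Field R \<Longrightarrow> (j x, j y) \<in> r \<longleftrightarrow> (x, y) \<in> R"
    and p: "p \<in> topspace (susp_real 1 R)"
  shows "\<exists>\<theta>. homeomorphic_map (susp_real 1 R) (order_realization (arc_poset b)) \<theta> \<and> \<theta> p b = 0"
  unfolding One_nat_def
proof (rule homeomorphic_map_suspension_arc[OF b fin])
  have F: "Field (nh_susp 0 R :: ('b + nat \<times> bool) rel) = Inl ` Field R" unfolding Field_nh_susp by auto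
  have "bij_betw projl (Inl ` Field R :: ('b + nat \<times> bool) set) (Field R)"
    by (auto simp: bij_betw_def inj_on_def image_image)
  then show "bij_betw (j \<circ> projl) (Field (nh_susp 0 R :: ('b + nat \<times> bool) rel)) (L b)"
    unfolding F using j by (rule bij_betw_trans)
  show "((j \<circ> projl) x, (j \<circ> projl) y) \<in> r \<longleftrightarrow> (x, y) \<in> nh_susp 0 R"
    if "x \<in> Field (nh_susp 0 R)" "y \<in> Field (nh_susp 0 R)" for x y :: "'b + nat \<times> bool"
    using that unfolding F by (auto simp: iso map_prod_iff)
  show "p \<in> topspace (susp_real (Suc 0) R)" using p by simp
qed

text \<open>The first suspension of the empty space is an antichain of two points, matched with
  \<open>c\<close> and \<open>y\<close>; the second adds the two points to be matched with
  \<open>a\<close> and \<open>b\<close>.\<close>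

lemma homeomorphic_map_suspension2_arc:
  assumes b: "b \<in> M" and Lb: "L b = {c, y}" and cy: "c \<noteq> y" "(c, y) \<notin> r" "(y, c) \<notin> r"
    and p: "p \<in> topspace (susp_real 2 ({} :: 'b rel))"
  shows "\<exists>\<theta>. homeomorphic_map (susp_real 2 ({} :: 'b rel)) (order_realization (arc_poset b)) \<theta> \<and> \<theta> p b = 0"
  unfolding numeral_2_eq_2
proof (rule homeomorphic_map_suspension_arc[OF b])
  let ?u = "Inr (0, False) :: 'b + nat \<times> bool" and ?v = "Inr (0, True) :: 'b + nat \<times> bool"
  have susp: "nh_susp (Suc 0) ({} :: 'b rel) = {(?u, ?u), (?v, ?v)}" by (auto simp: adjoin_tops_def)
  have F: "Field (nh_susp (Suc 0) ({} :: 'b rel)) = {?u, ?v}" unfolding susp by (auto simp: Field_def)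
  have refl: "(c, c) \<in> r" "(y, y) \<in> r"
    using L_below_a[OF b] Lb Partial_order_refl[OF po] by (auto simp: Field_def)
  show "finite (Field ({} :: 'b rel))" by simp
  show "bij_betw (\<lambda>x. if x = ?u then c else y) (Field (nh_susp (Suc 0) ({} :: 'b rel))) (L b)"
    unfolding F Lb using cy by (auto simp: bij_betw_def)
  show "((\<lambda>x. if x = ?u then c else y) x, (\<lambda>x. if x = ?u then c else y) x') \<in> r \<longleftrightarrow> (x, x') \<in> nh_susp (Suc 0) {}"
    if "x \<in> Field (nh_susp (Suc 0) {})" "x' \<in> Field (nh_susp (Suc 0) {})" for x x' :: "'b + nat \<times> bool"
    using that cy refl unfolding F susp by auto
  show "p \<in> topspace (susp_real (Suc (Suc 0)) ({} :: 'b rel))" using p by (simp add: numeral_2_eq_2)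
qed

end

section \<open>Assembling the two decompositions\<close>

lemma order_realization_nonempty:
  assumes fin: "finite (Field R)" and v: "(v, v) \<in> R"
  shows "(\<lambda>w. if w = v then 1 else 0) \<in> topspace (order_realization R)"
proof -
  have "v \<in> Field R" using v by (auto simp: Field_def)
  then show ?thesis
    using v fin by (simp add: topspace_order_realization[OF fin])
qed

lemma Partial_order_map_prod:
  assumes R: "Partial_order R" and f: "inj_on f (Field R)"
  shows "Partial_order (map_prod f f ` R)"
proof (rule Partial_orderI)
  have ex: "\<exists>x\<in>Field R. \<exists>y\<in>Field R. u = f x \<and> v = f y \<and> (x, y) \<in> R" if "(u, v) \<in> map_prod f f ` R" for u v
    using that by (auto intro: FieldI1 FieldI2)
  show "(u, u) \<in> map_prod f f ` R \<and> (v, v) \<in> map_prod f f ` R" if uv: "(u, v) \<in> map_prod f f ` R" for u v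
    using ex[OF uv] Partial_order_refl[OF R] by force
  show "(u, w) \<in> map_prod f f ` R" if uv: "(u, v) \<in> map_prod f f ` R" and vw: "(v, w) \<in> map_prod f f ` R" for u v w
  proof -
    obtain x y where xy: "x \<in> Field R" "y \<in> Field R" "u = f x" "v = f y" "(x, y) \<in> R" using ex[OF uv] by blast
    obtain y' z where yz: "y' \<in> Field R" "z \<in> Field R" "v = f y'" "w = f z" "(y', z) \<in> R" using ex[OF vw] by blast
    have "y = y'" using inj_onD[OF f] xy yz by metis
    then have "(x, z) \<in> R" using Partial_order_trans[OF R] xy yz by blast
    then show ?thesis using xy yz by force
  qed
  show "u = v" if uv: "(u, v) \<in> map_prod f f ` R" and vu: "(v, u) \<in> map_prod f f ` R" for u v
  proof -
    obtain x y where xy: "x \<in> Field R" "y \<in> Field R" "u = f x" "v = f y" "(x, y) \<in> R" using ex[OF uv] by blast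
    then have "(y, x) \<in> R" using vu map_prod_iff[OF f xy(2,1)] by simp
    then show ?thesis using Partial_order_antisym[OF R xy(5)] xy by simp
  qed
qed

lemma quotient_poset_topology:
  assumes e: "inj e"
  shows "quotient_topology (poset_topology X) e = poset_topology (map_prod e e ` X)"
proof (rule topology_eq[THEN iffD2], rule allI)
  fix U
  show "openin (quotient_topology (poset_topology X) e) U \<longleftrightarrow> openin (poset_topology (map_prod e e ` X)) U"
    unfolding openin_quotient_topology openin_poset_topology Field_map_prod topspace_poset_topology
  proof (intro conj_cong refl)
    assume U: "U \<subseteq> e ` Field X"
    show "({x \<in> Field X. e x \<in> U} \<subseteq> Field X \<and> (\<forall>y\<in>{x \<in> Field X. e x \<in> U}. \<forall>x. (x, y) \<in> X \<longrightarrow> x \<in> {x \<in> Field X. e x \<in> U}))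
      \<longleftrightarrow> (\<forall>y\<in>U. \<forall>x. (x, y) \<in> map_prod e e ` X \<longrightarrow> x \<in> U)" (is "?l \<longleftrightarrow> ?r")
    proof
      assume l: ?l
      show ?r
      proof (intro ballI allI impI)
        fix v u assume v: "v \<in> U" and uv: "(u, v) \<in> map_prod e e ` X"
        then obtain x y where "u = e x" "v = e y" "(x, y) \<in> X" by auto
        then show "u \<in> U" using l v FieldI2[of x y X] by blast
      qed
    next
      assume r: ?r
      have "e x \<in> U" if "e y \<in> U" "(x, y) \<in> X" for x y using r that by force
      then show ?l by (auto intro: FieldI1)
    qed
  qed
qed

lemma lift_equivalent_imp_zigzag:
  assumes "lift_equivalent Z Z'"
  shows "equivclp (\<lambda>V W. \<exists>f. weak_homotopy_equivalence V W f) Z Z'"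
  using assms
proof (induction rule: equivclp_induct)
  case (step Y Z)
  have "equivclp (\<lambda>V W. \<exists>f. weak_homotopy_equivalence V W f) Y Z"
    using step.hyps(2) lifting_map_imp_weak_homotopy_equivalence by (blast intro: r_into_equivclp equivclp_sym)
  with step.IH show ?case by (rule equivclp_trans)
qed simp

text \<open>The fan already lives on the type over which the zigzag is formed. \<open>X\<close> and
  \<open>W\<close> are moved there as constant functions tagged with \<open>Inl\<close> and
  \<open>Inr\<close>.\<close>

lemma fan_weakly_equivalent:
  fixes X :: "'a rel" and W :: "'b topology" and r :: "(real \<Rightarrow> 'a + 'b) rel"
  assumes "fan r s" and eq: "lift_equivalent (poset_topology (map_prod (\<lambda>x _. Inl x) (\<lambda>x _. Inl x) ` X)) (poset_topology r)"
    and W: "fan.arc_cover r s W (topspace W) w (mxl r - {s})"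
  shows "poset_topology X \<simeq>\<^sub>w W"
proof -
  interpret fan r s by fact
  let ?e = "\<lambda>x (_ :: real). Inl x :: 'a + 'b" and ?j = "\<lambda>x (_ :: real). Inr x :: 'a + 'b"
  have e: "inj ?e" and j: "inj ?j" by (auto simp: inj_def fun_eq_iff)
  have X: "poset_topology X homeomorphic_space poset_topology (map_prod ?e ?e ` X)"
    using quotient_topology_inj[OF e, of "poset_topology X"] unfolding quotient_poset_topology[OF e]
    by (rule homeomorphic_map_imp_homeomorphic_space)
  have WW: "W homeomorphic_space quotient_topology W ?j"
    using quotient_topology_inj[OF j] by (rule homeomorphic_map_imp_homeomorphic_space)
  have "arc_cover (quotient_topology W ?j) (?j ` topspace W) (?j w) M"
    using arc_cover_embedding[OF W closed_embedding_quotient_topology[OF j]] unfolding M_def by simp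
  then obtain q where "lifting_map (quotient_topology W ?j) (poset_topology r) q"
    using lifting_map_arc_cover[of "quotient_topology W ?j" "?j w"] by auto
  then have "lift_equivalent (poset_topology r) (quotient_topology W ?j)"
    by (intro equivclp_sym[OF lift_equivalentI])
  with eq have "lift_equivalent (poset_topology (map_prod ?e ?e ` X)) (quotient_topology W ?j)"
    by (rule equivclp_trans)
  then show ?thesis
    unfolding weakly_equivalent_def using X WW lift_equivalent_imp_zigzag by blast
qed

text \<open>\<open>B0\<close> may contain a maximal \<open>a\<close> or leave it out: the wedge in
  the statement has a summand for it, the splitting must not. The injection \<open>e\<close> into an
  infinite type makes room for the points added on the way, and \<open>\<beta>\<close> tells which
  maximal points of the fan carry the suspensions.\<close>

lemma star_poset_normal_form:
  fixes X :: "'a rel" and e :: "'a \<Rightarrow> 'c"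
  assumes po: "Partial_order X" and fin: "finite (Field X)" and conn: "connected_space (poset_topology X)"
    and a: "a \<in> Field X" and cover: "Field X = under X a \<union> mxl X \<union> mnl X"
    and e: "inj e" and inf: "infinite (UNIV :: 'c set)"
    and B0: "B0 \<subseteq> {b \<in> mxl X. under X a \<inter> under X b \<noteq> {}}"
    and near: "{b \<in> mxl X. under X a \<inter> under X b \<noteq> {}} - {a} \<subseteq> B0"
  shows "\<exists>r s \<beta>. fan r s \<and> lift_equivalent (poset_topology (map_prod e e ` X)) (poset_topology r) \<and>
     inj_on \<beta> B0 \<and> \<beta> ` B0 \<subseteq> mxl r - {s} \<and>
     (\<forall>b\<in>B0. bij_betw e (under X a \<inter> under X b) (fan.L r (\<beta> b)) \<and>
        (\<forall>x\<in>under X a \<inter> under X b. \<forall>y\<in>under X a \<inter> under X b. (e x, e y) \<in> r \<longleftrightarrow> (x, y) \<in> X)) \<and>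
     (\<forall>d\<in>mxl r - {s} - \<beta> ` B0. \<exists>c y. fan.L r d = {c, y} \<and> c \<noteq> y \<and> (c, y) \<notin> r \<and> (y, c) \<notin> r)"
proof -
  define r0 where "r0 = map_prod e e ` X"
  have e_inj: "inj_on e (Field X)" using e by (rule inj_on_subset) simp
  have F0: "Field r0 = e ` Field X" by (simp add: r0_def Field_map_prod)
  have po0: "Partial_order r0" unfolding r0_def by (rule Partial_order_map_prod[OF po e_inj])
  have r0I: "(e x, e y) \<in> r0 \<longleftrightarrow> (x, y) \<in> X" for x y
    unfolding r0_def using e by (auto simp: inj_eq)
  have r0D: "\<exists>x y. u = e x \<and> v = e y \<and> (x, y) \<in> X" if "(u, v) \<in> r0" for u v
    using that by (auto simp: r0_def)
  have ee: "e x = e y \<longleftrightarrow> x = y" for x y using e by (simp add: inj_eq)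
  have finF0: "finite (Field r0)" using fin by (simp add: F0)
  obtain s where s: "s \<notin> Field r0" using ex_new_if_finite[OF inf finF0] by blast
  have "finite (insert s (Field r0))" using finF0 by simp
  then obtain s2 where s2: "s2 \<notin> insert s (Field r0)" using ex_new_if_finite[OF inf] by blast
  define r1 where "r1 = add_top r0 (under r0 (e a)) s"
  \<comment> \<open>A maximal \<open>a\<close> ceases to be maximal under \<open>s\<close>. If it
    belongs to \<open>B0\<close>, then \<open>s2\<close>, with the same points strictly below it as
    \<open>s\<close>, provides the maximal point for its summand.\<close>
  define r2 where "r2 = (if a \<in> B0 then add_top r1 (under r1 (e a)) s2 else r1)"
  have ea: "e a \<in> Field r0" using a by (simp add: F0)
  have sne: "(s, x) \<notin> r0" "(x, s) \<notin> r0" "(s2, x) \<notin> r0" "(x, s2) \<notin> r0" for x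
    using s s2 by (auto simp: Field_def)
  have ne: "s \<noteq> e x" "s2 \<noteq> e x" if "x \<in> Field X" for x using s s2 that by (auto simp: F0)
  have ss: "s2 \<noteq> s" using s2 by simp
  have und: "under r0 (e a) \<subseteq> Field r0" "under r1 (e a) \<subseteq> Field r1" by (auto simp: under_def Field_def)
  have po1: "Partial_order r1"
    unfolding r1_def by (rule Partial_order_add_top[OF po0 und(1) _ s])
      (use Partial_order_trans[OF po0] in \<open>auto simp: under_def\<close>)
  have F1: "Field r1 = insert s (Field r0)" unfolding r1_def by (rule Field_add_top[OF und(1)])
  have s2F1: "s2 \<notin> Field r1" using s2 F1 by simp
  have po2: "Partial_order r2"
    using po1 Partial_order_add_top[OF po1 und(2) _ s2F1] Partial_order_trans[OF po1]
    by (auto simp: r2_def under_def)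
  have F2: "Field r2 = insert s (Field r0) \<union> (if a \<in> B0 then {s2} else {})"
    using Field_add_top[OF und(2)] F1 by (auto simp: r2_def)
  have eq: "lift_equivalent (poset_topology r0) (poset_topology r2)"
  proof -
    have 1: "lift_equivalent (poset_topology r0) (poset_topology r1)"
      unfolding r1_def by (rule lift_equivalent_add_down_beat[OF po0 ea s])
    have "e a \<in> Field r1" using ea F1 by simp
    then have "lift_equivalent (poset_topology r1) (poset_topology (add_top r1 (under r1 (e a)) s2))"
      by (rule lift_equivalent_add_down_beat[OF po1 _ s2F1])
    with 1 show ?thesis unfolding r2_def by (auto intro: equivclp_trans)
  qed
  have r1_iff: "(x, y) \<in> r1 \<longleftrightarrow> (x, y) \<in> r0 \<or> y = s \<and> (x = s \<or> (x, e a) \<in> r0)" for x y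
    by (auto simp: r1_def add_top_iff under_def)
  have "(x, e a) \<in> r1 \<longleftrightarrow> (x, e a) \<in> r0" for x using ne(1)[OF a] by (auto simp: r1_iff)
  then have r2_iff: "(x, y) \<in> r2 \<longleftrightarrow> (x, y) \<in> r0 \<or> y = s \<and> (x = s \<or> (x, e a) \<in> r0) \<or>
      a \<in> B0 \<and> y = s2 \<and> (x = s2 \<or> (x, e a) \<in> r0)" for x y
    by (auto simp: r2_def add_top_iff under_def r1_iff)
  have e2: "(e x, e y) \<in> r2 \<longleftrightarrow> (x, y) \<in> X" if "y \<in> Field X" for x y
    using ne[OF that] by (auto simp: r2_iff r0I)
  have e2D: "\<exists>x. u = e x \<and> (x, y) \<in> X" if "(u, e y) \<in> r2" "y \<in> Field X" for u y
    using that ne[OF that(2)] r0D[of u "e y"] by (auto simp: r2_iff ee)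
  have s_mxl: "s \<in> mxl r2" using ss sne by (auto simp: mxl_def F2 r2_iff)
  have s2_mxl: "s2 \<in> mxl r2" if "a \<in> B0" using ss sne that by (auto simp: mxl_def F2 r2_iff)
  have e_mxl: "e x \<in> mxl r2 \<longleftrightarrow> x \<in> mxl X \<and> x \<noteq> a" if x: "x \<in> Field X" for x
  proof
    assume m: "e x \<in> mxl r2"
    have "y = x" if "(x, y) \<in> X" for y
    proof -
      have "(e x, e y) \<in> r2" using that FieldI2[OF that] by (simp add: e2)
      then show ?thesis using m by (auto simp: mxl_def ee)
    qed
    moreover have "x \<noteq> a"
    proof
      assume "x = a"
      then have "(e x, s) \<in> r2" using Partial_order_refl[OF po0 ea] by (simp add: r2_iff)
      then show False using m ne[OF x] by (auto simp: mxl_def)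
    qed
    ultimately show "x \<in> mxl X \<and> x \<noteq> a" using x by (simp add: mxl_def)
  next
    assume m: "x \<in> mxl X \<and> x \<noteq> a"
    then have "(x, a) \<notin> X" by (auto simp: mxl_def)
    moreover have "v = e x" if "(e x, v) \<in> r0" for v using r0D[OF that] m by (auto simp: mxl_def ee)
    ultimately show "e x \<in> mxl r2" using x ne[OF x] by (auto simp: mxl_def F2 F0 r2_iff r0I)
  qed
  have e_mnl: "e x \<in> mnl r2" if x: "x \<in> mnl X" for x
  proof -
    have xF: "x \<in> Field X" using x by (simp add: mnl_def)
    then show ?thesis using x e2D[OF _ xF] by (auto simp: mnl_def F2 F0)
  qed
  define \<beta> where "\<beta> = (\<lambda>b. if b = a then s2 else e b)"
  have B0F: "b \<in> Field X" if "b \<in> B0" for b using that B0 by (auto simp: mxl_def)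
  have \<beta>_inj: "inj_on \<beta> B0"
    using ne B0F by (auto simp: inj_on_def \<beta>_def ee split: if_splits)
  \<comment> \<open>Indexed by points of the new poset: the union has one term on the image of
    \<open>\<beta>\<close> and is empty elsewhere, as \<open>edge_form\<close> demands.\<close>
  define Lo where "Lo = (\<lambda>v. \<Union>b\<in>{b \<in> B0. \<beta> b = v}. e ` (under X a \<inter> under X b))"
  have Lo: "Lo (\<beta> b) = e ` (under X a \<inter> under X b)" if "b \<in> B0" for b
  proof -
    have "{b' \<in> B0. \<beta> b' = \<beta> b} = {b}" using that \<beta>_inj by (auto dest: inj_onD)
    then show ?thesis unfolding Lo_def by simp
  qed
  have LoD: "\<exists>x b. u = e x \<and> b \<in> B0 \<and> v = \<beta> b \<and> (x, a) \<in> X \<and> (x, b) \<in> X" if "u \<in> Lo v" for u v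
    using that by (auto simp: Lo_def under_def)
  \<comment> \<open>Here the shape of \<open>X\<close> enters: what lies strictly below a maximal
    point but not below \<open>a\<close> is minimal in \<open>X\<close>.\<close>
  have low: "\<exists>x b. u = e x \<and> v = e b \<and> (x, a) \<notin> X \<and> x \<in> mnl X"
    if v: "v \<in> mxl r2" "v \<noteq> s" and uv: "(u, v) \<in> r2" "u \<noteq> v" and u: "u \<notin> Lo v" for u v
  proof -
    have "v \<in> Field r2" using v(1) by (simp add: mxl_def)
    then consider "a \<in> B0" "v = s2" | b where "b \<in> Field X" "v = e b"
      using v(2) by (auto simp: F2 F0 split: if_splits)
    then show ?thesis
    proof cases
      case 1
      then have "(u, e a) \<in> r0" using uv sne ss by (auto simp: r2_iff)
      then obtain x where x: "u = e x" "(x, a) \<in> X" using r0D[of u "e a"] by (auto simp: ee)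
      have "s2 = \<beta> a" by (simp add: \<beta>_def)
      then have "u \<in> Lo v" using 1 x Lo[OF 1(1)] by (simp add: under_def)
      then show ?thesis using u by blast
    next
      case 2
      have b: "b \<in> mxl X" "b \<noteq> a" using e_mxl[OF 2(1)] v(1) 2(2) by auto
      obtain x where x: "u = e x" "(x, b) \<in> X" using e2D[OF _ 2(1)] uv(1) 2(2) by blast
      have xb: "x \<noteq> b" using x uv(2) 2(2) by blast
      have xF: "x \<in> Field X" using x by (auto intro: FieldI1)
      have xa: "(x, a) \<notin> X"
      proof
        assume xa: "(x, a) \<in> X"
        then have "b \<in> B0" using near b x by (auto simp: under_def)
        moreover have "\<beta> b = v" using b 2(2) by (simp add: \<beta>_def)
        ultimately have "u \<in> Lo v" using Lo[of b] x xa by (simp add: under_def)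
        then show False using u by blast
      qed
      moreover have "x \<notin> mxl X" using x xb by (auto simp: mxl_def)
      ultimately have "x \<in> mnl X" using cover xF by (auto simp: under_def)
      then show ?thesis using x 2 xa by blast
    qed
  qed
  have nf: "edge_form r2 s (\<beta> ` B0) Lo"
  proof (rule edge_form.intro)
    show "Partial_order r2" "s \<in> mxl r2" by (fact po2 s_mxl)+
    show "finite (Field r2)" using finF0 by (simp add: F2)
    show "Field r2 = under r2 s \<union> mxl r2 \<union> mnl r2"
    proof (intro equalityI subsetI)
      fix v assume "v \<in> Field r2"
      then consider "v = s" | "v = s2" "a \<in> B0" | x where "x \<in> Field X" "v = e x"
        by (auto simp: F2 F0 split: if_splits)
      then show "v \<in> under r2 s \<union> mxl r2 \<union> mnl r2"
      proof cases
        case 3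
        then consider "(x, a) \<in> X" | "x \<in> mxl X" "x \<noteq> a" | "x \<in> mnl X"
          using cover Partial_order_refl[OF po a] by (auto simp: under_def)
        then show ?thesis
        proof cases
          case 1
          then show ?thesis using 3 by (simp add: under_def r2_iff r0I)
        qed (use 3 e_mxl e_mnl in auto)
      qed (use s_mxl s2_mxl in auto)
    qed (auto simp: under_def mxl_def mnl_def intro: FieldI1)
    have "path_connected_space (poset_topology X)"
      by (rule finite_poset_connected_imp_path_connected) (fact po conn)+
    moreover have "poset_topology X homeomorphic_space poset_topology r0"
      using quotient_topology_inj[OF e, of "poset_topology X"] unfolding quotient_poset_topology[OF e] r0_def
      by (rule homeomorphic_map_imp_homeomorphic_space)
    ultimately have "path_connected_space (poset_topology r0)"
      by (simp add: homeomorphic_path_connected_space)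
    then show "path_connected_space (poset_topology r2)"
      using lift_equivalent_path_connected_space[OF eq] by blast
    show "\<beta> ` B0 \<subseteq> mxl r2 - {s}"
    proof
      fix v assume "v \<in> \<beta> ` B0"
      then obtain b where b: "b \<in> B0" "v = \<beta> b" by blast
      then show "v \<in> mxl r2 - {s}"
        using s2_mxl ss e_mxl[OF B0F[OF b(1)]] ne[OF B0F[OF b(1)]] B0 by (auto simp: \<beta>_def)
    qed
    show "Lo v \<noteq> {}" if "v \<in> \<beta> ` B0" for v using that Lo B0 by auto
    show "(u, s) \<in> r2" if u: "u \<in> Lo v" for u v using LoD[OF u] by (auto simp: r2_iff r0I)
    show "(u, v) \<in> r2 \<and> u \<noteq> v" if u: "u \<in> Lo v" for u v
    proof -
      obtain x b where xb: "u = e x" "b \<in> B0" "v = \<beta> b" "(x, a) \<in> X" "(x, b) \<in> X" using LoD[OF u] by blast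
      have xF: "x \<in> Field X" using xb(4) by (rule FieldI1)
      show ?thesis
      proof (cases "b = a")
        case True
        then show ?thesis using xb ne[OF xF] by (auto simp: \<beta>_def r2_iff r0I)
      next
        case False
        have "b \<in> mxl X" using xb(2) B0 by blast
        then have "x \<noteq> b" using xb(4) False by (auto simp: mxl_def)
        then show ?thesis using xb False by (auto simp: \<beta>_def r2_iff r0I ee)
      qed
    qed
    show "Lo v = {}" if "v \<notin> \<beta> ` B0" for v using that by (auto simp: Lo_def)
    show "u \<in> mnl r2" if "v \<in> mxl r2" "v \<noteq> s" "(u, v) \<in> r2" "u \<noteq> v" "u \<notin> Lo v" for u v
      using low[OF that] e_mnl by blast
    show "(u, z) \<notin> r2" if uv: "v \<in> mxl r2" "v \<noteq> s" "(u, v) \<in> r2" "u \<noteq> v" "u \<notin> Lo v" and z: "z \<in> Lo v" for u v z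
    proof
      assume uz: "(u, z) \<in> r2"
      obtain x where x: "u = e x" "(x, a) \<notin> X" using low[OF uv] by blast
      obtain z' where z': "z = e z'" "(z', a) \<in> X" using LoD[OF z] by blast
      have "(x, z') \<in> X" using uz x z' e2[OF FieldI1[OF z'(2)]] by simp
      then show False using x z' Partial_order_trans[OF po] by blast
    qed
  qed
  obtain r where "edge_form r s (\<beta> ` B0) Lo"
    and r: "lift_equivalent (poset_topology r2) (poset_topology r)" "\<forall>b\<in>\<beta> ` B0. Restr r (Lo b) = Restr r2 (Lo b)"
      "Field r = under r s \<union> mxl r" "\<forall>b\<in>\<beta> ` B0. extra r Lo b = {}"
      "\<forall>b\<in>mxl r - {s} - \<beta> ` B0. card (extra r Lo b) = 2"
    using edge_form_reduction[OF inf nf] by (elim exE conjE) (rule that)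
  interpret ef: edge_form r s "\<beta> ` B0" Lo by fact
  have fan: "fan r s" using ef.po ef.fin ef.a r(3) by unfold_locales
  interpret fan r s by (rule fan)
  have LoL: "L v = Lo v" if v: "v \<in> \<beta> ` B0" for v
  proof -
    have "extra r Lo v = {}" using r(4) v by blast
    then have "u \<in> Lo v" if "(u, v) \<in> r" "u \<noteq> v" for u using that by (auto simp: extra_def)
    then show ?thesis using ef.Lo_b[OF v] by (auto simp: L_iff)
  qed
  have \<beta>M: "\<beta> ` B0 \<subseteq> mxl r - {s}" using ef.B .
  show ?thesis
  proof (intro exI conjI)
    show "fan r s" by (rule fan)
    show "lift_equivalent (poset_topology (map_prod e e ` X)) (poset_topology r)"
      using equivclp_trans[OF eq r(1)] unfolding r0_def .
    show "inj_on \<beta> B0" "\<beta> ` B0 \<subseteq> mxl r - {s}" by (fact \<beta>_inj \<beta>M)+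
    show "\<forall>b\<in>B0. bij_betw e (under X a \<inter> under X b) (fan.L r (\<beta> b)) \<and>
        (\<forall>x\<in>under X a \<inter> under X b. \<forall>y\<in>under X a \<inter> under X b. (e x, e y) \<in> r \<longleftrightarrow> (x, y) \<in> X)"
    proof (intro ballI conjI)
      fix b assume b: "b \<in> B0"
      then have b': "\<beta> b \<in> \<beta> ` B0" by simp
      show "bij_betw e (under X a \<inter> under X b) (fan.L r (\<beta> b))"
        unfolding LoL[OF b'] Lo[OF b] using e by (simp add: bij_betw_def inj_on_subset[OF e])
      fix x y assume xy: "x \<in> under X a \<inter> under X b" "y \<in> under X a \<inter> under X b"
      have "Restr r (Lo (\<beta> b)) = Restr r2 (Lo (\<beta> b))" using r(2) b' by blast
      moreover have "e x \<in> Lo (\<beta> b)" "e y \<in> Lo (\<beta> b)" using xy Lo[OF b] by simp_all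
      ultimately have "(e x, e y) \<in> r \<longleftrightarrow> (e x, e y) \<in> r2" by blast
      moreover have "y \<in> Field X" using xy by (auto simp: under_def intro: FieldI1)
      ultimately show "(e x, e y) \<in> r \<longleftrightarrow> (x, y) \<in> X" by (simp add: e2)
    qed
    show "\<forall>d\<in>mxl r - {s} - \<beta> ` B0. \<exists>c y. fan.L r d = {c, y} \<and> c \<noteq> y \<and> (c, y) \<notin> r \<and> (y, c) \<notin> r"
    proof
      fix d assume d: "d \<in> mxl r - {s} - \<beta> ` B0"
      have "L d = extra r Lo d" using ef.Lo_empty[of d] d by (auto simp: L_iff extra_def)
      moreover have "card (extra r Lo d) = 2" using r(5) d by blast
      ultimately obtain c y where cy: "L d = {c, y}" "c \<noteq> y" by (auto simp: card_2_iff)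
      have "c \<in> L d" "y \<in> L d" using cy by simp_all
      then have "c \<in> mnl r" "y \<in> mnl r"
        using ef.extra_mnl[of d] ef.Lo_empty[of d] d by (auto simp: L_iff)
      then show "\<exists>c y. fan.L r d = {c, y} \<and> c \<noteq> y \<and> (c, y) \<notin> r \<and> (y, c) \<notin> r"
        using cy by (intro exI[of _ c] exI[of _ y]) (auto simp: mnl_def)
    qed
  qed
qed

text \<open>The functions that take the value \<open>Inl undefined\<close> at one real and
  \<open>Inr undefined\<close> elsewhere are pairwise different, whatever the types
  \<open>'a\<close> and \<open>'b\<close> are.\<close>

lemma infinite_UNIV_fun: "infinite (UNIV :: (real \<Rightarrow> 'a + 'b) set)"
proof
  let ?f = "\<lambda>t x. if x = t then Inl undefined else Inr undefined :: 'a + 'b"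
  assume fin: "finite (UNIV :: (real \<Rightarrow> 'a + 'b) set)"
  have "t = t'" if "?f t = ?f t'" for t t' :: real
    using fun_cong[OF that, of t] by (simp split: if_splits)
  then have "inj (?f :: real \<Rightarrow> _)" by (rule injI)
  then have "finite (UNIV :: real set)" by (rule inj_on_finite[OF _ subset_UNIV fin])
  then show False using infinite_UNIV_char_0 by blast
qed

lemma closedin_susp_real_point: "p \<in> topspace (susp_real n R) \<Longrightarrow> closedin (susp_real n R) {p}"
  by (rule closedin_Hausdorff_singleton[OF Hausdorff_space_order_realization])

text \<open>\<open>k\<close> counts the maximal points of the fan, other than its cone point, that
  do not come from \<open>B\<close>. The fan is constructed before base points are chosen, so
  \<open>k\<close> does not depend on them.\<close>

lemma weakly_equivalent_wedge_circles:
  fixes X :: "'a rel"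
  assumes poX: "Partial_order X" and finX: "finite (Field X)" and conn: "connected_space (poset_topology X)"
    and aX: "a \<in> Field X" and coverX: "Field X = under X a \<union> mxl X \<union> mnl X"
    and B: "B = {b \<in> mxl X. under X a \<inter> under X b \<noteq> {}}"
  shows "\<exists>k. \<forall>p q. (\<forall>b\<in>B. p b \<in> topspace (susp_real 1 (Restr X (under X a \<inter> under X b)))) \<longrightarrow>
     (\<forall>j<k. q j \<in> topspace (top_of_set (sphere (0::complex) 1))) \<longrightarrow>
     poset_topology X \<simeq>\<^sub>w wedge2 (wedge B (\<lambda>b. susp_real 1 (Restr X (under X a \<inter> under X b))) p) None
       (wedge {..<k::nat} (\<lambda>_. top_of_set (sphere 0 1)) q) None"
proof -
  let ?D = "\<lambda>b. under X a \<inter> under X b"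
  let ?S = "\<lambda>b. susp_real 1 (Restr X (?D b))"
  \<comment> \<open>The annotation is the type on which the zigzag to this particular wedge has to
    live; the normal form is built on that type at once.\<close>
  let ?e = "\<lambda>x (_ :: real). Inl x :: 'a +
    (bool \<times> (('a \<times> ('a + nat \<times> bool \<Rightarrow> real)) option + (nat \<times> complex) option)) option"
  have e: "inj ?e" by (auto simp: inj_def fun_eq_iff)
  have B1: "B \<subseteq> {b \<in> mxl X. ?D b \<noteq> {}}" and B2: "{b \<in> mxl X. ?D b \<noteq> {}} - {a} \<subseteq> B"
    by (auto simp: B)
  obtain r s \<beta> where fan: "fan r s" and eq: "lift_equivalent (poset_topology (map_prod ?e ?e ` X)) (poset_topology r)"
    and \<beta>: "inj_on \<beta> B" "\<beta> ` B \<subseteq> mxl r - {s}"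
    and arcs: "\<forall>b\<in>B. bij_betw ?e (?D b) (fan.L r (\<beta> b)) \<and> (\<forall>x\<in>?D b. \<forall>y\<in>?D b. (?e x, ?e y) \<in> r \<longleftrightarrow> (x, y) \<in> X)"
    and circles: "\<forall>d\<in>mxl r - {s} - \<beta> ` B. \<exists>c y. fan.L r d = {c, y} \<and> c \<noteq> y \<and> (c, y) \<notin> r \<and> (y, c) \<notin> r"
    using star_poset_normal_form[OF poX finX conn aX coverX e infinite_UNIV_fun B1 B2] by (elim exE conjE) (rule that)
  interpret fan r s by (rule fan)
  let ?N = "M - \<beta> ` B"
  have "finite ?N" using finite_M by simp
  then obtain \<nu> where "bij_betw \<nu> {0..<card ?N} ?N" using ex_bij_betw_nat_finite by blast
  then have \<nu>: "bij_betw \<nu> {..<card ?N} ?N" by (simp add: atLeast0LessThan)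
  have F: "Field (Restr X (?D b)) = ?D b" for b
    by (rule Field_Restr_poset[OF poX]) (auto simp: under_def intro: FieldI1)
  show ?thesis
  proof (intro exI[of _ "card ?N"] allI impI)
    fix p q
    assume p: "\<forall>b\<in>B. p b \<in> topspace (?S b)" and q: "\<forall>j<card ?N. q j \<in> topspace (top_of_set (sphere (0::complex) 1))"
    let ?W = "wedge B ?S p" and ?W' = "wedge {..<card ?N} (\<lambda>_. top_of_set (sphere (0::complex) 1)) q"
    have clp: "closedin (?S b) {p b}" if "b \<in> B" for b using p that closedin_susp_real_point by blast
    have clq: "closedin (top_of_set (sphere 0 1)) {q j}" if "j \<in> {..<card ?N}" for j
      using q that by (intro closedin_Hausdorff_singleton) (auto simp: Hausdorff_space_subtopology)
    have clW: "closedin ?W {None}" and clW': "closedin ?W' {None}"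
      by (rule closedin_wedge_base[OF clp], assumption) (rule closedin_wedge_base[OF clq])
    have "arc_cover ?W (topspace ?W) None (\<beta> ` B)"
    proof (rule arc_cover_wedge[OF inj_on_imp_bij_betw[OF \<beta>(1)] clp])
      fix b assume b: "b \<in> B"
      show "\<exists>\<theta>. homeomorphic_map (?S b) (order_realization (arc_poset (\<beta> b))) \<theta> \<and> \<theta> (p b) (\<beta> b) = 0"
      proof (rule homeomorphic_map_suspension1_arc)
        show "\<beta> b \<in> M" using \<beta>(2) b by (auto simp: M_def)
        show "finite (Field (Restr X (?D b)))" by (rule finite_subset[OF _ finX]) (auto simp: Field_def)
        show "bij_betw ?e (Field (Restr X (?D b))) (L (\<beta> b))" unfolding F using arcs b by blast
        show "(?e x, ?e y) \<in> r \<longleftrightarrow> (x, y) \<in> Restr X (?D b)"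
          if "x \<in> Field (Restr X (?D b))" "y \<in> Field (Restr X (?D b))" for x y
        proof -
          have "x \<in> ?D b" "y \<in> ?D b" using that unfolding F by blast+
          then show ?thesis using arcs b by blast
        qed
        show "p b \<in> topspace (?S b)" using p b by blast
      qed
    qed
    moreover have "arc_cover ?W' (topspace ?W') None ?N"
    proof (rule arc_cover_wedge[OF \<nu> clq])
      fix j assume j: "j \<in> {..<card ?N}"
      then have d: "\<nu> j \<in> ?N" using \<nu> bij_betwE by blast
      then obtain c y where cy: "L (\<nu> j) = {c, y}" "c \<noteq> y" "(c, y) \<notin> r" "(y, c) \<notin> r"
        using circles unfolding M_def by blast
      show "\<exists>\<theta>. homeomorphic_map (top_of_set (sphere (0::complex) 1)) (order_realization (arc_poset (\<nu> j))) \<theta> \<and>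
          \<theta> (q j) (\<nu> j) = 0"
        by (rule homeomorphic_map_circle_arc[OF _ cy]) (use d q j in auto)
    qed
    ultimately have "arc_cover (wedge2 ?W None ?W' None) (topspace (wedge2 ?W None ?W' None)) None (\<beta> ` B \<union> ?N)"
      by (rule arc_cover_wedge2[OF _ clW _ clW']) blast
    moreover have "\<beta> ` B \<union> ?N = mxl r - {s}" using \<beta>(2) unfolding M_def by blast
    ultimately have "arc_cover (wedge2 ?W None ?W' None) (topspace (wedge2 ?W None ?W' None)) None (mxl r - {s})"
      by simp
    then show "poset_topology X \<simeq>\<^sub>w wedge2 ?W None ?W' None"
      by (rule fan_weakly_equivalent[OF fan eq])
  qed
qed

text \<open>
  If \<open>a\<close> is maximal, it gives rise to a contractible summand, which is omitted here, since it is not smaller.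
  A circle is the double suspension of the empty space.
\<close>

lemma splits_into_smaller_star:
  fixes X :: "'a rel"
  assumes poX: "Partial_order X" and finX: "finite (Field X)" and conn: "connected_space (poset_topology X)"
    and aX: "a \<in> Field X" and coverX: "Field X = under X a \<union> mxl X \<union> mnl X"
  shows "splits_into_smaller X"
proof -
  let ?D = "\<lambda>b. under X a \<inter> under X b"
  let ?e = "\<lambda>x (_ :: real). Inl x :: 'a + (nat \<times> (nat + nat \<times> bool \<Rightarrow> real)) option"
  define B where "B = {b \<in> mxl X. ?D b \<noteq> {}} - {a}"
  have e: "inj ?e" by (auto simp: inj_def fun_eq_iff)
  have B1: "B \<subseteq> {b \<in> mxl X. ?D b \<noteq> {}}" and B2: "{b \<in> mxl X. ?D b \<noteq> {}} - {a} \<subseteq> B"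
    by (auto simp: B_def)
  obtain r s \<beta> where fan: "fan r s" and eq: "lift_equivalent (poset_topology (map_prod ?e ?e ` X)) (poset_topology r)"
    and \<beta>: "inj_on \<beta> B" "\<beta> ` B \<subseteq> mxl r - {s}"
    and arcs: "\<forall>b\<in>B. bij_betw ?e (?D b) (fan.L r (\<beta> b)) \<and> (\<forall>x\<in>?D b. \<forall>y\<in>?D b. (?e x, ?e y) \<in> r \<longleftrightarrow> (x, y) \<in> X)"
    and circles: "\<forall>d\<in>mxl r - {s} - \<beta> ` B. \<exists>c y. fan.L r d = {c, y} \<and> c \<noteq> y \<and> (c, y) \<notin> r \<and> (y, c) \<notin> r"
    using star_poset_normal_form[OF poX finX conn aX coverX e infinite_UNIV_fun B1 B2] by (elim exE conjE) (rule that)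
  interpret fan r s by (rule fan)
  obtain \<nu> where "bij_betw \<nu> {0..<card M} M" using ex_bij_betw_nat_finite[OF finite_M] by blast
  then have \<nu>: "bij_betw \<nu> {..<card M} M" by (simp add: atLeast0LessThan)
  obtain h :: "'a \<Rightarrow> nat" where h: "inj_on h (Field X)" using finite_imp_inj_to_nat_seg[OF finX] by blast
  \<comment> \<open>Poset, number of suspensions and base point have to be chosen together for each
    index, so all requirements on a summand are bundled before the choice.\<close>
  define good where "good = (\<lambda>i (A :: nat rel) n p. Partial_order A \<and> finite (Field A) \<and>
    card (Field A) < card (Field X) \<and> p \<in> topspace (susp_real n A) \<and>
    (\<exists>\<theta>. homeomorphic_map (susp_real n A) (order_realization (arc_poset (\<nu> i))) \<theta> \<and> \<theta> p (\<nu> i) = 0))"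
  have ex: "\<exists>A n p. good i A n p" if i: "i < card M" for i
  proof -
    have \<nu>i: "\<nu> i \<in> M" using i \<nu> bij_betwE by blast
    have pt: "\<exists>p. p \<in> topspace (susp_real (Suc n) A)" if "finite (Field A)" for n and A :: "nat rel"
    proof (rule exI, rule order_realization_nonempty)
      show "finite (Field (nh_susp (Suc n) A))" unfolding Field_nh_susp using that by simp
      show "(Inr (n, True), Inr (n, True)) \<in> nh_susp (Suc n) A" by (simp add: adjoin_tops_def)
    qed
    show ?thesis
    proof (cases "\<nu> i \<in> \<beta> ` B")
      case True
      then obtain b where b: "b \<in> B" "\<nu> i = \<beta> b" by blast
      let ?R = "Restr X (?D b)" and ?g = "inv_into (Field X) h"
      let ?A = "map_prod h h ` ?R"
      have DX: "?D b \<subseteq> Field X" by (auto simp: under_def intro: FieldI1)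
      have FR: "Field ?R = ?D b" by (rule Field_Restr_poset[OF poX DX])
      have FA: "Field ?A = h ` ?D b" unfolding Field_map_prod FR ..
      have hD: "inj_on h (?D b)" using h DX by (rule inj_on_subset)
      have finD: "finite (?D b)" using finX DX by (rule rev_finite_subset)
      have gh: "?g (h x) = x" if "x \<in> ?D b" for x using h DX that by (intro inv_into_f_f) auto
      have poA: "Partial_order ?A"
      proof (rule Partial_order_map_prod)
        show "Partial_order ?R"
          using poX by (rule Partial_order_Restr)
        show "inj_on h (Field ?R)" unfolding FR by (rule hD)
      qed
      have finA: "finite (Field ?A)" unfolding FA using finD by simp
      \<comment> \<open>A maximal \<open>b \<noteq> a\<close> is not below \<open>a\<close>, so
        \<open>b\<close> itself is missing from the intersection; this makes the summand strictly
        smaller.\<close>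
      have "b \<in> mxl X" "b \<noteq> a" using b by (auto simp: B_def)
      then have "b \<notin> ?D b" "b \<in> Field X" by (auto simp: mxl_def under_def)
      then have "?D b \<subset> Field X" using DX by blast
      then have card: "card (Field ?A) < card (Field X)"
        unfolding FA card_image[OF hD] by (rule psubset_card_mono[OF finX])
      obtain p where p: "p \<in> topspace (susp_real 1 ?A)" using pt[OF finA, of 0] by auto
      have "\<exists>\<theta>. homeomorphic_map (susp_real 1 ?A) (order_realization (arc_poset (\<nu> i))) \<theta> \<and> \<theta> p (\<nu> i) = 0"
      proof (rule homeomorphic_map_suspension1_arc[OF \<nu>i finA _ _ p])
        have "bij_betw ?g (h ` ?D b) (?D b)" using gh hD by (auto simp: bij_betw_def inj_on_def image_image)
        moreover have "bij_betw ?e (?D b) (L (\<beta> b))" using arcs b(1) by blast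
        ultimately show "bij_betw (?e \<circ> ?g) (Field ?A) (L (\<nu> i))"
          unfolding FA b(2) by (rule bij_betw_trans)
        show "((?e \<circ> ?g) u, (?e \<circ> ?g) v) \<in> r \<longleftrightarrow> (u, v) \<in> ?A" if "u \<in> Field ?A" "v \<in> Field ?A" for u v
        proof -
          obtain x y where xy: "x \<in> ?D b" "y \<in> ?D b" "u = h x" "v = h y" using \<open>u \<in> Field ?A\<close> \<open>v \<in> Field ?A\<close> unfolding FA by blast
          have "(u, v) \<in> ?A \<longleftrightarrow> (x, y) \<in> ?R"
            unfolding xy(3,4) by (rule map_prod_iff) (use hD xy FR in auto)
          moreover have "(?e x, ?e y) \<in> r \<longleftrightarrow> (x, y) \<in> X" using arcs b(1) xy(1,2) by blast
          ultimately show ?thesis using xy by (simp add: gh)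
        qed
      qed
      then have "good i ?A 1 p" unfolding good_def using poA finA card p by (intro conjI)
      then show ?thesis by (intro exI)
    next
      case False
      then have "\<nu> i \<in> mxl r - {s} - \<beta> ` B" using \<nu>i by (simp add: M_def)
      then obtain c y where cy: "L (\<nu> i) = {c, y}" "c \<noteq> y" "(c, y) \<notin> r" "(y, c) \<notin> r" using circles by blast
      obtain p where p: "p \<in> topspace (susp_real 2 ({} :: nat rel))" using pt[of "{}" 1] by (auto simp: numeral_2_eq_2)
      have "Partial_order ({} :: nat rel)" by (rule Partial_orderI) auto
      \<comment> \<open>The empty space, whose double suspension is used here, is smaller than
        \<open>X\<close> because \<open>X\<close> contains \<open>a\<close>.\<close>
      moreover have "card (Field X) > 0" using aX finX by (auto simp: card_gt_0_iff)
      ultimately have "good i {} 2 p"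
        unfolding good_def using p homeomorphic_map_suspension2_arc[OF \<nu>i cy p] by (intro conjI) simp_all
      then show ?thesis by (intro exI)
    qed
  qed
  have "\<exists>z. \<forall>i\<in>{..<card M}. good i (fst (z i)) (fst (snd (z i))) (snd (snd (z i)))"
  proof (rule bchoice, rule ballI)
    fix i assume "i \<in> {..<card M}"
    then obtain A n p where "good i A n p" using ex[of i] by auto
    then show "\<exists>z. good i (fst z) (fst (snd z)) (snd (snd z))" by (intro exI[of _ "(A, n, p)"]) simp
  qed
  then obtain z where z: "\<forall>i\<in>{..<card M}. good i (fst (z i)) (fst (snd (z i))) (snd (snd (z i)))"
    by (elim exE) (rule that)
  define A n p where "A = (\<lambda>i. fst (z i))" and "n = (\<lambda>i. fst (snd (z i)))" and "p = (\<lambda>i. snd (snd (z i)))"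
  have good: "good i (A i) (n i) (p i)" if "i \<in> {..<card M}" for i using z that by (simp add: A_def n_def p_def)
  let ?W = "wedge {..<card M} (\<lambda>i. susp_real (n i) (A i)) p"
  have "arc_cover ?W (topspace ?W) None M"
  proof (rule arc_cover_wedge[OF \<nu>])
    fix i assume "i \<in> {..<card M}"
    note g = good[OF this, unfolded good_def]
    show "closedin (susp_real (n i) (A i)) {p i}" using g closedin_susp_real_point by blast
    show "\<exists>\<theta>. homeomorphic_map (susp_real (n i) (A i)) (order_realization (arc_poset (\<nu> i))) \<theta> \<and> \<theta> (p i) (\<nu> i) = 0"
      using g by (elim conjE)
  qed
  then have "poset_topology X \<simeq>\<^sub>w ?W"
    unfolding M_def by (rule fan_weakly_equivalent[OF fan eq])
  then show ?thesis
    unfolding splits_into_smaller_def using good unfolding good_def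
    by (intro exI[of _ "card M"] exI[of _ A] exI[of _ n] exI[of _ p]) simp
qed

theorem corollary3p14:
  fixes X :: "'a rel" and a :: 'a
  assumes "Partial_order X" and "finite (Field X)"
    and "connected_space (poset_topology X)"
    and "a \<in> Field X"
    and "Field X = under X a \<union> mxl X \<union> mnl X"
  shows "(let B = {b \<in> mxl X. under X a \<inter> under X b \<noteq> {}};
              S = (\<lambda>b. susp_real 1 (Restr X (under X a \<inter> under X b)));
              S1 = top_of_set (sphere (0::complex) 1)
          in \<exists>k::nat. \<forall>p q.
               (\<forall>b\<in>B. p b \<in> topspace (S b)) \<longrightarrow> (\<forall>j<k. q j \<in> topspace S1) \<longrightarrow>
               poset_topology X \<simeq>\<^sub>w
                 wedge2 (wedge B S p) None (wedge {..<k} (\<lambda>_. S1) q) None)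
         \<and> splits_into_smaller X"
  unfolding Let_def
  by (intro conjI weakly_equivalent_wedge_circles[OF assms refl] splits_into_smaller_star[OF assms])

end
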